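(* Let $X_1,\dots,X_n$ be i.i.d. with law $P$ and $Y_1,\dots,Y_m$ i.i.d. with law $Q$ on a measurable space $E$, the two samples being independent, and let $\mathcal{F}$ be a symmetric class ($f\in\mathcal{F}\Rightarrow -f\in\mathcal{F}$) of measurable functions from $E$ to $[-1,1]$, separable for the topology of pointwise convergence. Let $\alpha,\delta\in(0,1)$, let $B\ge1$ be an integer, and define $$\alpha_B=\left(1+\frac1B\right)\left(\alpha-\sqrt{\frac{3\alpha}{B}\log\left(\frac1\delta\right)}-\frac{1}{B+1}\right).$$ Consider the test rejecting the null hypothesis $P=Q$ if $T_{n,m}(\mathcal{F})>\hat q_B(\alpha)$ (with $T_{n,m}(\mathcal F)$ and the permutation quantile $\hat q_B(\alpha)$ as defined in the context) and assume that $\alpha_B\in(0,1)$. Then the power of the test satisfies $\mathbb{P}(T_{n,m}(\mathcal{F})>\hat q_B(\alpha))\ge1-3\delta$ if either of the following inequalities holds: $$\left(1-\frac{2}{\sqrt{n+m-1}}\right)d_{\mathcal{F}}(P,Q)\ \ge\ \frac2n(M_n(P)+M_n(Q))+\frac2m(M_m(P)+M_m(Q))+\frac{12}{n+m}\log\left(\frac1\delta\right)+\sqrt{\frac1n+\frac1m}\left(2\sqrt{2\log\left(\frac1{\alpha_B}\right)}+\sqrt{2\log\left(\frac1\delta\right)}\right)$$ or $$\begin{aligned}&\left(1-\frac{2}{\sqrt{n+m-1}}-4\sqrt{3\left(\frac1n+\frac1m\right)\log\left(\frac1{\alpha_B}\right)}\right)d_{\mathcal{F}}(P,Q)\\ &\ge\left(\frac1n\vee\frac1m\right)\log\left(\frac1\delta\right)+\frac2n(M_n(P)+M_n(Q))+\frac2m(M_m(P)+M_m(Q))+\frac{12}{n+m}\log\left(\frac1\delta\right)\\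 &\quad+\sqrt{2\left(\frac{\sigma_P^2(\mathcal{F})}{n}+\frac{\sigma_Q^2(\mathcal{F})}{m}\right)\log\left(\frac1\delta\right)}+2\left(\frac1n+\frac1m\right)\sqrt{\log\left(\frac1{\alpha_B}\right)}\\ &\qquad\times\sqrt{34(M_n(P)+M_m(Q))+\frac{2m}{n(n+m)}M_n^2(P)+\frac{2n}{m(n+m)}M_m^2(Q)+V+4\log\left(\frac1\delta\right)}\ .\end{aligned}$$
   Context: Notation. $Z=(Z_1,\dots,Z_{n+m})=(X_1,\dots,X_n,Y_1,\dots,Y_m)$. Test statistic: $T_{n,m}(\mathcal{F})=\sup_{f\in\mathcal{F}}\left\{\frac1n\sum_{i=1}^nf(X_i)-\frac1m\sum_{j=1}^mf(Y_j)\right\}$. Permutation quantile: let $w\in\mathbb{R}^{n+m}$ have its first $n$ coordinates equal to $1/n$ and its last $m$ coordinates equal to $-1/m$; let $\xi^{(0)}=w$ and let $\xi^{(1)},\dots,\xi^{(B)}$ be i.i.d., independent of $Z$, each distributed as $(w_{\sigma(i)})_{1\le i\le n+m}$ with $\sigma$ a uniform random permutation of $\{1,\dots,n+m\}$. Put $T_\xi(Z)=\sup_{f\in\mathcal{F}}\sum_{i=1}^{n+m}\xi_if(Z_i)$ and $\hat F_B^{(\ell)}(x)=\frac1{B+1}\sum_{b=0}^B\mathbb{I}\{T_{\xi^{(b)}}(Z)<x\}$. Then $\hat q_B(\alpha)=\inf\{q:\hat F_B^{(\ell)}(q)\ge1-\alpha\}$. Other quantities: $d_{\mathcal{F}}(P,Q)=\sup_{f\in\mathcal{F}}\{\int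 f\,dP-\int f\,dQ\}$; for $R\in\{P,Q\}$, $\sigma_R^2(\mathcal{F})=\sup_{f\in\mathcal{F}}\mathrm{Var}_{Z_1\sim R}(f(Z_1))$; $V=\sup_{f\in\mathcal{F}}\{n\mathrm{Var}(f(X_1))+m\mathrm{Var}(f(Y_1))\}$; for an integer $k\ge1$, $M_k(R)=\mathbb{E}\left[\sup_{f\in\mathcal{F}}\sum_{i=1}^k(f(Z_i')-\mathbb{E}[f(Z_i')])\right]$ with $Z'_1,\dots,Z'_k$ i.i.d. of law $R$. *)

theory Defs
  imports "HOL-Probability.Probability" "HOL-Combinatorics.Permutations"
begin

text \<open>
  A function on the measurable space \<open>E\<close> is an element of \<open>space E \<rightarrow>\<^sub>E UNIV\<close>, i.e. it is
  \<open>undefined\<close> off \<open>space E\<close>. Hence the negation of \<open>f\<close> is \<open>\<lambda>x\<in>space E. - f x\<close>, and the topology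
  of pointwise convergence is the product topology indexed by \<open>space E\<close>, in the library's sense.
\<close>

definition bounded_function_class :: "'e measure \<Rightarrow> ('e \<Rightarrow> real) set \<Rightarrow> bool" where
  "bounded_function_class E F \<longleftrightarrow>
     F \<noteq> {} \<and> F \<subseteq> (space E \<rightarrow>\<^sub>E {-1..1}) \<and> F \<subseteq> borel_measurable E"

definition symmetric_class :: "'e measure \<Rightarrow> ('e \<Rightarrow> real) set \<Rightarrow> bool" where
  "symmetric_class E F \<longleftrightarrow> (\<forall>f\<in>F. (\<lambda>x\<in>space E. - f x) \<in> F)"

definition pointwise_separable :: "'e measure \<Rightarrow> ('e \<Rightarrow> real) set \<Rightarrow> bool" where
  "pointwise_separable E F \<longleftrightarrow>
     separable_space (subtopology (product_topology (\<lambda>_. euclideanreal) (space E)) F)"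

definition test_stat ::
    "('e \<Rightarrow> real) set \<Rightarrow> nat \<Rightarrow> nat \<Rightarrow> (nat \<Rightarrow> 'e) \<Rightarrow> (nat \<Rightarrow> 'e) \<Rightarrow> real" where
  "test_stat F n m x y =
     (SUP f\<in>F. (1 / real n) * (\<Sum>i=1..n. f (x i)) - (1 / real m) * (\<Sum>j=1..m. f (y j)))"

definition pooled :: "nat \<Rightarrow> (nat \<Rightarrow> 'a) \<Rightarrow> (nat \<Rightarrow> 'a) \<Rightarrow> nat \<Rightarrow> 'a" where
  "pooled n x y i = (if i \<le> n then x i else y (i - n))"

text \<open>
  Vectors in \<open>\<real>\<^bsup>n+m\<^esup>\<close> are extensional functions on \<open>{1..n + m}\<close>, the points of the
  space \<open>weight_space (n + m)\<close>.
\<close>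

abbreviation weight_space :: "nat \<Rightarrow> (nat \<Rightarrow> real) measure" where
  "weight_space N \<equiv> PiM {1..N} (\<lambda>_. borel)"

definition weights :: "nat \<Rightarrow> nat \<Rightarrow> nat \<Rightarrow> real" where
  "weights n m = (\<lambda>i\<in>{1..n+m}. if i \<le> n then 1 / real n else - (1 / real m))"

definition permuted_weights_law :: "nat \<Rightarrow> nat \<Rightarrow> (nat \<Rightarrow> real) measure" where
  "permuted_weights_law n m =
     distr (measure_pmf (pmf_of_set {\<sigma>. \<sigma> permutes {1..n+m}})) (weight_space (n+m))
       (\<lambda>\<sigma>. \<lambda>i\<in>{1..n+m}. weights n m (\<sigma> i))"

definition weighted_stat ::
    "('e \<Rightarrow> real) set \<Rightarrow> nat \<Rightarrow> (nat \<Rightarrow> real) \<Rightarrow> (nat \<Rightarrow> 'e) \<Rightarrow> real" where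
  "weighted_stat F N c z = (SUP f\<in>F. \<Sum>i=1..N. c i * f (z i))"

definition perm_cdf ::
    "('e \<Rightarrow> real) set \<Rightarrow> nat \<Rightarrow> nat \<Rightarrow> (nat \<Rightarrow> nat \<Rightarrow> real) \<Rightarrow> (nat \<Rightarrow> 'e) \<Rightarrow> real \<Rightarrow> real" where
  "perm_cdf F N B c z x =
     (1 / (real B + 1)) * (\<Sum>b=0..B. of_bool (weighted_stat F N (c b) z < x))"

definition perm_quantile ::
    "('e \<Rightarrow> real) set \<Rightarrow> nat \<Rightarrow> nat \<Rightarrow> (nat \<Rightarrow> nat \<Rightarrow> real) \<Rightarrow> (nat \<Rightarrow> 'e) \<Rightarrow> real \<Rightarrow> real" where
  "perm_quantile F N B c z \<alpha> = Inf {q. perm_cdf F N B c z q \<ge> 1 - \<alpha>}"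

definition ipm :: "('e \<Rightarrow> real) set \<Rightarrow> 'e measure \<Rightarrow> 'e measure \<Rightarrow> real" where
  "ipm F P Q = (SUP f\<in>F. (\<integral>x. f x \<partial>P) - (\<integral>x. f x \<partial>Q))"

definition sigma_sq :: "('e \<Rightarrow> real) set \<Rightarrow> 'e measure \<Rightarrow> real" where
  "sigma_sq F R = (SUP f\<in>F. prob_space.variance R f)"

definition total_var ::
    "('e \<Rightarrow> real) set \<Rightarrow> nat \<Rightarrow> nat \<Rightarrow> 'e measure \<Rightarrow> 'e measure \<Rightarrow> real" where
  "total_var F n m P Q =
     (SUP f\<in>F. real n * prob_space.variance P f + real m * prob_space.variance Q f)"

definition centered_sup :: "('e \<Rightarrow> real) set \<Rightarrow> 'e measure \<Rightarrow> nat \<Rightarrow> (nat \<Rightarrow> 'e) \<Rightarrow> real" where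
  "centered_sup F R k z = (SUP f\<in>F. \<Sum>i=1..k. (f (z i) - (\<integral>x. f x \<partial>R)))"

text \<open>
  The expectation of \<open>centered_sup F R k\<close> under \<open>k\<close> independent draws from \<open>R\<close>. For a
  symmetric class this supremum is nonnegative, but topological separability does not make it
  measurable: \<open>f \<mapsto> \<integral>f dR\<close> need not be continuous for pointwise convergence. The Bochner
  integral would then be \<open>0\<close> by convention. The nonnegative integral is instead the lower integral,
  and agrees with the expectation whenever that exists (lemma \<open>expected_sup_eq_expectation\<close>).
\<close>

definition expected_sup :: "('e \<Rightarrow> real) set \<Rightarrow> nat \<Rightarrow> 'e measure \<Rightarrow> real" where
  "expected_sup F k R =
     enn2real (\<integral>\<^sup>+z. ennreal (centered_sup F R k z) \<partial>PiM {1..k} (\<lambda>_. R))"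

lemma centered_sup_nonneg:
  fixes R E :: "'e measure"
  assumes "prob_space R" and R: "sets R = sets E"
    and F: "bounded_function_class E F" "symmetric_class E F"
    and z: "z \<in> {1..k} \<rightarrow> space E"
  shows "0 \<le> centered_sup F R k z"
proof -
  interpret prob_space R by fact
  have sp: "space R = space E"
    using R by (rule sets_eq_imp_space_eq)
  define v :: "('e \<Rightarrow> real) \<Rightarrow> real" where "v f = (\<Sum>i=1..k. (f (z i) - (\<integral>x. f x \<partial>R)))" for f
  obtain f where f: "f \<in> F"
    using F(1) by (auto simp: bounded_function_class_def)
  define g where "g = (\<lambda>x\<in>space E. - f x)"
  have g: "g \<in> F"
    using F(2) f by (auto simp: symmetric_class_def g_def)
  have "(\<integral>x. g x \<partial>R) = (\<integral>x. - f x \<partial>R)"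
    by (rule Bochner_Integration.integral_cong) (auto simp: g_def sp)
  then have int_g: "(\<integral>x. g x \<partial>R) = - (\<integral>x. f x \<partial>R)" by simp
  have g_z: "g (z i) = - f (z i)" if "i \<in> {1..k}" for i
    using z that by (auto simp: g_def Pi_iff)
  have "v g = (\<Sum>i=1..k. - (f (z i) - (\<integral>x. f x \<partial>R)))"
    unfolding v_def by (intro sum.cong) (simp_all add: int_g g_z)
  then have "v g = - v f"
    unfolding v_def sum_negf .
  moreover have bdd: "bdd_above (v ` F)"
  proof (rule bdd_aboveI2)
    fix h assume h: "h \<in> F"
    have hb: "\<bar>h x\<bar> \<le> 1" if "x \<in> space E" for x
      using F(1) h that by (fastforce simp: bounded_function_class_def PiE_iff)
    have "h \<in> borel_measurable R"
      using F(1) h R by (auto simp: bounded_function_class_def cong: measurable_cong_sets)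
    then have "integrable R h"
      by (intro integrable_const_bound [where B = 1]) (auto simp: sp hb intro!: AE_I2)
    moreover have "- 1 \<le> h x" if "x \<in> space E" for x
      using hb [OF that] by linarith
    ultimately have int_h: "- 1 \<le> (\<integral>x. h x \<partial>R)"
      by (intro integral_ge_const) (auto simp: sp intro!: AE_I2)
    have "h (z i) - (\<integral>x. h x \<partial>R) \<le> 2" if "i \<in> {1..k}" for i
      using hb [of "z i"] int_h z that by (auto simp: Pi_iff)
    then have "v h \<le> (\<Sum>i=1..k. 2)"
      unfolding v_def by (rule sum_mono)
    then show "v h \<le> 2 * real k" by simp
  qed
  have "v f \<le> (SUP f\<in>F. v f)" "v g \<le> (SUP f\<in>F. v f)"
    using f g bdd by (auto intro: cSUP_upper)
  ultimately show ?thesis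
    unfolding centered_sup_def v_def by linarith
qed

lemma expected_sup_eq_expectation:
  assumes "prob_space R" and R: "sets R = sets E"
    and F: "bounded_function_class E F" "symmetric_class E F"
    and meas: "centered_sup F R k \<in> borel_measurable (PiM {1..k} (\<lambda>_. R))"
  shows "expected_sup F k R = (\<integral>z. centered_sup F R k z \<partial>PiM {1..k} (\<lambda>_. R))"
  unfolding expected_sup_def
proof (rule integral_eq_nn_integral [symmetric, OF meas], rule AE_I2)
  fix z assume "z \<in> space (PiM {1..k} (\<lambda>_. R))"
  then show "0 \<le> centered_sup F R k z"
    using sets_eq_imp_space_eq [OF R]
    by (intro centered_sup_nonneg [OF assms(1) R F]) (auto simp: space_PiM PiE_iff)
qed

definition alpha_B :: "real \<Rightarrow> real \<Rightarrow> nat \<Rightarrow> real" where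
  "alpha_B \<alpha> \<delta> B =
     (1 + 1 / real B) * (\<alpha> - sqrt (3 * \<alpha> / real B * ln (1 / \<delta>)) - 1 / (real B + 1))"

end

theory Submission
  imports Defs
begin

text \<open>
  Replace \<open>F\<close> by a countable symmetric subclass \<open>G\<close> with the same statistics. With \<open>T\<close> the observed
  statistic, non-rejection means that more than \<open>(B + 1) \<alpha> - 1\<close> of the \<open>B\<close> permuted statistics are at
  least \<open>T\<close>. For any deterministic threshold \<open>t\<close> this forces \<open>T < t\<close>, or that the conditional probability,
  given the sample, of a permuted statistic being at least \<open>t\<close> exceeds \<open>alpha_B\<close>, or a binomial deviation of
  probability at most \<open>\<delta> powr (3/2)\<close>.

  The first event is controlled by the Hoeffding or Bernstein inequality for a single, nearly optimal
  \<open>f\<close>. For the second one, the permuted statistic is conditionally concentrated around its mean \<open>W\<close> over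
  all permutations: either by a Hoeffding argument revealing a random subset one element at a time, or
  by a modified logarithmic Sobolev inequality for swaps, in which case the variance proxy is the
  dispersion \<open>S\<close>, the supremum over \<open>f\<close> of the sum of \<open>(f (z i) - pooled_mean f) ^ 2\<close>. Both \<open>W\<close> (suitably scaled) and
  \<open>S\<close> are self-bounding functions of the sample, so tensorization of entropy gives upper tails around
  their expectations, which symmetrization and contraction bound by the quantities \<open>expected_sup\<close>, \<open>total_var\<close> and \<open>ipm\<close>.
\<close>

text \<open>\<open>G\<close> and \<open>F\<close> have the same finite-sample statistics, but
  integrals need not be continuous for pointwise convergence. So \<open>d\<close>, the variances and
  the near-optimal \<open>f\<close> stay with \<open>F\<close>, only upper bounds pass from
  \<open>G\<close> to \<open>F\<close>, and the lower tail is proved for an arbitrary bounded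
  measurable \<open>f\<close>. The factor \<open>2\<close> before the expectations comes from the
  self-bounding tail of \<open>W\<close> at parameter \<open>1/2\<close>, whose exponent contains
  the expectation of \<open>W\<close> divided by \<open>1 - 1/2\<close>. That expectation contains
  \<open>d / sqrt (n + m - 1)\<close>, hence the loss \<open>2 / sqrt (n + m - 1)\<close> in the
  coefficient of \<open>d\<close>. One coordinate moves \<open>W\<close> by at most
  \<open>4 / (n + m)\<close>; probability \<open>\<delta> powr (3/2)\<close> then costs
  \<open>12 / (n + m)\<close> times \<open>ln (1 / \<delta>)\<close>. The budget
  \<open>3 * \<delta>\<close> is shared unevenly: the lower tail takes \<delta>, and the other
  events take \<open>\<delta> powr (7/6)\<close> or \<open>\<delta> powr (3/2)\<close>, whose sum
  stays below \<open>2 * \<delta>\<close> as long as \<open>\<delta> < 1/3\<close>. For larger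
  \<delta> the claimed lower bound is not positive.\<close>

section \<open>The Herbst argument and finite entropy inequalities\<close>

text \<open>The differential inequality says that \<open>\<psi> x * (1 - x * h) / x - x * A\<close> is nonincreasing.\<close>

lemma herbst_argument:
  fixes \<psi> \<psi>' :: "real \<Rightarrow> real"
  assumes der: "\<And>x. 0 < x \<Longrightarrow> x \<le> l \<Longrightarrow> (\<psi> has_real_derivative \<psi>' x) (at x)"
    and der0: "(\<psi> has_real_derivative w) (at 0)" and "\<psi> 0 = 0"
    and ineq: "\<And>x. 0 < x \<Longrightarrow> x \<le> l \<Longrightarrow> x * \<psi>' x - \<psi> x \<le> x\<^sup>2 * (A + h * \<psi>' x)"
    and l: "0 < l" "l * h < 1"
  shows "\<psi> l \<le> l * (w + l * A) / (1 - l * h)"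
proof -
  define u where "u x = \<psi> x * (1 - x * h) / x - x * A" for x
  have du: "(u has_real_derivative ((\<psi>' x * (1 - x * h) - \<psi> x * h) * x - \<psi> x * (1 - x * h)) / (x * x) - A) (at x)"
    if "0 < x" "x \<le> l" for x
    unfolding u_def using der[OF that] that
    by (auto intro!: derivative_eq_intros)
  have neg: "((\<psi>' x * (1 - x * h) - \<psi> x * h) * x - \<psi> x * (1 - x * h)) / (x * x) - A \<le> 0"
    if "0 < x" "x \<le> l" for x
  proof -
    have "(\<psi>' x * (1 - x * h) - \<psi> x * h) * x - \<psi> x * (1 - x * h) \<le> A * (x * x)"
      using ineq[OF that] by (simp add: algebra_simps power2_eq_square)
    then show ?thesis using that by (simp add: pos_divide_le_eq)
  qed
  have mono: "u l \<le> u x" if "0 < x" "x \<le> l" for x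
  proof (rule DERIV_nonpos_imp_nonincreasing[OF that(2)])
    fix y assume "x \<le> y" "y \<le> l"
    then show "\<exists>z. DERIV u y :> z \<and> z \<le> 0"
      using du[of y] neg[of y] that by fastforce
  qed
  \<comment> \<open>Since \<open>\<psi> 0 = 0\<close>, this quotient is the difference quotient at
    \<open>0\<close>; it identifies the limit of \<open>u\<close> there, and monotonicity compares
    that limit with \<open>u l\<close>.\<close>
  have "((\<lambda>x. \<psi> x / x) \<longlongrightarrow> w) (at_right 0)"
    using der0 \<open>\<psi> 0 = 0\<close> unfolding has_field_derivative_iff
    by (auto intro: tendsto_mono[OF at_le])
  then have "((\<lambda>x. \<psi> x / x * (1 - x * h) - x * A) \<longlongrightarrow> w * (1 - 0 * h) - 0 * A) (at_right 0)"
    by (intro tendsto_intros)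
  moreover have "(\<lambda>x. \<psi> x / x * (1 - x * h) - x * A) = u"
    by (auto simp: u_def fun_eq_iff)
  ultimately have "(u \<longlongrightarrow> w) (at_right 0)" by simp
  moreover have "eventually (\<lambda>x. u l \<le> u x) (at_right 0)"
    unfolding eventually_at_right_field using l mono by (intro exI[of _ l]) auto
  ultimately have "u l \<le> w"
    by (rule tendsto_lowerbound) simp
  then have "\<psi> l * (1 - l * h) / l \<le> w + l * A" unfolding u_def by simp
  then have "\<psi> l * (1 - l * h) \<le> (w + l * A) * l" using l by (simp add: pos_divide_le_eq)
  then show ?thesis using l by (simp add: pos_le_divide_eq mult.commute)
qed

lemma exp_remainder_bound:
  fixes x :: real shows "\<bar>exp x - 1 - x\<bar> \<le> x\<^sup>2 * exp \<bar>x\<bar>"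
proof -
  obtain t where t: "\<bar>t\<bar> \<le> \<bar>x\<bar>" "exp x = (\<Sum>m<2. x ^ m / fact m) + exp t / fact 2 * x ^ 2"
    using Maclaurin_exp_le[of x 2] by blast
  then have "exp x - 1 - x = exp t / 2 * x\<^sup>2" by (simp add: numeral_2_eq_2)
  moreover have "exp t / 2 \<le> exp \<bar>x\<bar>"
  proof -
    have "exp t \<le> exp \<bar>x\<bar>" using t(1) by simp
    then show ?thesis using exp_gt_zero[of t] by linarith
  qed
  ultimately have "\<bar>exp x - 1 - x\<bar> = x\<^sup>2 * (exp t / 2)" by (simp only: abs_mult) simp
  also have "\<dots> \<le> x\<^sup>2 * exp \<bar>x\<bar>" using \<open>exp t / 2 \<le> exp \<bar>x\<bar>\<close> by (intro mult_left_mono) auto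
  finally show ?thesis .
qed

lemma mult_le_abs_bound:
  fixes s t C :: real
  assumes "\<bar>t\<bar> \<le> C" shows "s * t \<le> \<bar>s\<bar> * C"
proof -
  have "s * t \<le> \<bar>s\<bar> * \<bar>t\<bar>" by (metis abs_ge_self abs_mult)
  also have "\<dots> \<le> \<bar>s\<bar> * C" using assms by (intro mult_left_mono) auto
  finally show ?thesis .
qed

section \<open>From entropy bounds to exponential moments\<close>

context prob_space begin

text \<open>Boundedness of \<open>T\<close> makes the quadratic remainder
  \<open>K * h\<^sup>2\<close> uniform over the sample points, so the difference quotient is within
  \<open>K * \<bar>h\<bar>\<close> of the claimed derivative and no separate exchange of limit and
  integral is required.\<close>

lemma mgf_has_derivative:
  fixes T :: "'a \<Rightarrow> real"
  assumes [measurable]: "T \<in> borel_measurable M" and T: "\<And>x. x \<in> space M \<Longrightarrow> \<bar>T x\<bar> \<le> C"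
  shows "((\<lambda>s. expectation (\<lambda>x. exp (s * T x))) has_real_derivative expectation (\<lambda>x. T x * exp (s * T x))) (at s)"
proof -
  have C: "0 \<le> C" using T not_empty by force
  have i1: "integrable M (\<lambda>x. exp (r * T x))" for r
  proof (rule integrable_const_bound[where B="exp (\<bar>r\<bar> * C)"])
    show "AE x in M. norm (exp (r * T x)) \<le> exp (\<bar>r\<bar> * C)"
    proof (rule AE_I2)
      fix x assume "x \<in> space M"
      then have "r * T x \<le> \<bar>r\<bar> * C"
        using T by (intro mult_le_abs_bound) auto
      then show "norm (exp (r * T x)) \<le> exp (\<bar>r\<bar> * C)" by simp
    qed
  qed simp
  have i2: "integrable M (\<lambda>x. T x * exp (r * T x))" for r
  proof (rule Bochner_Integration.integrable_bound[OF integrable_mult_right[OF i1[of r], of C]])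
    show "AE x in M. norm (T x * exp (r * T x)) \<le> norm (C * exp (r * T x))"
      using T C by (auto intro!: AE_I2 mult_right_mono simp: abs_mult)
  qed simp
  define K where "K = C\<^sup>2 * exp C * exp (\<bar>s\<bar> * C)"
  have key: "\<bar>(expectation (\<lambda>x. exp ((s + h) * T x)) - expectation (\<lambda>x. exp (s * T x))) / h
      - expectation (\<lambda>x. T x * exp (s * T x))\<bar> \<le> K * \<bar>h\<bar>" if h: "h \<noteq> 0" "\<bar>h\<bar> \<le> 1" for h
  proof -
    have "(expectation (\<lambda>x. exp ((s + h) * T x)) - expectation (\<lambda>x. exp (s * T x)))
      - h * expectation (\<lambda>x. T x * exp (s * T x))
      = expectation (\<lambda>x. exp ((s + h) * T x) - exp (s * T x) - h * (T x * exp (s * T x)))"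
      using i1 i2 by simp
    then have "\<bar>(expectation (\<lambda>x. exp ((s + h) * T x)) - expectation (\<lambda>x. exp (s * T x)))
      - h * expectation (\<lambda>x. T x * exp (s * T x))\<bar>
      = \<bar>expectation (\<lambda>x. exp ((s + h) * T x) - exp (s * T x) - h * (T x * exp (s * T x)))\<bar>"
      by simp
    also have "\<bar>expectation (\<lambda>x. exp ((s + h) * T x) - exp (s * T x) - h * (T x * exp (s * T x)))\<bar> \<le> expectation (\<lambda>x. \<bar>exp ((s + h) * T x) - exp (s * T x) - h * (T x * exp (s * T x))\<bar>)"
      by (rule integral_abs_bound)
    also have "\<dots> \<le> expectation (\<lambda>x. K * h\<^sup>2)"
    proof (rule integral_mono)
      show "integrable M (\<lambda>x. \<bar>exp ((s + h) * T x) - exp (s * T x) - h * (T x * exp (s * T x))\<bar>)"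
        using i1 i2 by simp
      fix x assume x: "x \<in> space M"
      have "exp ((s + h) * T x) - exp (s * T x) - h * (T x * exp (s * T x))
        = exp (s * T x) * (exp (h * T x) - 1 - h * T x)"
        by (simp add: algebra_simps exp_add)
      then have "\<bar>exp ((s + h) * T x) - exp (s * T x) - h * (T x * exp (s * T x))\<bar>
        = exp (s * T x) * \<bar>exp (h * T x) - 1 - h * T x\<bar>" by (simp add: abs_mult)
      also have "\<dots> \<le> exp (\<bar>s\<bar> * C) * ((h * T x)\<^sup>2 * exp \<bar>h * T x\<bar>)"
      proof (intro mult_mono exp_remainder_bound)
        have "s * T x \<le> \<bar>s\<bar> * C"
          using T x by (intro mult_le_abs_bound) auto
        then show "exp (s * T x) \<le> exp (\<bar>s\<bar> * C)" by simp
      qed auto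
      also have "\<dots> \<le> exp (\<bar>s\<bar> * C) * ((h * C)\<^sup>2 * exp C)"
      proof (intro mult_left_mono mult_mono)
        have "\<bar>h * T x\<bar> \<le> \<bar>h\<bar> * C" using T[OF x] by (simp add: abs_mult mult_left_mono)
        then show "(h * T x)\<^sup>2 \<le> (h * C)\<^sup>2" using C by (metis abs_le_square_iff abs_mult abs_of_nonneg)
        have "\<bar>h\<bar> * C \<le> 1 * C" using h C by (intro mult_right_mono) auto
        then show "exp \<bar>h * T x\<bar> \<le> exp C" using \<open>\<bar>h * T x\<bar> \<le> \<bar>h\<bar> * C\<close> by simp
      qed auto
      also have "\<dots> = K * h\<^sup>2" by (simp add: K_def power_mult_distrib)
      finally show "\<bar>exp ((s + h) * T x) - exp (s * T x) - h * (T x * exp (s * T x))\<bar> \<le> K * h\<^sup>2" .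
    qed simp
    finally have "\<bar>(expectation (\<lambda>x. exp ((s + h) * T x)) - expectation (\<lambda>x. exp (s * T x)))
      - h * expectation (\<lambda>x. T x * exp (s * T x))\<bar> \<le> K * h\<^sup>2" by (simp add: prob_space)
    then have "\<bar>(expectation (\<lambda>x. exp ((s + h) * T x)) - expectation (\<lambda>x. exp (s * T x)))
      - h * expectation (\<lambda>x. T x * exp (s * T x))\<bar> / \<bar>h\<bar> \<le> K * h\<^sup>2 / \<bar>h\<bar>"
      by (rule divide_right_mono) simp
    moreover have "K * h\<^sup>2 / \<bar>h\<bar> = K * \<bar>h\<bar>" using h
      by (metis (no_types, opaque_lifting) abs_eq_0 nonzero_mult_div_cancel_right power2_abs power2_eq_square times_divide_eq_right)
    ultimately show ?thesis using h
      by (simp add: diff_divide_distrib flip: abs_divide)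
  qed
  show ?thesis
    unfolding DERIV_def
  proof (rule Lim_null[THEN iffD2], rule Lim_null_comparison)
    show "\<forall>\<^sub>F h in at 0. norm ((expectation (\<lambda>x. exp ((s + h) * T x)) - expectation (\<lambda>x. exp (s * T x))) / h
      - expectation (\<lambda>x. T x * exp (s * T x))) \<le> K * \<bar>h\<bar>"
      unfolding eventually_at using key by (intro exI[of _ 1]) (auto simp: dist_real_def)
    show "((\<lambda>h. K * \<bar>h\<bar>) \<longlongrightarrow> 0) (at 0)"
      by (auto intro!: tendsto_eq_intros)
  qed
qed

text \<open>Dividing the entropy bound by the moment generating function gives the differential
  inequality of \<open>herbst_argument\<close> for its logarithm. \<open>A\<close> is a variance
  term and \<open>h\<close> a self-bounding term: the statistic on slices has both, self-bounding
  functions of independent variables have \<open>A = 0\<close>.\<close>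

lemma herbst_mgf:
  fixes T :: "'a \<Rightarrow> real"
  assumes T_meas[measurable]: "T \<in> borel_measurable M" and T: "\<And>x. x \<in> space M \<Longrightarrow> \<bar>T x\<bar> \<le> C"
    and ineq: "\<And>s. 0 < s \<Longrightarrow> s \<le> l \<Longrightarrow>
       s * expectation (\<lambda>x. T x * exp (s * T x))
         - expectation (\<lambda>x. exp (s * T x)) * ln (expectation (\<lambda>x. exp (s * T x)))
       \<le> s\<^sup>2 * (A * expectation (\<lambda>x. exp (s * T x)) + h * expectation (\<lambda>x. T x * exp (s * T x)))"
    and l: "0 < l" "l * h < 1"
  shows "expectation (\<lambda>x. exp (l * T x)) \<le> exp (l * (expectation T + l * A) / (1 - l * h))"
proof -
  define Z where "Z s = expectation (\<lambda>x. exp (s * T x))" for s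
  define Y where "Y s = expectation (\<lambda>x. T x * exp (s * T x))" for s
  have Z_pos: "0 < Z s" for s
  proof -
    have "exp (- (\<bar>s\<bar> * C)) \<le> Z s" unfolding Z_def
    proof (rule integral_ge_const)
      show "integrable M (\<lambda>x. exp (s * T x))"
      proof (rule integrable_const_bound[where B="exp (\<bar>s\<bar> * C)"])
        show "AE x in M. norm (exp (s * T x)) \<le> exp (\<bar>s\<bar> * C)"
        proof (rule AE_I2)
          fix x assume "x \<in> space M"
          then have "s * T x \<le> \<bar>s\<bar> * C"
            using T by (intro mult_le_abs_bound) auto
          then show "norm (exp (s * T x)) \<le> exp (\<bar>s\<bar> * C)" by simp
        qed
      qed simp
      show "AE x in M. exp (- (\<bar>s\<bar> * C)) \<le> exp (s * T x)"
      proof (rule AE_I2)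
        fix x assume "x \<in> space M"
        then have "- (s * T x) \<le> \<bar>s\<bar> * C"
          using T mult_le_abs_bound[of "T x" C "- s"] by auto
        then show "exp (- (\<bar>s\<bar> * C)) \<le> exp (s * T x)" by simp
      qed
    qed
    then show ?thesis using exp_gt_zero less_le_trans by blast
  qed
  have dZ: "(Z has_real_derivative Y s) (at s)" for s
    unfolding Z_def Y_def using T by (rule mgf_has_derivative[OF T_meas])
  have dlnZ: "((\<lambda>s. ln (Z s)) has_real_derivative Y s / Z s) (at s)" for s
    using DERIV_chain2[OF DERIV_ln_divide[OF Z_pos] dZ] by simp
  have Z0: "Z 0 = 1" by (simp add: Z_def prob_space)
  have "ln (Z l) \<le> l * (Y 0 / Z 0 + l * A) / (1 - l * h)"
  proof (rule herbst_argument[where \<psi>'="\<lambda>s. Y s / Z s"])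
    fix s assume s: "0 < s" "s \<le> l"
    have "s * Y s - Z s * ln (Z s) \<le> s\<^sup>2 * (A * Z s + h * Y s)"
      using ineq[OF s] unfolding Z_def Y_def .
    then have "(s * Y s - Z s * ln (Z s)) / Z s \<le> s\<^sup>2 * (A * Z s + h * Y s) / Z s"
      using Z_pos[of s] by (intro divide_right_mono) auto
    then show "s * (Y s / Z s) - ln (Z s) \<le> s\<^sup>2 * (A + h * (Y s / Z s))"
      using Z_pos[of s] by (simp add: field_simps)
  qed (use dlnZ[of 0] dlnZ l Z0 in auto)
  then have "ln (Z l) \<le> l * (expectation T + l * A) / (1 - l * h)"
    by (simp add: Z0) (simp add: Y_def)
  then show ?thesis using Z_pos[of l] unfolding Z_def[symmetric]
    by (metis exp_le_cancel_iff exp_ln)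
qed

end

text \<open>Chebyshev's association inequality for the weights \<open>exp (s * g x)\<close>: the
  tilted mean of a function that is nondecreasing in \<open>g\<close> grows with the tilt. Doubling
  the sum makes every summand a product of two factors of the same sign.\<close>

lemma sum_tilt_mono:
  fixes g q :: "'a \<Rightarrow> real"
  assumes "s \<le> t" and q: "\<And>x y. x \<in> S \<Longrightarrow> y \<in> S \<Longrightarrow> g x \<le> g y \<Longrightarrow> q x \<le> q y"
  shows "(\<Sum>x\<in>S. exp (s * g x) * q x) * (\<Sum>x\<in>S. exp (t * g x))
    \<le> (\<Sum>x\<in>S. exp (t * g x) * q x) * (\<Sum>x\<in>S. exp (s * g x))"
proof -
  define D where "D x y = (exp (t * g x) * exp (s * g y) - exp (s * g x) * exp (t * g y))" for x y
  have "0 \<le> (\<Sum>x\<in>S. \<Sum>y\<in>S. D x y * (q x - q y))"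
  proof (intro sum_nonneg)
    fix x y assume xy: "x \<in> S" "y \<in> S"
    have D: "D x y = exp (s * g x + s * g y) * (exp ((t - s) * g x) - exp ((t - s) * g y))"
      by (simp add: D_def algebra_simps flip: exp_add)
    show "0 \<le> D x y * (q x - q y)"
    proof (cases "g x \<le> g y")
      case True
      then have "(t - s) * g x \<le> (t - s) * g y" using \<open>s \<le> t\<close> by (intro mult_left_mono) auto
      then have "D x y \<le> 0" unfolding D by (simp add: mult_le_0_iff)
      then show ?thesis using q[OF xy True] by (simp add: mult_nonpos_nonpos)
    next
      case False
      then have "(t - s) * g y \<le> (t - s) * g x" using \<open>s \<le> t\<close> by (intro mult_left_mono) auto
      then have "D x y \<ge> 0" unfolding D by simp
      then show ?thesis using q[OF xy(2,1)] False by simp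
    qed
  qed
  also have "\<dots> = (\<Sum>x\<in>S. \<Sum>y\<in>S. D x y * q x) - (\<Sum>x\<in>S. \<Sum>y\<in>S. D x y * q y)"
    by (simp add: algebra_simps sum_subtractf)
  also have "(\<Sum>x\<in>S. \<Sum>y\<in>S. D x y * q y) = (\<Sum>x\<in>S. \<Sum>y\<in>S. D y x * q x)"
    by (rule sum.swap)
  also have "\<dots> = - (\<Sum>x\<in>S. \<Sum>y\<in>S. D x y * q x)"
  proof -
    have "D y x * q x = - (D x y * q x)" for x y by (simp add: D_def left_diff_distrib)
    then show ?thesis by (simp only: sum_negf)
  qed
  also have "(\<Sum>x\<in>S. \<Sum>y\<in>S. D x y * q x) =
     (\<Sum>x\<in>S. exp (t * g x) * q x) * (\<Sum>x\<in>S. exp (s * g x)) - (\<Sum>x\<in>S. exp (s * g x) * q x) * (\<Sum>x\<in>S. exp (t * g x))"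
  proof -
    have "(\<Sum>x\<in>S. \<Sum>y\<in>S. D x y * q x) = (\<Sum>x\<in>S. \<Sum>y\<in>S. (exp (t * g x) * q x) * exp (s * g y) - (exp (s * g x) * q x) * exp (t * g y))"
      by (intro sum.cong refl) (simp add: D_def left_diff_distrib)
    then show ?thesis by (simp only: sum_subtractf sum_product)
  qed
  finally show ?thesis by linarith
qed

text \<open>With \<psi> the logarithm of \<open>Z s / card S\<close>, the entropy is
  \<open>Z 1\<close> times \<open>\<psi>'(1) - \<psi>(1)\<close>, and
  \<open>s * \<psi>' - \<psi>\<close> has derivative \<open>s * \<psi>''\<close>, where
  \<open>\<psi>''\<close> is the variance of \<open>g\<close> under the tilted law. So a bound on
  these variances that is uniform in \<open>s\<close> suffices. Written with the one-sided square,
  each is at most the mixed quantity \<open>J\<close>, tilted fully in \<open>x\<close> and not at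
  all in \<open>y\<close>.\<close>

lemma entropy_le_pair_energy:
  fixes g :: "'a \<Rightarrow> real"
  assumes S: "finite S" "S \<noteq> {}"
  shows "(\<Sum>x\<in>S. exp (g x) * g x) - (\<Sum>x\<in>S. exp (g x)) * ln ((\<Sum>x\<in>S. exp (g x)) / card S)
    \<le> (\<Sum>x\<in>S. \<Sum>y\<in>S. exp (g x) * (max 0 (g x - g y))\<^sup>2) / (2 * card S)"
proof -
  define q where "q x y = (max 0 (g x - g y))\<^sup>2" for x y
  define Z where "Z s = (\<Sum>x\<in>S. exp (s * g x))" for s
  define Y where "Y s = (\<Sum>x\<in>S. exp (s * g x) * g x)" for s
  define X where "X s = (\<Sum>x\<in>S. exp (s * g x) * (g x)\<^sup>2)" for s
  define J where "J = (\<Sum>x\<in>S. \<Sum>y\<in>S. exp (g x) * q x y) / (card S * Z 1)"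
  have c: "0 < real (card S)" using S by (simp add: card_gt_0_iff)
  have Z_pos: "0 < Z s" for s unfolding Z_def using S by (intro sum_pos) auto
  have dZ: "(Z has_real_derivative Y s) (at s)" for s
    unfolding Z_def Y_def by (auto intro!: derivative_eq_intros sum.cong)
  have dY: "(Y has_real_derivative X s) (at s)" for s
    unfolding Y_def X_def by (auto intro!: derivative_eq_intros sum.cong simp: power2_eq_square)
  have var: "X s * Z s - Y s * Y s = (\<Sum>x\<in>S. \<Sum>y\<in>S. exp (s * g x) * exp (s * g y) * q x y)" for s
  proof -
    have eq: "(g x - g y)\<^sup>2 = q x y + q y x" for x y
      by (cases "g x \<le> g y") (auto simp: q_def max_def power2_commute)
    have "2 * (X s * Z s - Y s * Y s) = (\<Sum>x\<in>S. \<Sum>y\<in>S. exp (s * g x) * exp (s * g y) * (g x - g y)\<^sup>2)"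
    proof -
      have "(\<Sum>x\<in>S. \<Sum>y\<in>S. exp (s * g x) * exp (s * g y) * (g x - g y)\<^sup>2)
        = (\<Sum>x\<in>S. \<Sum>y\<in>S. exp (s * g x) * (g x)\<^sup>2 * exp (s * g y)) + (\<Sum>x\<in>S. \<Sum>y\<in>S. exp (s * g x) * (exp (s * g y) * (g y)\<^sup>2))
        - 2 * (\<Sum>x\<in>S. \<Sum>y\<in>S. (exp (s * g x) * g x) * (exp (s * g y) * g y))"
        by (simp add: power2_diff algebra_simps sum.distrib sum_subtractf sum_distrib_left)
      then show ?thesis unfolding X_def Y_def Z_def sum_product[symmetric] by simp
    qed
    also have "\<dots> = (\<Sum>x\<in>S. \<Sum>y\<in>S. exp (s * g x) * exp (s * g y) * q x y)
        + (\<Sum>x\<in>S. \<Sum>y\<in>S. exp (s * g x) * exp (s * g y) * q y x)"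
      by (simp add: eq algebra_simps sum.distrib)
    also have "(\<Sum>x\<in>S. \<Sum>y\<in>S. exp (s * g x) * exp (s * g y) * q y x)
       = (\<Sum>x\<in>S. \<Sum>y\<in>S. exp (s * g x) * exp (s * g y) * q x y)"
      by (subst sum.swap) (simp add: mult_ac)
    finally show ?thesis by simp
  qed
  have J: "(X s * Z s - Y s * Y s) / (Z s * Z s) \<le> J" if s: "0 \<le> s" "s \<le> 1" for s
  proof -
    \<comment> \<open>\<open>q x y\<close> is nondecreasing in \<open>g x\<close> and nonincreasing
      in \<open>g y\<close>, so the tilt may be raised to \<open>1\<close> in the first variable and
      lowered to \<open>0\<close> in the second.\<close>
    have 1: "(\<Sum>x\<in>S. exp (s * g x) * q x y) * Z 1 \<le> (\<Sum>x\<in>S. exp (1 * g x) * q x y) * Z s" for y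
      unfolding Z_def using s
      by (intro sum_tilt_mono) (auto simp: q_def intro!: power_mono)
    have 2: "(\<Sum>y\<in>S. exp (s * g y) * q x y) * card S \<le> (\<Sum>y\<in>S. q x y) * Z s" for x
      using sum_tilt_mono[of 0 s S g "\<lambda>y. - q x y"] s
      by (auto simp: q_def Z_def sum_negf intro!: power_mono)
    have "(X s * Z s - Y s * Y s) * (card S * Z 1) = card S * (\<Sum>y\<in>S. exp (s * g y) * ((\<Sum>x\<in>S. exp (s * g x) * q x y) * Z 1))"
      unfolding var by (subst sum.swap) (simp add: sum_distrib_left sum_distrib_right mult_ac)
    also have "\<dots> \<le> card S * (\<Sum>y\<in>S. exp (s * g y) * ((\<Sum>x\<in>S. exp (g x) * q x y) * Z s))"
      using 1 by (intro mult_left_mono sum_mono) auto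
    also have "\<dots> = Z s * (\<Sum>x\<in>S. exp (g x) * ((\<Sum>y\<in>S. exp (s * g y) * q x y) * card S))"
      by (simp only: sum_distrib_left sum_distrib_right, subst sum.swap) (simp only: mult_ac)
    also have "\<dots> \<le> Z s * (\<Sum>x\<in>S. exp (g x) * ((\<Sum>y\<in>S. q x y) * Z s))"
      using 2 Z_pos[of s] by (intro mult_left_mono sum_mono) auto
    also have "\<dots> = (\<Sum>x\<in>S. \<Sum>y\<in>S. exp (g x) * q x y) * (Z s * Z s)"
      by (simp add: sum_distrib_left sum_distrib_right mult_ac)
    finally show ?thesis unfolding J_def using Z_pos c
      by (simp add: divide_le_eq le_divide_eq field_simps)
  qed
  define K where "K s = s * (Y s / Z s) - ln (Z s / card S) - s\<^sup>2 / 2 * J" for s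
  have dK: "(K has_real_derivative s * ((X s * Z s - Y s * Y s) / (Z s * Z s) - J)) (at s)" for s
  proof -
    have 1: "((\<lambda>s. Y s / Z s) has_real_derivative (X s * Z s - Y s * Y s) / (Z s * Z s)) (at s)"
      using DERIV_divide[OF dY dZ, of s] Z_pos[of s] by simp
    have 2: "((\<lambda>s. ln (Z s / card S)) has_real_derivative Y s / Z s) (at s)"
    proof -
      have "0 < Z s / card S" using Z_pos c by simp
      have "((\<lambda>s. ln (Z s / card S)) has_real_derivative 1 / (Z s / card S) * (Y s / card S)) (at s)"
        by (rule DERIV_chain2[where f=ln and g="\<lambda>s. Z s / card S", OF DERIV_ln_divide DERIV_cdivide[OF dZ]]) fact
      then show ?thesis using c by simp
    qed
    show ?thesis unfolding K_def
      by (rule DERIV_cong[OF DERIV_diff[OF DERIV_diff[OF DERIV_mult[OF DERIV_ident 1] 2]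
          DERIV_cmult_right[OF DERIV_cdivide[OF DERIV_power[OF DERIV_ident]]]]])
        (simp add: algebra_simps)
  qed
  have "K 1 \<le> K 0"
  proof (rule DERIV_nonpos_imp_nonincreasing[of 0 1 K])
    fix x :: real assume x: "0 \<le> x" "x \<le> 1"
    show "\<exists>y. DERIV K x :> y \<and> y \<le> 0"
      using dK[of x] J[OF x] x by (intro exI[of _ "x * ((X x * Z x - Y x * Y x) / (Z x * Z x) - J)"]) (auto intro: mult_nonneg_nonpos)
  qed simp
  moreover have "K 0 = 0" using c by (simp add: K_def Z_def)
  ultimately have "Y 1 / Z 1 - ln (Z 1 / card S) \<le> J / 2" by (simp add: K_def)
  then have "(Y 1 / Z 1 - ln (Z 1 / card S)) * Z 1 \<le> J / 2 * Z 1"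
    using Z_pos[of 1] by (intro mult_right_mono) auto
  moreover have "(Y 1 / Z 1 - ln (Z 1 / card S)) * Z 1 = Y 1 - Z 1 * ln (Z 1 / card S)"
    using Z_pos[of 1] by (simp add: left_diff_distrib)
  ultimately have "Y 1 - Z 1 * ln (Z 1 / card S) \<le> J / 2 * Z 1" by simp
  also have "J / 2 * Z 1 = (\<Sum>x\<in>S. \<Sum>y\<in>S. exp (g x) * q x y) / (2 * card S)"
    using Z_pos[of 1] by (simp add: J_def field_simps)
  finally show ?thesis by (simp add: Y_def Z_def q_def)
qed

lemma log_sum_inequality:
  fixes x y :: "'a \<Rightarrow> real"
  assumes pos: "\<And>k. k \<in> S \<Longrightarrow> 0 < x k" "\<And>k. k \<in> S \<Longrightarrow> 0 < y k" and S: "finite S" "S \<noteq> {}"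
  shows "sum x S * (ln (sum x S) - ln (sum y S)) \<le> (\<Sum>k\<in>S. x k * (ln (x k) - ln (y k)))"
proof -
  define X where "X = sum x S" define Y where "Y = sum y S"
  have XY: "0 < X" "0 < Y" unfolding X_def Y_def using pos S by (auto intro!: sum_pos)
  have "0 = (\<Sum>k\<in>S. x k - y k * (X / Y))"
    using XY by (simp add: sum_subtractf sum_distrib_right[symmetric] sum_divide_distrib[symmetric]
      flip: X_def Y_def)
  also have "\<dots> \<le> (\<Sum>k\<in>S. x k * (ln (x k) - ln (y k) - (ln X - ln Y)))"
  proof (rule sum_mono)
    fix k assume k: "k \<in> S"
    have "ln (y k * X / (x k * Y)) \<le> y k * X / (x k * Y) - 1"
      using pos[OF k] XY by (intro ln_le_minus_one) auto
    then have "1 - y k * X / (x k * Y) \<le> ln (x k) - ln (y k) - (ln X - ln Y)"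
      using pos[OF k] XY by (simp add: ln_div ln_mult)
    then have "x k * (1 - y k * X / (x k * Y)) \<le> x k * (ln (x k) - ln (y k) - (ln X - ln Y))"
      using pos[OF k] by (intro mult_left_mono) auto
    moreover have "x k * (1 - y k * X / (x k * Y)) = x k - y k * (X / Y)"
      using pos[OF k] XY by (simp add: field_simps)
    ultimately show "x k - y k * (X / Y) \<le> x k * (ln (x k) - ln (y k) - (ln X - ln Y))" by simp
  qed
  also have "\<dots> = (\<Sum>k\<in>S. x k * (ln (x k) - ln (y k))) - X * (ln X - ln Y)"
    by (simp add: X_def right_diff_distrib sum_subtractf sum_distrib_right)
  finally show ?thesis by (simp add: X_def Y_def)
qed

text \<open>The log-sum inequality bounds \<open>l\<close> by the mean of the positive parts
  \<open>u\<close> weighted by \<open>x\<close>, and expanding the square around \<open>l\<close> is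
  Jensen's inequality for that mean. This is how the pair energy of a marginal is bounded by
  energies on the fibres.\<close>

lemma energy_sum_superadditive:
  fixes x y :: "'a \<Rightarrow> real"
  assumes pos: "\<And>k. k \<in> S \<Longrightarrow> 0 < x k" "\<And>k. k \<in> S \<Longrightarrow> 0 < y k" and S: "finite S" "S \<noteq> {}"
  shows "sum x S * (max 0 (ln (sum x S) - ln (sum y S)))\<^sup>2 \<le> (\<Sum>k\<in>S. x k * (max 0 (ln (x k) - ln (y k)))\<^sup>2)"
proof (cases "ln (sum x S) - ln (sum y S) \<le> 0")
  case True
  then have "sum x S * (max 0 (ln (sum x S) - ln (sum y S)))\<^sup>2 = 0" by (simp add: max_def)
  also have "\<dots> \<le> (\<Sum>k\<in>S. x k * (max 0 (ln (x k) - ln (y k)))\<^sup>2)"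
    using pos by (intro sum_nonneg mult_nonneg_nonneg) (auto intro: less_imp_le)
  finally show ?thesis .
next
  case False
  define u where "u k = max 0 (ln (x k) - ln (y k))" for k
  define X where "X = sum x S" define l where "l = ln X - ln (sum y S)"
  have X: "0 < X" unfolding X_def using pos S by (auto intro!: sum_pos)
  have l: "0 < l" using False by (simp add: l_def X_def)
  have "X * l \<le> (\<Sum>k\<in>S. x k * (ln (x k) - ln (y k)))"
    unfolding X_def l_def using assms by (rule log_sum_inequality)
  also have "\<dots> \<le> (\<Sum>k\<in>S. x k * u k)"
    using pos by (intro sum_mono mult_left_mono) (auto simp: u_def less_imp_le)
  finally have a: "X * l \<le> (\<Sum>k\<in>S. x k * u k)" .
  have "0 \<le> (\<Sum>k\<in>S. x k * (u k - l)\<^sup>2)"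
    using pos by (intro sum_nonneg mult_nonneg_nonneg) (auto simp: less_imp_le)
  also have "\<dots> = (\<Sum>k\<in>S. x k * (u k)\<^sup>2) - 2 * l * (\<Sum>k\<in>S. x k * u k) + X * l\<^sup>2"
    by (simp add: power2_diff X_def algebra_simps sum.distrib sum_subtractf sum_distrib_left sum_distrib_right)
  also have "\<dots> \<le> (\<Sum>k\<in>S. x k * (u k)\<^sup>2) - 2 * l * (X * l) + X * l\<^sup>2"
    using a l by (simp add: mult_left_mono)
  finally have "X * l\<^sup>2 \<le> (\<Sum>k\<in>S. x k * (u k)\<^sup>2)" by (simp add: power2_eq_square algebra_simps)
  then show ?thesis using l by (simp add: u_def l_def X_def max_def)
qed

section \<open>Entropy on the slices of the hypercube\<close>

definition slice :: "'a set \<Rightarrow> nat \<Rightarrow> 'a set set" where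
  "slice U k = {A. A \<subseteq> U \<and> card A = k}"

lemma finite_slice: "finite U \<Longrightarrow> finite (slice U k)"
  by (simp add: slice_def)

lemma card_slice: "finite U \<Longrightarrow> card (slice U k) = card U choose k"
  by (simp add: slice_def n_subsets)

lemma slice_nonempty: "finite U \<Longrightarrow> k \<le> card U \<Longrightarrow> slice U k \<noteq> {}"
  using card_slice[of U k] by (metis binomial_eq_0_iff card.empty not_le)

lemma slice_0: "finite U \<Longrightarrow> slice U 0 = {{}}"
  by (auto simp: slice_def dest: finite_subset)

text \<open>Double counting: a set of size \<open>Suc k\<close> with a marked element is the same
  thing as the element together with a set of size \<open>k\<close> avoiding it.\<close>

lemma sum_slice_Suc:
  fixes G :: "'a \<Rightarrow> 'a set \<Rightarrow> real"
  assumes U: "finite U"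
  shows "(\<Sum>A\<in>slice U (Suc k). \<Sum>x\<in>A. G x A) = (\<Sum>x\<in>U. \<Sum>A\<in>slice (U - {x}) k. G x (insert x A))"
proof -
  have fin: "A \<in> slice U j \<Longrightarrow> finite A" for A j using U by (auto simp: slice_def dest: finite_subset)
  have "(\<Sum>A\<in>slice U (Suc k). \<Sum>x\<in>A. G x A) = (\<Sum>(A, x)\<in>(SIGMA A:slice U (Suc k). A). G x A)"
    using U fin by (intro sum.Sigma) (auto intro: finite_slice)
  also have "\<dots> = (\<Sum>(x, A)\<in>(SIGMA x:U. slice (U - {x}) k). G x (insert x A))"
  proof (rule sum.reindex_bij_witness[where j="\<lambda>(A, x). (x, A - {x})" and i="\<lambda>(x, A). (insert x A, x)"])
    fix a assume "a \<in> (SIGMA A:slice U (Suc k). A)"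
    then obtain A x where a: "a = (A, x)" "x \<in> A" "A \<subseteq> U" "card A = Suc k" by (auto simp: slice_def)
    then have "finite A" using U by (auto dest: finite_subset)
    then have "card (A - {x}) = k" "A - {x} \<subseteq> U - {x}" "x \<in> U" "insert x (A - {x}) = A" using a by auto
    then show "(case (case a of (A, x) \<Rightarrow> (x, A - {x})) of (x, A) \<Rightarrow> (insert x A, x)) = a"
      "(case a of (A, x) \<Rightarrow> (x, A - {x})) \<in> (SIGMA x:U. slice (U - {x}) k)"
      "(case (case a of (A, x) \<Rightarrow> (x, A - {x})) of (x, A) \<Rightarrow> G x (insert x A)) = (case a of (A, x) \<Rightarrow> G x A)"
      unfolding a by (simp_all add: slice_def)
  next
    fix b assume b: "b \<in> (SIGMA x:U. slice (U - {x}) k)"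
    then obtain x A where xA: "b = (x, A)" "x \<in> U" "A \<subseteq> U - {x}" "card A = k" by (auto simp: slice_def)
    then have "finite A" "x \<notin> A" using U by (auto dest: finite_subset)
    then show "(case (case b of (x, A) \<Rightarrow> (insert x A, x)) of (A, x) \<Rightarrow> (x, A - {x})) = b"
      "(case b of (x, A) \<Rightarrow> (insert x A, x)) \<in> (SIGMA A:slice U (Suc k). A)"
      using xA by (auto simp: slice_def)
  qed
  also have "\<dots> = (\<Sum>x\<in>U. \<Sum>A\<in>slice (U - {x}) k. G x (insert x A))"
    using U by (intro sum.Sigma[symmetric]) (auto intro: finite_slice)
  finally show ?thesis .
qed

lemma transpose_image_slice:
  assumes "A \<in> slice U k" "x \<in> U" "y \<in> U"
  shows "Transposition.transpose x y ` A \<in> slice U k"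
proof -
  have "inj_on (Transposition.transpose x y) A" by (meson inj_on_subset inj_transpose subset_UNIV)
  then have "card (Transposition.transpose x y ` A) = k" using assms by (simp add: card_image slice_def)
  moreover have "Transposition.transpose x y ` A \<subseteq> U"
    using assms by (auto simp: slice_def Transposition.transpose_def)
  ultimately show ?thesis by (simp add: slice_def)
qed

lemma transpose_image_slice_diff:
  assumes "A \<in> slice (U - {x}) k" "x \<in> U" "y \<in> U"
  shows "Transposition.transpose x y ` A \<in> slice (U - {y}) k"
proof -
  have "inj_on (Transposition.transpose x y) A" by (meson inj_on_subset inj_transpose subset_UNIV)
  then have "card (Transposition.transpose x y ` A) = k" using assms by (simp add: card_image slice_def)
  moreover have "Transposition.transpose x y ` A \<subseteq> U - {y}"
    using assms by (auto simp: slice_def Transposition.transpose_def)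
  ultimately show ?thesis by (simp add: slice_def)
qed

text \<open>The transposition couples the two conditional laws of the random set, given that
  \<open>x\<close>, respectively \<open>y\<close>, is its marked element.\<close>

lemma sum_slice_swap:
  fixes G :: "'a set \<Rightarrow> real"
  assumes U: "finite U" and xy: "x \<in> U" "y \<in> U"
  shows "(\<Sum>A\<in>slice (U - {y}) k. G (insert y A)) = (\<Sum>A\<in>slice (U - {x}) k. G (Transposition.transpose x y ` insert x A))"
proof -
  have inv: "Transposition.transpose x y ` Transposition.transpose x y ` B = B" for B by (simp add: image_comp)
  show ?thesis
  proof (rule sum.reindex_bij_witness[where i="\<lambda>A. Transposition.transpose x y ` A" and j="\<lambda>A. Transposition.transpose x y ` A"])
    fix A assume A: "A \<in> slice (U - {y}) k"
    show "Transposition.transpose x y ` Transposition.transpose x y ` A = A" by (rule inv)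
    show "Transposition.transpose x y ` A \<in> slice (U - {x}) k"
      using transpose_image_slice_diff[OF A xy(2,1)] by (simp add: transpose_commute)
    show "G (Transposition.transpose x y ` insert x (Transposition.transpose x y ` A)) = G (insert y A)"
      using inv by (simp add: image_insert)
  next
    fix A assume A: "A \<in> slice (U - {x}) k"
    show "Transposition.transpose x y ` Transposition.transpose x y ` A = A" by (rule inv)
    show "Transposition.transpose x y ` A \<in> slice (U - {y}) k"
      using transpose_image_slice_diff[OF A xy] .
  qed
qed

text \<open>This is \<open>card S\<close> times the entropy of \<open>f\<close> under the uniform
  law on \<open>S\<close>. In this unnormalized form the entropies of the fibres simply add up in
  the chain rule.\<close>

definition entropy_on :: "'a set \<Rightarrow> ('a \<Rightarrow> real) \<Rightarrow> real" where
  "entropy_on S f = (\<Sum>x\<in>S. f x * ln (f x)) - sum f S * ln (sum f S / card S)"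

definition swap_energy :: "('a set \<Rightarrow> real) \<Rightarrow> 'a \<Rightarrow> 'a \<Rightarrow> 'a set \<Rightarrow> real" where
  "swap_energy f x y A = f A * (max 0 (ln (f A) - ln (f (Transposition.transpose x y ` A))))\<^sup>2"

lemma transpose_image_both: "x \<in> A \<Longrightarrow> y \<in> A \<Longrightarrow> Transposition.transpose x y ` A = A"
  by (auto simp: Transposition.transpose_def image_iff)

lemma swap_energy_nonneg: "0 \<le> f A \<Longrightarrow> 0 \<le> swap_energy f x y A"
  by (simp add: swap_energy_def)

lemma entropy_on_le_pairs:
  assumes S: "finite S" "S \<noteq> {}" and h: "\<And>x. x \<in> S \<Longrightarrow> 0 < h x"
  shows "entropy_on S h \<le> (\<Sum>x\<in>S. \<Sum>y\<in>S. h x * (max 0 (ln (h x) - ln (h y)))\<^sup>2) / (2 * card S)"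
proof -
  have *: "exp (ln (h x)) = h x" if "x \<in> S" for x using h[OF that] by simp
  have "(\<Sum>x\<in>S. exp (ln (h x)) * ln (h x)) = (\<Sum>x\<in>S. h x * ln (h x))"
    "(\<Sum>x\<in>S. exp (ln (h x))) = sum h S"
    "(\<Sum>x\<in>S. \<Sum>y\<in>S. exp (ln (h x)) * (max 0 (ln (h x) - ln (h y)))\<^sup>2) = (\<Sum>x\<in>S. \<Sum>y\<in>S. h x * (max 0 (ln (h x) - ln (h y)))\<^sup>2)"
    using * by (simp_all cong: sum.cong)
  then show ?thesis
    using entropy_le_pair_energy[OF S, of "\<lambda>x. ln (h x)"] unfolding entropy_on_def by simp
qed

text \<open>Induction on \<open>k\<close>: choose one element of the random set uniformly and apply the chain rule of entropy.\<close>

theorem slice_entropy_le_swap_energy: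
  fixes f :: "'a set \<Rightarrow> real"
  assumes "finite U" "k \<le> card U" "\<And>A. A \<in> slice U k \<Longrightarrow> 0 < f A"
  shows "2 * (real (card U) - real k) * entropy_on (slice U k) f
    \<le> (\<Sum>A\<in>slice U k. \<Sum>x\<in>A. \<Sum>y\<in>U - A. swap_energy f x y A)"
  using assms
proof (induction k arbitrary: U f)
  case 0
  then show ?case by (simp add: slice_0 entropy_on_def)
next
  case (Suc k)
  define M where "M = card U"
  define S where "S = slice U (Suc k)"
  define C where "C = real (M - 1 choose k)"
  define Fx where "Fx x = (\<Sum>A\<in>slice (U - {x}) k. f (insert x A))" for x
  define h where "h x = Fx x / C" for x
  define D where "D = (\<Sum>A\<in>S. \<Sum>x\<in>A. \<Sum>y\<in>U - A. swap_energy f x y A)"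
  have fin: "finite U" and pos: "\<And>A. A \<in> S \<Longrightarrow> 0 < f A" and kM: "Suc k \<le> M"
    using Suc.prems by (auto simp: S_def M_def)
  have finS: "finite S" unfolding S_def using fin by (rule finite_slice)
  have M0: "0 < M" using kM by simp
  have finA: "finite A" "card A = Suc k" "A \<subseteq> U" if "A \<in> S" for A
    using that fin by (auto simp: S_def slice_def dest: finite_subset)
  have D_nonneg: "0 \<le> D" unfolding D_def
    by (intro sum_nonneg swap_energy_nonneg less_imp_le pos)
  have C_pos: "0 < C" using kM by (simp add: C_def)
  have cU: "card (U - {x}) = M - 1" if "x \<in> U" for x using that fin by (simp add: M_def)
  have cardsl: "real (card (slice (U - {x}) k)) = C" if "x \<in> U" for x
    using cU[OF that] fin by (simp add: card_slice C_def)
  have posI: "0 < f (insert x A)" if "x \<in> U" "A \<in> slice (U - {x}) k" for x A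
  proof -
    have "finite A" "x \<notin> A" using that fin by (auto simp: slice_def dest: finite_subset)
    then have "insert x A \<in> S" using that by (auto simp: S_def slice_def)
    then show ?thesis by (rule pos)
  qed
  have Fx_pos: "0 < Fx x" if "x \<in> U" for x
    unfolding Fx_def using that fin cU[OF that] kM
    by (intro sum_pos posI finite_slice slice_nonempty) auto
  have cardS: "real (Suc k) * card S = M * C"
  proof -
    have "Suc k * (M choose Suc k) = M * (M - 1 choose k)"
      using Suc_times_binomial_eq[of "M - 1" k] M0 by (simp add: mult.commute)
    then show ?thesis unfolding S_def card_slice[OF fin] M_def[symmetric] C_def
      by (metis of_nat_mult)
  qed
  have sumF: "real (Suc k) * sum f S = sum Fx U"
  proof -
    have "sum Fx U = (\<Sum>A\<in>S. \<Sum>x\<in>A. f A)"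
      unfolding Fx_def S_def by (rule sum_slice_Suc[OF fin, symmetric])
    also have "\<dots> = (\<Sum>A\<in>S. real (Suc k) * f A)"
      by (intro sum.cong refl) (simp add: finA)
    finally show ?thesis by (simp add: sum_distrib_left)
  qed
  have sumFl: "real (Suc k) * (\<Sum>A\<in>S. f A * ln (f A)) = (\<Sum>x\<in>U. \<Sum>A\<in>slice (U - {x}) k. f (insert x A) * ln (f (insert x A)))"
  proof -
    have "(\<Sum>x\<in>U. \<Sum>A\<in>slice (U - {x}) k. f (insert x A) * ln (f (insert x A))) = (\<Sum>A\<in>S. \<Sum>x\<in>A. f A * ln (f A))"
      unfolding S_def by (rule sum_slice_Suc[OF fin, symmetric])
    also have "\<dots> = (\<Sum>A\<in>S. real (Suc k) * (f A * ln (f A)))"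
      by (intro sum.cong refl) (simp add: finA)
    finally show ?thesis by (simp add: sum_distrib_left)
  qed
  \<comment> \<open>\<open>h\<close> is the density of the marked element, the fibre over
    \<open>x\<close> being averaged. Each set has \<open>Suc k\<close> possible marks, whence the
    factor; the logarithms of \<open>h\<close> cancel between the fibres and the marginal.\<close>
  have chain: "real (Suc k) * entropy_on S f
     = (\<Sum>x\<in>U. entropy_on (slice (U - {x}) k) (\<lambda>A. f (insert x A))) + C * entropy_on U h"
  proof -
    have sh: "C * sum h U = sum Fx U" using C_pos by (simp add: h_def sum_divide_distrib[symmetric])
    have "(\<Sum>x\<in>U. entropy_on (slice (U - {x}) k) (\<lambda>A. f (insert x A)))
      = real (Suc k) * (\<Sum>A\<in>S. f A * ln (f A)) - (\<Sum>x\<in>U. Fx x * ln (h x))"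
      unfolding sumFl entropy_on_def sum_subtractf
      by (intro arg_cong2[where f="(-)"] refl sum.cong) (simp add: Fx_def h_def cardsl)
    moreover have "C * entropy_on U h = (\<Sum>x\<in>U. Fx x * ln (h x)) - sum Fx U * ln (sum h U / M)"
    proof -
      have "C * (\<Sum>x\<in>U. h x * ln (h x)) = (\<Sum>x\<in>U. Fx x * ln (h x))"
        unfolding sum_distrib_left using C_pos by (intro sum.cong) (auto simp: h_def)
      then show ?thesis unfolding entropy_on_def M_def[symmetric] right_diff_distrib
        by (simp add: sh[symmetric])
    qed
    moreover have "real (Suc k) * entropy_on S f = real (Suc k) * (\<Sum>A\<in>S. f A * ln (f A)) - sum Fx U * ln (sum h U / M)"
    proof -
      have "sum f S / card S = sum h U / M"
      proof -
        have "sum f S / card S = (real (Suc k) * sum f S) / (real (Suc k) * card S)" by simp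
        also have "\<dots> = (C * sum h U) / (M * C)" unfolding sumF cardS sh ..
        also have "\<dots> = sum h U / M" using C_pos by simp
        finally show ?thesis .
      qed
      then show ?thesis unfolding entropy_on_def sumF[symmetric] by (simp add: algebra_simps)
    qed
    ultimately show ?thesis by simp
  qed
  have outer: "C * entropy_on U h \<le> D / (2 * M)"
  proof -
    \<comment> \<open>The coupling by transposition writes \<open>Fx y\<close> as a sum over the
      fibre of \<open>x\<close>, so that superadditivity compares the two sums term by term.\<close>
    have pair: "Fx x * (max 0 (ln (h x) - ln (h y)))\<^sup>2 \<le> (\<Sum>A\<in>slice (U - {x}) k. swap_energy f x y (insert x A))"
      if xy: "x \<in> U" "y \<in> U" for x y
    proof -
      have "Fx y = (\<Sum>A\<in>slice (U - {x}) k. f (Transposition.transpose x y ` insert x A))"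
        unfolding Fx_def using sum_slice_swap[OF fin xy] .
      moreover have "0 < f (Transposition.transpose x y ` insert x A)" if A: "A \<in> slice (U - {x}) k" for A
      proof (rule pos)
        have "finite A" "x \<notin> A" "A \<subseteq> U" "card A = k" using A fin by (auto simp: slice_def dest: finite_subset)
        then have "insert x A \<in> S" using xy by (auto simp: S_def slice_def)
        then show "Transposition.transpose x y ` insert x A \<in> S"
          unfolding S_def using xy by (rule transpose_image_slice)
      qed
      moreover have "finite (slice (U - {x}) k)" "slice (U - {x}) k \<noteq> {}"
        using fin cU[OF xy(1)] kM by (simp_all add: finite_slice slice_nonempty del: card_Diff_insert card_Diff_singleton)
      moreover have "ln (h x) - ln (h y) = ln (Fx x) - ln (Fx y)"
        using Fx_pos[OF xy(1)] Fx_pos[OF xy(2)] C_pos by (simp add: h_def ln_div)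
      ultimately show ?thesis
        using energy_sum_superadditive[of "slice (U - {x}) k" "\<lambda>A. f (insert x A)" "\<lambda>A. f (Transposition.transpose x y ` insert x A)"]
          posI[OF xy(1)] unfolding Fx_def swap_energy_def by simp
    qed
    have "C * entropy_on U h \<le> C * ((\<Sum>x\<in>U. \<Sum>y\<in>U. h x * (max 0 (ln (h x) - ln (h y)))\<^sup>2) / (2 * M))"
      unfolding M_def using C_pos fin M0 Fx_pos
      by (intro mult_left_mono entropy_on_le_pairs) (auto simp: h_def M_def)
    also have "\<dots> = (\<Sum>x\<in>U. \<Sum>y\<in>U. Fx x * (max 0 (ln (h x) - ln (h y)))\<^sup>2) / (2 * M)"
      using C_pos by (simp add: h_def sum_distrib_left)
    also have "\<dots> \<le> (\<Sum>x\<in>U. \<Sum>y\<in>U. \<Sum>A\<in>slice (U - {x}) k. swap_energy f x y (insert x A)) / (2 * M)"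
      by (intro divide_right_mono sum_mono pair) auto
    also have "(\<Sum>x\<in>U. \<Sum>y\<in>U. \<Sum>A\<in>slice (U - {x}) k. swap_energy f x y (insert x A))
      = (\<Sum>A\<in>S. \<Sum>x\<in>A. \<Sum>y\<in>U. swap_energy f x y A)"
      unfolding S_def by (subst sum_slice_Suc[OF fin]) (intro sum.cong refl sum.swap)
    also have "\<dots> = D" unfolding D_def
    proof (rule sum.cong[OF refl], rule sum.cong[OF refl])
      fix A x assume "A \<in> S" "x \<in> A"
      then show "(\<Sum>y\<in>U. swap_energy f x y A) = (\<Sum>y\<in>U - A. swap_energy f x y A)"
        using fin by (intro sum.mono_neutral_right) (auto simp: swap_energy_def transpose_image_both)
    qed
    finally show ?thesis .
  qed
  show ?case
  \<comment> \<open>If the set exhausts \<open>U\<close>, the factor on the left is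
    \<open>0\<close>. Otherwise each fibre lives on \<open>card U - 1\<close> points with sets of
    size \<open>k\<close>, so the difference of sizes is again \<open>c\<close>.\<close>
  proof (cases "Suc k = M")
    case True
    then show ?thesis using D_nonneg by (simp add: D_def S_def M_def)
  next
    case False
    define c where "c = real M - real (Suc k)"
    have c: "0 < c" "c \<le> M" using False kM by (auto simp: c_def)
    have inner: "(\<Sum>x\<in>U. entropy_on (slice (U - {x}) k) (\<lambda>A. f (insert x A))) \<le> k * D / (2 * c)"
    proof -
      have "2 * c * entropy_on (slice (U - {x}) k) (\<lambda>A. f (insert x A))
        \<le> (\<Sum>A\<in>slice (U - {x}) k. \<Sum>i\<in>insert x A - {x}. \<Sum>j\<in>U - insert x A. swap_energy f i j (insert x A))"
        if x: "x \<in> U" for x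
      proof -
        have "2 * (real (card (U - {x})) - real k) * entropy_on (slice (U - {x}) k) (\<lambda>A. f (insert x A))
          \<le> (\<Sum>A\<in>slice (U - {x}) k. \<Sum>i\<in>A. \<Sum>j\<in>U - {x} - A. swap_energy (\<lambda>A. f (insert x A)) i j A)"
          using x cU kM fin posI by (intro Suc.IH) auto
        moreover have "real (card (U - {x})) - real k = c" using cU[OF x] kM by (simp add: c_def of_nat_diff)
        moreover have "(\<Sum>i\<in>A. \<Sum>j\<in>U - {x} - A. swap_energy (\<lambda>A. f (insert x A)) i j A)
          = (\<Sum>i\<in>insert x A - {x}. \<Sum>j\<in>U - insert x A. swap_energy f i j (insert x A))"
          if A: "A \<in> slice (U - {x}) k" for A
        proof -
          have xA: "x \<notin> A" using A by (auto simp: slice_def)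
          then have eqs: "insert x A - {x} = A" "U - {x} - A = U - insert x A" by auto
          have "swap_energy (\<lambda>A. f (insert x A)) i j A = swap_energy f i j (insert x A)"
            if "i \<in> A" "j \<in> U - insert x A" for i j
          proof -
            have "Transposition.transpose i j x = x" using that xA by (auto simp: Transposition.transpose_def)
            then show ?thesis by (simp add: swap_energy_def)
          qed
          then show ?thesis unfolding eqs by (intro sum.cong refl)
        qed
        ultimately show ?thesis by (simp cong: sum.cong)
      qed
      then have "(\<Sum>x\<in>U. 2 * c * entropy_on (slice (U - {x}) k) (\<lambda>A. f (insert x A)))
        \<le> (\<Sum>x\<in>U. \<Sum>A\<in>slice (U - {x}) k. \<Sum>i\<in>insert x A - {x}. \<Sum>j\<in>U - insert x A. swap_energy f i j (insert x A))"
        by (rule sum_mono)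
      also have "\<dots> = (\<Sum>A\<in>S. \<Sum>x\<in>A. \<Sum>i\<in>A - {x}. \<Sum>j\<in>U - A. swap_energy f i j A)"
        unfolding S_def by (rule sum_slice_Suc[OF fin, symmetric])
      also have "\<dots> = (\<Sum>A\<in>S. real k * (\<Sum>x\<in>A. \<Sum>j\<in>U - A. swap_energy f x j A))"
      proof (intro sum.cong refl)
        fix A assume A: "A \<in> S"
        \<comment> \<open>Each \<open>i\<close> survives the removal of \<open>x\<close> for
          \<open>k\<close> of the \<open>Suc k\<close> choices of \<open>x\<close>.\<close>
        have "(\<Sum>x\<in>A. \<Sum>i\<in>A - {x}. g i) = real k * sum g A" for g :: "'a \<Rightarrow> real"
          using finA[OF A] by (simp add: sum_diff1 sum_subtractf algebra_simps)
        then show "(\<Sum>x\<in>A. \<Sum>i\<in>A - {x}. \<Sum>j\<in>U - A. swap_energy f i j A) = real k * (\<Sum>x\<in>A. \<Sum>j\<in>U - A. swap_energy f x j A)" .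
      qed
      also have "\<dots> = k * D" by (simp add: D_def sum_distrib_left)
      finally show ?thesis using c by (simp add: sum_distrib_left[symmetric] field_simps)
    qed
    have "real (Suc k) * entropy_on S f \<le> k * D / (2 * c) + D / (2 * M)"
      unfolding chain using inner outer by simp
    \<comment> \<open>Weakening \<open>1 / M\<close> to \<open>1 / c\<close> makes the marginal one
      more share of \<open>D / (2 * c)\<close>; with the \<open>k\<close> shares of the fibres this
      gives \<open>Suc k\<close> shares, and the factor cancels.\<close>
    also have "D / (2 * M) \<le> D / (2 * c)" using c D_nonneg by (intro divide_left_mono) auto
    finally have "real (Suc k) * entropy_on S f \<le> real (Suc k) * (D / (2 * c))" by (simp add: algebra_simps add_divide_distrib)
    then have "entropy_on S f \<le> D / (2 * c)" by (simp only: mult_le_cancel_left_pos of_nat_0_less_iff zero_less_Suc)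
    then show ?thesis using c unfolding D_def S_def M_def[symmetric] c_def[symmetric] by (simp add: field_simps)
  qed
qed

section \<open>Concentration on slices\<close>

lemma Hoeffdings_lemma_finite:
  fixes f :: "'a \<Rightarrow> real"
  assumes S: "finite S" "S \<noteq> {}" and osc: "\<And>x y. x \<in> S \<Longrightarrow> y \<in> S \<Longrightarrow> f x - f y \<le> c"
  shows "(\<Sum>x\<in>S. exp (f x)) / card S \<le> exp (sum f S / card S + c\<^sup>2 / 8)"
proof -
  interpret pmf_as_measure: prob_space "measure_pmf (pmf_of_set S)" by (rule measure_pmf.prob_space_axioms)
  define lo where "lo = Min (f ` S)"
  have lo: "lo \<le> f x" "f x \<le> lo + c" if "x \<in> S" for x
  proof -
    show "lo \<le> f x" using S that by (simp add: lo_def)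
    have "lo \<in> f ` S" unfolding lo_def using S by (intro Min_in) auto
    then show "f x \<le> lo + c" using osc that by fastforce
  qed
  interpret interval_bounded_random_variable "measure_pmf (pmf_of_set S)" f lo "lo + c"
    by unfold_locales (use lo S in \<open>auto simp: AE_measure_pmf_iff\<close>)
  have E: "integral\<^sup>L (measure_pmf (pmf_of_set S)) g = sum g S / card S" for g :: "'a \<Rightarrow> real"
    using S by (rule integral_pmf_of_set[rotated])
  let ?m = "sum f S / card S"
  have "nn_integral (measure_pmf (pmf_of_set S)) (\<lambda>x. exp (1 * (f x - ?m))) \<le> ennreal (exp (1\<^sup>2 * (lo + c - ?m - (lo - ?m))\<^sup>2 / 8))"
    using Hoeffdings_lemma_nn_integral[of 1] unfolding E by simp
  then have "ennreal (integral\<^sup>L (measure_pmf (pmf_of_set S)) (\<lambda>x. exp (f x - ?m))) \<le> ennreal (exp (c\<^sup>2 / 8))"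
  proof (subst nn_integral_eq_integral[symmetric])
    show "integrable (measure_pmf (pmf_of_set S)) (\<lambda>x. exp (f x - ?m))"
      using S by (intro integrable_measure_pmf_finite) simp
  qed auto
  then have "(\<Sum>x\<in>S. exp (f x - ?m)) / card S \<le> exp (c\<^sup>2 / 8)"
    unfolding E by simp
  then have "exp ?m * ((\<Sum>x\<in>S. exp (f x - ?m)) / card S) \<le> exp ?m * exp (c\<^sup>2 / 8)"
    by (intro mult_left_mono) auto
  then show ?thesis by (simp add: sum_distrib_left flip: exp_add)
qed

lemma slice_average_Suc:
  fixes f :: "'a set \<Rightarrow> real"
  assumes U: "finite U" "Suc k \<le> card U"
  shows "sum f (slice U (Suc k)) / card (slice U (Suc k))
    = (\<Sum>x\<in>U. (\<Sum>A\<in>slice (U - {x}) k. f (insert x A)) / card (slice (U - {x}) k)) / card U"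
proof -
  define C where "C = real ((card U - 1) choose k)"
  have c: "real (card (slice (U - {x}) k)) = C" if "x \<in> U" for x
    using that U by (simp add: card_slice C_def)
  have "real (Suc k) * sum f (slice U (Suc k)) = (\<Sum>A\<in>slice U (Suc k). \<Sum>x\<in>A. f A)"
    unfolding sum_distrib_left by (intro sum.cong refl) (auto simp: slice_def)
  also have "\<dots> = (\<Sum>x\<in>U. \<Sum>A\<in>slice (U - {x}) k. f (insert x A))" by (rule sum_slice_Suc[OF U(1)])
  finally have 1: "real (Suc k) * sum f (slice U (Suc k)) = \<dots>" .
  have 2: "real (Suc k) * card (slice U (Suc k)) = card U * C"
    using Suc_times_binomial_eq[of "card U - 1" k] U unfolding card_slice[OF U(1)] C_def
    by (metis Suc_diff_1 Suc_le_lessD gr_zeroI mult.commute not_less_zero of_nat_mult)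
  have "sum f (slice U (Suc k)) / card (slice U (Suc k)) = (real (Suc k) * sum f (slice U (Suc k))) / (real (Suc k) * card (slice U (Suc k)))"
    by simp
  also have "\<dots> = (\<Sum>x\<in>U. \<Sum>A\<in>slice (U - {x}) k. f (insert x A)) / (card U * C)" unfolding 1 2 ..
  also have "\<dots> = (\<Sum>x\<in>U. (\<Sum>A\<in>slice (U - {x}) k. f (insert x A)) / C) / card U"
    by (simp add: sum_divide_distrib[symmetric])
  also have "\<dots> = (\<Sum>x\<in>U. (\<Sum>A\<in>slice (U - {x}) k. f (insert x A)) / card (slice (U - {x}) k)) / card U"
    using c by (simp cong: sum.cong)
  finally show ?thesis .
qed

text \<open>Reveal one element \<open>x\<close> of the random set. The conditional mean
  \<open>h x\<close> oscillates by at most \<open>c\<close>, because two choices of \<open>x\<close>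
  are coupled by a transposition, so Hoeffding's lemma charges \<open>c\<^sup>2 / 8\<close> for this
  step and induction treats the remaining \<open>k\<close> elements conditionally. The cost is
  proportional to the size of the set, which favours taking the smaller sample as the random
  set.\<close>

theorem slice_Hoeffding:
  fixes f :: "'a set \<Rightarrow> real"
  assumes "finite U" "k \<le> card U"
    and "\<And>A x y. A \<in> slice U k \<Longrightarrow> x \<in> A \<Longrightarrow> y \<in> U \<Longrightarrow> f A - f (Transposition.transpose x y ` A) \<le> c"
  shows "(\<Sum>A\<in>slice U k. exp (f A)) / card (slice U k) \<le> exp (sum f (slice U k) / card (slice U k) + k * c\<^sup>2 / 8)"
  using assms
proof (induction k arbitrary: U f)
  case 0
  then show ?case by (simp add: slice_0)
next
  case (Suc k)
  define h where "h x = (\<Sum>A\<in>slice (U - {x}) k. f (insert x A)) / card (slice (U - {x}) k)" for x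
  have cU: "card (U - {x}) = card U - 1" if "x \<in> U" for x using that Suc.prems by simp
  have sl: "insert x A \<in> slice U (Suc k)" if "x \<in> U" "A \<in> slice (U - {x}) k" for x A
  proof -
    have "finite A" "x \<notin> A" using that Suc.prems by (auto simp: slice_def dest: finite_subset)
    then show ?thesis using that by (auto simp: slice_def)
  qed
  have ne: "finite (slice (U - {x}) k)" "slice (U - {x}) k \<noteq> {}" if "x \<in> U" for x
    using that Suc.prems cU[OF that] by (simp_all add: finite_slice slice_nonempty del: card_Diff_insert card_Diff_singleton)
  have osc: "h x - h y \<le> c" if xy: "x \<in> U" "y \<in> U" for x y
  proof -
    have eq: "card (slice (U - {y}) k) = card (slice (U - {x}) k)" using xy Suc.prems by (simp add: card_slice)
    have "h x - h y = (\<Sum>A\<in>slice (U - {x}) k. f (insert x A) - f (Transposition.transpose x y ` insert x A)) / card (slice (U - {x}) k)"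
      unfolding h_def eq sum_slice_swap[OF Suc.prems(1) xy] sum_subtractf diff_divide_distrib ..
    also have "\<dots> \<le> (\<Sum>A\<in>slice (U - {x}) k. c) / card (slice (U - {x}) k)"
      using xy by (intro divide_right_mono sum_mono Suc.prems sl) auto
    also have "\<dots> = c" using ne[OF xy(1)] by (simp add: card_gt_0_iff)
    finally show ?thesis .
  qed
  have "(\<Sum>A\<in>slice U (Suc k). exp (f A)) / card (slice U (Suc k))
      = (\<Sum>x\<in>U. (\<Sum>A\<in>slice (U - {x}) k. exp (f (insert x A))) / card (slice (U - {x}) k)) / card U"
    using Suc.prems by (intro slice_average_Suc)
  also have "\<dots> \<le> (\<Sum>x\<in>U. exp (h x + k * c\<^sup>2 / 8)) / card U"
  proof (intro divide_right_mono sum_mono)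
    fix x assume x: "x \<in> U"
    show "(\<Sum>A\<in>slice (U - {x}) k. exp (f (insert x A))) / card (slice (U - {x}) k) \<le> exp (h x + k * c\<^sup>2 / 8)"
      unfolding h_def
    proof (rule Suc.IH)
      fix A i j assume A: "A \<in> slice (U - {x}) k" "i \<in> A" "j \<in> U - {x}"
      have "x \<noteq> i" "x \<noteq> j" using A by (auto simp: slice_def)
      then have "insert x (Transposition.transpose i j ` A) = Transposition.transpose i j ` insert x A"
        by simp
      then show "f (insert x A) - f (insert x (Transposition.transpose i j ` A)) \<le> c"
        using A sl[OF x A(1)] Suc.prems(3)[of "insert x A" i j] by simp
    qed (use cU[OF x] Suc.prems in auto)
  qed simp
  also have "\<dots> = ((\<Sum>x\<in>U. exp (h x)) / card U) * exp (k * c\<^sup>2 / 8)"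
    by (simp add: exp_add sum_distrib_right)
  also have "\<dots> \<le> exp (sum h U / card U + c\<^sup>2 / 8) * exp (k * c\<^sup>2 / 8)"
    using Suc.prems osc by (intro mult_right_mono Hoeffdings_lemma_finite) auto
  also have "\<dots> = exp (sum h U / card U + Suc k * c\<^sup>2 / 8)"
    by (simp add: algebra_simps add_divide_distrib flip: exp_add)
  also have "sum h U / card U = sum f (slice U (Suc k)) / card (slice U (Suc k))"
    unfolding h_def using Suc.prems by (intro slice_average_Suc[symmetric])
  finally show ?case .
qed

text \<open>The permuted statistic seen as a function of the set of positions that receive the
  weight of one sample. The class enters only through \<open>K\<close>, its vectors of values at the
  sample points.\<close>

definition slice_stat :: "('a \<Rightarrow> real) set \<Rightarrow> 'a set \<Rightarrow> real \<Rightarrow> real \<Rightarrow> 'a set \<Rightarrow> real" where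
  "slice_stat K U a b A = (SUP v\<in>K. \<Sum>i\<in>U. (if i \<in> A then 1 / a else - (1 / b)) * v i)"

lemma slice_weights_sum:
  fixes v :: "'a \<Rightarrow> real"
  assumes "finite U" "A \<subseteq> U"
  shows "(\<Sum>i\<in>U. (if i \<in> A then 1 / a else - (1 / b)) * v i) = (1 / a + 1 / b) * sum v A - sum v U / b"
proof -
  have "(\<Sum>i\<in>U. (if i \<in> A then 1 / a else - (1 / b)) * v i) = (\<Sum>i\<in>A. 1 / a * v i) + (\<Sum>i\<in>U - A. - (1 / b) * v i)"
    using assms by (subst sum.subset_diff[of A U]) (auto intro!: arg_cong2[where f="(+)"] sum.cong)
  also have "\<dots> = sum v A / a - (sum v U - sum v A) / b"
    using assms by (simp add: sum_divide_distrib[symmetric] sum_negf sum_diff)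
  finally show ?thesis by (simp add: field_simps diff_divide_distrib add_divide_distrib)
qed

lemma transpose_image_sum:
  fixes v :: "'a \<Rightarrow> real"
  assumes "finite A" "i \<in> A" "j \<notin> A"
  shows "sum v (Transposition.transpose i j ` A) = sum v A - v i + v j"
proof -
  have "Transposition.transpose i j ` A = insert j (A - {i})"
    using assms(2,3) by (auto simp: Transposition.transpose_def image_iff)
  then show ?thesis using assms by (simp add: sum_diff1)
qed

text \<open>Cauchy-Schwarz against the weight vector, whose squares sum to
  \<open>1 / a + 1 / b\<close>. It serves as the a priori bound on the statistic.\<close>

lemma slice_weights_square:
  fixes v :: "'a \<Rightarrow> real" and a b :: nat
  assumes fin: "finite U" and card: "card U = a + b" and ab: "1 \<le> a" "1 \<le> b"
    and A: "A \<in> slice U a" and z: "sum v U = 0"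
  shows "((1 / a + 1 / b) * sum v A)\<^sup>2 \<le> (1 / a + 1 / b) * (\<Sum>i\<in>U. (v i)\<^sup>2)"
proof -
  have A': "A \<subseteq> U" "card A = a" using A by (auto simp: slice_def)
  define w where "w i = (if i \<in> A then 1 / real a else - (1 / real b))" for i
  have "(\<Sum>i\<in>U. w i * v i) = (1 / a + 1 / b) * sum v A"
    unfolding w_def using slice_weights_sum[OF fin A'(1)] z by simp
  moreover have "(\<Sum>i\<in>U. w i * v i)\<^sup>2 \<le> (\<Sum>i\<in>U. (w i)\<^sup>2) * (\<Sum>i\<in>U. (v i)\<^sup>2)"
    by (rule Cauchy_Schwarz_ineq_sum)
  moreover have "(\<Sum>i\<in>U. (w i)\<^sup>2) = 1 / a + 1 / b"
  proof -
    have "(\<Sum>i\<in>U. (w i)\<^sup>2) = (\<Sum>i\<in>A. (1 / real a)\<^sup>2) + (\<Sum>i\<in>U - A. (1 / real b)\<^sup>2)"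
      using fin A' by (subst sum.subset_diff[of A U]) (auto simp: w_def intro!: arg_cong2[where f="(+)"] sum.cong)
    moreover have "card (U - A) = b" using A' card fin by (simp add: card_Diff_subset finite_subset)
    ultimately show ?thesis using A' ab by (simp add: power2_eq_square)
  qed
  ultimately show ?thesis by simp
qed

text \<open>The diagonal terms carry the factor \<open>b\<close> inside \<open>A\<close> and
  \<open>a\<close> outside, and \<open>a \<le> b\<close> merges them. The two partial sums are
  opposite because the total is \<open>0\<close>, so the cross term becomes
  \<open>2 * (sum v A)\<^sup>2\<close>.\<close>

lemma cut_pair_sum:
  fixes v :: "'a \<Rightarrow> real"
  assumes fin: "finite U" and A: "A \<subseteq> U" "card A = a" "card (U - A) = b" and z: "sum v U = 0" and ab: "a \<le> b"
  shows "(\<Sum>i\<in>A. \<Sum>j\<in>U - A. (v i - v j)\<^sup>2) \<le> b * (\<Sum>i\<in>U. (v i)\<^sup>2) + 2 * (sum v A)\<^sup>2"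
proof -
  have U: "sum g U = sum g A + sum g (U - A)" for g :: "'a \<Rightarrow> real"
    using fin A by (metis add.commute sum.subset_diff)
  have "(\<Sum>i\<in>A. \<Sum>j\<in>U - A. (v i - v j)\<^sup>2)
    = (\<Sum>i\<in>A. \<Sum>j\<in>U - A. (v i)\<^sup>2) + (\<Sum>i\<in>A. \<Sum>j\<in>U - A. (v j)\<^sup>2) - 2 * (\<Sum>i\<in>A. \<Sum>j\<in>U - A. v i * v j)"
    by (simp add: power2_diff sum.distrib sum_subtractf sum_distrib_left algebra_simps)
  also have "(\<Sum>i\<in>A. \<Sum>j\<in>U - A. v i * v j) = sum v A * sum v (U - A)" by (simp add: sum_product)
  also have "sum v (U - A) = - sum v A" using z U[of v] by simp
  also have "(\<Sum>i\<in>A. \<Sum>j\<in>U - A. (v i)\<^sup>2) + (\<Sum>i\<in>A. \<Sum>j\<in>U - A. (v j)\<^sup>2) = b * (\<Sum>i\<in>A. (v i)\<^sup>2) + a * (\<Sum>j\<in>U - A. (v j)\<^sup>2)"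
    using A by (simp add: sum_distrib_left)
  also have "\<dots> \<le> b * (\<Sum>i\<in>A. (v i)\<^sup>2) + b * (\<Sum>j\<in>U - A. (v j)\<^sup>2)"
    using ab by (intro add_left_mono mult_right_mono sum_nonneg) auto
  also have "\<dots> = b * (\<Sum>i\<in>U. (v i)\<^sup>2)" by (simp add: U[of "\<lambda>i. (v i)\<^sup>2"] distrib_left)
  finally show ?thesis by (simp add: power2_eq_square)
qed

text \<open>At a set \<open>A\<close> fix a maximizing vector: a swap lowers the statistic by at
  most \<kappa> times a difference of two values, so the energy is governed by
  \<open>cut_pair_sum\<close>. Its last term is proportional to \<open>(t A)\<^sup>2\<close>; the a
  priori bound \<open>t A \<le> sqrt \<kappa> * s\<close> makes it linear in \<open>t A\<close>, the
  shape that \<open>herbst_mgf\<close> accepts. The factor \<open>2 * b\<close> cancels against the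
  one in \<open>slice_entropy_le_swap_energy\<close>.\<close>

lemma slice_concentration_finite:
  fixes K :: "('a \<Rightarrow> real) set" and a b :: nat
  assumes fin: "finite U" and card: "card U = a + b" and ab: "1 \<le> a" "a \<le> b"
    and K: "finite K" "K \<noteq> {}" and sym: "\<And>v. v \<in> K \<Longrightarrow> \<exists>u\<in>K. \<forall>i\<in>U. u i = - v i"
    and s: "0 \<le> s" "\<And>v. v \<in> K \<Longrightarrow> (\<Sum>i\<in>U. (v i - sum v U / card U)\<^sup>2) \<le> s\<^sup>2"
    and l: "0 < l" "l * (sqrt (1 / a + 1 / b) * s / b) < 1"
  shows "(\<Sum>A\<in>slice U a. exp (l * slice_stat K U a b A)) / card (slice U a)
    \<le> exp (l * ((\<Sum>A\<in>slice U a. slice_stat K U a b A) / card (slice U a) + l * ((1 / a + 1 / b)\<^sup>2 * s\<^sup>2 / 2))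
         / (1 - l * (sqrt (1 / a + 1 / b) * s / b)))"
proof -
  define S where "S = slice U a"
  define t where "t = slice_stat K U a b"
  define \<kappa> where "\<kappa> = 1 / real a + 1 / real b"
  define N where "N = real (card S)"
  have \<kappa>: "0 < \<kappa>" using ab by (simp add: \<kappa>_def add_pos_pos)
  have S: "finite S" "S \<noteq> {}" using fin card slice_nonempty[OF fin, of a] by (auto simp: S_def intro!: finite_slice)
  have N: "0 < N" using S by (simp add: N_def card_gt_0_iff)
  have SA: "A \<subseteq> U" "finite A" "card A = a" "card (U - A) = b" if "A \<in> S" for A
  proof -
    show *: "A \<subseteq> U" "card A = a" using that by (auto simp: S_def slice_def)
    then show "finite A" using fin finite_subset by blast
    then show "card (U - A) = b" using * card by (simp add: card_Diff_subset)
  qed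
  define L where "L v A = (\<Sum>i\<in>U. (if i \<in> A then 1 / real a else - (1 / real b)) * v i)" for v A
  have L: "L v A = \<kappa> * sum v A - sum v U / b" if "A \<subseteq> U" for v A
    unfolding L_def \<kappa>_def using slice_weights_sum[OF fin that] .
  have t_Max: "t A = Max ((\<lambda>v. L v A) ` K)" for A
    unfolding t_def slice_stat_def L_def using K by (intro cSup_eq_Max) auto
  have t_ge: "L v A \<le> t A" if "v \<in> K" for v A
    unfolding t_Max using K that by simp
  have t_ex: "\<exists>v\<in>K. t A = L v A" for A
  proof -
    have "Max ((\<lambda>v. L v A) ` K) \<in> (\<lambda>v. L v A) ` K" using K by (intro Max_in) auto
    then show ?thesis unfolding t_Max by auto
  qed
  have t_nonneg: "0 \<le> t A" for A
  proof -
    obtain v where v: "v \<in> K" using K by auto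
    then obtain u where u: "u \<in> K" "\<forall>i\<in>U. u i = - v i" using sym by blast
    have "L u A = - L v A" using u(2) by (simp add: L_def sum_negf[symmetric])
    then show ?thesis using t_ge[OF v, of A] t_ge[OF u(1), of A] by linarith
  qed
  define h where "h = sqrt \<kappa> * s / b"
  have energy: "(\<Sum>x\<in>A. \<Sum>y\<in>U - A. swap_energy (\<lambda>A. exp (r * t A)) x y A)
      \<le> exp (r * t A) * (2 * b * (r\<^sup>2 * (\<kappa>\<^sup>2 * s\<^sup>2 / 2 + h * t A)))" if A: "A \<in> S" and r: "0 < r" for A r
  proof -
    obtain v where v: "v \<in> K" "t A = L v A" using t_ex by blast
    define c where "c i = v i - sum v U / card U" for i
    have cU: "card U \<noteq> 0" using card ab by simp
    have c0: "sum c U = 0" using cU by (simp add: c_def sum_subtractf)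
    have cs: "(\<Sum>i\<in>U. (c i)\<^sup>2) \<le> s\<^sup>2" unfolding c_def using s v by blast
    \<comment> \<open>The weights sum to \<open>0\<close>, so centering the vector leaves the
      statistic unchanged.\<close>
    have tA: "t A = \<kappa> * sum c A"
    proof -
      have "L v A = L c A + L (\<lambda>_. sum v U / card U) A"
        unfolding L_def sum.distrib[symmetric] distrib_left[symmetric] by (simp add: c_def)
      moreover have "L (\<lambda>_. sum v U / card U) A = 0"
      proof -
        have "(1 / real a + 1 / real b) * (real a * q) - (real a + real b) * q / b = 0" for q
          using ab by (simp add: field_simps)
        then show ?thesis unfolding L[OF SA(1)[OF A]] \<kappa>_def using SA[OF A] card by simp
      qed
      ultimately show ?thesis using L[OF SA(1)[OF A], of c] c0 v by simp
    qed
    have t2: "(t A)\<^sup>2 \<le> \<kappa> * s\<^sup>2"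
    proof -
      have "(\<kappa> * sum c A)\<^sup>2 \<le> \<kappa> * (\<Sum>i\<in>U. (c i)\<^sup>2)"
        unfolding \<kappa>_def using fin card ab A c0 by (intro slice_weights_square) (auto simp: S_def)
      also have "\<dots> \<le> \<kappa> * s\<^sup>2" using \<kappa> cs by (intro mult_left_mono) auto
      finally show ?thesis unfolding tA .
    qed
    have ts: "t A \<le> sqrt \<kappa> * s"
    proof (rule power2_le_imp_le)
      show "(t A)\<^sup>2 \<le> (sqrt \<kappa> * s)\<^sup>2" using t2 \<kappa> by (simp add: power_mult_distrib)
      show "0 \<le> sqrt \<kappa> * s" using s \<kappa> by simp
    qed
    have swap: "swap_energy (\<lambda>A. exp (r * t A)) x y A \<le> exp (r * t A) * (r\<^sup>2 * \<kappa>\<^sup>2 * (c x - c y)\<^sup>2)"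
      if xy: "x \<in> A" "y \<in> U - A" for x y
    proof -
      define A' where "A' = Transposition.transpose x y ` A"
      have A': "A' \<in> S" unfolding A'_def S_def using A xy SA[OF A] by (intro transpose_image_slice) (auto simp: S_def)
      have "L v A' = L v A - \<kappa> * (v x - v y)"
      proof -
        have eq: "sum v A' = sum v A - v x + v y"
          unfolding A'_def using transpose_image_sum[OF SA(2)[OF A] xy(1), of y v] xy by simp
        show ?thesis unfolding L[OF SA(1)[OF A]] L[OF SA(1)[OF A']] eq by (simp add: algebra_simps)
      qed
      then have "r * t A - r * t A' \<le> r * (\<kappa> * (c x - c y))"
        unfolding right_diff_distrib[symmetric]
        using t_ge[OF v(1), of A'] v(2) r by (intro mult_left_mono) (auto simp: c_def)
      then have "(max 0 (r * t A - r * t A'))\<^sup>2 \<le> (max 0 (r * (\<kappa> * (c x - c y))))\<^sup>2"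
        by (intro power_mono) auto
      also have "\<dots> \<le> (r * (\<kappa> * (c x - c y)))\<^sup>2" by (simp add: max_def)
      finally show ?thesis unfolding swap_energy_def A'_def[symmetric]
        by (simp add: power_mult_distrib mult_ac)
    qed
    have "(\<Sum>x\<in>A. \<Sum>y\<in>U - A. swap_energy (\<lambda>A. exp (r * t A)) x y A)
      \<le> (\<Sum>x\<in>A. \<Sum>y\<in>U - A. exp (r * t A) * (r\<^sup>2 * \<kappa>\<^sup>2 * (c x - c y)\<^sup>2))"
      by (intro sum_mono swap)
    also have "\<dots> = exp (r * t A) * (r\<^sup>2 * \<kappa>\<^sup>2 * (\<Sum>x\<in>A. \<Sum>y\<in>U - A. (c x - c y)\<^sup>2))"
      by (simp add: sum_distrib_left)
    also have "\<dots> \<le> exp (r * t A) * (r\<^sup>2 * \<kappa>\<^sup>2 * (b * s\<^sup>2 + 2 * (sum c A)\<^sup>2))"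
    proof (intro mult_left_mono)
      have "(\<Sum>x\<in>A. \<Sum>y\<in>U - A. (c x - c y)\<^sup>2) \<le> b * (\<Sum>i\<in>U. (c i)\<^sup>2) + 2 * (sum c A)\<^sup>2"
        using fin SA[OF A] c0 ab by (intro cut_pair_sum) auto
      also have "\<dots> \<le> b * s\<^sup>2 + 2 * (sum c A)\<^sup>2" using cs by (intro add_right_mono mult_left_mono) auto
      finally show "(\<Sum>x\<in>A. \<Sum>y\<in>U - A. (c x - c y)\<^sup>2) \<le> b * s\<^sup>2 + 2 * (sum c A)\<^sup>2" .
    qed auto
    also have "r\<^sup>2 * \<kappa>\<^sup>2 * (b * s\<^sup>2 + 2 * (sum c A)\<^sup>2) = r\<^sup>2 * (\<kappa>\<^sup>2 * b * s\<^sup>2 + 2 * (t A * t A))"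
      unfolding tA by (simp add: power2_eq_square algebra_simps)
    also have "exp (r * t A) * (r\<^sup>2 * (\<kappa>\<^sup>2 * b * s\<^sup>2 + 2 * (t A * t A))) \<le> exp (r * t A) * (r\<^sup>2 * (\<kappa>\<^sup>2 * b * s\<^sup>2 + 2 * ((sqrt \<kappa> * s) * t A)))"
      using ts t_nonneg[of A] by (intro mult_left_mono add_left_mono mult_right_mono) auto
    also have "r\<^sup>2 * (\<kappa>\<^sup>2 * b * s\<^sup>2 + 2 * ((sqrt \<kappa> * s) * t A)) = 2 * b * (r\<^sup>2 * (\<kappa>\<^sup>2 * s\<^sup>2 / 2 + h * t A))"
      using ab by (simp add: h_def field_simps)
    finally show ?thesis .
  qed
  let ?E = "integral\<^sup>L (measure_pmf (pmf_of_set S))"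
  have E: "integral\<^sup>L (measure_pmf (pmf_of_set S)) g = sum g S / N" for g :: "'a set \<Rightarrow> real"
    unfolding N_def using S by (rule integral_pmf_of_set[rotated])
  \<comment> \<open>\<open>herbst_mgf\<close> asks for a bound on the whole space of the measure,
    which here consists of all sets. Cutting the statistic to \<open>0\<close> off the slice
    provides it and does not affect averages over the slice.\<close>
  have "?E (\<lambda>A. exp (l * (if A \<in> S then t A else 0))) \<le> exp (l * (?E (\<lambda>A. if A \<in> S then t A else 0) + l * (\<kappa>\<^sup>2 * s\<^sup>2 / 2)) / (1 - l * h))"
  proof (rule measure_pmf.herbst_mgf[where C="Max ((\<lambda>A. \<bar>t A\<bar>) ` S)"])
    fix A show "\<bar>if A \<in> S then t A else 0\<bar> \<le> Max ((\<lambda>A. \<bar>t A\<bar>) ` S)"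
      using S by (auto intro: Max_ge order_trans[OF abs_ge_zero Max_ge])
  next
    fix r :: real assume r: "0 < r" "r \<le> l"
    define F where "F A = exp (r * t A)" for A
    have "2 * (real (card U) - real a) * entropy_on S F \<le> (\<Sum>A\<in>S. \<Sum>x\<in>A. \<Sum>y\<in>U - A. swap_energy F x y A)"
      unfolding S_def using fin card by (intro slice_entropy_le_swap_energy) (auto simp: F_def)
    also have "\<dots> \<le> (\<Sum>A\<in>S. F A * (2 * b * (r\<^sup>2 * (\<kappa>\<^sup>2 * s\<^sup>2 / 2 + h * t A))))"
      unfolding F_def using r by (intro sum_mono energy) auto
    also have "\<dots> = 2 * b * (\<Sum>A\<in>S. F A * (r\<^sup>2 * (\<kappa>\<^sup>2 * s\<^sup>2 / 2 + h * t A)))"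
      by (simp add: sum_distrib_left mult_ac)
    finally have "entropy_on S F \<le> (\<Sum>A\<in>S. F A * (r\<^sup>2 * (\<kappa>\<^sup>2 * s\<^sup>2 / 2 + h * t A)))"
      using ab card by simp
    also have "\<dots> = r\<^sup>2 * ((\<kappa>\<^sup>2 * s\<^sup>2 / 2) * sum F S + h * (\<Sum>A\<in>S. t A * F A))"
      by (simp add: sum_distrib_left sum_distrib_right sum.distrib algebra_simps)
    finally have "entropy_on S F / N \<le> r\<^sup>2 * ((\<kappa>\<^sup>2 * s\<^sup>2 / 2) * sum F S + h * (\<Sum>A\<in>S. t A * F A)) / N"
      using N by (intro divide_right_mono) auto
    moreover have "entropy_on S F = r * (\<Sum>A\<in>S. t A * F A) - sum F S * ln (sum F S / N)"
      by (simp add: entropy_on_def N_def F_def sum_distrib_left mult_ac)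
    ultimately have main: "r * ((\<Sum>A\<in>S. t A * F A) / N) - (sum F S / N) * ln (sum F S / N)
      \<le> r\<^sup>2 * ((\<kappa>\<^sup>2 * s\<^sup>2 / 2) * (sum F S / N) + h * ((\<Sum>A\<in>S. t A * F A) / N))"
      by (simp add: diff_divide_distrib add_divide_distrib distrib_left)
    have "(\<Sum>A\<in>S. exp (r * (if A \<in> S then t A else 0))) = sum F S"
      "(\<Sum>A\<in>S. (if A \<in> S then t A else 0) * exp (r * (if A \<in> S then t A else 0))) = (\<Sum>A\<in>S. t A * F A)"
      by (simp_all add: F_def)
    with main show "r * ?E (\<lambda>A. (if A \<in> S then t A else 0) * exp (r * (if A \<in> S then t A else 0)))
       - ?E (\<lambda>A. exp (r * (if A \<in> S then t A else 0))) * ln (?E (\<lambda>A. exp (r * (if A \<in> S then t A else 0))))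
       \<le> r\<^sup>2 * (\<kappa>\<^sup>2 * s\<^sup>2 / 2 * ?E (\<lambda>A. exp (r * (if A \<in> S then t A else 0)))
         + h * ?E (\<lambda>A. (if A \<in> S then t A else 0) * exp (r * (if A \<in> S then t A else 0))))"
      unfolding E by simp
  qed (use l in \<open>auto simp: h_def \<kappa>_def\<close>)
  then show ?thesis unfolding E by (simp add: S_def N_def t_def \<kappa>_def h_def)
qed

text \<open>There are finitely many sets \<open>A\<close>, so near-maximizers for each of them,
  together with their negatives, form a finite symmetric subclass \<open>J\<close> whose statistic
  is within \<open>e\<close> of the original one on the slice. The error is removed on the
  logarithmic scale.\<close>

lemma slice_concentration:
  fixes K :: "('a \<Rightarrow> real) set" and a b :: nat
  assumes fin: "finite U" and card: "card U = a + b" and ab: "1 \<le> a" "a \<le> b"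
    and K: "K \<noteq> {}" and bd: "\<And>v i. v \<in> K \<Longrightarrow> i \<in> U \<Longrightarrow> \<bar>v i\<bar> \<le> C"
    and sym: "\<And>v. v \<in> K \<Longrightarrow> \<exists>u\<in>K. \<forall>i\<in>U. u i = - v i"
    and s: "0 \<le> s" "\<And>v. v \<in> K \<Longrightarrow> (\<Sum>i\<in>U. (v i - sum v U / card U)\<^sup>2) \<le> s\<^sup>2"
    and l: "0 < l" "l * (sqrt (1 / a + 1 / b) * s / b) < 1"
  shows "(\<Sum>A\<in>slice U a. exp (l * slice_stat K U a b A)) / card (slice U a)
    \<le> exp (l * ((\<Sum>A\<in>slice U a. slice_stat K U a b A) / card (slice U a) + l * ((1 / a + 1 / b)\<^sup>2 * s\<^sup>2 / 2))
         / (1 - l * (sqrt (1 / a + 1 / b) * s / b)))" (is "?lhs \<le> exp (l * (?W K + ?A) / ?h)")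
proof -
  define S where "S = slice U a"
  define L where "L v A = (\<Sum>i\<in>U. (if i \<in> A then 1 / real a else - (1 / real b)) * v i)" for v A
  have S: "finite S" "S \<noteq> {}" using fin card slice_nonempty[OF fin, of a] by (auto simp: S_def intro!: finite_slice)
  have st: "slice_stat J U a b A = (SUP v\<in>J. L v A)" for J A by (simp add: slice_stat_def L_def)
  have bdd: "bdd_above ((\<lambda>v. L v A) ` K)" for A
  proof (rule bdd_aboveI2)
    fix v assume v: "v \<in> K"
    have "L v A \<le> (\<Sum>i\<in>U. \<bar>(if i \<in> A then 1 / real a else - (1 / real b)) * v i\<bar>)"
      unfolding L_def by (intro sum_mono) simp
    also have "\<dots> \<le> (\<Sum>i\<in>U. 1 * C)"
      unfolding abs_mult using bd v ab by (intro sum_mono mult_mono) auto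
    finally show "L v A \<le> (\<Sum>i\<in>U. 1 * C)" .
  qed
  have h: "0 < ?h" using l by simp
  have eps: "?lhs \<le> exp (l * (?W K + ?A) / ?h + l * e)" if e: "0 < e" for e
  proof -
    have "\<exists>v\<in>K. slice_stat K U a b A - e < L v A" for A
    proof -
      have "slice_stat K U a b A - e < (SUP v\<in>K. L v A)" using e by (simp add: st)
      then show ?thesis using less_cSUP_iff[OF K bdd, of _ A] by blast
    qed
    then obtain V where V: "\<And>A. V A \<in> K" "\<And>A. slice_stat K U a b A - e < L (V A) A" by metis
    obtain neg where neg: "\<And>v. v \<in> K \<Longrightarrow> neg v \<in> K" "\<And>v i. v \<in> K \<Longrightarrow> i \<in> U \<Longrightarrow> neg v i = - v i"
      using sym by metis
    define J where "J = V ` S \<union> (\<lambda>v. neg v) ` V ` S"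
    have J: "finite J" "J \<noteq> {}" "J \<subseteq> K" using S V neg by (auto simp: J_def)
    have symJ: "\<exists>u\<in>J. \<forall>i\<in>U. u i = - v i" if "v \<in> J" for v
    proof -
      from that consider A where "A \<in> S" "v = V A" | A where "A \<in> S" "v = neg (V A)" by (auto simp: J_def)
      then show ?thesis
      proof cases
        case 1 then show ?thesis using neg(2)[OF V(1)] by (intro bexI[of _ "neg (V A)"]) (auto simp: J_def)
      next
        case 2 then show ?thesis using neg(2)[OF V(1)] by (intro bexI[of _ "V A"]) (auto simp: J_def)
      qed
    qed
    have le: "slice_stat J U a b A \<le> slice_stat K U a b A" for A
      unfolding st using J bdd by (intro cSUP_subset_mono) auto
    have ge: "slice_stat K U a b A - e \<le> slice_stat J U a b A" if A: "A \<in> S" for A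
    proof -
      have "L (V A) A \<le> slice_stat J U a b A" unfolding st
        using J A by (intro cSUP_upper) (auto simp: J_def intro!: bdd_above_finite)
      then show ?thesis using V(2)[of A] by simp
    qed
    have "?lhs \<le> (\<Sum>A\<in>S. exp (l * e) * exp (l * slice_stat J U a b A)) / card S"
      unfolding S_def[symmetric]
    proof (intro divide_right_mono sum_mono)
      fix A assume "A \<in> S"
      then have "l * slice_stat K U a b A \<le> l * (e + slice_stat J U a b A)" using ge l by (intro mult_left_mono) (auto simp: algebra_simps)
      then show "exp (l * slice_stat K U a b A) \<le> exp (l * e) * exp (l * slice_stat J U a b A)"
        by (simp add: exp_add[symmetric] distrib_left)
    qed auto
    also have "\<dots> = exp (l * e) * ((\<Sum>A\<in>S. exp (l * slice_stat J U a b A)) / card S)" by (simp add: sum_distrib_left)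
    also have "\<dots> \<le> exp (l * e) * exp (l * (?W J + ?A) / ?h)"
      unfolding S_def using fin card ab J symJ s l
      by (intro mult_left_mono slice_concentration_finite) auto
    also have "\<dots> \<le> exp (l * e) * exp (l * (?W K + ?A) / ?h)"
      using l h le by (intro mult_left_mono exp_le_cancel_iff[THEN iffD2] divide_right_mono add_right_mono sum_mono) auto
    finally show ?thesis by (simp only: exp_add mult.commute)
  qed
  have pos: "0 < ?lhs" using S unfolding S_def[symmetric] by (intro divide_pos_pos sum_pos) (auto simp: card_gt_0_iff)
  have "ln ?lhs \<le> l * (?W K + ?A) / ?h"
  proof (rule field_le_epsilon)
    fix e :: real assume "0 < e"
    then have "?lhs \<le> exp (l * (?W K + ?A) / ?h + l * (e / l))" using l by (intro eps) simp
    then have "ln ?lhs \<le> ln (exp (l * (?W K + ?A) / ?h + l * (e / l)))" using pos by (subst ln_le_cancel_iff) auto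
    then show "ln ?lhs \<le> l * (?W K + ?A) / ?h + e" using l by simp
  qed
  then have "exp (ln ?lhs) \<le> exp (l * (?W K + ?A) / ?h)" by (simp only: exp_le_cancel_iff)
  then show ?thesis using pos by (simp only: exp_ln)
qed

section \<open>Tensorization of entropy and self-bounding functions\<close>

lemma (in prob_space) integrable_bounded:
  fixes f :: "'a \<Rightarrow> real"
  assumes "f \<in> borel_measurable M" "\<And>x. x \<in> space M \<Longrightarrow> \<bar>f x\<bar> \<le> C"
  shows "integrable M f"
  using assms by (intro integrable_const_bound[where B=C]) auto

lemma abs_mult_ln_diff_le:
  fixes s t :: real
  assumes "0 < c" "c \<le> s" "s \<le> C" "c \<le> t" "t \<le> C"
  shows "\<bar>s * (ln s - ln t)\<bar> \<le> C * (ln C - ln c)"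
proof -
  have "ln c \<le> ln s" "ln s \<le> ln C" "ln c \<le> ln t" "ln t \<le> ln C" using assms by (auto simp: ln_le_cancel_iff)
  then have "\<bar>ln s - ln t\<bar> \<le> ln C - ln c" by linarith
  then show ?thesis unfolding abs_mult using assms by (intro mult_mono) auto
qed

lemma relative_entropy_nonneg:
  fixes a b :: real
  assumes "0 < a" "0 < b" shows "0 \<le> a * (ln a - ln b) - a + b"
proof -
  have "ln (b / a) \<le> b / a - 1" using assms by (intro ln_le_minus_one) auto
  then have "a * (ln b - ln a) \<le> a * (b / a - 1)" using assms by (intro mult_left_mono) (auto simp: ln_div)
  then show ?thesis using assms by (simp add: algebra_simps)
qed

lemma (in prob_space) bounded_expectation:
  fixes f :: "'a \<Rightarrow> real"
  assumes "f \<in> borel_measurable M" "\<And>x. x \<in> space M \<Longrightarrow> c \<le> f x" "\<And>x. x \<in> space M \<Longrightarrow> f x \<le> C"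
  shows "c \<le> expectation f" "expectation f \<le> C" "integrable M f"
proof -
  show i: "integrable M f"
  proof (rule integrable_bounded[OF assms(1)])
    fix x assume "x \<in> space M"
    from assms(2,3)[OF this] show "\<bar>f x\<bar> \<le> max \<bar>c\<bar> \<bar>C\<bar>" by (simp add: abs_le_iff) linarith
  qed
  show "c \<le> expectation f" using i assms by (intro integral_ge_const AE_I2)
  show "expectation f \<le> C" using i assms by (intro integral_le_const AE_I2)
qed

lemma (in prob_space) abs_expectation_le:
  fixes f :: "'a \<Rightarrow> real"
  assumes "f \<in> borel_measurable M" "\<And>x. x \<in> space M \<Longrightarrow> \<bar>f x\<bar> \<le> C"
  shows "\<bar>expectation f\<bar> \<le> C"
proof -
  have "- C \<le> f x \<and> f x \<le> C" if "x \<in> space M" for x using assms(2)[OF that] by linarith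
  then have "- C \<le> expectation f" "expectation f \<le> C"
    using bounded_expectation[OF assms(1), of "- C" C] by auto
  then show ?thesis by linarith
qed

text \<open>Integral form of \<open>log_sum_inequality\<close>; in the tensorization it says that
  averaging one coordinate out of both functions can only decrease their relative entropy.\<close>

lemma (in prob_space) log_sum_integral:
  fixes f v :: "'a \<Rightarrow> real"
  assumes [measurable]: "f \<in> borel_measurable M" "v \<in> borel_measurable M" and c: "0 < c"
    and f: "\<And>x. x \<in> space M \<Longrightarrow> c \<le> f x" "\<And>x. x \<in> space M \<Longrightarrow> f x \<le> C"
    and v: "\<And>x. x \<in> space M \<Longrightarrow> c \<le> v x" "\<And>x. x \<in> space M \<Longrightarrow> v x \<le> C"
  shows "expectation f * (ln (expectation f) - ln (expectation v)) \<le> expectation (\<lambda>x. f x * (ln (f x) - ln (v x)))"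
proof -
  define F where "F = expectation f" define V where "V = expectation v"
  have F: "c \<le> F" "integrable M f" and V: "c \<le> V" "integrable M v"
    unfolding F_def V_def using f v by (auto intro: bounded_expectation(1)[of _ c C] bounded_expectation(3)[of _ c C])
  have pos: "0 < F" "0 < V" using F V c by auto
  have i: "integrable M (\<lambda>x. f x * (ln (f x) - ln (v x)))"
    using f v c by (intro integrable_bounded[of _ "C * (ln C - ln c)"] abs_mult_ln_diff_le) auto
  have "expectation (\<lambda>x. f x * (ln F - ln V) + (f x - v x * (F / V))) \<le> expectation (\<lambda>x. f x * (ln (f x) - ln (v x)))"
  proof (rule integral_mono)
    fix x assume x: "x \<in> space M"
    have fx: "0 < f x" "0 < v x" using f(1)[OF x] v(1)[OF x] c by auto
    have "ln (v x * F / (f x * V)) \<le> v x * F / (f x * V) - 1"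
      using fx pos by (intro ln_le_minus_one) auto
    then have "f x * (1 - v x * F / (f x * V)) \<le> f x * (ln (f x) - ln (v x) - (ln F - ln V))"
      using fx pos by (intro mult_left_mono) (auto simp: ln_div ln_mult)
    moreover have "f x * (1 - v x * F / (f x * V)) = f x - v x * (F / V)"
      using fx pos by (simp add: field_simps)
    ultimately show "f x * (ln F - ln V) + (f x - v x * (F / V)) \<le> f x * (ln (f x) - ln (v x))"
      by (simp add: algebra_simps)
  qed (use F V i in auto)
  also have "expectation (\<lambda>x. f x * (ln F - ln V) + (f x - v x * (F / V))) = F * (ln F - ln V)"
  proof -
    have "expectation (\<lambda>x. f x * (ln F - ln V) + (f x - v x * (F / V))) = F * (ln F - ln V) + (F - V * (F / V))"
      using F(2) V(2) by (simp add: F_def V_def)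
    then show ?thesis using pos by simp
  qed
  finally show ?thesis by (simp add: F_def V_def)
qed

section \<open>Product measures and tensorization of entropy\<close>

locale prob_family =
  fixes M :: "'i \<Rightarrow> 'a measure"
  assumes prob_space_component: "\<And>i. prob_space (M i)"
begin

sublocale product_sigma_finite M
  by (simp add: product_sigma_finite_def prob_space_component prob_space_imp_sigma_finite)

lemma prob_space_product: "prob_space (PiM I M)"
  by (intro prob_space_PiM prob_space_component)

lemma PiM_integral_insert_bounded:
  fixes g :: "('i \<Rightarrow> 'a) \<Rightarrow> real"
  assumes "finite I" "x \<notin> I" and g: "g \<in> borel_measurable (PiM (insert x I) M)"
    "\<And>z. z \<in> space (PiM (insert x I) M) \<Longrightarrow> \<bar>g z\<bar> \<le> C"
  shows "(\<integral>z. g z \<partial>PiM (insert x I) M) = (\<integral>z. (\<integral>y. g (z(x:=y)) \<partial>M x) \<partial>PiM I M)"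
proof -
  interpret J: prob_space "PiM (insert x I) M" by (rule prob_space_product)
  show ?thesis using assms by (intro product_integral_insert J.integrable_bounded)
qed

lemma fun_upd_space_PiM:
  "z \<in> space (PiM I M) \<Longrightarrow> y \<in> space (M x) \<Longrightarrow> z(x:=y) \<in> space (PiM (insert x I) M)"
  by (auto simp: space_PiM PiE_iff extensional_def)

lemma section_measurable:
  fixes g :: "('i \<Rightarrow> 'a) \<Rightarrow> real"
  assumes g[measurable]: "g \<in> borel_measurable (PiM (insert x I) M)" and z: "z \<in> space (PiM I M)"
  shows "(\<lambda>y. g (z(x:=y))) \<in> borel_measurable (M x)"
  using measurable_compose[OF measurable_fun_upd[of "insert x I" I x "\<lambda>_. z" _ M "\<lambda>y. y"] g] z
  by auto

lemma partial_integral_measurable: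
  fixes g :: "('i \<Rightarrow> 'a) \<Rightarrow> real"
  assumes g[measurable]: "g \<in> borel_measurable (PiM (insert x I) M)"
  shows "(\<lambda>z. \<integral>y. g (z(x:=y)) \<partial>M x) \<in> borel_measurable (PiM I M)"
proof -
  interpret sigma_finite_measure "M x" by (rule sigma_finite_measures)
  have "(\<lambda>(z, y). g (z(x:=y))) \<in> borel_measurable (PiM I M \<Otimes>\<^sub>M M x)"
    using measurable_compose[OF measurable_add_dim g] by (simp add: case_prod_beta')
  then show ?thesis by (rule borel_measurable_lebesgue_integral)
qed

text \<open>Variational form: for every comparison function \<open>v i\<close> that ignores
  coordinate \<open>i\<close>, the summand for \<open>i\<close> dominates the mean entropy in that
  coordinate, and the choice of \<open>v\<close> is left to the application. Integrating out the new
  coordinate \<open>x\<close>, its own summand pays for the passage from \<open>f\<close> to the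
  marginal \<open>f1\<close>, and the other summands do not increase under averaging.\<close>

theorem entropy_tensorization:
  fixes f :: "('i \<Rightarrow> 'a) \<Rightarrow> real" and v :: "'i \<Rightarrow> ('i \<Rightarrow> 'a) \<Rightarrow> real"
  assumes "finite I" and c: "0 < c"
    and "f \<in> borel_measurable (PiM I M)"
    and "\<And>z. z \<in> space (PiM I M) \<Longrightarrow> c \<le> f z \<and> f z \<le> C"
    and "\<And>i. i \<in> I \<Longrightarrow> v i \<in> borel_measurable (PiM I M)"
    and "\<And>i z. i \<in> I \<Longrightarrow> z \<in> space (PiM I M) \<Longrightarrow> c \<le> v i z \<and> v i z \<le> C"
    and "\<And>i z y. i \<in> I \<Longrightarrow> z \<in> space (PiM I M) \<Longrightarrow> y \<in> space (M i) \<Longrightarrow> v i (z(i:=y)) = v i z"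
  shows "(\<integral>z. f z * ln (f z) \<partial>PiM I M) - (\<integral>z. f z \<partial>PiM I M) * ln (\<integral>z. f z \<partial>PiM I M)
    \<le> (\<Sum>i\<in>I. \<integral>z. f z * (ln (f z) - ln (v i z)) - f z + v i z \<partial>PiM I M)"
  using assms(1,3-)
proof (induction I arbitrary: f v rule: finite_induct)
  case empty
  interpret P: prob_space "PiM {} M" by (rule prob_space_product)
  have "(\<integral>z. g z \<partial>PiM {} M) = g (\<lambda>_. undefined)" for g :: "('i \<Rightarrow> 'a) \<Rightarrow> real"
  proof -
    have "(\<integral>z. g z \<partial>PiM {} M) = (\<integral>z. g (\<lambda>_. undefined) \<partial>PiM {} M)"
      by (intro Bochner_Integration.integral_cong) (auto simp: space_PiM)
    then show ?thesis by (simp add: P.prob_space)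
  qed
  then show ?case by simp
next
  case (insert x I)
  let ?J = "PiM (insert x I) M"
  interpret P: prob_space "PiM I M" by (rule prob_space_product)
  interpret J: prob_space ?J by (rule prob_space_product)
  interpret x: prob_space "M x" by (rule prob_space_component)
  note [measurable] = insert.prems(1) insert.prems(3)[OF insertI1]
  note fb = insert.prems(2) and vb = insert.prems(4)
  have vm: "v i \<in> borel_measurable ?J" if "i \<in> insert x I" for i by (rule insert.prems(3)[OF that])
  define f1 where "f1 z = (\<integral>y. f (z(x:=y)) \<partial>M x)" for z
  define v1 where "v1 i z = (\<integral>y. v i (z(x:=y)) \<partial>M x)" for i z
  have f1m[measurable]: "f1 \<in> borel_measurable (PiM I M)"
    unfolding f1_def by (rule partial_integral_measurable) measurable
  have v1m[measurable]: "v1 i \<in> borel_measurable (PiM I M)" if "i \<in> I" for i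
    unfolding v1_def using that by (intro partial_integral_measurable vm) auto
  have sec: "(\<lambda>y. f (z(x:=y))) \<in> borel_measurable (M x)" "\<And>i. i \<in> insert x I \<Longrightarrow> (\<lambda>y. v i (z(x:=y))) \<in> borel_measurable (M x)"
    if "z \<in> space (PiM I M)" for z
    using that vm by (auto intro!: section_measurable)
  have fbs: "c \<le> f (z(x:=y))" "f (z(x:=y)) \<le> C"
    and vbs: "\<And>i. i \<in> insert x I \<Longrightarrow> c \<le> v i (z(x:=y))" "\<And>i. i \<in> insert x I \<Longrightarrow> v i (z(x:=y)) \<le> C"
    if "z \<in> space (PiM I M)" "y \<in> space (M x)" for z y
    using fb[OF fun_upd_space_PiM[OF that]] vb[OF _ fun_upd_space_PiM[OF that]] by blast+
  have f1b: "c \<le> f1 z \<and> f1 z \<le> C" if "z \<in> space (PiM I M)" for z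
    unfolding f1_def using that
    by (intro conjI x.bounded_expectation(1)[where C=C] x.bounded_expectation(2)[where c=c] sec fbs)
  have v1b: "c \<le> v1 i z \<and> v1 i z \<le> C" if "i \<in> I" "z \<in> space (PiM I M)" for i z
    unfolding v1_def using that
    by (intro conjI x.bounded_expectation(1)[where C=C] x.bounded_expectation(2)[where c=c] sec vbs) auto
  define K where "K = \<bar>C * (ln C - ln c)\<bar> + \<bar>C * (ln C - ln 1)\<bar> + \<bar>C * (ln 1 - ln c)\<bar> + 2 * C"
  obtain z0 where "z0 \<in> space ?J" using J.not_empty by blast
  then have Cpos: "0 < C" using fb[of z0] c by linarith
  have bd1: "\<bar>s * (ln s - ln t) - s + t\<bar> \<le> K" "\<bar>s * (ln s - ln t)\<bar> \<le> K" "\<bar>s\<bar> \<le> K" if "c \<le> s" "s \<le> C" "c \<le> t" "t \<le> C" for s t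
  proof -
    have *: "\<bar>s * (ln s - ln t)\<bar> \<le> C * (ln C - ln c)" using that c by (intro abs_mult_ln_diff_le) auto
    show "\<bar>s * (ln s - ln t)\<bar> \<le> K" "\<bar>s * (ln s - ln t) - s + t\<bar> \<le> K" "\<bar>s\<bar> \<le> K"
      using * that c Cpos unfolding K_def by linarith+
  qed
  have bd2: "\<bar>s * ln s\<bar> \<le> C * (\<bar>ln c\<bar> + \<bar>ln C\<bar>)" if "c \<le> s" "s \<le> C" for s
  proof -
    have "ln c \<le> ln s" "ln s \<le> ln C" using that c by auto
    then have "\<bar>ln s\<bar> \<le> \<bar>ln c\<bar> + \<bar>ln C\<bar>" by linarith
    then show ?thesis unfolding abs_mult using that c by (intro mult_mono) auto
  qed
  have fA: "\<bar>f z\<bar> \<le> C" "\<bar>f z * ln (f z)\<bar> \<le> C * (\<bar>ln c\<bar> + \<bar>ln C\<bar>)" if "z \<in> space ?J" for z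
    using fb[OF that] c bd2[of "f z"] by auto
  have fH: "\<bar>f z * (ln (f z) - ln (v i z)) - f z + v i z\<bar> \<le> K" "\<bar>f z * (ln (f z) - ln (v i z))\<bar> \<le> K" "\<bar>v i z\<bar> \<le> C"
    if "i \<in> insert x I" "z \<in> space ?J" for i z
    using fb[OF that(2)] vb[OF that] c bd1[of "f z" "v i z"] by auto
  have Iint: "(\<integral>z. f z \<partial>?J) = (\<integral>z. f1 z \<partial>PiM I M)"
    unfolding f1_def using insert.hyps by (intro PiM_integral_insert_bounded[where C=C] fA) measurable
  have Iln: "(\<integral>z. f z * ln (f z) \<partial>?J) = (\<integral>z. (\<integral>y. f (z(x:=y)) * ln (f (z(x:=y))) \<partial>M x) \<partial>PiM I M)"
    using insert.hyps by (intro PiM_integral_insert_bounded[where C="C * (\<bar>ln c\<bar> + \<bar>ln C\<bar>)"] fA) measurable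
  define H where "H i z = (\<integral>y. f (z(x:=y)) * (ln (f (z(x:=y))) - ln (v i (z(x:=y)))) - f (z(x:=y)) + v i (z(x:=y)) \<partial>M x)" for i z
  have IH: "(\<integral>z. f z * (ln (f z) - ln (v i z)) - f z + v i z \<partial>?J) = (\<integral>z. H i z \<partial>PiM I M)" if i: "i \<in> insert x I" for i
  proof -
    note [measurable] = vm[OF i]
    show ?thesis unfolding H_def
      using insert.hyps i by (intro PiM_integral_insert_bounded[where C=K] fH) measurable
  qed
  have HI: "integrable (PiM I M) (H i)" if i: "i \<in> insert x I" for i
  proof -
    note [measurable] = vm[OF i]
    have m: "H i \<in> borel_measurable (PiM I M)" unfolding H_def by (rule partial_integral_measurable[where g="\<lambda>z. f z * (ln (f z) - ln (v i z)) - f z + v i z"]) measurable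
    show ?thesis
    proof (rule P.integrable_bounded[OF m])
      fix z assume z: "z \<in> space (PiM I M)"
      note [measurable] = sec(1)[OF z] sec(2)[OF z i]
      show "\<bar>H i z\<bar> \<le> K" unfolding H_def
      proof (rule x.abs_expectation_le)
        show "(\<lambda>y. f (z(x := y)) * (ln (f (z(x := y))) - ln (v i (z(x := y)))) - f (z(x := y)) + v i (z(x := y))) \<in> borel_measurable (M x)"
          by (intro borel_measurable_add borel_measurable_diff borel_measurable_times borel_measurable_ln sec i z)
      qed (intro fH i fun_upd_space_PiM z)
    qed
  qed
  have secint: "integrable (M x) (\<lambda>y. f (z(x:=y)))"
    "integrable (M x) (\<lambda>y. f (z(x:=y)) * ln (f (z(x:=y))))"
    "\<And>i. i \<in> insert x I \<Longrightarrow> integrable (M x) (\<lambda>y. v i (z(x:=y)))"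
    "\<And>i. i \<in> insert x I \<Longrightarrow> integrable (M x) (\<lambda>y. f (z(x:=y)) * (ln (f (z(x:=y))) - ln (v i (z(x:=y)))))"
    if z: "z \<in> space (PiM I M)" for z
  proof -
    note [measurable] = sec(1)[OF z]
    note J = fun_upd_space_PiM[OF z]
    show "integrable (M x) (\<lambda>y. f (z(x:=y)))" using fA(1)[OF J] by (intro x.integrable_bounded[where C=C]) auto
    show "integrable (M x) (\<lambda>y. f (z(x:=y)) * ln (f (z(x:=y))))" using fA(2)[OF J] by (intro x.integrable_bounded[where C="C * (\<bar>ln c\<bar> + \<bar>ln C\<bar>)"]) auto
    fix i assume i: "i \<in> insert x I"
    note [measurable] = sec(2)[OF z i]
    show "integrable (M x) (\<lambda>y. v i (z(x:=y)))" using fH(3)[OF i J] by (intro x.integrable_bounded[where C=C]) auto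
    show "integrable (M x) (\<lambda>y. f (z(x:=y)) * (ln (f (z(x:=y))) - ln (v i (z(x:=y)))))" using fH(2)[OF i J] by (intro x.integrable_bounded[where C=K]) auto
  qed
  have f1ln: "integrable (PiM I M) (\<lambda>z. f1 z * ln (f1 z))"
    using f1b bd2 by (intro P.integrable_bounded[where C="C * (\<bar>ln c\<bar> + \<bar>ln C\<bar>)"]) auto
  have first: "(\<integral>z. f z * ln (f z) \<partial>?J) - (\<integral>z. f1 z * ln (f1 z) \<partial>PiM I M) \<le> (\<integral>z. H x z \<partial>PiM I M)"
  proof -
    have "(\<integral>z. (\<integral>y. f (z(x:=y)) * ln (f (z(x:=y))) \<partial>M x) \<partial>PiM I M) \<le> (\<integral>z. f1 z * ln (f1 z) + H x z \<partial>PiM I M)"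
    proof (rule integral_mono)
      show "integrable (PiM I M) (\<lambda>z. (\<integral>y. f (z(x:=y)) * ln (f (z(x:=y))) \<partial>M x))"
      proof (rule P.integrable_bounded[where C="C * (\<bar>ln c\<bar> + \<bar>ln C\<bar>)"])
        show "(\<lambda>z. (\<integral>y. f (z(x:=y)) * ln (f (z(x:=y))) \<partial>M x)) \<in> borel_measurable (PiM I M)"
          by (rule partial_integral_measurable[where g="\<lambda>z. f z * ln (f z)"]) measurable
        fix z assume z: "z \<in> space (PiM I M)"
        note [measurable] = sec(1)[OF z]
        show "\<bar>\<integral>y. f (z(x:=y)) * ln (f (z(x:=y))) \<partial>M x\<bar> \<le> C * (\<bar>ln c\<bar> + \<bar>ln C\<bar>)"
          by (intro x.abs_expectation_le borel_measurable_times borel_measurable_ln sec fA fun_upd_space_PiM z)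
      qed
      show "integrable (PiM I M) (\<lambda>z. f1 z * ln (f1 z) + H x z)" using f1ln HI[of x] by simp
      fix z assume z: "z \<in> space (PiM I M)"
      obtain y0 where y0: "y0 \<in> space (M x)" using x.not_empty by auto
      \<comment> \<open>On this fibre \<open>v x\<close> is a constant \<open>w\<close>. Among
        constants the mean \<open>f1 z\<close> is the best comparison value, which is the content of
        \<open>relative_entropy_nonneg\<close>.\<close>
      define w where "w = v x (z(x:=y0))"
      have w: "v x (z(x:=y)) = w" if "y \<in> space (M x)" for y
        using insert.prems(5)[OF insertI1 fun_upd_space_PiM[OF z y0] that] unfolding w_def fun_upd_upd .
      have wpos: "0 < w" unfolding w_def using vb[of x] fun_upd_space_PiM[OF z y0] c by force
      have "H x z = (\<integral>y. f (z(x:=y)) * ln (f (z(x:=y))) - f (z(x:=y)) * ln w - f (z(x:=y)) + w \<partial>M x)"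
        unfolding H_def by (intro Bochner_Integration.integral_cong) (auto simp: w algebra_simps)
      also have "\<dots> = (\<integral>y. f (z(x:=y)) * ln (f (z(x:=y))) \<partial>M x) - f1 z * ln w - f1 z + w"
        using secint[OF z] by (simp add: f1_def x.prob_space)
      finally have "H x z = (\<integral>y. f (z(x:=y)) * ln (f (z(x:=y))) \<partial>M x) - f1 z * ln w - f1 z + w" .
      moreover have "0 \<le> f1 z * (ln (f1 z) - ln w) - f1 z + w"
        using f1b[OF z] c wpos by (intro relative_entropy_nonneg) auto
      ultimately show "(\<integral>y. f (z(x:=y)) * ln (f (z(x:=y))) \<partial>M x) \<le> f1 z * ln (f1 z) + H x z"
        by (simp add: algebra_simps)
    qed
    then show ?thesis unfolding Iln using f1ln HI[of x] by simp
  qed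
  have second: "(\<integral>z. f1 z * (ln (f1 z) - ln (v1 i z)) - f1 z + v1 i z \<partial>PiM I M) \<le> (\<integral>z. H i z \<partial>PiM I M)" if i: "i \<in> I" for i
  proof (rule integral_mono)
    show "integrable (PiM I M) (\<lambda>z. f1 z * (ln (f1 z) - ln (v1 i z)) - f1 z + v1 i z)"
      using i f1b v1b bd1 by (intro P.integrable_bounded[where C=K]) auto
    show "integrable (PiM I M) (H i)" using HI i by simp
    fix z assume z: "z \<in> space (PiM I M)"
    note [measurable] = sec(1)[OF z] sec(2)[OF z]
    have "f1 z * (ln (f1 z) - ln (v1 i z)) \<le> (\<integral>y. f (z(x:=y)) * (ln (f (z(x:=y))) - ln (v i (z(x:=y)))) \<partial>M x)"
      unfolding f1_def v1_def using i z by (intro x.log_sum_integral[where c=c and C=C] sec fbs vbs c) auto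
    moreover have "H i z = (\<integral>y. f (z(x:=y)) * (ln (f (z(x:=y))) - ln (v i (z(x:=y)))) \<partial>M x) - f1 z + v1 i z"
      unfolding H_def f1_def v1_def using secint[OF z] i by simp
    ultimately show "f1 z * (ln (f1 z) - ln (v1 i z)) - f1 z + v1 i z \<le> H i z" by simp
  qed
  have "(\<integral>z. f1 z * ln (f1 z) \<partial>PiM I M) - (\<integral>z. f1 z \<partial>PiM I M) * ln (\<integral>z. f1 z \<partial>PiM I M)
    \<le> (\<Sum>i\<in>I. \<integral>z. f1 z * (ln (f1 z) - ln (v1 i z)) - f1 z + v1 i z \<partial>PiM I M)"
  proof (rule insert.IH)
    fix i z y assume i: "i \<in> I" "z \<in> space (PiM I M)" "y \<in> space (M i)"
    have "i \<noteq> x" using i insert.hyps by auto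
    show "v1 i (z(i:=y)) = v1 i z" unfolding v1_def
    proof (rule Bochner_Integration.integral_cong[OF refl])
      fix u assume "u \<in> space (M x)"
      then have "v i ((z(x:=u))(i:=y)) = v i (z(x:=u))"
        by (rule insert.prems(5)[OF insertI2[OF i(1)] fun_upd_space_PiM[OF i(2)] i(3)])
      then show "v i (z(i:=y, x:=u)) = v i (z(x:=u))" using \<open>i \<noteq> x\<close> by (simp add: fun_upd_twist)
    qed
  qed (use f1b v1b in auto)
  also have "\<dots> \<le> (\<Sum>i\<in>I. \<integral>z. H i z \<partial>PiM I M)" by (intro sum_mono second)
  finally show ?case unfolding Iint using first insert.hyps by (simp add: IH)
qed

end

section \<open>Self-bounding functions\<close>

lemma exp_minus_le_quadratic:
  fixes u :: real assumes "0 \<le> u" shows "exp (- u) \<le> 1 - u + u\<^sup>2 / 2"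
proof -
  define g where "g u = 1 - u + u\<^sup>2 / 2 - exp (- u)" for u :: real
  have "g 0 \<le> g u"
  proof (rule DERIV_nonneg_imp_nondecreasing[OF assms])
    fix x :: real
    have "(g has_real_derivative x - 1 + exp (- x)) (at x)"
      unfolding g_def by (auto intro!: derivative_eq_intros)
    moreover have "0 \<le> x - 1 + exp (- x)" using exp_ge_add_one_self[of "- x"] by simp
    ultimately show "\<exists>y. DERIV g x :> y \<and> 0 \<le> y" by blast
  qed
  then show ?thesis by (simp add: g_def)
qed

text \<open>Tensorization with \<open>v i = exp (s * Y' i)\<close>. For an increment
  \<open>u\<close> between \<open>0\<close> and \<open>1\<close> the integrand is
  \<open>f * (exp (- (s * u)) - 1 + s * u)\<close>, at most \<open>f * (s\<^sup>2 / 2 * u)\<close>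
  since \<open>u\<^sup>2 \<le> u\<close>. The increments sum to at most \<open>a * Y\<close>, so the
  entropy bound has only a self-bounding term, with \<open>h = a / 2\<close>.\<close>

theorem (in prob_family) self_bounding_mgf:
  fixes Y :: "('i \<Rightarrow> 'a) \<Rightarrow> real" and Y' :: "'i \<Rightarrow> ('i \<Rightarrow> 'a) \<Rightarrow> real"
  assumes I: "finite I" and Y[measurable]: "Y \<in> borel_measurable (PiM I M)"
    and K: "\<And>z. z \<in> space (PiM I M) \<Longrightarrow> \<bar>Y z\<bar> \<le> K"
    and Y'[measurable]: "\<And>i. i \<in> I \<Longrightarrow> Y' i \<in> borel_measurable (PiM I M)"
    and dep: "\<And>i z y. i \<in> I \<Longrightarrow> z \<in> space (PiM I M) \<Longrightarrow> y \<in> space (M i) \<Longrightarrow> Y' i (z(i:=y)) = Y' i z"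
    and diff: "\<And>i z. i \<in> I \<Longrightarrow> z \<in> space (PiM I M) \<Longrightarrow> 0 \<le> Y z - Y' i z \<and> Y z - Y' i z \<le> 1"
    and total: "\<And>z. z \<in> space (PiM I M) \<Longrightarrow> (\<Sum>i\<in>I. Y z - Y' i z) \<le> a * Y z"
    and l: "0 < l" "l * (a / 2) < 1"
  shows "(\<integral>z. exp (l * Y z) \<partial>PiM I M) \<le> exp (l * (\<integral>z. Y z \<partial>PiM I M) / (1 - l * (a / 2)))"
proof -
  interpret P: prob_space "PiM I M" by (rule prob_space_product)
  have "P.expectation (\<lambda>z. exp (l * Y z)) \<le> exp (l * (P.expectation Y + l * 0) / (1 - l * (a / 2)))"
  proof (rule P.herbst_mgf[OF Y K _ l])
    fix s :: real assume s: "0 < s" "s \<le> l"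
    define f where "f z = exp (s * Y z)" for z
    define v where "v i z = exp (s * Y' i z)" for i z
    have fm[measurable]: "f \<in> borel_measurable (PiM I M)" unfolding f_def by measurable
    have bY: "\<bar>s * Y z\<bar> \<le> s * K + s" "\<bar>f z\<bar> \<le> exp (s * K + s)" if "z \<in> space (PiM I M)" for z
    proof -
      have "\<bar>s * Y z\<bar> \<le> s * K" using K[OF that] s by (simp add: abs_mult)
      then have "\<bar>s * Y z\<bar> \<le> s * K + s" using s by linarith
      then show "\<bar>s * Y z\<bar> \<le> s * K + s" "\<bar>f z\<bar> \<le> exp (s * K + s)" unfolding f_def by auto
    qed
    have bY': "\<bar>s * Y' i z\<bar> \<le> s * K + s" if "i \<in> I" "z \<in> space (PiM I M)" for i z
    proof -
      have "\<bar>Y' i z\<bar> \<le> K + 1" using K[OF that(2)] diff[OF that] by linarith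
      then show ?thesis using s by (simp add: abs_mult flip: distrib_left[of s K 1, simplified])
    qed
    have fi: "integrable (PiM I M) f" using bY by (intro P.integrable_bounded[where C="exp (s * K + s)"]) auto
    have Yfi: "integrable (PiM I M) (\<lambda>z. Y z * f z)"
    proof (rule Bochner_Integration.integrable_bound[OF integrable_mult_right[OF fi, of K]])
      show "AE z in PiM I M. norm (Y z * f z) \<le> norm (K * f z)"
        using K by (intro AE_I2) (auto simp: abs_mult f_def intro!: mult_right_mono order_trans[OF _ abs_ge_self])
    qed simp
    have "P.expectation (\<lambda>z. f z * ln (f z)) - P.expectation f * ln (P.expectation f)
      \<le> (\<Sum>i\<in>I. P.expectation (\<lambda>z. f z * (ln (f z) - ln (v i z)) - f z + v i z))"
    proof (rule entropy_tensorization[OF I, where c="exp (- (s * K + s))" and C="exp (s * K + s)"])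
      fix z assume z: "z \<in> space (PiM I M)"
      show "exp (- (s * K + s)) \<le> f z \<and> f z \<le> exp (s * K + s)"
        using bY[OF z] unfolding f_def by (auto simp: abs_le_iff)
      fix i assume i: "i \<in> I"
      show "exp (- (s * K + s)) \<le> v i z \<and> v i z \<le> exp (s * K + s)"
        using bY'[OF i z] unfolding v_def by (auto simp: abs_le_iff)
      fix y assume "y \<in> space (M i)"
      then show "v i (z(i:=y)) = v i z" using dep[OF i z] by (simp add: v_def)
    qed (auto simp: v_def)
    also have "\<dots> \<le> (\<Sum>i\<in>I. P.expectation (\<lambda>z. s\<^sup>2 / 2 * ((Y z - Y' i z) * f z)))"
    proof (intro sum_mono integral_mono)
      fix i assume i: "i \<in> I"
      note [measurable] = Y'[OF i]
      have bd: "\<bar>(Y z - Y' i z) * f z\<bar> \<le> exp (s * K + s)" if z: "z \<in> space (PiM I M)" for z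
      proof -
        have "\<bar>(Y z - Y' i z) * f z\<bar> \<le> 1 * exp (s * K + s)"
          unfolding abs_mult using diff[OF i z] bY[OF z] by (intro mult_mono) auto
        then show ?thesis by simp
      qed
      show "integrable (PiM I M) (\<lambda>z. s\<^sup>2 / 2 * ((Y z - Y' i z) * f z))"
        using bd by (intro integrable_mult_right P.integrable_bounded[where C="exp (s * K + s)"]) auto
      have vi: "integrable (PiM I M) (v i)"
        using bY'[OF i] unfolding v_def by (intro P.integrable_bounded[where C="exp (s * K + s)"]) (auto simp: abs_le_iff)
      have "integrable (PiM I M) (\<lambda>z. s * ((Y z - Y' i z) * f z))"
        using bd by (intro integrable_mult_right P.integrable_bounded[where C="exp (s * K + s)"]) auto
      moreover have eq: "(\<lambda>z. f z * (ln (f z) - ln (v i z)) - f z + v i z) = (\<lambda>z. s * ((Y z - Y' i z) * f z) - f z + v i z)"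
        by (simp add: f_def v_def algebra_simps fun_eq_iff)
      ultimately show "integrable (PiM I M) (\<lambda>z. f z * (ln (f z) - ln (v i z)) - f z + v i z)"
        unfolding eq using fi vi by (intro Bochner_Integration.integrable_add Bochner_Integration.integrable_diff)
      fix z assume z: "z \<in> space (PiM I M)"
      define u where "u = Y z - Y' i z"
      have u: "0 \<le> u" "u \<le> 1" using diff[OF i z] by (auto simp: u_def)
      have vz: "v i z = f z * exp (- (s * u))" by (simp add: f_def v_def u_def exp_add[symmetric] algebra_simps)
      have "ln (f z) - ln (v i z) = s * u" by (simp add: f_def v_def u_def algebra_simps)
      then have "f z * (ln (f z) - ln (v i z)) - f z + v i z = f z * (exp (- (s * u)) - 1 + s * u)"
        unfolding vz by (simp add: algebra_simps)
      also have "\<dots> \<le> f z * (s\<^sup>2 / 2 * u)"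
      proof (rule mult_left_mono)
        have "exp (- (s * u)) - 1 + s * u \<le> (s * u)\<^sup>2 / 2" using exp_minus_le_quadratic[of "s * u"] s u by simp
        also have "\<dots> = s\<^sup>2 / 2 * (u * u)" by (simp add: power2_eq_square)
        also have "\<dots> \<le> s\<^sup>2 / 2 * (u * 1)" using u by (intro mult_left_mono) auto
        finally show "exp (- (s * u)) - 1 + s * u \<le> s\<^sup>2 / 2 * u" by simp
      qed (simp add: f_def)
      finally show "f z * (ln (f z) - ln (v i z)) - f z + v i z \<le> s\<^sup>2 / 2 * ((Y z - Y' i z) * f z)"
        by (simp add: u_def mult_ac)
    qed
    also have "\<dots> = s\<^sup>2 / 2 * P.expectation (\<lambda>z. (\<Sum>i\<in>I. Y z - Y' i z) * f z)"
    proof -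
      have "integrable (PiM I M) (\<lambda>z. (Y z - Y' i z) * f z)" if i: "i \<in> I" for i
      proof (rule P.integrable_bounded)
        note [measurable] = Y'[OF i]
        show "(\<lambda>z. (Y z - Y' i z) * f z) \<in> borel_measurable (PiM I M)" by measurable
        fix z assume z: "z \<in> space (PiM I M)"
        have "\<bar>(Y z - Y' i z) * f z\<bar> \<le> 1 * exp (s * K + s)"
          unfolding abs_mult using diff[OF i z] bY[OF z] by (intro mult_mono) auto
        then show "\<bar>(Y z - Y' i z) * f z\<bar> \<le> exp (s * K + s)" by simp
      qed
      then show ?thesis by (simp add: sum_distrib_left sum_distrib_right)
    qed
    also have "\<dots> \<le> s\<^sup>2 / 2 * P.expectation (\<lambda>z. a * (Y z * f z))"
    proof (intro mult_left_mono integral_mono)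
      show "integrable (PiM I M) (\<lambda>z. (\<Sum>i\<in>I. Y z - Y' i z) * f z)"
      proof (rule P.integrable_bounded)
        show "(\<lambda>z. (\<Sum>i\<in>I. Y z - Y' i z) * f z) \<in> borel_measurable (PiM I M)" by measurable
        fix z assume z: "z \<in> space (PiM I M)"
        have "\<bar>\<Sum>i\<in>I. Y z - Y' i z\<bar> \<le> (\<Sum>i\<in>I. 1)"
          using diff[OF _ z] by (intro sum_abs[THEN order_trans] sum_mono) auto
        then have "\<bar>(\<Sum>i\<in>I. Y z - Y' i z) * f z\<bar> \<le> (\<Sum>i\<in>I. 1) * exp (s * K + s)"
          unfolding abs_mult using bY[OF z] by (intro mult_mono) auto
        then show "\<bar>(\<Sum>i\<in>I. Y z - Y' i z) * f z\<bar> \<le> (\<Sum>i\<in>I. 1) * exp (s * K + s)" .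
      qed
      fix z assume z: "z \<in> space (PiM I M)"
      have "(\<Sum>i\<in>I. Y z - Y' i z) * f z \<le> (a * Y z) * f z"
        using total[OF z] by (intro mult_right_mono) (auto simp: f_def)
      then show "(\<Sum>i\<in>I. Y z - Y' i z) * f z \<le> a * (Y z * f z)" by (simp add: mult_ac)
    qed (use Yfi in auto)
    also have "\<dots> = s\<^sup>2 * (a / 2 * P.expectation (\<lambda>z. Y z * f z))" by simp
    also have "P.expectation (\<lambda>z. f z * ln (f z)) = s * P.expectation (\<lambda>z. Y z * f z)"
      unfolding f_def by (simp add: mult_ac flip: integral_mult_right_zero)
    finally show "s * P.expectation (\<lambda>x. Y x * exp (s * Y x)) - P.expectation (\<lambda>x. exp (s * Y x)) * ln (P.expectation (\<lambda>x. exp (s * Y x)))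
       \<le> s\<^sup>2 * (0 * P.expectation (\<lambda>x. exp (s * Y x)) + a / 2 * P.expectation (\<lambda>x. Y x * exp (s * Y x)))"
      by (simp add: f_def)
  qed
  then show ?thesis by simp
qed

section \<open>Convexity and contraction for empirical suprema\<close>

lemma cSUP_real_bounds:
  fixes h :: "'f \<Rightarrow> real"
  assumes "G \<noteq> {}" "\<And>f. f \<in> G \<Longrightarrow> \<bar>h f\<bar> \<le> C"
  shows "bdd_above (h ` G)" "\<bar>SUP f\<in>G. h f\<bar> \<le> C" "\<And>f. f \<in> G \<Longrightarrow> h f \<le> (SUP f\<in>G. h f)"
proof -
  have b: "- C \<le> h f \<and> h f \<le> C" if "f \<in> G" for f using assms(2)[OF that] by linarith
  show bdd: "bdd_above (h ` G)" using b by (intro bdd_aboveI2[of _ _ C]) auto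
  show up: "h f \<le> (SUP f\<in>G. h f)" if "f \<in> G" for f using bdd that by (intro cSUP_upper)
  have "(SUP f\<in>G. h f) \<le> C" using assms(1) b by (intro cSUP_least) auto
  moreover obtain f where "f \<in> G" using assms(1) by auto
  ultimately show "\<bar>SUP f\<in>G. h f\<bar> \<le> C" using up[of f] b[of f] by linarith
qed

lemma cSUP_measurable_bounded:
  fixes h :: "'f \<Rightarrow> 'a \<Rightarrow> real"
  assumes "countable G" "G \<noteq> {}" "\<And>f. f \<in> G \<Longrightarrow> h f \<in> borel_measurable N"
    "\<And>f x. f \<in> G \<Longrightarrow> x \<in> space N \<Longrightarrow> \<bar>h f x\<bar> \<le> C"
  shows "(\<lambda>x. SUP f\<in>G. h f x) \<in> borel_measurable N"
  using assms by (intro borel_measurable_cSUP cSUP_real_bounds(1)[of G _ C]) auto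

lemma abs_sum_le_card:
  fixes g :: "'i \<Rightarrow> real" and C :: real
  assumes "\<And>i. i \<in> I \<Longrightarrow> \<bar>g i\<bar> \<le> C" shows "\<bar>sum g I\<bar> \<le> card I * C"
proof -
  have "\<bar>sum g I\<bar> \<le> (\<Sum>i\<in>I. C)" using assms by (intro order_trans[OF sum_abs] sum_mono)
  then show ?thesis by simp
qed

context prob_family begin

text \<open>Jensen: the supremum of averages over one coordinate is at most the average of the
  supremum. The bounded term \<open>b\<close> holds the integrals of the coordinates still to be
  treated, so that the step can be iterated.\<close>

lemma SUP_integrate_out_one:
  fixes g :: "'f \<Rightarrow> 'i \<Rightarrow> 'a \<Rightarrow> real" and b :: "'f \<Rightarrow> real"
  assumes G: "countable G" "G \<noteq> {}" and I: "finite I" "x \<notin> I"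
    and g: "\<And>f i. f \<in> G \<Longrightarrow> i \<in> insert x I \<Longrightarrow> g f i \<in> borel_measurable (M i)"
    and C: "\<And>f i y. f \<in> G \<Longrightarrow> i \<in> insert x I \<Longrightarrow> y \<in> space (M i) \<Longrightarrow> \<bar>g f i y\<bar> \<le> C"
    and b: "\<And>f. f \<in> G \<Longrightarrow> \<bar>b f\<bar> \<le> D"
  shows "(\<integral>z. (SUP f\<in>G. (\<Sum>i\<in>I. g f i (z i)) + (b f + (\<integral>y. g f x y \<partial>M x))) \<partial>PiM I M)
    \<le> (\<integral>z. (SUP f\<in>G. (\<Sum>i\<in>insert x I. g f i (z i)) + b f) \<partial>PiM (insert x I) M)"
proof -
  let ?J = "insert x I"
  interpret P: prob_space "PiM I M" by (rule prob_space_product)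
  interpret J: prob_space "PiM ?J M" by (rule prob_space_product)
  interpret x: prob_space "M x" by (rule prob_space_component)
  define B where "B = card ?J * C + D"
  define h where "h f z = (\<Sum>i\<in>?J. g f i (z i)) + b f" for f z
  have hm: "h f \<in> borel_measurable (PiM ?J M)" if "f \<in> G" for f
    unfolding h_def using g[OF that]
    by (intro borel_measurable_add borel_measurable_sum measurable_compose[OF measurable_component_singleton]) auto
  have hb: "\<bar>h f z\<bar> \<le> B" if "f \<in> G" "z \<in> space (PiM ?J M)" for f z
  proof -
    have "\<bar>\<Sum>i\<in>?J. g f i (z i)\<bar> \<le> card ?J * C"
      using that by (intro abs_sum_le_card C) (auto simp: space_PiM PiE_iff)
    then show ?thesis using b[OF that(1)] unfolding h_def B_def by linarith
  qed
  define H where "H z = (SUP f\<in>G. h f z)" for z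
  have Hm: "H \<in> borel_measurable (PiM ?J M)" unfolding H_def using G hm hb by (intro cSUP_measurable_bounded)
  have Hb: "\<bar>H z\<bar> \<le> B" if "z \<in> space (PiM ?J M)" for z
    unfolding H_def using hb[OF _ that] G by (intro cSUP_real_bounds)
  have split: "(\<Sum>i\<in>I. g f i (z i)) + (b f + (\<integral>y. g f x y \<partial>M x)) = (\<integral>y. h f (z(x:=y)) \<partial>M x)"
    if f: "f \<in> G" and z: "z \<in> space (PiM I M)" for f z
  proof -
    have "h f (z(x:=y)) = ((\<Sum>i\<in>I. g f i (z i)) + b f) + g f x y" for y
    proof -
      have "(\<Sum>i\<in>I. g f i ((z(x:=y)) i)) = (\<Sum>i\<in>I. g f i (z i))" using I by (intro sum.cong) auto
      then show ?thesis using I by (simp add: h_def)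
    qed
    moreover have "integrable (M x) (g f x)" using f g C by (intro x.integrable_bounded[where C=C]) auto
    ultimately show ?thesis by (simp add: x.prob_space)
  qed
  have le: "(\<integral>y. h f (z(x:=y)) \<partial>M x) \<le> (\<integral>y. H (z(x:=y)) \<partial>M x)" if f: "f \<in> G" and z: "z \<in> space (PiM I M)" for f z
  proof (rule integral_mono)
    show "integrable (M x) (\<lambda>y. h f (z(x:=y)))"
      using f z hm hb fun_upd_space_PiM[OF z] by (intro x.integrable_bounded[where C=B] section_measurable) auto
    show "integrable (M x) (\<lambda>y. H (z(x:=y)))"
      using z Hm Hb fun_upd_space_PiM[OF z] by (intro x.integrable_bounded[where C=B] section_measurable) auto
    fix y assume "y \<in> space (M x)"
    then show "h f (z(x:=y)) \<le> H (z(x:=y))"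
      unfolding H_def using f G hb[OF _ fun_upd_space_PiM[OF z]] by (intro cSUP_real_bounds(3)[of G _ B]) auto
  qed
  have "(\<integral>z. (SUP f\<in>G. (\<integral>y. h f (z(x:=y)) \<partial>M x)) \<partial>PiM I M) \<le> (\<integral>z. (\<integral>y. H (z(x:=y)) \<partial>M x) \<partial>PiM I M)"
  proof (rule integral_mono)
    have *: "\<bar>\<integral>y. h f (z(x:=y)) \<partial>M x\<bar> \<le> B" if "f \<in> G" "z \<in> space (PiM I M)" for f z
      using that hm hb fun_upd_space_PiM[OF that(2)] by (intro x.abs_expectation_le section_measurable) auto
    show "integrable (PiM I M) (\<lambda>z. SUP f\<in>G. (\<integral>y. h f (z(x:=y)) \<partial>M x))"
      using G * hm by (intro P.integrable_bounded[where C=B] cSUP_measurable_bounded[where C=B] cSUP_real_bounds partial_integral_measurable) auto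
    show "integrable (PiM I M) (\<lambda>z. (\<integral>y. H (z(x:=y)) \<partial>M x))"
      using Hm Hb fun_upd_space_PiM by (intro P.integrable_bounded[where C=B] partial_integral_measurable x.abs_expectation_le section_measurable) auto
    fix z assume "z \<in> space (PiM I M)"
    then show "(SUP f\<in>G. (\<integral>y. h f (z(x:=y)) \<partial>M x)) \<le> (\<integral>y. H (z(x:=y)) \<partial>M x)"
      using G le by (intro cSUP_least) auto
  qed
  also have "\<dots> = (\<integral>z. H z \<partial>PiM ?J M)"
    using I Hm Hb by (intro PiM_integral_insert_bounded[symmetric, where C=B]) auto
  finally show ?thesis
    unfolding H_def h_def[symmetric] using split by (simp cong: Bochner_Integration.integral_cong SUP_cong)
qed

lemma SUP_integrate_out:
  fixes g :: "'f \<Rightarrow> 'i \<Rightarrow> 'a \<Rightarrow> real"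
  assumes G: "countable G" "G \<noteq> {}" and "finite K" "finite I" "I \<inter> K = {}"
    and "\<And>f i. f \<in> G \<Longrightarrow> i \<in> I \<union> K \<Longrightarrow> g f i \<in> borel_measurable (M i)"
    and "\<And>f i y. f \<in> G \<Longrightarrow> i \<in> I \<union> K \<Longrightarrow> y \<in> space (M i) \<Longrightarrow> \<bar>g f i y\<bar> \<le> C"
  shows "(\<integral>z. (SUP f\<in>G. (\<Sum>i\<in>I. g f i (z i)) + (\<Sum>i\<in>K. \<integral>y. g f i y \<partial>M i)) \<partial>PiM I M)
    \<le> (\<integral>z. (SUP f\<in>G. (\<Sum>i\<in>I \<union> K. g f i (z i))) \<partial>PiM (I \<union> K) M)"
  using assms(3-)
proof (induction K arbitrary: I rule: finite_induct)
  case (insert x K)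
  define b where "b f = (\<Sum>i\<in>K. \<integral>y. g f i y \<partial>M i)" for f
  have bb: "\<bar>b f\<bar> \<le> card K * C" if "f \<in> G" for f
    unfolding b_def using insert.prems that
    by (intro abs_sum_le_card prob_space.abs_expectation_le[OF prob_space_component]) auto
  have "(\<integral>z. (SUP f\<in>G. (\<Sum>i\<in>I. g f i (z i)) + (\<Sum>i\<in>insert x K. \<integral>y. g f i y \<partial>M i)) \<partial>PiM I M)
    = (\<integral>z. (SUP f\<in>G. (\<Sum>i\<in>I. g f i (z i)) + (b f + (\<integral>y. g f x y \<partial>M x))) \<partial>PiM I M)"
    using insert.hyps by (simp add: b_def add_ac)
  also have "\<dots> \<le> (\<integral>z. (SUP f\<in>G. (\<Sum>i\<in>insert x I. g f i (z i)) + b f) \<partial>PiM (insert x I) M)"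
    using insert.prems G bb by (intro SUP_integrate_out_one[where C=C and D="card K * C"]) auto
  also have "\<dots> \<le> (\<integral>z. (SUP f\<in>G. (\<Sum>i\<in>insert x I \<union> K. g f i (z i))) \<partial>PiM (insert x I \<union> K) M)"
    unfolding b_def using insert.hyps insert.prems by (intro insert.IH) auto
  finally show ?case by simp
qed simp

text \<open>Serves to move a block of coordinates to \<open>{1..k}\<close>, to shift a ghost sample
  back, and to exchange coordinates with their ghosts.\<close>

lemma integral_reindex_iid:
  fixes h :: "(nat \<Rightarrow> 'a) \<Rightarrow> real"
  assumes e: "inj_on e {1..k}" "e \<in> {1..k} \<rightarrow> I" "\<And>i. i \<in> {1..k} \<Longrightarrow> M (e i) = R"
    and h: "h \<in> borel_measurable (PiM {1..k} (\<lambda>_. R))"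
  shows "(\<integral>z. h (\<lambda>n\<in>{1..k}. z (e n)) \<partial>PiM I M) = (\<integral>z. h z \<partial>PiM {1..k} (\<lambda>_. R))"
proof -
  have eq: "PiM {1..k} (\<lambda>i. M (e i)) = PiM {1..k} (\<lambda>_. R)" using e(3) by (intro PiM_cong) auto
  have "distr (PiM I M) (PiM {1..k} (\<lambda>i. M (e i))) (\<lambda>\<omega>. \<lambda>n\<in>{1..k}. \<omega> (e n)) = PiM {1..k} (\<lambda>i. M (e i))"
    using e(1,2) by (intro distr_PiM_reindex prob_space_component)
  then have d: "distr (PiM I M) (PiM {1..k} (\<lambda>_. R)) (\<lambda>\<omega>. \<lambda>n\<in>{1..k}. \<omega> (e n)) = PiM {1..k} (\<lambda>_. R)"
    unfolding eq .
  have m: "(\<lambda>\<omega>. \<lambda>n\<in>{1..k}. \<omega> (e n)) \<in> measurable (PiM I M) (PiM {1..k} (\<lambda>_. R))"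
  proof (rule measurable_restrict)
    fix i assume i: "i \<in> {1..k}"
    then have "e i \<in> I" using e(2) by auto
    then show "(\<lambda>\<omega>. \<omega> (e i)) \<in> measurable (PiM I M) R"
      using measurable_component_singleton[of "e i" I M] e(3)[OF i] by simp
  qed
  have "(\<integral>z. h z \<partial>PiM {1..k} (\<lambda>_. R)) = (\<integral>z. h z \<partial>distr (PiM I M) (PiM {1..k} (\<lambda>_. R)) (\<lambda>\<omega>. \<lambda>n\<in>{1..k}. \<omega> (e n)))"
    unfolding d ..
  also have "\<dots> = (\<integral>z. h (\<lambda>n\<in>{1..k}. z (e n)) \<partial>PiM I M)" by (rule integral_distr[OF m h])
  finally show ?thesis ..
qed

end

text \<open>Rademacher signs are encoded by the set of indices with sign \<open>1\<close>, so that
  an average over signs is a finite sum over a power set.\<close>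

definition sgn_of :: "'i set \<Rightarrow> 'i \<Rightarrow> real" where
  "sgn_of S i = (if i \<in> S then 1 else - 1)"

text \<open>For a pair \<open>f\<close>, \<open>g\<close> the difference \<open>a f - a g\<close> is
  at most \<open>\<bar>b f - b g\<bar>\<close>, which is \<open>b f - b g\<close> or
  \<open>b g - b f\<close>. In the second case \<open>f\<close> and \<open>g\<close> exchange their
  roles in the two suprema on the right.\<close>

lemma contraction_one:
  fixes A a b :: "'f \<Rightarrow> real"
  assumes G: "G \<noteq> {}" and bd: "\<And>f. f \<in> G \<Longrightarrow> \<bar>A f\<bar> \<le> C" "\<And>f. f \<in> G \<Longrightarrow> \<bar>b f\<bar> \<le> C"
    and lip: "\<And>f g. f \<in> G \<Longrightarrow> g \<in> G \<Longrightarrow> \<bar>a f - a g\<bar> \<le> \<bar>b f - b g\<bar>"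
  shows "(SUP f\<in>G. A f + a f) + (SUP f\<in>G. A f - a f) \<le> (SUP f\<in>G. A f + b f) + (SUP f\<in>G. A f - b f)"
proof -
  have ab: "\<bar>A f + b f\<bar> \<le> C + C" "\<bar>A f - b f\<bar> \<le> C + C" if "f \<in> G" for f
    using bd[OF that] by linarith+
  have p: "A f + b f \<le> (SUP f\<in>G. A f + b f)" if "f \<in> G" for f
    using that G ab by (intro cSUP_real_bounds(3)[of G _ "C + C"])
  have m: "A f - b f \<le> (SUP f\<in>G. A f - b f)" if "f \<in> G" for f
    using that G ab by (intro cSUP_real_bounds(3)[of G _ "C + C"])
  have key: "A f + a f + (A g - a g) \<le> (SUP f\<in>G. A f + b f) + (SUP f\<in>G. A f - b f)" if "f \<in> G" "g \<in> G" for f g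
    using p[OF that(1)] m[OF that(2)] p[OF that(2)] m[OF that(1)] lip[OF that] by linarith
  have "(SUP f\<in>G. A f + a f) \<le> (SUP f\<in>G. A f + b f) + (SUP f\<in>G. A f - b f) - (A g - a g)" if "g \<in> G" for g
    using key[OF _ that] G by (intro cSUP_least) (auto simp: algebra_simps)
  then have "(SUP f\<in>G. A f - a f) \<le> (SUP f\<in>G. A f + b f) + (SUP f\<in>G. A f - b f) - (SUP f\<in>G. A f + a f)"
    using G by (intro cSUP_least) (auto simp: algebra_simps)
  then show ?thesis by simp
qed

text \<open>The offset \<open>A\<close> is arbitrary so that it can absorb the signed term of the
  index \<open>x\<close> while the induction replaces all other coefficients. Afterwards those terms
  form the offset, and \<open>contraction_one\<close> replaces the coefficient of
  \<open>x\<close>.\<close>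

theorem Rademacher_contraction:
  fixes A :: "'f \<Rightarrow> real" and a b :: "'f \<Rightarrow> 'i \<Rightarrow> real"
  assumes G: "G \<noteq> {}" and "finite J" and "\<And>f. f \<in> G \<Longrightarrow> \<bar>A f\<bar> \<le> D"
    and "\<And>f i. f \<in> G \<Longrightarrow> i \<in> J \<Longrightarrow> \<bar>a f i\<bar> \<le> C" "\<And>f i. f \<in> G \<Longrightarrow> i \<in> J \<Longrightarrow> \<bar>b f i\<bar> \<le> C"
    and "\<And>f g i. f \<in> G \<Longrightarrow> g \<in> G \<Longrightarrow> i \<in> J \<Longrightarrow> \<bar>a f i - a g i\<bar> \<le> \<bar>b f i - b g i\<bar>"
  shows "(\<Sum>S\<in>Pow J. SUP f\<in>G. A f + (\<Sum>i\<in>J. sgn_of S i * a f i))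
    \<le> (\<Sum>S\<in>Pow J. SUP f\<in>G. A f + (\<Sum>i\<in>J. sgn_of S i * b f i))"
  using assms(2-)
proof (induction J arbitrary: A D rule: finite_induct)
  case (insert x J)
  have Pow: "(\<Sum>S\<in>Pow (insert x J). H S) = (\<Sum>S\<in>Pow J. H (insert x S) + H S)" for H :: "'i set \<Rightarrow> real"
  proof -
    have inj: "inj_on (insert x) (Pow J)" using insert.hyps(2) by (auto simp: inj_on_def)
    have "(\<Sum>S\<in>Pow (insert x J). H S) = sum H (Pow J) + sum H (insert x ` Pow J)"
      unfolding Pow_insert using insert.hyps by (intro sum.union_disjoint) auto
    also have "sum H (insert x ` Pow J) = (\<Sum>S\<in>Pow J. H (insert x S))"
      using inj by (subst sum.reindex) auto
    finally show ?thesis by (simp add: sum.distrib)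
  qed
  have sg: "(\<Sum>i\<in>insert x J. sgn_of S i * c f i) = - c f x + (\<Sum>i\<in>J. sgn_of S i * c f i)"
    "(\<Sum>i\<in>insert x J. sgn_of (insert x S) i * c f i) = c f x + (\<Sum>i\<in>J. sgn_of S i * c f i)"
    if "S \<in> Pow J" for S and c :: "'f \<Rightarrow> 'i \<Rightarrow> real" and f
  proof -
    have "x \<notin> S" using that insert.hyps by auto
    then show "(\<Sum>i\<in>insert x J. sgn_of S i * c f i) = - c f x + (\<Sum>i\<in>J. sgn_of S i * c f i)"
      using insert.hyps by (simp add: sgn_of_def)
    have "(\<Sum>i\<in>J. sgn_of (insert x S) i * c f i) = (\<Sum>i\<in>J. sgn_of S i * c f i)"
      using insert.hyps by (intro sum.cong) (auto simp: sgn_of_def)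
    then show "(\<Sum>i\<in>insert x J. sgn_of (insert x S) i * c f i) = c f x + (\<Sum>i\<in>J. sgn_of S i * c f i)"
      using insert.hyps by (simp add: sgn_of_def)
  qed
  have ex: "(SUP f\<in>G. A f + (\<Sum>i\<in>insert x J. sgn_of (insert x S) i * c f i)) = (SUP f\<in>G. (A f + c f x) + (\<Sum>i\<in>J. sgn_of S i * c f i))"
    "(SUP f\<in>G. A f + (\<Sum>i\<in>insert x J. sgn_of S i * c f i)) = (SUP f\<in>G. (A f - c f x) + (\<Sum>i\<in>J. sgn_of S i * c f i))"
    if "S \<in> Pow J" for S and c :: "'f \<Rightarrow> 'i \<Rightarrow> real"
    unfolding sg[OF that] by (simp_all add: algebra_simps)
  have bound: "\<bar>A f + (\<Sum>i\<in>J. sgn_of S i * b f i)\<bar> \<le> D + card J * C" if "f \<in> G" for f S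
  proof -
    have "\<bar>\<Sum>i\<in>J. sgn_of S i * b f i\<bar> \<le> card J * C"
      using insert.prems that by (intro abs_sum_le_card) (auto simp: sgn_of_def)
    then show ?thesis using insert.prems(1)[OF that] by linarith
  qed
  have IHp: "(\<Sum>S\<in>Pow J. SUP f\<in>G. (A f + t * a f x) + (\<Sum>i\<in>J. sgn_of S i * a f i))
      \<le> (\<Sum>S\<in>Pow J. SUP f\<in>G. (A f + t * a f x) + (\<Sum>i\<in>J. sgn_of S i * b f i))" if "\<bar>t\<bar> \<le> 1" for t
  proof (rule insert.IH)
    fix f assume f: "f \<in> G"
    have "\<bar>t * a f x\<bar> \<le> 1 * C" unfolding abs_mult using that insert.prems(2)[OF f, of x] by (intro mult_mono) auto
    then show "\<bar>A f + t * a f x\<bar> \<le> D + C" using insert.prems(1)[OF f] by linarith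
  qed (use insert.prems in auto)
  have "(\<Sum>S\<in>Pow (insert x J). SUP f\<in>G. A f + (\<Sum>i\<in>insert x J. sgn_of S i * a f i))
    = (\<Sum>S\<in>Pow J. SUP f\<in>G. (A f + 1 * a f x) + (\<Sum>i\<in>J. sgn_of S i * a f i))
     + (\<Sum>S\<in>Pow J. SUP f\<in>G. (A f + - 1 * a f x) + (\<Sum>i\<in>J. sgn_of S i * a f i))"
    unfolding Pow sum.distrib[symmetric] by (intro sum.cong refl) (simp add: ex)
  also have "\<dots> \<le> (\<Sum>S\<in>Pow J. SUP f\<in>G. (A f + 1 * a f x) + (\<Sum>i\<in>J. sgn_of S i * b f i))
     + (\<Sum>S\<in>Pow J. SUP f\<in>G. (A f + - 1 * a f x) + (\<Sum>i\<in>J. sgn_of S i * b f i))"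
    by (intro add_mono IHp) auto
  also have "\<dots> = (\<Sum>S\<in>Pow J. (SUP f\<in>G. (A f + (\<Sum>i\<in>J. sgn_of S i * b f i)) + a f x) + (SUP f\<in>G. (A f + (\<Sum>i\<in>J. sgn_of S i * b f i)) - a f x))"
    by (simp add: sum.distrib algebra_simps)
  also have "\<dots> \<le> (\<Sum>S\<in>Pow J. (SUP f\<in>G. (A f + (\<Sum>i\<in>J. sgn_of S i * b f i)) + b f x) + (SUP f\<in>G. (A f + (\<Sum>i\<in>J. sgn_of S i * b f i)) - b f x))"
  proof (rule sum_mono, rule contraction_one[OF G])
    fix S f assume f: "f \<in> G"
    have bx: "\<bar>b f x\<bar> \<le> C" by (rule insert.prems(3)[OF f insertI1])
    then have C: "0 \<le> C" by linarith
    have D: "0 \<le> D" using insert.prems(1)[OF f] by linarith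
    show "\<bar>A f + (\<Sum>i\<in>J. sgn_of S i * b f i)\<bar> \<le> D + card J * C + C" using bound[OF f, of S] C by linarith
    show "\<bar>b f x\<bar> \<le> D + card J * C + C" using bx D C by (simp add: add_increasing)
  qed (use insert.prems in auto)
  also have "\<dots> = (\<Sum>S\<in>Pow (insert x J). SUP f\<in>G. A f + (\<Sum>i\<in>insert x J. sgn_of S i * b f i))"
    unfolding Pow by (intro sum.cong refl) (simp only: ex, simp add: algebra_simps)
  finally show ?case .
qed simp

section \<open>Suprema over a countable symmetric class\<close>

declare One_nat_def [simp del]

lemma measurable_coordinate:
  assumes "i \<in> I" "sets (M i) = sets E"
  shows "(\<lambda>z. z i) \<in> measurable (PiM I M) E"
  using measurable_component_singleton[OF assms(1), of M] measurable_cong_sets[OF refl assms(2)] by blast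

lemma SUP_sum_measurable:
  fixes t :: "'f \<Rightarrow> 'i \<Rightarrow> 'a \<Rightarrow> real"
  assumes G: "countable G" "G \<noteq> {}"
    and t: "\<And>f i. f \<in> G \<Longrightarrow> i \<in> J \<Longrightarrow> t f i \<in> borel_measurable N"
    and C: "\<And>f i z. f \<in> G \<Longrightarrow> i \<in> J \<Longrightarrow> z \<in> space N \<Longrightarrow> \<bar>t f i z\<bar> \<le> C"
  shows "(\<lambda>z. SUP f\<in>G. \<Sum>i\<in>J. t f i z) \<in> borel_measurable N"
    "\<And>z. z \<in> space N \<Longrightarrow> \<bar>SUP f\<in>G. \<Sum>i\<in>J. t f i z\<bar> \<le> real (card J) * C"
    "\<And>f z. f \<in> G \<Longrightarrow> z \<in> space N \<Longrightarrow> (\<Sum>i\<in>J. t f i z) \<le> (SUP f\<in>G. \<Sum>i\<in>J. t f i z)"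
proof -
  have b: "\<bar>\<Sum>i\<in>J. t f i z\<bar> \<le> real (card J) * C" if "f \<in> G" "z \<in> space N" for f z
    using that by (intro abs_sum_le_card C)
  show "(\<lambda>z. SUP f\<in>G. \<Sum>i\<in>J. t f i z) \<in> borel_measurable N"
    using G b t by (intro cSUP_measurable_bounded[where C="real (card J) * C"] borel_measurable_sum) auto
  show "\<bar>SUP f\<in>G. \<Sum>i\<in>J. t f i z\<bar> \<le> real (card J) * C" if "z \<in> space N" for z
    using G b that by (intro cSUP_real_bounds(2))
  show "(\<Sum>i\<in>J. t f i z) \<le> (SUP f\<in>G. \<Sum>i\<in>J. t f i z)" if "f \<in> G" "z \<in> space N" for f z
    using G b that by (intro cSUP_real_bounds(3)[where C="real (card J) * C"])
qed

lemma (in prob_family) SUP_sum_integral_iid: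
  fixes q :: "'f \<Rightarrow> 'a \<Rightarrow> real"
  assumes G: "countable G" "G \<noteq> {}" and J: "finite J" "J \<subseteq> I" "\<And>i. i \<in> J \<Longrightarrow> M i = R"
    and q: "\<And>f. f \<in> G \<Longrightarrow> q f \<in> borel_measurable R"
    and C: "\<And>f y. f \<in> G \<Longrightarrow> y \<in> space R \<Longrightarrow> \<bar>q f y\<bar> \<le> C"
  shows "(\<integral>z. (SUP f\<in>G. \<Sum>i\<in>J. q f (z i)) \<partial>PiM I M)
    = (\<integral>z. (SUP f\<in>G. \<Sum>i\<in>{1..card J}. q f (z i)) \<partial>PiM {1..card J} (\<lambda>_. R))"
proof -
  obtain e where e: "bij_betw e {1..card J} J" using ex_bij_betw_nat_finite_1[OF J(1)] by blast
  define h where "h z = (SUP f\<in>G. \<Sum>i\<in>{1..card J}. q f (z i))" for z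
  have "(SUP f\<in>G. \<Sum>i\<in>J. q f (z i)) = h (\<lambda>i\<in>{1..card J}. z (e i))" for z
    unfolding h_def
    by (intro SUP_cong refl, subst sum.reindex_bij_betw[OF e, symmetric]) (auto intro!: sum.cong)
  moreover have "(\<integral>z. h (\<lambda>i\<in>{1..card J}. z (e i)) \<partial>PiM I M) = (\<integral>z. h z \<partial>PiM {1..card J} (\<lambda>_. R))"
  proof (rule integral_reindex_iid)
    have eJ: "e i \<in> J" if "i \<in> {1..card J}" for i using e that by (auto simp: bij_betw_def)
    show "inj_on e {1..card J}" using e by (simp add: bij_betw_def)
    show "e \<in> {1..card J} \<rightarrow> I" using eJ J by auto
    show "M (e i) = R" if "i \<in> {1..card J}" for i using J(3) eJ[OF that] by blast
    show "h \<in> borel_measurable (PiM {1..card J} (\<lambda>_. R))" unfolding h_def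
    proof (rule SUP_sum_measurable(1)[OF G])
      fix f i assume "f \<in> G" "i \<in> {1..card J}"
      then show "(\<lambda>z. q f (z i)) \<in> borel_measurable (PiM {1..card J} (\<lambda>_. R))"
        using measurable_compose[OF measurable_component_singleton[of i "{1..card J}" "\<lambda>_. R"] q[of f]] by blast
      fix z assume "z \<in> space (PiM {1..card J} (\<lambda>_. R))"
      then have "z i \<in> space R" using \<open>i \<in> _\<close> by (auto simp: space_PiM)
      then show "\<bar>q f (z i)\<bar> \<le> C" by (rule C[OF \<open>f \<in> G\<close>])
    qed
  qed
  ultimately show ?thesis by (simp add: h_def)
qed

text \<open>Countability makes the suprema measurable. Closure under negation makes the supremum of
  an odd functional nonnegative and lets it dominate absolute values.\<close>

locale countable_class =
  fixes E :: "'e measure" and G :: "('e \<Rightarrow> real) set"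
  assumes countable: "countable G" and class_bounded: "bounded_function_class E G"
    and symmetric: "symmetric_class E G"
begin

lemma nonempty: "G \<noteq> {}"
  using class_bounded by (simp add: bounded_function_class_def)

lemma class_measurable:
  assumes "f \<in> G" "sets R = sets E" shows "f \<in> borel_measurable R"
  using class_bounded assms by (auto simp: bounded_function_class_def cong: measurable_cong_sets)

lemma class_abs_le:
  assumes "f \<in> G" "x \<in> space E" shows "\<bar>f x\<bar> \<le> 1"
proof -
  have "f \<in> space E \<rightarrow>\<^sub>E {-1..1}" using class_bounded assms by (auto simp: bounded_function_class_def)
  then have "f x \<in> {-1..1}" using assms(2) by (auto simp: PiE_iff)
  then show ?thesis by (auto simp: abs_le_iff)
qed

definition neg :: "('e \<Rightarrow> real) \<Rightarrow> 'e \<Rightarrow> real" where "neg f = (\<lambda>x\<in>space E. - f x)"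

lemma neg_mem: "f \<in> G \<Longrightarrow> neg f \<in> G"
  using symmetric by (simp add: neg_def symmetric_class_def)

lemma neg_apply: "x \<in> space E \<Longrightarrow> neg f x = - f x"
  by (simp add: neg_def)

lemma neg_integral:
  assumes "sets R = sets E" shows "(\<integral>x. neg f x \<partial>R) = - (\<integral>x. f x \<partial>R)"
proof -
  have "(\<integral>x. neg f x \<partial>R) = (\<integral>x. - f x \<partial>R)"
    using sets_eq_imp_space_eq[OF assms] by (intro Bochner_Integration.integral_cong) (auto simp: neg_apply)
  then show ?thesis by simp
qed

lemma SUP_neg_le:
  fixes h :: "('e \<Rightarrow> real) \<Rightarrow> real"
  assumes "\<And>f. f \<in> G \<Longrightarrow> \<bar>h f\<bar> \<le> C" "\<And>f. f \<in> G \<Longrightarrow> h (neg f) = - h f"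
  shows "(SUP f\<in>G. - h f) \<le> (SUP f\<in>G. h f)" "\<And>f. f \<in> G \<Longrightarrow> \<bar>h f\<bar> \<le> (SUP f\<in>G. h f)" "0 \<le> (SUP f\<in>G. h f)"
proof -
  have up: "h f \<le> (SUP f\<in>G. h f)" if "f \<in> G" for f
    using assms(1) that nonempty by (intro cSUP_real_bounds(3)[of G _ C])
  have up': "- h f \<le> (SUP f\<in>G. h f)" if "f \<in> G" for f
    using up[OF neg_mem[OF that]] assms(2)[OF that] by simp
  show "(SUP f\<in>G. - h f) \<le> (SUP f\<in>G. h f)" using nonempty up' by (intro cSUP_least)
  show *: "\<bar>h f\<bar> \<le> (SUP f\<in>G. h f)" if "f \<in> G" for f using up[OF that] up'[OF that] by linarith
  obtain f where "f \<in> G" using nonempty by auto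
  then show "0 \<le> (SUP f\<in>G. h f)" using *[of f] by linarith
qed

lemma integral_abs_le:
  assumes "prob_space R" "sets R = sets E" "f \<in> G"
  shows "\<bar>\<integral>x. f x \<partial>R\<bar> \<le> 1"
  using assms class_abs_le sets_eq_imp_space_eq[OF assms(2)]
  by (intro prob_space.abs_expectation_le class_measurable) auto

definition block :: "'e measure \<Rightarrow> 'i set \<Rightarrow> ('i \<Rightarrow> 'e) \<Rightarrow> real" where
  "block R J z = (SUP f\<in>G. \<Sum>i\<in>J. (f (z i) - (\<integral>x. f x \<partial>R)))"

lemma block_atLeastAtMost: "block R {1..k} = centered_sup G R k"
  by (simp add: block_def centered_sup_def fun_eq_iff)

context
  fixes R :: "'e measure"
  assumes R: "prob_space R" "sets R = sets E"
begin

lemma centered_abs_le: "f \<in> G \<Longrightarrow> x \<in> space E \<Longrightarrow> \<bar>f x - (\<integral>x. f x \<partial>R)\<bar> \<le> 2"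
  using class_abs_le[of f x] integral_abs_le[OF R, of f] by linarith

lemma centered_block_abs_le:
  assumes "f \<in> G" "\<And>i. i \<in> J \<Longrightarrow> z i \<in> space E"
  shows "\<bar>\<Sum>i\<in>J. (f (z i) - (\<integral>x. f x \<partial>R))\<bar> \<le> real (card J) * 2"
  using assms by (intro abs_sum_le_card centered_abs_le)

lemma block_bounds:
  assumes z: "\<And>i. i \<in> J \<Longrightarrow> z i \<in> space E"
  shows "0 \<le> block R J z" "block R J z \<le> real (card J) * 2"
    "\<And>f. f \<in> G \<Longrightarrow> \<bar>\<Sum>i\<in>J. (f (z i) - (\<integral>x. f x \<partial>R))\<bar> \<le> block R J z"
proof -
  have n: "(\<Sum>i\<in>J. (neg f (z i) - (\<integral>x. neg f x \<partial>R))) = - (\<Sum>i\<in>J. (f (z i) - (\<integral>x. f x \<partial>R)))" for f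
    unfolding sum_negf[symmetric] using z by (intro sum.cong) (auto simp: neg_apply neg_integral[OF R(2)])
  note b = centered_block_abs_le[of _ J z, OF _ z]
  show "0 \<le> block R J z" unfolding block_def using b n by (intro SUP_neg_le(3)[where C="real (card J) * 2"])
  show "\<bar>\<Sum>i\<in>J. (f (z i) - (\<integral>x. f x \<partial>R))\<bar> \<le> block R J z" if "f \<in> G" for f
    unfolding block_def using b n that by (intro SUP_neg_le(2)[where C="real (card J) * 2"])
  show "block R J z \<le> real (card J) * 2"
    using cSUP_real_bounds(2)[OF nonempty b, of "\<lambda>f. f"] unfolding block_def by linarith
qed

lemma block_measurable:
  assumes "\<And>i. i \<in> J \<Longrightarrow> (\<lambda>z. z i) \<in> measurable N E"
  shows "block R J \<in> borel_measurable N"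
proof -
  have z: "z i \<in> space E" if "i \<in> J" "z \<in> space N" for z i using measurable_space[OF assms[OF that(1)] that(2)] .
  show ?thesis unfolding block_def
  proof (rule cSUP_measurable_bounded[where C="real (card J) * 2", OF countable nonempty])
    fix f assume "f \<in> G"
    then have "(\<lambda>z. f (z i)) \<in> borel_measurable N" if "i \<in> J" for i
      by (rule measurable_compose[OF assms[OF that] class_measurable]) simp
    then show "(\<lambda>z. \<Sum>i\<in>J. (f (z i) - (\<integral>x. f x \<partial>R))) \<in> borel_measurable N"
      by (intro borel_measurable_sum borel_measurable_diff borel_measurable_const)
  next
    fix f x assume "f \<in> G" "x \<in> space N"
    then show "\<bar>\<Sum>i\<in>J. (f (x i) - (\<integral>x. f x \<partial>R))\<bar> \<le> real (card J) * 2"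
      using z by (intro centered_block_abs_le)
  qed
qed

lemma expected_sup_eq_integral:
  "expected_sup G k R = (\<integral>z. block R {1..k} z \<partial>PiM {1..k} (\<lambda>_. R))"
proof -
  have "centered_sup G R k \<in> borel_measurable (PiM {1..k} (\<lambda>_. R))"
    unfolding block_atLeastAtMost[symmetric] by (intro block_measurable measurable_coordinate R(2))
  then show ?thesis
    unfolding block_atLeastAtMost by (intro expected_sup_eq_expectation[OF R class_bounded symmetric])
qed

lemma block_integral_family:
  fixes M :: "'i \<Rightarrow> 'e measure"
  assumes M: "prob_family M" and J: "finite J" "J \<subseteq> I" "\<And>i. i \<in> J \<Longrightarrow> M i = R"
  shows "(\<integral>z. block R J z \<partial>PiM I M) = expected_sup G (card J) R"
  unfolding expected_sup_eq_integral block_def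
  using countable nonempty J class_measurable[OF _ R(2)] centered_abs_le sets_eq_imp_space_eq[OF R(2)]
  by (intro prob_family.SUP_sum_integral_iid[OF M, where C=2]) auto

text \<open>The additional centered summand has mean \<open>0\<close>, so integrating it out inside
  the supremum leaves the supremum over \<open>k\<close> terms; \<open>SUP_integrate_out_one\<close>
  compares the two.\<close>

lemma expected_sup_Suc: "expected_sup G k R \<le> expected_sup G (Suc k) R"
proof -
  interpret prob_family "\<lambda>_::nat. R" by (rule prob_family.intro) (rule R)
  interpret R: prob_space R by (rule R)
  note sp = sets_eq_imp_space_eq[OF R(2)]
  define g where "g f i y = f y - (\<integral>x. f x \<partial>R)" for f :: "'e \<Rightarrow> real" and i :: nat and y
  have gm: "g f i \<in> borel_measurable R" and gb: "y \<in> space R \<Longrightarrow> \<bar>g f i y\<bar> \<le> 2" if "f \<in> G" for f i y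
    using class_measurable[OF that R(2)] centered_abs_le[OF that] sp unfolding g_def by auto
  have g0: "(\<integral>y. g f i y \<partial>R) = 0" if "f \<in> G" for f i
  proof -
    have "integrable R f" using class_measurable[OF that R(2)] class_abs_le[OF that] sp
      by (intro R.integrable_bounded[where C=1]) auto
    then show ?thesis by (simp add: g_def R.prob_space)
  qed
  have "(\<integral>z. (SUP f\<in>G. (\<Sum>i\<in>{1..k}. g f i (z i)) + (0 + (\<integral>y. g f (Suc k) y \<partial>R))) \<partial>PiM {1..k} (\<lambda>_. R))
    \<le> (\<integral>z. (SUP f\<in>G. (\<Sum>i\<in>insert (Suc k) {1..k}. g f i (z i)) + 0) \<partial>PiM (insert (Suc k) {1..k}) (\<lambda>_. R))"
    using gm gb countable nonempty by (intro SUP_integrate_out_one[where C=2 and D=0]) auto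
  moreover have eq: "insert (Suc k) {1..k} = {1..Suc k}" by auto
  moreover have "(SUP f\<in>G. (\<Sum>i\<in>{1..k}. g f i (z i)) + (0 + (\<integral>y. g f (Suc k) y \<partial>R))) = block R {1..k} z" for z
    unfolding block_def by (intro SUP_cong refl) (simp only: g0 add_0_right, simp only: g_def)
  moreover have "(SUP f\<in>G. (\<Sum>i\<in>{1..Suc k}. g f i (z i)) + 0) = block R {1..Suc k} z" for z
    unfolding block_def g_def add_0_right ..
  ultimately show ?thesis unfolding expected_sup_eq_integral by (simp only:)
qed

lemma expected_sup_mono: "k \<le> l \<Longrightarrow> expected_sup G k R \<le> expected_sup G l R"
  by (rule lift_Suc_mono_le) (rule expected_sup_Suc)

text \<open>The supremum over \<open>H\<close> need not be measurable, so the comparison is made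
  between nonnegative integrals.\<close>

lemma expected_sup_subclass_le:
  assumes "G \<subseteq> H" "bounded_function_class E H" "symmetric_class E H"
  shows "expected_sup G k R \<le> expected_sup H k R"
proof -
  interpret prob_family "\<lambda>_::nat. R" by (rule prob_family.intro) (rule R)
  interpret P: prob_space "PiM {1..k} (\<lambda>_. R)" by (rule prob_space_product)
  note sp = sets_eq_imp_space_eq[OF R(2)]
  have Hb: "\<bar>\<Sum>i\<in>{1..k}. (f (z i) - (\<integral>x. f x \<partial>R))\<bar> \<le> real k * 2"
    if f: "f \<in> H" and z: "z \<in> space (PiM {1..k} (\<lambda>_. R))" for f z
  proof -
    interpret R: prob_space R by (rule R)
    have fb: "\<bar>f x\<bar> \<le> 1" if "x \<in> space E" for x
    proof -
      have "f \<in> space E \<rightarrow>\<^sub>E {-1..1}" using assms(2) f by (auto simp: bounded_function_class_def)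
      then have "f x \<in> {-1..1}" using that by (auto simp: PiE_iff)
      then show ?thesis by (auto simp: abs_le_iff)
    qed
    have fm: "f \<in> borel_measurable R" using assms(2) f R(2) by (auto simp: bounded_function_class_def cong: measurable_cong_sets)
    have "\<bar>\<integral>x. f x \<partial>R\<bar> \<le> 1" using fm fb sp by (intro R.abs_expectation_le) auto
    moreover have "z i \<in> space E" if "i \<in> {1..k}" for i using z that sp by (auto simp: space_PiM PiE_iff)
    ultimately have "\<bar>f (z i) - (\<integral>x. f x \<partial>R)\<bar> \<le> 2" if "i \<in> {1..k}" for i
      using fb that abs_triangle_ineq4[of "f (z i)" "\<integral>x. f x \<partial>R"] by fastforce
    then show ?thesis using abs_sum_le_card[of "{1..k}" "\<lambda>i. f (z i) - (\<integral>x. f x \<partial>R)" 2] by simp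
  qed
  have Hne: "H \<noteq> {}" using assms(2) by (simp add: bounded_function_class_def)
  have "(\<integral>\<^sup>+z. ennreal (centered_sup G R k z) \<partial>PiM {1..k} (\<lambda>_. R)) \<le> (\<integral>\<^sup>+z. ennreal (centered_sup H R k z) \<partial>PiM {1..k} (\<lambda>_. R))"
    unfolding centered_sup_def using assms(1) nonempty Hb Hne
    by (intro nn_integral_mono ennreal_leI cSUP_subset_mono cSUP_real_bounds(1)[of H _ "real k * 2"]) auto
  \<comment> \<open>\<open>enn2real\<close> sends the infinite value to \<open>0\<close>, so it
    preserves the order only if the larger integral is finite.\<close>
  moreover have "(\<integral>\<^sup>+z. ennreal (centered_sup H R k z) \<partial>PiM {1..k} (\<lambda>_. R)) < top"
  proof -
    have "(\<integral>\<^sup>+z. ennreal (centered_sup H R k z) \<partial>PiM {1..k} (\<lambda>_. R)) \<le> (\<integral>\<^sup>+z. ennreal (real k * 2) \<partial>PiM {1..k} (\<lambda>_. R))"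
      unfolding centered_sup_def using Hb Hne
      by (intro nn_integral_mono ennreal_leI order_trans[OF abs_ge_self cSUP_real_bounds(2)]) auto
    also have "\<dots> < top" by (simp only: nn_integral_const P.emeasure_space_1 mult_1_right ennreal_less_top)
    finally show ?thesis .
  qed
  ultimately show ?thesis unfolding expected_sup_def by (intro enn2real_mono)
qed

end

end

section \<open>The two-sample model and expectations of weighted statistics\<close>

locale two_samples = countable_class E G + PP: prob_space P + QQ: prob_space Q
  for E :: "'e measure" and G and P Q :: "'e measure" +
  fixes n m :: nat
  assumes sets_P: "sets P = sets E" and sets_Q: "sets Q = sets E" and n: "1 \<le> n" and m: "1 \<le> m"
begin

abbreviation component :: "nat \<Rightarrow> 'e measure" where
  "component i \<equiv> (if i \<le> n then P else Q)"

abbreviation sample :: "(nat \<Rightarrow> 'e) measure" where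
  "sample \<equiv> PiM {1..n+m} component"

sublocale prob_family component
  by (rule prob_family.intro) (simp add: PP.prob_space_axioms QQ.prob_space_axioms)

sublocale sample: prob_space sample
  by (rule prob_space_product)

lemma prob_P: "prob_space P" and prob_Q: "prob_space Q"
  by (rule PP.prob_space_axioms, rule QQ.prob_space_axioms)

lemma sample_space:
  assumes "z \<in> space sample" "i \<in> {1..n+m}" shows "z i \<in> space E"
proof -
  have "z i \<in> space (component i)" using assms unfolding space_PiM by (rule PiE_mem)
  then show ?thesis using sets_eq_imp_space_eq[OF sets_P] sets_eq_imp_space_eq[OF sets_Q] by (metis (full_types))
qed

lemma coord_measurable: "i \<in> {1..n+m} \<Longrightarrow> (\<lambda>z. z i) \<in> measurable sample E"
  by (rule measurable_coordinate) (simp_all add: sets_P sets_Q)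

lemma coord_class_measurable: "f \<in> G \<Longrightarrow> i \<in> {1..n+m} \<Longrightarrow> (\<lambda>z. f (z i)) \<in> borel_measurable sample"
  by (rule measurable_compose[OF coord_measurable class_measurable]) auto

lemma block_integral:
  assumes J: "J \<subseteq> {1..n+m}" and R: "prob_space R" "sets R = sets E" and JR: "\<And>i. i \<in> J \<Longrightarrow> component i = R"
  shows "(\<integral>z. block R J z \<partial>sample) = expected_sup G (card J) R"
proof -
  have "finite J" using J finite_subset by blast
  then show ?thesis
    by (intro block_integral_family[OF R] prob_family_axioms J) (use JR in auto)
qed

lemma block_sample_integrable:
  assumes J: "J \<subseteq> {1..n+m}" and R: "prob_space R" "sets R = sets E"
  shows "integrable sample (block R J)"
proof (rule sample.integrable_bounded)
  show "block R J \<in> borel_measurable sample" using J by (intro block_measurable R coord_measurable) auto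
  fix z assume z: "z \<in> space sample"
  have zE: "z i \<in> space E" if "i \<in> J" for i using that J sample_space[OF z] by auto
  show "\<bar>block R J z\<bar> \<le> real (card J) * 2"
    using block_bounds(1,2)[OF R, of J z, OF zE] by simp
qed

lemma mean_diff_abs_le:
  assumes d: "\<And>f. f \<in> G \<Longrightarrow> (\<integral>x. f x \<partial>P) - (\<integral>x. f x \<partial>Q) \<le> d" and f: "f \<in> G"
  shows "\<bar>(\<integral>x. f x \<partial>P) - (\<integral>x. f x \<partial>Q)\<bar> \<le> d"
  using d[OF f] d[OF neg_mem[OF f]] unfolding neg_integral[OF sets_P] neg_integral[OF sets_Q] by linarith

lemma weighted_stat_sample_bounds:
  assumes "z \<in> space sample"
  shows "\<And>f. f \<in> G \<Longrightarrow> \<bar>\<Sum>i=1..n+m. c i * f (z i)\<bar> \<le> (\<Sum>i=1..n+m. \<bar>c i\<bar>)"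
    "0 \<le> weighted_stat G (n+m) c z" "weighted_stat G (n+m) c z \<le> (\<Sum>i=1..n+m. \<bar>c i\<bar>)"
    "\<And>f. f \<in> G \<Longrightarrow> (\<Sum>i=1..n+m. c i * f (z i)) \<le> weighted_stat G (n+m) c z"
proof -
  show b: "\<bar>\<Sum>i=1..n+m. c i * f (z i)\<bar> \<le> (\<Sum>i=1..n+m. \<bar>c i\<bar>)" if "f \<in> G" for f
  proof -
    have "\<bar>c i * f (z i)\<bar> \<le> \<bar>c i\<bar>" if "i \<in> {1..n+m}" for i
      using class_abs_le[OF \<open>f \<in> G\<close> sample_space[OF assms that]] by (simp add: abs_mult mult_left_le)
    then show ?thesis by (intro order_trans[OF sum_abs] sum_mono)
  qed
  have n: "(\<Sum>i=1..n+m. c i * neg f (z i)) = - (\<Sum>i=1..n+m. c i * f (z i))" for f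
    unfolding sum_negf[symmetric] using sample_space[OF assms] by (intro sum.cong) (auto simp: neg_apply)
  show "0 \<le> weighted_stat G (n+m) c z" unfolding weighted_stat_def
    by (rule SUP_neg_le(3)[where h="\<lambda>f. \<Sum>i=1..n+m. c i * f (z i)", OF b n])
  show "(\<Sum>i=1..n+m. c i * f (z i)) \<le> weighted_stat G (n+m) c z" if "f \<in> G" for f
    unfolding weighted_stat_def using that nonempty b
    by (intro cSUP_real_bounds(3)[where h="\<lambda>f. \<Sum>i=1..n+m. c i * f (z i)" and C="\<Sum>i=1..n+m. \<bar>c i\<bar>"])
  show "weighted_stat G (n+m) c z \<le> (\<Sum>i=1..n+m. \<bar>c i\<bar>)"
    using cSUP_real_bounds(2)[OF nonempty b, of "\<lambda>f. f"] unfolding weighted_stat_def by linarith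
qed

lemma weighted_stat_measurable: "weighted_stat G (n+m) c \<in> borel_measurable sample"
  unfolding weighted_stat_def
  using countable nonempty weighted_stat_sample_bounds(1) coord_class_measurable
  by (intro cSUP_measurable_bounded[where C="\<Sum>i=1..n+m. \<bar>c i\<bar>"] borel_measurable_sum borel_measurable_times borel_measurable_const) auto

lemma weighted_stat_integrable: "integrable sample (weighted_stat G (n+m) c)"
  using weighted_stat_sample_bounds(2,3)
  by (intro sample.integrable_bounded[where C="\<Sum>i=1..n+m. \<bar>c i\<bar>"] weighted_stat_measurable) auto

text \<open>Crossing \<open>A\<close> and its complement with the two samples gives four blocks on
  which both weight and law are constant. Centering produces suprema over blocks of at most
  \<open>n\<close> or \<open>m\<close> terms, which \<open>expected_sup_mono\<close> enlarges to
  full size. The means leave \<open>u * (p - q)\<close>, because the weights on the first sample sum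
  to \<open>u\<close> and those on the second to \<open>- u\<close>.\<close>

theorem weighted_stat_expectation_le:
  assumes A: "A \<subseteq> {1..n+m}" "card A = n"
    and c: "\<And>i. i \<in> {1..n+m} \<Longrightarrow> c i = (if i \<in> A then 1 / real n else - (1 / real m))"
    and d: "\<And>f. f \<in> G \<Longrightarrow> (\<integral>x. f x \<partial>P) - (\<integral>x. f x \<partial>Q) \<le> d"
  shows "(\<integral>z. weighted_stat G (n+m) c z \<partial>sample)
    \<le> (expected_sup G n P + expected_sup G n Q) / n + (expected_sup G m P + expected_sup G m Q) / m
       + \<bar>\<Sum>i=1..n. c i\<bar> * d"
proof -
  let ?U = "{1..n+m}" and ?X = "{1..n}" and ?Y = "{n+1..n+m}"
  define J1 where "J1 = A \<inter> ?X" define J2 where "J2 = A \<inter> ?Y"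
  define J3 where "J3 = ?X - A" define J4 where "J4 = ?Y - A"
  have Js: "J1 \<subseteq> ?U" "J2 \<subseteq> ?U" "J3 \<subseteq> ?U" "J4 \<subseteq> ?U" by (auto simp: J1_def J2_def J3_def J4_def)
  have finA: "finite A" using A finite_subset by blast
  have cA: "card (?U - A) = m" using A finA by (simp add: card_Diff_subset)
  have cards: "card J1 \<le> n" "card J2 \<le> n" "card J3 \<le> m" "card J4 \<le> m"
  proof -
    have "J1 \<subseteq> A" "J2 \<subseteq> A" by (auto simp: J1_def J2_def)
    then show "card J1 \<le> n" "card J2 \<le> n" using card_mono[OF finA] A(2) by auto
    have "J3 \<subseteq> ?U - A" "J4 \<subseteq> ?U - A" by (auto simp: J3_def J4_def)
    then show "card J3 \<le> m" "card J4 \<le> m" using card_mono[of "?U - A"] cA by auto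
  qed
  have parts: "sum h ?U = sum h J1 + sum h J2 + sum h J3 + sum h J4" for h :: "nat \<Rightarrow> real"
  proof -
    have "?U = (J1 \<union> J2) \<union> (J3 \<union> J4)" using A by (auto simp: J1_def J2_def J3_def J4_def)
    moreover have "(J1 \<union> J2) \<inter> (J3 \<union> J4) = {}" "J1 \<inter> J2 = {}" "J3 \<inter> J4 = {}" "finite J1" "finite J2" "finite J3" "finite J4"
      using finA by (auto simp: J1_def J2_def J3_def J4_def)
    ultimately show ?thesis by (simp add: sum.union_disjoint)
  qed
  have partsX: "sum h ?X = sum h J1 + sum h J3" for h :: "nat \<Rightarrow> real"
    using finA by (subst sum.union_disjoint[symmetric]) (auto simp: J1_def J3_def intro!: sum.cong)
  have partsY: "sum h ?Y = sum h J2 + sum h J4" for h :: "nat \<Rightarrow> real"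
    using finA by (subst sum.union_disjoint[symmetric]) (auto simp: J2_def J4_def intro!: sum.cong)
  have cJ: "sum (\<lambda>i. c i * h i) J1 = (1 / n) * sum h J1" "sum (\<lambda>i. c i * h i) J2 = (1 / n) * sum h J2"
    "sum (\<lambda>i. c i * h i) J3 = - (1 / m) * sum h J3" "sum (\<lambda>i. c i * h i) J4 = - (1 / m) * sum h J4" for h :: "nat \<Rightarrow> real"
    unfolding sum_distrib_left using Js by (auto intro!: sum.cong simp: c J1_def J2_def J3_def J4_def)
  define u where "u = (\<Sum>i=1..n. c i)"
  have c0: "sum c ?U = 0"
  proof -
    have "sum c ?U = sum c A + sum c (?U - A)" using A by (metis add.commute finite_atLeastAtMost sum.subset_diff)
    also have "sum c A = (\<Sum>i\<in>A. 1 / real n)" using A c by (intro sum.cong) auto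
    also have "sum c (?U - A) = (\<Sum>i\<in>?U - A. - (1 / real m))" using c by (intro sum.cong) auto
    finally show ?thesis using A cA n m by simp
  qed
  have uY: "sum c ?Y = - u"
    using c0 parts[of c] partsX[of c] partsY[of c] by (simp add: u_def)
  have pointwise: "weighted_stat G (n+m) c z
    \<le> (1 / n) * block P J1 z + (1 / n) * block Q J2 z + (1 / m) * block P J3 z + (1 / m) * block Q J4 z + \<bar>u\<bar> * d"
    if z: "z \<in> space sample" for z
    unfolding weighted_stat_def
  proof (rule cSUP_least[OF nonempty])
    fix f assume f: "f \<in> G"
    define p where "p = (\<integral>x. f x \<partial>P)" define q where "q = (\<integral>x. f x \<partial>Q)"
    have zE: "z i \<in> space E" if "i \<in> ?U" for i using sample_space[OF z that] .
    have b: "\<bar>\<Sum>i\<in>J1. (f (z i) - p)\<bar> \<le> block P J1 z" "\<bar>\<Sum>i\<in>J2. (f (z i) - q)\<bar> \<le> block Q J2 z"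
      "\<bar>\<Sum>i\<in>J3. (f (z i) - p)\<bar> \<le> block P J3 z" "\<bar>\<Sum>i\<in>J4. (f (z i) - q)\<bar> \<le> block Q J4 z"
      unfolding p_def q_def using f zE Js
      by (auto intro!: block_bounds(3) prob_P prob_Q sets_P sets_Q)
    have "(\<Sum>i=1..n+m. c i * f (z i)) = (\<Sum>i\<in>J1. c i * (f (z i) - p)) + (\<Sum>i\<in>J2. c i * (f (z i) - q))
      + (\<Sum>i\<in>J3. c i * (f (z i) - p)) + (\<Sum>i\<in>J4. c i * (f (z i) - q)) + sum c ?X * p + sum c ?Y * q"
      unfolding parts partsX partsY by (simp add: right_diff_distrib sum_subtractf sum_distrib_left algebra_simps)
    also have "\<dots> = (1 / n) * (\<Sum>i\<in>J1. (f (z i) - p)) + (1 / n) * (\<Sum>i\<in>J2. (f (z i) - q))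
      + (1 / m) * (- (\<Sum>i\<in>J3. (f (z i) - p))) + (1 / m) * (- (\<Sum>i\<in>J4. (f (z i) - q))) + u * (p - q)"
      unfolding cJ uY by (simp add: u_def algebra_simps)
    \<comment> \<open>The minus signs on the blocks outside \<open>A\<close> are harmless: the block
      suprema bound absolute values.\<close>
    also have "\<dots> \<le> (1 / n) * block P J1 z + (1 / n) * block Q J2 z + (1 / m) * block P J3 z + (1 / m) * block Q J4 z + \<bar>u\<bar> * d"
    proof (intro add_mono mult_left_mono)
      have "u * (p - q) \<le> \<bar>u\<bar> * \<bar>p - q\<bar>" by (metis abs_ge_self abs_mult)
      also have "\<dots> \<le> \<bar>u\<bar> * d" unfolding p_def q_def using d f by (intro mult_left_mono mean_diff_abs_le) auto
      finally show "u * (p - q) \<le> \<bar>u\<bar> * d" .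
    qed (use b in auto)
    finally show "(\<Sum>i=1..n+m. c i * f (z i)) \<le> \<dots>" .
  qed
  have int: "integrable sample (block P J1)" "integrable sample (block Q J2)" "integrable sample (block P J3)" "integrable sample (block Q J4)"
    using block_sample_integrable[OF Js(1) prob_P sets_P] block_sample_integrable[OF Js(2) prob_Q sets_Q]
      block_sample_integrable[OF Js(3) prob_P sets_P] block_sample_integrable[OF Js(4) prob_Q sets_Q] by auto
  have ib: "(\<integral>z. block P J1 z \<partial>sample) \<le> expected_sup G n P" "(\<integral>z. block Q J2 z \<partial>sample) \<le> expected_sup G n Q"
    "(\<integral>z. block P J3 z \<partial>sample) \<le> expected_sup G m P" "(\<integral>z. block Q J4 z \<partial>sample) \<le> expected_sup G m Q"
  proof -
    have "(\<integral>z. block P J1 z \<partial>sample) = expected_sup G (card J1) P" "(\<integral>z. block Q J2 z \<partial>sample) = expected_sup G (card J2) Q"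
      "(\<integral>z. block P J3 z \<partial>sample) = expected_sup G (card J3) P" "(\<integral>z. block Q J4 z \<partial>sample) = expected_sup G (card J4) Q"
      by (intro block_integral prob_P prob_Q sets_P sets_Q Js; simp add: J1_def J2_def J3_def J4_def)+
    then show "(\<integral>z. block P J1 z \<partial>sample) \<le> expected_sup G n P" "(\<integral>z. block Q J2 z \<partial>sample) \<le> expected_sup G n Q"
      "(\<integral>z. block P J3 z \<partial>sample) \<le> expected_sup G m P" "(\<integral>z. block Q J4 z \<partial>sample) \<le> expected_sup G m Q"
      using cards expected_sup_mono[OF prob_P sets_P] expected_sup_mono[OF prob_Q sets_Q] by auto
  qed
  have "(\<integral>z. weighted_stat G (n+m) c z \<partial>sample) \<le> (\<integral>z. (1 / n) * block P J1 z + (1 / n) * block Q J2 z + (1 / m) * block P J3 z + (1 / m) * block Q J4 z + \<bar>u\<bar> * d \<partial>sample)"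
    by (intro integral_mono weighted_stat_integrable Bochner_Integration.integrable_add integrable_mult_right
        sample.integrable_const int pointwise)
  also have "\<dots> = (1 / n) * (\<integral>z. block P J1 z \<partial>sample) + (1 / n) * (\<integral>z. block Q J2 z \<partial>sample) + (1 / m) * (\<integral>z. block P J3 z \<partial>sample) + (1 / m) * (\<integral>z. block Q J4 z \<partial>sample) + \<bar>u\<bar> * d"
    using int by (simp add: sample.prob_space)
  also have "\<dots> \<le> (1 / n) * expected_sup G n P + (1 / n) * expected_sup G n Q + (1 / m) * expected_sup G m P + (1 / m) * expected_sup G m Q + \<bar>u\<bar> * d"
    using ib by (intro add_mono mult_left_mono) auto
  finally show ?thesis by (simp add: u_def add_divide_distrib)
qed

end

section \<open>The dispersion of the class over the pooled sample\<close>

context countable_class begin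

definition square_dev :: "'e measure \<Rightarrow> ('e \<Rightarrow> real) \<Rightarrow> 'e \<Rightarrow> real" where
  "square_dev R f y = (f y - (\<integral>x. f x \<partial>R))\<^sup>2"

definition square_block :: "'e measure \<Rightarrow> 'i set \<Rightarrow> ('i \<Rightarrow> 'e) \<Rightarrow> real" where
  "square_block R J z = (SUP f\<in>G. \<Sum>i\<in>J. (square_dev R f (z i) - (\<integral>y. square_dev R f y \<partial>R)))"

context
  fixes R :: "'e measure"
  assumes R: "prob_space R" "sets R = sets E"
begin

lemma square_dev_bounds:
  assumes "f \<in> G" "y \<in> space E"
  shows "0 \<le> square_dev R f y" "square_dev R f y \<le> 4"
proof -
  show "0 \<le> square_dev R f y" by (simp add: square_dev_def)
  have "\<bar>f y - (\<integral>x. f x \<partial>R)\<bar> \<le> 2" using R assms by (rule centered_abs_le)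
  then have "(f y - (\<integral>x. f x \<partial>R))\<^sup>2 \<le> 2\<^sup>2" by (intro abs_le_square_iff[THEN iffD1]) simp
  then show "square_dev R f y \<le> 4" by (simp add: square_dev_def)
qed

lemma square_dev_measurable: "f \<in> G \<Longrightarrow> square_dev R f \<in> borel_measurable R"
  unfolding square_dev_def using class_measurable[OF _ R(2)] by measurable

lemma square_dev_integral: assumes "f \<in> G" shows "0 \<le> (\<integral>y. square_dev R f y \<partial>R)" "(\<integral>y. square_dev R f y \<partial>R) \<le> 4"
  using square_dev_bounds[OF assms] sets_eq_imp_space_eq[OF R(2)]
  by (auto intro!: prob_space.bounded_expectation[OF R(1) square_dev_measurable[OF assms], where c=0 and C=4])

lemma square_centered_abs_le:
  assumes "f \<in> G" "y \<in> space E" shows "\<bar>square_dev R f y - (\<integral>y. square_dev R f y \<partial>R)\<bar> \<le> 4"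
  using square_dev_bounds[OF assms] square_dev_integral[OF assms(1)] by linarith

text \<open>The square is Lipschitz with constant \<open>4\<close> on the range of the centered
  values, an interval from \<open>-2\<close> to \<open>2\<close>.\<close>

lemma square_dev_contraction:
  assumes "f \<in> G" "g \<in> G" "y \<in> space E"
  shows "\<bar>square_dev R f y - square_dev R g y\<bar> \<le> \<bar>4 * (f y - (\<integral>x. f x \<partial>R)) - 4 * (g y - (\<integral>x. g x \<partial>R))\<bar>"
proof -
  let ?u = "f y - (\<integral>x. f x \<partial>R)" and ?v = "g y - (\<integral>x. g x \<partial>R)"
  have "\<bar>?u\<bar> \<le> 2" "\<bar>?v\<bar> \<le> 2" using assms by (auto intro!: centered_abs_le[OF R])
  then have uv: "\<bar>?u + ?v\<bar> \<le> 4" by linarith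
  have "\<bar>?u\<^sup>2 - ?v\<^sup>2\<bar> = \<bar>?u + ?v\<bar> * \<bar>?u - ?v\<bar>"
    by (simp add: power2_eq_square square_diff_square_factored abs_mult)
  also have "\<dots> \<le> 4 * \<bar>?u - ?v\<bar>" using uv by (rule mult_right_mono) simp
  also have "\<dots> = \<bar>4 * ?u - 4 * ?v\<bar>" by (simp only: right_diff_distrib[symmetric] abs_mult abs_numeral)
  finally show ?thesis unfolding square_dev_def .
qed

text \<open>The factor \<open>16\<close> is \<open>2 * 4 * 2\<close>: symmetrization with a ghost
  sample splits into two equal halves, contraction from the square to the centered value costs
  \<open>4\<close>, and a signed centered sum splits into the block with sign \<open>1\<close> and
  the block with sign \<open>- 1\<close>. The contraction keeps the mean of \<open>f\<close> inside
  the summand, so both last blocks are already centered and bounded directly by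
  \<open>expected_sup\<close>.\<close>

theorem square_block_symmetrization:
  "(\<integral>z. square_block R {1..k} z \<partial>PiM {1..k} (\<lambda>_. R)) \<le> 16 * expected_sup G k R"
proof -
  let ?I = "{1..k}" and ?K = "{1+k..k+k}" and ?U = "{1..k+k}"
  have UIK: "?U = ?I \<union> ?K" by auto
  have fam: "prob_family (\<lambda>_::nat. R)" by (rule prob_family.intro) (rule R)
  interpret prob_family "\<lambda>_::nat. R" by (rule fam)
  interpret I: prob_space "PiM ?I (\<lambda>_. R)" by (rule prob_space_product)
  interpret U: prob_space "PiM ?U (\<lambda>_. R)" by (rule prob_space_product)
  note sp = sets_eq_imp_space_eq[OF R(2)]
  define \<phi> where "\<phi> = square_dev R"
  have \<phi>m: "\<phi> f \<in> borel_measurable R" if "f \<in> G" for f unfolding \<phi>_def using that by (rule square_dev_measurable)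
  have \<phi>b: "\<bar>\<phi> f y\<bar> \<le> 4" if "f \<in> G" "y \<in> space E" for f y using square_dev_bounds[OF that] by (simp add: \<phi>_def)
  have zsp: "z i \<in> space E" if "z \<in> space (PiM A (\<lambda>_. R))" "i \<in> A" for z A and i :: nat
    using that sp by (auto simp: space_PiM)
  have \<phi>zm: "(\<lambda>z. \<phi> f (z i)) \<in> borel_measurable (PiM A (\<lambda>_. R))" if "f \<in> G" "i \<in> A" for f A and i :: nat
    using measurable_compose[OF measurable_component_singleton[OF that(2)] \<phi>m[OF that(1)]] .
  define H where "H S z = (SUP f\<in>G. \<Sum>i\<in>?I. sgn_of S i * \<phi> f (z i) - sgn_of S i * \<phi> f (z (i + k)))" for S and z :: "nat \<Rightarrow> 'e"
  define \<Psi> where "\<Psi> S z = (SUP f\<in>G. \<Sum>i\<in>?I. sgn_of S i * \<phi> f (z i))" for S and z :: "nat \<Rightarrow> 'e"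
  define \<Theta> where "\<Theta> S z = (SUP f\<in>G. \<Sum>i\<in>?I. sgn_of S i * (4 * (f (z i) - (\<integral>x. f x \<partial>R))))" for S and z :: "nat \<Rightarrow> 'e"
  have sgn1: "\<bar>sgn_of S i\<bar> = 1" for S and i :: nat by (simp add: sgn_of_def)
  have Hm: "H S \<in> borel_measurable (PiM ?U (\<lambda>_. R))" and Hb: "z \<in> space (PiM ?U (\<lambda>_. R)) \<Longrightarrow> \<bar>H S z\<bar> \<le> real (card ?I) * 8" for S z
  proof -
    have m: "(\<lambda>z. sgn_of S i * \<phi> f (z i) - sgn_of S i * \<phi> f (z (i + k))) \<in> borel_measurable (PiM ?U (\<lambda>_. R))"
      if "f \<in> G" "i \<in> ?I" for f i
      using that by (intro borel_measurable_diff borel_measurable_times borel_measurable_const \<phi>zm) auto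
    have b: "\<bar>sgn_of S i * \<phi> f (z i) - sgn_of S i * \<phi> f (z (i + k))\<bar> \<le> 8"
      if "f \<in> G" "i \<in> ?I" "z \<in> space (PiM ?U (\<lambda>_. R))" for f i z
    proof -
      have "\<bar>\<phi> f (z i)\<bar> \<le> 4" "\<bar>\<phi> f (z (i + k))\<bar> \<le> 4" using that by (auto intro!: \<phi>b zsp[OF that(3)])
      then show ?thesis by (auto simp: sgn_of_def)
    qed
    show "H S \<in> borel_measurable (PiM ?U (\<lambda>_. R))" unfolding H_def using countable nonempty m b by (rule SUP_sum_measurable(1))
    show "z \<in> space (PiM ?U (\<lambda>_. R)) \<Longrightarrow> \<bar>H S z\<bar> \<le> real (card ?I) * 8" unfolding H_def using countable nonempty m b by (rule SUP_sum_measurable(2))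
  qed
  have Hint: "integrable (PiM ?U (\<lambda>_. R)) (H S)" for S using Hm Hb by (rule U.integrable_bounded)
  have \<Psi>m: "(\<lambda>z. sgn_of S i * \<phi> f (z i)) \<in> borel_measurable (PiM ?I (\<lambda>_. R))" and
    \<Psi>b: "z \<in> space (PiM ?I (\<lambda>_. R)) \<Longrightarrow> \<bar>sgn_of S i * \<phi> f (z i)\<bar> \<le> 4" if "f \<in> G" "i \<in> ?I" for S f i z
  proof -
    show "(\<lambda>z. sgn_of S i * \<phi> f (z i)) \<in> borel_measurable (PiM ?I (\<lambda>_. R))"
      using that by (intro borel_measurable_times borel_measurable_const \<phi>zm)
    assume "z \<in> space (PiM ?I (\<lambda>_. R))"
    then show "\<bar>sgn_of S i * \<phi> f (z i)\<bar> \<le> 4" using that by (simp add: abs_mult sgn1 \<phi>b zsp)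
  qed
  have \<Psi>meas: "\<Psi> S \<in> borel_measurable (PiM ?I (\<lambda>_. R))" for S
    unfolding \<Psi>_def by (rule SUP_sum_measurable(1)[where C=4, OF countable nonempty]; (rule \<Psi>m \<Psi>b; assumption))
  have \<Psi>abs: "\<bar>\<Psi> S z\<bar> \<le> real (card ?I) * 4" if "z \<in> space (PiM ?I (\<lambda>_. R))" for S z
    unfolding \<Psi>_def by (rule SUP_sum_measurable(2)[where C=4, OF countable nonempty _ _ that]; (rule \<Psi>m \<Psi>b; assumption))
  have \<Psi>int: "integrable (PiM ?I (\<lambda>_. R)) (\<Psi> S)" for S
    using \<Psi>meas \<Psi>abs by (rule I.integrable_bounded)
  have ghost: "(\<integral>z. square_block R ?I z \<partial>PiM ?I (\<lambda>_. R)) \<le> (\<integral>z. H ?I z \<partial>PiM ?U (\<lambda>_. R))"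
  proof -
    \<comment> \<open>Coordinates above \<open>k\<close> form the ghost sample; integrating out
      their negated squares produces the centering terms.\<close>
    define g where "g f i = (if i \<le> k then \<phi> f else (\<lambda>y. - \<phi> f y))" for f and i :: nat
    have "(\<integral>z. (SUP f\<in>G. (\<Sum>i\<in>?I. g f i (z i)) + (\<Sum>i\<in>?K. \<integral>y. g f i y \<partial>R)) \<partial>PiM ?I (\<lambda>_. R))
      \<le> (\<integral>z. (SUP f\<in>G. (\<Sum>i\<in>?I \<union> ?K. g f i (z i))) \<partial>PiM (?I \<union> ?K) (\<lambda>_. R))"
      using countable nonempty \<phi>m \<phi>b sp by (intro SUP_integrate_out[where C=4]) (auto simp: g_def)
    moreover have "(\<Sum>i\<in>?I. g f i (z i)) + (\<Sum>i\<in>?K. \<integral>y. g f i y \<partial>R) = (\<Sum>i\<in>?I. (\<phi> f (z i) - (\<integral>y. \<phi> f y \<partial>R)))" for f z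
    proof -
      have "(\<Sum>i\<in>?I. g f i (z i)) = (\<Sum>i\<in>?I. \<phi> f (z i))" by (intro sum.cong) (auto simp: g_def)
      moreover have "(\<Sum>i\<in>?K. \<integral>y. g f i y \<partial>R) = (\<Sum>i\<in>?K. - (\<integral>y. \<phi> f y \<partial>R))" by (intro sum.cong) (auto simp: g_def)
      ultimately show ?thesis by (simp add: sum_subtractf sum_negf)
    qed
    moreover have "(\<Sum>i\<in>?I \<union> ?K. g f i (z i)) = (\<Sum>i\<in>?I. sgn_of ?I i * \<phi> f (z i) - sgn_of ?I i * \<phi> f (z (i + k)))" for f z
    proof -
      have "(\<Sum>i\<in>?I \<union> ?K. g f i (z i)) = (\<Sum>i\<in>?I. g f i (z i)) + (\<Sum>i\<in>?K. g f i (z i))"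
        by (intro sum.union_disjoint) auto
      also have "(\<Sum>i\<in>?K. g f i (z i)) = (\<Sum>i\<in>?I. g f (i + k) (z (i + k)))" by (rule sum.shift_bounds_cl_nat_ivl)
      finally show ?thesis by (simp add: sum.distrib[symmetric] g_def sgn_of_def)
    qed
    ultimately show ?thesis
      unfolding UIK H_def square_block_def \<phi>_def[symmetric] by (simp only:)
  qed
  have flip: "(\<integral>z. H S z \<partial>PiM ?U (\<lambda>_. R)) = (\<integral>z. H ?I z \<partial>PiM ?U (\<lambda>_. R))" for S
  proof -
    \<comment> \<open>\<pi> exchanges \<open>j\<close> with its ghost \<open>j + k\<close> exactly
      for \<open>j \<notin> S\<close>. This preserves the product measure and reverses the signs off
      \<open>S\<close>.\<close>
    define \<pi> where "\<pi> j = (if j \<le> k then (if j \<in> S then j else j + k) else (if j - k \<in> S then j else j - k))" for j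
    have "H ?I (\<lambda>n\<in>?U. z (\<pi> n)) = H S z" for z
      unfolding H_def by (intro SUP_cong sum.cong refl) (auto simp: \<pi>_def sgn_of_def)
    moreover have "(\<integral>z. H ?I (\<lambda>n\<in>?U. z (\<pi> n)) \<partial>PiM ?U (\<lambda>_. R)) = (\<integral>z. H ?I z \<partial>PiM ?U (\<lambda>_. R))"
    proof (rule integral_reindex_iid[OF _ _ _ Hm])
      show "inj_on \<pi> ?U" by (rule inj_on_inverseI[where g=\<pi>]) (auto simp: \<pi>_def)
      show "\<pi> \<in> ?U \<rightarrow> ?U" by (auto simp: \<pi>_def)
    qed simp
    ultimately show ?thesis by simp
  qed
  have split: "(\<integral>z. H S z \<partial>PiM ?U (\<lambda>_. R)) \<le> (\<integral>z. \<Psi> S z \<partial>PiM ?I (\<lambda>_. R)) + (\<integral>z. \<Psi> (?I - S) z \<partial>PiM ?I (\<lambda>_. R))" for S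
  proof -
    define A where "A z = (SUP f\<in>G. \<Sum>i\<in>?I. sgn_of S i * \<phi> f (z i))" for z :: "nat \<Rightarrow> 'e"
    define B where "B z = (SUP f\<in>G. \<Sum>i\<in>?I. sgn_of (?I - S) i * \<phi> f (z (i + k)))" for z :: "nat \<Rightarrow> 'e"
    have am: "(\<lambda>z. sgn_of S i * \<phi> f (z i)) \<in> borel_measurable (PiM ?U (\<lambda>_. R))"
      and bm: "(\<lambda>z. sgn_of (?I - S) i * \<phi> f (z (i + k))) \<in> borel_measurable (PiM ?U (\<lambda>_. R))"
      and ab: "z \<in> space (PiM ?U (\<lambda>_. R)) \<Longrightarrow> \<bar>sgn_of S i * \<phi> f (z i)\<bar> \<le> 4"
      and bb: "z \<in> space (PiM ?U (\<lambda>_. R)) \<Longrightarrow> \<bar>sgn_of (?I - S) i * \<phi> f (z (i + k))\<bar> \<le> 4"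
      if "f \<in> G" "i \<in> ?I" for f i z
    proof -
      show "(\<lambda>z. sgn_of S i * \<phi> f (z i)) \<in> borel_measurable (PiM ?U (\<lambda>_. R))"
        "(\<lambda>z. sgn_of (?I - S) i * \<phi> f (z (i + k))) \<in> borel_measurable (PiM ?U (\<lambda>_. R))"
        using that by (auto intro!: borel_measurable_times borel_measurable_const \<phi>zm)
      assume z: "z \<in> space (PiM ?U (\<lambda>_. R))"
      have "\<bar>\<phi> f (z i)\<bar> \<le> 4" "\<bar>\<phi> f (z (i + k))\<bar> \<le> 4" using that by (auto intro!: \<phi>b zsp[OF z])
      then show "\<bar>sgn_of S i * \<phi> f (z i)\<bar> \<le> 4" "\<bar>sgn_of (?I - S) i * \<phi> f (z (i + k))\<bar> \<le> 4" by (simp_all add: abs_mult sgn1)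
    qed
    have Ai: "integrable (PiM ?U (\<lambda>_. R)) A"
    proof (rule U.integrable_bounded)
      show "A \<in> borel_measurable (PiM ?U (\<lambda>_. R))"
        unfolding A_def by (rule SUP_sum_measurable(1)[where C=4, OF countable nonempty]; (rule am ab; assumption))
      show "\<bar>A z\<bar> \<le> real (card ?I) * 4" if "z \<in> space (PiM ?U (\<lambda>_. R))" for z
        unfolding A_def by (rule SUP_sum_measurable(2)[where C=4, OF countable nonempty _ _ that]; (rule am ab; assumption))
    qed
    have Bi: "integrable (PiM ?U (\<lambda>_. R)) B"
    proof (rule U.integrable_bounded)
      show "B \<in> borel_measurable (PiM ?U (\<lambda>_. R))"
        unfolding B_def by (rule SUP_sum_measurable(1)[where C=4, OF countable nonempty]; (rule bm bb; assumption))
      show "\<bar>B z\<bar> \<le> real (card ?I) * 4" if "z \<in> space (PiM ?U (\<lambda>_. R))" for z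
        unfolding B_def by (rule SUP_sum_measurable(2)[where C=4, OF countable nonempty _ _ that]; (rule bm bb; assumption))
    qed
    have Aup: "(\<Sum>i\<in>?I. sgn_of S i * \<phi> f (z i)) \<le> A z" if "f \<in> G" "z \<in> space (PiM ?U (\<lambda>_. R))" for f z
      unfolding A_def by (rule SUP_sum_measurable(3)[where C=4, OF countable nonempty _ _ that]; (rule am ab; assumption))
    have Bup: "(\<Sum>i\<in>?I. sgn_of (?I - S) i * \<phi> f (z (i + k))) \<le> B z" if "f \<in> G" "z \<in> space (PiM ?U (\<lambda>_. R))" for f z
      unfolding B_def by (rule SUP_sum_measurable(3)[where C=4, OF countable nonempty _ _ that]; (rule bm bb; assumption))
    have "(\<integral>z. H S z \<partial>PiM ?U (\<lambda>_. R)) \<le> (\<integral>z. A z + B z \<partial>PiM ?U (\<lambda>_. R))"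
    proof (rule integral_mono[OF Hint Bochner_Integration.integrable_add[OF Ai Bi]])
      fix z assume z: "z \<in> space (PiM ?U (\<lambda>_. R))"
      show "H S z \<le> A z + B z" unfolding H_def
      proof (rule cSUP_least[OF nonempty])
        fix f assume f: "f \<in> G"
        have "(\<Sum>i\<in>?I. sgn_of S i * \<phi> f (z i) - sgn_of S i * \<phi> f (z (i + k)))
          = (\<Sum>i\<in>?I. sgn_of S i * \<phi> f (z i)) + (\<Sum>i\<in>?I. sgn_of (?I - S) i * \<phi> f (z (i + k)))"
          unfolding sum.distrib[symmetric] by (intro sum.cong refl) (auto simp: sgn_of_def)
        also have "\<dots> \<le> A z + B z" using Aup[OF f z] Bup[OF f z] by (rule add_mono)
        finally show "(\<Sum>i\<in>?I. sgn_of S i * \<phi> f (z i) - sgn_of S i * \<phi> f (z (i + k))) \<le> A z + B z" .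
      qed
    qed
    also have "\<dots> = (\<integral>z. A z \<partial>PiM ?U (\<lambda>_. R)) + (\<integral>z. B z \<partial>PiM ?U (\<lambda>_. R))" using Ai Bi by simp
    also have "(\<integral>z. A z \<partial>PiM ?U (\<lambda>_. R)) = (\<integral>z. \<Psi> S (\<lambda>n\<in>?I. z n) \<partial>PiM ?U (\<lambda>_. R))"
      unfolding A_def \<Psi>_def by (intro Bochner_Integration.integral_cong SUP_cong sum.cong refl) auto
    also have "\<dots> = (\<integral>z. \<Psi> S z \<partial>PiM ?I (\<lambda>_. R))"
      by (rule integral_reindex_iid[OF _ _ _ \<Psi>meas]) auto
    also have "(\<integral>z. B z \<partial>PiM ?U (\<lambda>_. R)) = (\<integral>z. \<Psi> (?I - S) (\<lambda>n\<in>?I. z (n + k)) \<partial>PiM ?U (\<lambda>_. R))"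
      unfolding B_def \<Psi>_def by (intro Bochner_Integration.integral_cong SUP_cong sum.cong refl) auto
    also have "\<dots> = (\<integral>z. \<Psi> (?I - S) z \<partial>PiM ?I (\<lambda>_. R))"
      by (rule integral_reindex_iid[OF _ _ _ \<Psi>meas]) auto
    finally show ?thesis .
  qed
  have \<Theta>m: "(\<lambda>z. sgn_of S i * (4 * (f (z i) - (\<integral>x. f x \<partial>R)))) \<in> borel_measurable (PiM ?I (\<lambda>_. R))"
    and \<Theta>b: "z \<in> space (PiM ?I (\<lambda>_. R)) \<Longrightarrow> \<bar>sgn_of S i * (4 * (f (z i) - (\<integral>x. f x \<partial>R)))\<bar> \<le> 8"
    if "f \<in> G" "i \<in> ?I" for S f i z
  proof -
    have "(\<lambda>z. f (z i)) \<in> borel_measurable (PiM ?I (\<lambda>_. R))"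
      using measurable_compose[OF measurable_component_singleton[OF that(2)] class_measurable[OF that(1) R(2)]] .
    then show "(\<lambda>z. sgn_of S i * (4 * (f (z i) - (\<integral>x. f x \<partial>R)))) \<in> borel_measurable (PiM ?I (\<lambda>_. R))"
      by (intro borel_measurable_times borel_measurable_diff borel_measurable_const)
    assume "z \<in> space (PiM ?I (\<lambda>_. R))"
    then have "\<bar>f (z i) - (\<integral>x. f x \<partial>R)\<bar> \<le> 2" using that by (intro centered_abs_le[OF R] zsp)
    then show "\<bar>sgn_of S i * (4 * (f (z i) - (\<integral>x. f x \<partial>R)))\<bar> \<le> 8" by (simp add: abs_mult sgn1)
  qed
  have \<Theta>int: "integrable (PiM ?I (\<lambda>_. R)) (\<Theta> S)" for S
  proof (rule I.integrable_bounded)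
    show "\<Theta> S \<in> borel_measurable (PiM ?I (\<lambda>_. R))"
      unfolding \<Theta>_def by (rule SUP_sum_measurable(1)[where C=8, OF countable nonempty]; (rule \<Theta>m \<Theta>b; assumption))
    show "\<bar>\<Theta> S z\<bar> \<le> real (card ?I) * 8" if "z \<in> space (PiM ?I (\<lambda>_. R))" for z
      unfolding \<Theta>_def by (rule SUP_sum_measurable(2)[where C=8, OF countable nonempty _ _ that]; (rule \<Theta>m \<Theta>b; assumption))
  qed
  have contract: "(\<Sum>S\<in>Pow ?I. \<Psi> S z) \<le> (\<Sum>S\<in>Pow ?I. \<Theta> S z)" if z: "z \<in> space (PiM ?I (\<lambda>_. R))" for z
  proof -
    have "(\<Sum>S\<in>Pow ?I. SUP f\<in>G. 0 + (\<Sum>i\<in>?I. sgn_of S i * \<phi> f (z i)))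
      \<le> (\<Sum>S\<in>Pow ?I. SUP f\<in>G. 0 + (\<Sum>i\<in>?I. sgn_of S i * (4 * (f (z i) - (\<integral>x. f x \<partial>R)))))"
    proof (rule Rademacher_contraction[OF nonempty, where C=8 and D=0])
      fix f i assume fi: "f \<in> G" "i \<in> ?I"
      show "\<bar>\<phi> f (z i)\<bar> \<le> 8" using \<phi>b[OF fi(1) zsp[OF z fi(2)]] by simp
      show "\<bar>4 * (f (z i) - (\<integral>x. f x \<partial>R))\<bar> \<le> 8" using centered_abs_le[OF R fi(1) zsp[OF z fi(2)]] by simp
      fix g assume "g \<in> G"
      then show "\<bar>\<phi> f (z i) - \<phi> g (z i)\<bar> \<le> \<bar>4 * (f (z i) - (\<integral>x. f x \<partial>R)) - 4 * (g (z i) - (\<integral>x. g x \<partial>R))\<bar>"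
        unfolding \<phi>_def using fi zsp[OF z] by (intro square_dev_contraction)
    qed auto
    then show ?thesis unfolding \<Psi>_def \<Theta>_def add_0_left .
  qed
  have desym: "(\<integral>z. \<Theta> S z \<partial>PiM ?I (\<lambda>_. R)) \<le> 8 * expected_sup G k R" if S: "S \<subseteq> ?I" for S
  proof -
    have bi: "integrable (PiM ?I (\<lambda>_. R)) (block R J)" if J: "J \<subseteq> ?I" for J
    proof (rule I.integrable_bounded)
      show "block R J \<in> borel_measurable (PiM ?I (\<lambda>_. R))" using J R by (intro block_measurable measurable_coordinate) auto
      fix z assume z: "z \<in> space (PiM ?I (\<lambda>_. R))"
      have "z i \<in> space E" if "i \<in> J" for i using J that by (intro zsp[OF z]) auto
      then show "\<bar>block R J z\<bar> \<le> real (card J) * 2" using block_bounds(1,2)[OF R, of J z] by simp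
    qed
    have be: "(\<integral>z. block R J z \<partial>PiM ?I (\<lambda>_. R)) \<le> expected_sup G k R" if J: "J \<subseteq> ?I" for J
    proof -
      have "finite J" using J finite_subset by blast
      then have "(\<integral>z. block R J z \<partial>PiM ?I (\<lambda>_. R)) = expected_sup G (card J) R"
        using J by (intro block_integral_family[OF R fam]) auto
      also have "\<dots> \<le> expected_sup G k R" using card_mono[OF _ J] by (intro expected_sup_mono[OF R]) simp
      finally show ?thesis .
    qed
    have "(\<integral>z. \<Theta> S z \<partial>PiM ?I (\<lambda>_. R)) \<le> (\<integral>z. 4 * block R S z + 4 * block R (?I - S) z \<partial>PiM ?I (\<lambda>_. R))"
    proof (rule integral_mono[OF \<Theta>int])
      show "integrable (PiM ?I (\<lambda>_. R)) (\<lambda>z. 4 * block R S z + 4 * block R (?I - S) z)"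
        using bi[of S] bi[of "?I - S"] S by auto
      fix z assume z: "z \<in> space (PiM ?I (\<lambda>_. R))"
      have zS: "z i \<in> space E" if "i \<in> S" for i using S that by (intro zsp[OF z]) auto
      have zS': "z i \<in> space E" if "i \<in> ?I - S" for i using that by (intro zsp[OF z]) auto
      show "\<Theta> S z \<le> 4 * block R S z + 4 * block R (?I - S) z" unfolding \<Theta>_def
      proof (rule cSUP_least[OF nonempty])
        fix f assume f: "f \<in> G"
        let ?c = "\<lambda>i. f (z i) - (\<integral>x. f x \<partial>R)"
        have "(\<Sum>i\<in>?I. sgn_of S i * (4 * ?c i)) = (\<Sum>i\<in>S. 4 * ?c i) + (\<Sum>i\<in>?I - S. - (4 * ?c i))"
          using S by (subst sum.subset_diff[of S ?I]) (auto simp: sgn_of_def intro!: arg_cong2[where f="(+)"] sum.cong)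
        also have "\<dots> = 4 * (\<Sum>i\<in>S. ?c i) + 4 * (- (\<Sum>i\<in>?I - S. ?c i))"
          by (simp only: sum_distrib_left[symmetric] sum_negf)
        also have "\<dots> \<le> 4 * block R S z + 4 * block R (?I - S) z"
          using block_bounds(3)[OF R, of S z f] block_bounds(3)[OF R, of "?I - S" z f] zS zS' f by fastforce
        finally show "(\<Sum>i\<in>?I. sgn_of S i * (4 * ?c i)) \<le> 4 * block R S z + 4 * block R (?I - S) z" .
      qed
    qed
    also have "\<dots> = 4 * (\<integral>z. block R S z \<partial>PiM ?I (\<lambda>_. R)) + 4 * (\<integral>z. block R (?I - S) z \<partial>PiM ?I (\<lambda>_. R))"
      using bi[of S] bi[of "?I - S"] S by simp
    also have "\<dots> \<le> 4 * expected_sup G k R + 4 * expected_sup G k R"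
      using be[of S] be[of "?I - S"] S by auto
    finally show ?thesis by simp
  qed
  have cP: "real (card (Pow ?I)) = 2 ^ k" by (simp add: card_Pow)
  have "2 ^ k * (\<integral>z. H ?I z \<partial>PiM ?U (\<lambda>_. R)) = (\<Sum>S\<in>Pow ?I. \<integral>z. H S z \<partial>PiM ?U (\<lambda>_. R))"
  proof -
    have "(\<Sum>S\<in>Pow ?I. \<integral>z. H S z \<partial>PiM ?U (\<lambda>_. R)) = (\<Sum>S\<in>Pow ?I. \<integral>z. H ?I z \<partial>PiM ?U (\<lambda>_. R))"
      by (intro sum.cong refl flip)
    then show ?thesis by (simp only: sum_constant cP)
  qed
  also have "\<dots> \<le> (\<Sum>S\<in>Pow ?I. (\<integral>z. \<Psi> S z \<partial>PiM ?I (\<lambda>_. R)) + (\<integral>z. \<Psi> (?I - S) z \<partial>PiM ?I (\<lambda>_. R)))"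
    by (intro sum_mono split)
  also have "\<dots> = (\<Sum>S\<in>Pow ?I. \<integral>z. \<Psi> S z \<partial>PiM ?I (\<lambda>_. R)) + (\<Sum>S\<in>Pow ?I. \<integral>z. \<Psi> (?I - S) z \<partial>PiM ?I (\<lambda>_. R))"
    by (rule sum.distrib)
  also have "(\<Sum>S\<in>Pow ?I. \<integral>z. \<Psi> (?I - S) z \<partial>PiM ?I (\<lambda>_. R)) = (\<Sum>S\<in>Pow ?I. \<integral>z. \<Psi> S z \<partial>PiM ?I (\<lambda>_. R))"
    by (rule sum.reindex_bij_witness[where i="\<lambda>S. ?I - S" and j="\<lambda>S. ?I - S"]) (auto simp: double_diff)
  also have "(\<Sum>S\<in>Pow ?I. \<integral>z. \<Psi> S z \<partial>PiM ?I (\<lambda>_. R)) + (\<Sum>S\<in>Pow ?I. \<integral>z. \<Psi> S z \<partial>PiM ?I (\<lambda>_. R))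
    = 2 * (\<integral>z. (\<Sum>S\<in>Pow ?I. \<Psi> S z) \<partial>PiM ?I (\<lambda>_. R))"
    using \<Psi>int by (subst Bochner_Integration.integral_sum) auto
  also have "\<dots> \<le> 2 * (\<integral>z. (\<Sum>S\<in>Pow ?I. \<Theta> S z) \<partial>PiM ?I (\<lambda>_. R))"
    using \<Psi>int \<Theta>int contract by (intro mult_left_mono integral_mono Bochner_Integration.integrable_sum) auto
  also have "\<dots> = 2 * (\<Sum>S\<in>Pow ?I. \<integral>z. \<Theta> S z \<partial>PiM ?I (\<lambda>_. R))"
    using \<Theta>int by (subst Bochner_Integration.integral_sum) auto
  also have "\<dots> \<le> 2 * (\<Sum>S\<in>Pow ?I. 8 * expected_sup G k R)"
    by (intro mult_left_mono sum_mono desym) auto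
  also have "\<dots> = 2 ^ k * (16 * expected_sup G k R)" by (simp add: cP[symmetric])
  finally have "(\<integral>z. H ?I z \<partial>PiM ?U (\<lambda>_. R)) \<le> 16 * expected_sup G k R" by simp
  then show ?thesis using ghost by linarith
qed

lemma square_block_abs_le:
  assumes "\<And>i. i \<in> J \<Longrightarrow> z i \<in> space E" shows "\<bar>square_block R J z\<bar> \<le> real (card J) * 4"
  unfolding square_block_def using assms by (intro cSUP_real_bounds(2)[OF nonempty] abs_sum_le_card square_centered_abs_le)

lemma square_block_ge:
  assumes "f \<in> G" "\<And>i. i \<in> J \<Longrightarrow> z i \<in> space E"
  shows "(\<Sum>i\<in>J. (square_dev R f (z i) - (\<integral>y. square_dev R f y \<partial>R))) \<le> square_block R J z"
  unfolding square_block_def using assms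
  by (intro cSUP_real_bounds(3)[OF nonempty, where C="real (card J) * 4"] abs_sum_le_card square_centered_abs_le)

lemma square_block_measurable:
  assumes "\<And>i. i \<in> J \<Longrightarrow> (\<lambda>z. z i) \<in> measurable N E"
  shows "square_block R J \<in> borel_measurable N"
  unfolding square_block_def
proof (rule SUP_sum_measurable(1)[OF countable nonempty, where C=4])
  fix f i assume fi: "f \<in> G" "i \<in> J"
  have "square_dev R f \<in> borel_measurable E"
    using square_dev_measurable[OF fi(1)] measurable_cong_sets[OF R(2) refl] by blast
  then show "(\<lambda>z. square_dev R f (z i) - (\<integral>y. square_dev R f y \<partial>R)) \<in> borel_measurable N"
    by (intro borel_measurable_diff borel_measurable_const measurable_compose[OF assms[OF fi(2)]])
  fix z assume "z \<in> space N"
  then have "z i \<in> space E" by (rule measurable_space[OF assms[OF fi(2)]])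
  then show "\<bar>square_dev R f (z i) - (\<integral>y. square_dev R f y \<partial>R)\<bar> \<le> 4" by (rule square_centered_abs_le[OF fi(1)])
qed

lemma square_block_integral_family:
  fixes M :: "'i \<Rightarrow> 'e measure"
  assumes M: "prob_family M" and J: "finite J" "J \<subseteq> I" "\<And>i. i \<in> J \<Longrightarrow> M i = R"
  shows "(\<integral>z. square_block R J z \<partial>PiM I M) \<le> 16 * expected_sup G (card J) R"
proof -
  have "(\<integral>z. square_block R J z \<partial>PiM I M) = (\<integral>z. square_block R {1..card J} z \<partial>PiM {1..card J} (\<lambda>_. R))"
    unfolding square_block_def
    using countable nonempty J square_dev_measurable square_centered_abs_le sets_eq_imp_space_eq[OF R(2)]
    by (intro prob_family.SUP_sum_integral_iid[OF M, where C=4]) auto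
  then show ?thesis using square_block_symmetrization by simp
qed

end

end

section \<open>Dispersion about the pooled mean\<close>

context two_samples begin

text \<open>A deterministic centre: the empirical mean would move with every coordinate, whereas
  with a fixed centre the dispersion is self-bounding. Replacing the centre by the empirical mean
  only lowers a sum of squares, so the dispersion still controls the permuted statistic.\<close>

definition pooled_mean :: "('e \<Rightarrow> real) \<Rightarrow> real" where
  "pooled_mean f = (real n * (\<integral>x. f x \<partial>P) + real m * (\<integral>x. f x \<partial>Q)) / real (n + m)"

definition dispersion_on :: "nat set \<Rightarrow> (nat \<Rightarrow> 'e) \<Rightarrow> real" where
  "dispersion_on J z = (SUP f\<in>G. \<Sum>i\<in>J. (f (z i) - pooled_mean f)\<^sup>2)"

lemma pooled_mean_abs_le: assumes "f \<in> G" shows "\<bar>pooled_mean f\<bar> \<le> 1"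
proof -
  have "\<bar>\<integral>x. f x \<partial>P\<bar> \<le> 1" "\<bar>\<integral>x. f x \<partial>Q\<bar> \<le> 1"
    using assms by (auto intro!: integral_abs_le prob_P prob_Q sets_P sets_Q)
  then have "\<bar>real n * (\<integral>x. f x \<partial>P)\<bar> \<le> real n * 1" "\<bar>real m * (\<integral>x. f x \<partial>Q)\<bar> \<le> real m * 1"
    by (simp_all add: abs_mult mult_left_le)
  then have "\<bar>real n * (\<integral>x. f x \<partial>P) + real m * (\<integral>x. f x \<partial>Q)\<bar> \<le> real (n + m)" by simp
  then show ?thesis using n by (simp add: pooled_mean_def divide_le_eq)
qed

lemma pooled_square_bounds:
  assumes "f \<in> G" "y \<in> space E" shows "0 \<le> (f y - pooled_mean f)\<^sup>2" "(f y - pooled_mean f)\<^sup>2 \<le> 4" "\<bar>(f y - pooled_mean f)\<^sup>2\<bar> \<le> 4"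
proof -
  have "\<bar>f y - pooled_mean f\<bar> \<le> 2" using class_abs_le[OF assms] pooled_mean_abs_le[OF assms(1)] by linarith
  then have "(f y - pooled_mean f)\<^sup>2 \<le> 2\<^sup>2" by (intro abs_le_square_iff[THEN iffD1]) simp
  then show "0 \<le> (f y - pooled_mean f)\<^sup>2" "(f y - pooled_mean f)\<^sup>2 \<le> 4" "\<bar>(f y - pooled_mean f)\<^sup>2\<bar> \<le> 4" by auto
qed

lemma dispersion_bounds:
  assumes "z \<in> space sample" "J \<subseteq> {1..n+m}"
  shows "\<bar>dispersion_on J z\<bar> \<le> real (card J) * 4"
    "\<And>f. f \<in> G \<Longrightarrow> (\<Sum>i\<in>J. (f (z i) - pooled_mean f)\<^sup>2) \<le> dispersion_on J z"
    "0 \<le> dispersion_on J z"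
proof -
  have zE: "z i \<in> space E" if "i \<in> J" for i using sample_space[OF assms(1)] assms(2) that by auto
  show "\<bar>dispersion_on J z\<bar> \<le> real (card J) * 4"
    unfolding dispersion_on_def using zE by (intro cSUP_real_bounds(2)[OF nonempty] abs_sum_le_card pooled_square_bounds(3))
  show up: "(\<Sum>i\<in>J. (f (z i) - pooled_mean f)\<^sup>2) \<le> dispersion_on J z" if "f \<in> G" for f
    unfolding dispersion_on_def using zE that
    by (intro cSUP_real_bounds(3)[OF nonempty, where C="real (card J) * 4"] abs_sum_le_card pooled_square_bounds(3))
  obtain f where "f \<in> G" using nonempty by auto
  have "0 \<le> (\<Sum>i\<in>J. (f (z i) - pooled_mean f)\<^sup>2)" by (intro sum_nonneg) simp
  then show "0 \<le> dispersion_on J z" using up[OF \<open>f \<in> G\<close>] by linarith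
qed

lemma dispersion_measurable: "J \<subseteq> {1..n+m} \<Longrightarrow> dispersion_on J \<in> borel_measurable sample"
  unfolding dispersion_on_def
  using coord_class_measurable pooled_square_bounds(3) sample_space
  by (intro SUP_sum_measurable(1)[OF countable nonempty, where C=4] borel_measurable_power borel_measurable_diff borel_measurable_const) auto

text \<open>On the first sample \<open>f - c\<close> is \<open>(f - p) + (m / N) * D\<close>, on the
  second \<open>(f - q) - (n / N) * D\<close>. Squaring gives centered squares, variances, two cross
  terms and a total of \<open>(n * m / N) * D\<^sup>2\<close>. Each cross term is split into a
  quadratic term and a further \<open>(n * m / N) * d\<^sup>2\<close>, hence the factor
  \<open>3\<close>.\<close>

theorem dispersion_expectation_le:
  assumes d: "\<And>f. f \<in> G \<Longrightarrow> (\<integral>x. f x \<partial>P) - (\<integral>x. f x \<partial>Q) \<le> d"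
    and V: "\<And>f. f \<in> G \<Longrightarrow> real n * PP.variance f + real m * QQ.variance f \<le> V"
  shows "(\<integral>z. dispersion_on {1..n+m} z \<partial>sample)
    \<le> V + 16 * (expected_sup G n P + expected_sup G m Q) + m / (n * (n + m)) * (expected_sup G n P)\<^sup>2
       + n / (m * (n + m)) * (expected_sup G m Q)\<^sup>2 + 3 * (n * m / (n + m)) * d\<^sup>2"
proof -
  let ?U = "{1..n+m}" and ?X = "{1..n}" and ?Y = "{n+1..n+m}"
  define N where "N = real (n + m)"
  have N: "0 < N" "N = real n + real m" using n by (auto simp: N_def)
  have XY: "?X \<subseteq> ?U" "?Y \<subseteq> ?U" "card ?X = n" "card ?Y = m" by auto
  obtain f0 where "f0 \<in> G" using nonempty by auto
  then have d0: "0 \<le> d" using mean_diff_abs_le[OF d] by (meson abs_ge_zero order_trans)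
  have pointwise: "dispersion_on ?U z \<le> square_block P ?X z + square_block Q ?Y z + V
      + 2 * (m / N) * d * block P ?X z + 2 * (n / N) * d * block Q ?Y z + (n * m / N) * d\<^sup>2"
    if z: "z \<in> space sample" for z
    unfolding dispersion_on_def
  proof (rule cSUP_least[OF nonempty])
    fix f assume f: "f \<in> G"
    define p where "p = (\<integral>x. f x \<partial>P)" define q where "q = (\<integral>x. f x \<partial>Q)"
    define c where "c = pooled_mean f" define D where "D = p - q"
    define vp where "vp = (\<integral>y. square_dev P f y \<partial>P)" define vq where "vq = (\<integral>y. square_dev Q f y \<partial>Q)"
    have zE: "z i \<in> space E" if "i \<in> ?U" for i using sample_space[OF z that] .
    have "c = p - (m / N) * D"
      using N unfolding c_def pooled_mean_def N_def[symmetric] p_def[symmetric] q_def[symmetric] D_def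
      by (simp add: N(2) field_simps)
    then have pc: "f y - c = (f y - p) + (m / N) * D" for y by simp
    have "c = q + (n / N) * D"
      using N unfolding c_def pooled_mean_def N_def[symmetric] p_def[symmetric] q_def[symmetric] D_def
      by (simp add: N(2) field_simps)
    then have qc: "f y - c = (f y - q) - (n / N) * D" for y by simp
    have Dd: "\<bar>D\<bar> \<le> d" unfolding D_def p_def q_def using mean_diff_abs_le[OF d f] .
    have split: "sum h ?U = sum h ?X + sum h ?Y" for h :: "nat \<Rightarrow> real"
      by (subst sum.union_disjoint[symmetric]) (auto intro!: sum.cong)
    have X: "(\<Sum>i\<in>?X. (f (z i) - c)\<^sup>2) = (\<Sum>i\<in>?X. square_dev P f (z i) - vp) + n * vp
        + 2 * (m / N) * D * (\<Sum>i\<in>?X. f (z i) - p) + n * ((m / N) * D)\<^sup>2"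
      unfolding pc power2_sum square_dev_def p_def[symmetric]
      by (simp add: sum.distrib sum_subtractf sum_distrib_left sum_divide_distrib algebra_simps)
    have Y: "(\<Sum>i\<in>?Y. (f (z i) - c)\<^sup>2) = (\<Sum>i\<in>?Y. square_dev Q f (z i) - vq) + m * vq
        - 2 * (n / N) * D * (\<Sum>i\<in>?Y. f (z i) - q) + m * ((n / N) * D)\<^sup>2"
      unfolding qc power2_diff square_dev_def q_def[symmetric]
      by (simp add: sum.distrib sum_subtractf sum_distrib_left sum_divide_distrib algebra_simps)
    have quad: "n * ((m / N) * D)\<^sup>2 + m * ((n / N) * D)\<^sup>2 = (n * m / N) * D\<^sup>2"
    proof -
      have "n * ((m / N) * D)\<^sup>2 + m * ((n / N) * D)\<^sup>2 = n * m * (real n + real m) * D\<^sup>2 / (N * N)"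
        by (simp add: power2_eq_square add_divide_distrib algebra_simps)
      also have "\<dots> = (n * m / N) * D\<^sup>2" unfolding N(2)[symmetric] using N(1) by simp
      finally show ?thesis .
    qed
    have bX: "\<bar>\<Sum>i\<in>?X. f (z i) - p\<bar> \<le> block P ?X z" unfolding p_def using f zE XY
      by (intro block_bounds(3)[OF prob_P sets_P]) auto
    have bY: "\<bar>\<Sum>i\<in>?Y. f (z i) - q\<bar> \<le> block Q ?Y z" unfolding q_def using f zE XY
      by (intro block_bounds(3)[OF prob_Q sets_Q]) auto
    have prod: "D * s \<le> d * b" "- (D * s) \<le> d * b" if "\<bar>s\<bar> \<le> b" for s b
    proof -
      have "\<bar>D * s\<bar> \<le> d * b" unfolding abs_mult using that Dd by (intro mult_mono) auto
      then show "D * s \<le> d * b" "- (D * s) \<le> d * b" by linarith+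
    qed
    have t1: "(\<Sum>i\<in>?X. square_dev P f (z i) - vp) \<le> square_block P ?X z" unfolding vp_def
      using f zE XY by (intro square_block_ge[OF prob_P sets_P]) auto
    have t2: "(\<Sum>i\<in>?Y. square_dev Q f (z i) - vq) \<le> square_block Q ?Y z" unfolding vq_def
      using f zE XY by (intro square_block_ge[OF prob_Q sets_Q]) auto
    have t3: "n * vp + m * vq \<le> V" using V[OF f] unfolding vp_def vq_def square_dev_def by simp
    have t4: "2 * (m / N) * D * (\<Sum>i\<in>?X. f (z i) - p) \<le> 2 * (m / N) * d * block P ?X z"
      using mult_left_mono[OF prod(1)[OF bX], of "2 * (m / N)"] N by (simp add: mult.assoc)
    have t5: "- (2 * (n / N) * D * (\<Sum>i\<in>?Y. f (z i) - q)) \<le> 2 * (n / N) * d * block Q ?Y z"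
      using mult_left_mono[OF prod(2)[OF bY], of "2 * (n / N)"] N by (simp add: mult.assoc)
    have t6: "(n * m / N) * D\<^sup>2 \<le> (n * m / N) * d\<^sup>2"
    proof (rule mult_left_mono)
      show "D\<^sup>2 \<le> d\<^sup>2" using Dd d0 by (intro abs_le_square_iff[THEN iffD1]) simp
    qed (use N in simp)
    show "(\<Sum>i\<in>?U. (f (z i) - pooled_mean f)\<^sup>2) \<le> square_block P ?X z + square_block Q ?Y z + V
      + 2 * (m / N) * d * block P ?X z + 2 * (n / N) * d * block Q ?Y z + (n * m / N) * d\<^sup>2"
      unfolding c_def[symmetric] split X Y using t1 t2 t3 t4 t5 t6 quad by linarith
  qed
  have bint: "integrable sample (block P ?X)" "integrable sample (block Q ?Y)"
    using block_sample_integrable[OF XY(1) prob_P sets_P] block_sample_integrable[OF XY(2) prob_Q sets_Q] by auto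
  have sqint: "integrable sample (square_block R J)" if "J \<subseteq> ?U" "prob_space R" "sets R = sets E" for R J
  proof (rule sample.integrable_bounded)
    show "square_block R J \<in> borel_measurable sample" using that by (intro square_block_measurable coord_measurable) auto
    fix z assume "z \<in> space sample"
    then show "\<bar>square_block R J z\<bar> \<le> real (card J) * 4" using that sample_space by (intro square_block_abs_le) auto
  qed
  have sint: "integrable sample (square_block P ?X)" "integrable sample (square_block Q ?Y)"
    using sqint[OF XY(1) prob_P sets_P] sqint[OF XY(2) prob_Q sets_Q] by auto
  have dint: "integrable sample (dispersion_on ?U)"
    using dispersion_measurable[of ?U] dispersion_bounds(1)[of _ ?U] by (intro sample.integrable_bounded) auto
  define eP where "eP = expected_sup G n P" define eQ where "eQ = expected_sup G m Q"
  have i1: "(\<integral>z. block P ?X z \<partial>sample) = eP" "(\<integral>z. block Q ?Y z \<partial>sample) = eQ"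
    using block_integral[OF XY(1) prob_P sets_P] block_integral[OF XY(2) prob_Q sets_Q] by (auto simp: eP_def eQ_def)
  have i2: "(\<integral>z. square_block P ?X z \<partial>sample) \<le> 16 * eP" "(\<integral>z. square_block Q ?Y z \<partial>sample) \<le> 16 * eQ"
    using square_block_integral_family[OF prob_P sets_P prob_family_axioms, of ?X ?U]
      square_block_integral_family[OF prob_Q sets_Q prob_family_axioms, of ?Y ?U] by (auto simp: eP_def eQ_def)
  have "(\<integral>z. dispersion_on ?U z \<partial>sample) \<le> (\<integral>z. square_block P ?X z + square_block Q ?Y z + V
      + 2 * (m / N) * d * block P ?X z + 2 * (n / N) * d * block Q ?Y z + (n * m / N) * d\<^sup>2 \<partial>sample)"
    by (intro integral_mono dint Bochner_Integration.integrable_add integrable_mult_right bint sint sample.integrable_const pointwise)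
  also have "\<dots> = (\<integral>z. square_block P ?X z \<partial>sample) + (\<integral>z. square_block Q ?Y z \<partial>sample) + V
      + 2 * (m / N) * d * eP + 2 * (n / N) * d * eQ + (n * m / N) * d\<^sup>2"
    using bint sint by (simp add: sample.prob_space i1)
  also have "\<dots> \<le> 16 * eP + 16 * eQ + V + 2 * (m / N) * d * eP + 2 * (n / N) * d * eQ + (n * m / N) * d\<^sup>2"
    using i2 by linarith
  also have "2 * (m / N) * d * eP \<le> m / (n * N) * eP\<^sup>2 + (n * m / N) * d\<^sup>2"
  proof -
    \<comment> \<open>The weight of this completed square makes its term in \<open>d\<^sup>2\<close>
      equal to the one already present.\<close>
    have "0 \<le> (m / (n * N)) * (eP - n * d)\<^sup>2" using N by simp
    also have "\<dots> = m / (n * N) * eP\<^sup>2 + (n * m / N) * d\<^sup>2 - 2 * (m / N) * d * eP"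
      using n N(1) by (simp add: power2_eq_square field_simps)
    finally show ?thesis by simp
  qed
  also have "2 * (n / N) * d * eQ \<le> n / (m * N) * eQ\<^sup>2 + (n * m / N) * d\<^sup>2"
  proof -
    have "0 \<le> (n / (m * N)) * (eQ - m * d)\<^sup>2" using N by simp
    also have "\<dots> = n / (m * N) * eQ\<^sup>2 + (n * m / N) * d\<^sup>2 - 2 * (n / N) * d * eQ"
      using m N(1) by (simp add: power2_eq_square field_simps)
    finally show ?thesis by simp
  qed
  finally show ?thesis by (simp add: eP_def eQ_def N_def algebra_simps)
qed

end

section \<open>Averages over permutations\<close>

definition perm_avg :: "'a set \<Rightarrow> (('a \<Rightarrow> 'a) \<Rightarrow> real) \<Rightarrow> real" where
  "perm_avg U H = (\<Sum>\<sigma> | \<sigma> permutes U. H \<sigma>) / fact (card U)"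

lemma perm_avg_mono:
  assumes "\<And>\<sigma>. \<sigma> permutes U \<Longrightarrow> H \<sigma> \<le> K \<sigma>" shows "perm_avg U H \<le> perm_avg U K"
  unfolding perm_avg_def using assms by (intro divide_right_mono sum_mono) auto

lemma perm_avg_cong:
  assumes "\<And>\<sigma>. \<sigma> permutes U \<Longrightarrow> H \<sigma> = K \<sigma>" shows "perm_avg U H = perm_avg U K"
  unfolding perm_avg_def using assms by (intro arg_cong2[where f="(/)"] sum.cong) auto

lemma perm_avg_add: "perm_avg U (\<lambda>\<sigma>. H \<sigma> + K \<sigma>) = perm_avg U H + perm_avg U K"
  by (simp add: perm_avg_def sum.distrib add_divide_distrib)

lemma perm_avg_diff: "perm_avg U (\<lambda>\<sigma>. H \<sigma> - K \<sigma>) = perm_avg U H - perm_avg U K"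
  by (simp add: perm_avg_def sum_subtractf diff_divide_distrib)

lemma perm_avg_cmult: "perm_avg U (\<lambda>\<sigma>. c * H \<sigma>) = c * perm_avg U H"
  by (simp add: perm_avg_def sum_distrib_left)

lemma perm_avg_sum: "perm_avg U (\<lambda>\<sigma>. \<Sum>i\<in>I. H i \<sigma>) = (\<Sum>i\<in>I. perm_avg U (H i))"
  unfolding perm_avg_def by (subst sum.swap) (simp add: sum_divide_distrib)

lemma perm_avg_const: "finite U \<Longrightarrow> perm_avg U (\<lambda>_. c) = c"
  by (simp add: perm_avg_def card_permutations)

lemma perm_avg_compose:
  assumes "\<tau> permutes U" shows "perm_avg U (\<lambda>\<sigma>. H (\<sigma> \<circ> \<tau>)) = perm_avg U H"
  unfolding perm_avg_def using sum_permutations_compose_right[OF assms, of H] by simp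

lemma perm_avg_nonneg: "finite U \<Longrightarrow> (\<And>\<sigma>. \<sigma> permutes U \<Longrightarrow> 0 \<le> H \<sigma>) \<Longrightarrow> 0 \<le> perm_avg U H"
  using perm_avg_mono[of U "\<lambda>_. 0" H] by (simp add: perm_avg_const)

lemma perm_avg_eval:
  fixes g :: "'a \<Rightarrow> real"
  assumes U: "finite U" and i: "i \<in> U"
  shows "perm_avg U (\<lambda>\<sigma>. g (\<sigma> i)) = sum g U / card U"
proof -
  have eq: "perm_avg U (\<lambda>\<sigma>. g (\<sigma> j)) = perm_avg U (\<lambda>\<sigma>. g (\<sigma> i))" if "j \<in> U" for j
    using perm_avg_compose[OF permutes_swap_id[OF i that], of "\<lambda>\<sigma>. g (\<sigma> i)"] by simp
  have "card U * perm_avg U (\<lambda>\<sigma>. g (\<sigma> i)) = (\<Sum>j\<in>U. perm_avg U (\<lambda>\<sigma>. g (\<sigma> j)))"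
  proof -
    have "(\<Sum>j\<in>U. perm_avg U (\<lambda>\<sigma>. g (\<sigma> j))) = (\<Sum>j\<in>U. perm_avg U (\<lambda>\<sigma>. g (\<sigma> i)))"
      by (intro sum.cong refl eq)
    then show ?thesis by simp
  qed
  also have "\<dots> = perm_avg U (\<lambda>\<sigma>. \<Sum>j\<in>U. g (\<sigma> j))" by (rule perm_avg_sum[symmetric])
  also have "\<dots> = perm_avg U (\<lambda>\<sigma>. sum g U)"
    by (intro perm_avg_cong) (simp add: sum.permute[of _ U g] comp_def)
  also have "\<dots> = sum g U" using U by (rule perm_avg_const)
  finally have "card U * perm_avg U (\<lambda>\<sigma>. g (\<sigma> i)) = sum g U" .
  moreover have "card U \<noteq> 0" using U i by auto
  ultimately show ?thesis by (simp add: eq_divide_eq mult.commute)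
qed

text \<open>All pairs have the same average by exchangeability, and summing over the second index
  gives \<open>- (w (\<sigma> i))\<^sup>2\<close> because the weights sum to
  \<open>0\<close>.\<close>

lemma perm_avg_pair:
  fixes w :: "'a \<Rightarrow> real"
  assumes U: "finite U" and ij: "i \<in> U" "j \<in> U" "i \<noteq> j" and w: "sum w U = 0"
  shows "perm_avg U (\<lambda>\<sigma>. w (\<sigma> i) * w (\<sigma> j)) = - ((\<Sum>k\<in>U. (w k)\<^sup>2) / (card U * (card U - 1)))"
proof -
  have c: "2 \<le> card U" using ij U card_mono[of U "{i, j}"] by simp
  have eq: "perm_avg U (\<lambda>\<sigma>. w (\<sigma> i) * w (\<sigma> k)) = perm_avg U (\<lambda>\<sigma>. w (\<sigma> i) * w (\<sigma> j))" if "k \<in> U - {i}" for k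
  proof -
    have "Transposition.transpose j k i = i" using ij that by (auto simp: Transposition.transpose_def)
    then show ?thesis
      using perm_avg_compose[OF permutes_swap_id[of j U k], of "\<lambda>\<sigma>. w (\<sigma> i) * w (\<sigma> j)"] ij that by simp
  qed
  have "(card U - 1) * perm_avg U (\<lambda>\<sigma>. w (\<sigma> i) * w (\<sigma> j)) = (\<Sum>k\<in>U - {i}. perm_avg U (\<lambda>\<sigma>. w (\<sigma> i) * w (\<sigma> k)))"
  proof -
    have "(\<Sum>k\<in>U - {i}. perm_avg U (\<lambda>\<sigma>. w (\<sigma> i) * w (\<sigma> k))) = (\<Sum>k\<in>U - {i}. perm_avg U (\<lambda>\<sigma>. w (\<sigma> i) * w (\<sigma> j)))"
      by (intro sum.cong refl eq)
    also have "\<dots> = (card U - 1) * perm_avg U (\<lambda>\<sigma>. w (\<sigma> i) * w (\<sigma> j))" using U ij by simp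
    finally show ?thesis ..
  qed
  also have "\<dots> = perm_avg U (\<lambda>\<sigma>. \<Sum>k\<in>U - {i}. w (\<sigma> i) * w (\<sigma> k))" by (rule perm_avg_sum[symmetric])
  also have "\<dots> = perm_avg U (\<lambda>\<sigma>. - 1 * (w (\<sigma> i))\<^sup>2)"
  proof (rule perm_avg_cong)
    fix \<sigma> assume s: "\<sigma> permutes U"
    have "(\<Sum>k\<in>U. w (\<sigma> k)) = 0" using w sum.permute[OF s, of w] by (simp add: comp_def)
    then have "(\<Sum>k\<in>U - {i}. w (\<sigma> k)) = - w (\<sigma> i)" using U ij by (simp add: sum_diff1)
    then show "(\<Sum>k\<in>U - {i}. w (\<sigma> i) * w (\<sigma> k)) = - 1 * (w (\<sigma> i))\<^sup>2"
      by (simp add: sum_distrib_left[symmetric] power2_eq_square)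
  qed
  also have "\<dots> = - ((\<Sum>k\<in>U. (w k)\<^sup>2) / card U)"
    unfolding perm_avg_cmult using perm_avg_eval[OF U ij(1), of "\<lambda>k. (w k)\<^sup>2"] by simp
  finally have main: "real (card U - 1) * perm_avg U (\<lambda>\<sigma>. w (\<sigma> i) * w (\<sigma> j)) = - ((\<Sum>k\<in>U. (w k)\<^sup>2) / card U)" .
  have gen: "x = - (s / (N * d))" if "d * x = - (s / N)" "0 < d" for x s N d :: real
  proof -
    have "x = (d * x) / d" using that(2) by simp
    also have "\<dots> = - (s / (N * d))" unfolding that(1) by simp
    finally show ?thesis .
  qed
  have "0 < real (card U - 1)" using c by simp
  from gen[OF main this] show ?thesis by simp
qed

text \<open>The variance of a sum drawn without replacement: diagonal terms from
  \<open>perm_avg_eval\<close>, negatively correlated off-diagonal terms from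
  \<open>perm_avg_pair\<close>.\<close>

lemma perm_avg_block_square:
  fixes w :: "'a \<Rightarrow> real"
  assumes U: "finite U" "2 \<le> card U" and X: "X \<subseteq> U" and w: "sum w U = 0"
  shows "perm_avg U (\<lambda>\<sigma>. (\<Sum>i\<in>X. w (\<sigma> i))\<^sup>2)
    = real (card X) * (real (card U) - real (card X)) / (real (card U) * (real (card U) - 1)) * (\<Sum>k\<in>U. (w k)\<^sup>2)"
proof -
  define s where "s = (\<Sum>k\<in>U. (w k)\<^sup>2)" define N where "N = real (card U)"
  have N: "2 \<le> N" "real (card U - 1) = N - 1" using U by (auto simp: N_def of_nat_diff)
  have finX: "finite X" using X U finite_subset by blast
  have "perm_avg U (\<lambda>\<sigma>. (\<Sum>i\<in>X. w (\<sigma> i))\<^sup>2) = perm_avg U (\<lambda>\<sigma>. \<Sum>i\<in>X. \<Sum>j\<in>X. w (\<sigma> i) * w (\<sigma> j))"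
    by (simp add: power2_eq_square sum_product)
  also have "\<dots> = (\<Sum>i\<in>X. \<Sum>j\<in>X. perm_avg U (\<lambda>\<sigma>. w (\<sigma> i) * w (\<sigma> j)))" unfolding perm_avg_sum ..
  also have "\<dots> = (\<Sum>i\<in>X. s / N - (real (card X) - 1) * (s / (N * (N - 1))))"
  proof (rule sum.cong[OF refl])
    fix i assume i: "i \<in> X"
    have "(\<Sum>j\<in>X. perm_avg U (\<lambda>\<sigma>. w (\<sigma> i) * w (\<sigma> j))) = perm_avg U (\<lambda>\<sigma>. w (\<sigma> i) * w (\<sigma> i)) + (\<Sum>j\<in>X - {i}. perm_avg U (\<lambda>\<sigma>. w (\<sigma> i) * w (\<sigma> j)))"
      using finX i by (rule sum.remove)
    also have "perm_avg U (\<lambda>\<sigma>. w (\<sigma> i) * w (\<sigma> i)) = s / N"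
      using perm_avg_eval[OF U(1), of i "\<lambda>k. w k * w k"] i X by (auto simp: s_def N_def power2_eq_square)
    also have "(\<Sum>j\<in>X - {i}. perm_avg U (\<lambda>\<sigma>. w (\<sigma> i) * w (\<sigma> j))) = (\<Sum>j\<in>X - {i}. - (s / (N * (N - 1))))"
      using i X U w N(2) by (intro sum.cong refl) (subst perm_avg_pair, auto simp: s_def N_def)
    also have "\<dots> = - ((real (card X) - 1) * (s / (N * (N - 1))))"
    proof -
      have "1 \<le> card X" using i finX by (metis Suc_leI card_gt_0_iff empty_iff One_nat_def)
      then have "real (card (X - {i})) = real (card X) - 1" using i finX by (simp add: of_nat_diff)
      then show ?thesis by simp
    qed
    finally show "(\<Sum>j\<in>X. perm_avg U (\<lambda>\<sigma>. w (\<sigma> i) * w (\<sigma> j))) = s / N - (real (card X) - 1) * (s / (N * (N - 1)))" by simp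
  qed
  also have "\<dots> = real (card X) * (N - real (card X)) / (N * (N - 1)) * s"
    using N(1) by (simp add: field_simps)
  finally show ?thesis by (simp add: s_def N_def)
qed

lemma perm_avg_abs_le:
  assumes U: "finite U" shows "perm_avg U (\<lambda>\<sigma>. \<bar>h \<sigma>\<bar>) \<le> sqrt (perm_avg U (\<lambda>\<sigma>. (h \<sigma>)\<^sup>2))"
proof (rule real_le_rsqrt)
  define a where "a = perm_avg U (\<lambda>\<sigma>. \<bar>h \<sigma>\<bar>)"
  have "0 \<le> perm_avg U (\<lambda>\<sigma>. (\<bar>h \<sigma>\<bar> - a)\<^sup>2)" using U by (intro perm_avg_nonneg) auto
  also have "\<dots> = perm_avg U (\<lambda>\<sigma>. (h \<sigma>)\<^sup>2 - 2 * a * \<bar>h \<sigma>\<bar> + a\<^sup>2)"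
    by (intro perm_avg_cong) (simp add: power2_diff)
  also have "\<dots> = perm_avg U (\<lambda>\<sigma>. (h \<sigma>)\<^sup>2) - a\<^sup>2"
    unfolding perm_avg_add perm_avg_diff perm_avg_cmult perm_avg_const[OF U] a_def[symmetric]
    by (simp add: power2_eq_square)
  finally show "(perm_avg U (\<lambda>\<sigma>. \<bar>h \<sigma>\<bar>))\<^sup>2 \<le> perm_avg U (\<lambda>\<sigma>. (h \<sigma>)\<^sup>2)" by (simp add: a_def)
qed

lemma ex_permutes_image:
  assumes U: "finite U" and A: "A \<subseteq> U" "B \<subseteq> U" "card A = card B"
  shows "\<exists>p. p permutes U \<and> p ` A = B"
proof -
  have fin: "finite A" "finite B" using U A finite_subset by auto
  obtain f where f: "bij_betw f A B" using finite_same_card_bij[OF fin A(3)] by blast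
  have "card (U - A) = card (U - B)" using fin A by (simp add: card_Diff_subset)
  then obtain g where g: "bij_betw g (U - A) (U - B)" using finite_same_card_bij[of "U - A" "U - B"] U by blast
  define p where "p x = (if x \<in> A then f x else if x \<in> U then g x else x)" for x
  have "bij_betw p A B" using f by (rule bij_betw_cong[THEN iffD1, rotated]) (simp add: p_def)
  moreover have "bij_betw p (U - A) (U - B)" using g by (rule bij_betw_cong[THEN iffD1, rotated]) (simp add: p_def)
  ultimately have "bij_betw p (A \<union> (U - A)) (B \<union> (U - B))" by (rule bij_betw_combine) auto
  moreover have "A \<union> (U - A) = U" "B \<union> (U - B) = U" using A by auto
  ultimately have "p permutes U" by (intro bij_imp_permutes) (use A(1) in \<open>auto simp: p_def\<close>)
  moreover have "p ` A = B" using \<open>bij_betw p A B\<close> by (simp add: bij_betw_def)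
  ultimately show ?thesis by blast
qed

text \<open>Composition with a permutation carrying \<open>A\<close> to \<open>J\<close> shows that
  all sets of the slice are equally likely as the preimage of \<open>J\<close>. The common
  probability is not computed but read off from the constant function \<open>1\<close>.\<close>

theorem perm_avg_preimage:
  fixes H :: "'a set \<Rightarrow> real"
  assumes U: "finite U" and J: "J \<subseteq> U"
  shows "perm_avg U (\<lambda>\<sigma>. H {i\<in>U. \<sigma> i \<in> J}) = sum H (slice U (card J)) / card (slice U (card J))"
proof -
  define S where "S = slice U (card J)"
  have finS: "finite S" unfolding S_def using U by (rule finite_slice)
  have JS: "J \<in> S" using J by (simp add: S_def slice_def)
  have pre: "{i\<in>U. \<sigma> i \<in> J} \<in> S" if s: "\<sigma> permutes U" for \<sigma>
  proof -
    have "\<sigma> ` {i\<in>U. \<sigma> i \<in> J} = J"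
    proof
      show "J \<subseteq> \<sigma> ` {i\<in>U. \<sigma> i \<in> J}"
      proof
        fix j assume "j \<in> J"
        then have "j \<in> \<sigma> ` U" using permutes_image[OF s] J by auto
        then show "j \<in> \<sigma> ` {i\<in>U. \<sigma> i \<in> J}" using \<open>j \<in> J\<close> by auto
      qed
    qed auto
    moreover have "inj_on \<sigma> {i\<in>U. \<sigma> i \<in> J}" using permutes_inj_on[OF s] .
    ultimately have "card {i\<in>U. \<sigma> i \<in> J} = card J" by (metis card_image)
    then show ?thesis by (auto simp: S_def slice_def)
  qed
  define c where "c A = perm_avg U (\<lambda>\<sigma>. of_bool ({i\<in>U. \<sigma> i \<in> J} = A))" for A
  have const: "c A = c J" if A: "A \<in> S" for A
  proof -
    obtain p where p: "p permutes U" "p ` A = J"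
      using ex_permutes_image[OF U, of A J] A J by (auto simp: S_def slice_def)
    have "c J = perm_avg U (\<lambda>\<sigma>. of_bool ({i\<in>U. (\<sigma> \<circ> p) i \<in> J} = A))"
      unfolding c_def
    proof (rule perm_avg_cong)
      fix \<sigma> assume s: "\<sigma> permutes U"
      have AU: "A \<subseteq> U" using A by (simp add: S_def slice_def)
      have eq1: "{i\<in>U. (\<sigma> \<circ> p) i \<in> J} = {i\<in>U. p i \<in> {i\<in>U. \<sigma> i \<in> J}}" using permutes_in_image[OF p(1)] by auto
      have iff: "({i\<in>U. p i \<in> B} = A) \<longleftrightarrow> B = J" if "B \<subseteq> U" for B
      proof
        assume "{i\<in>U. p i \<in> B} = A"
        then have "p ` {i\<in>U. p i \<in> B} = J" using p(2) by simp
        moreover have "p ` {i\<in>U. p i \<in> B} = B"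
        proof
          show "B \<subseteq> p ` {i\<in>U. p i \<in> B}"
          proof
            fix b assume "b \<in> B"
            then have "b \<in> p ` U" using permutes_image[OF p(1)] that by auto
            then show "b \<in> p ` {i\<in>U. p i \<in> B}" using \<open>b \<in> B\<close> by auto
          qed
        qed auto
        ultimately show "B = J" by simp
      next
        assume "B = J"
        moreover have "p i \<in> J \<longleftrightarrow> i \<in> A" for i
          using inj_image_mem_iff[OF permutes_inj[OF p(1)], of i A] unfolding p(2) .
        ultimately show "{i\<in>U. p i \<in> B} = A" using AU by blast
      qed
      have "{i\<in>U. \<sigma> i \<in> J} \<subseteq> U" by blast
      from iff[OF this] show "of_bool ({i\<in>U. \<sigma> i \<in> J} = J) = (of_bool ({i\<in>U. (\<sigma> \<circ> p) i \<in> J} = A) :: real)"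
        unfolding eq1 by (simp only:)
    qed
    also have "\<dots> = c A" unfolding c_def by (rule perm_avg_compose[OF p(1), where H="\<lambda>\<sigma>. of_bool ({i\<in>U. \<sigma> i \<in> J} = A)"])
    finally show ?thesis ..
  qed
  have expand: "perm_avg U (\<lambda>\<sigma>. K {i\<in>U. \<sigma> i \<in> J}) = c J * sum K S" for K :: "'a set \<Rightarrow> real"
  proof -
    have "perm_avg U (\<lambda>\<sigma>. K {i\<in>U. \<sigma> i \<in> J}) = perm_avg U (\<lambda>\<sigma>. \<Sum>A\<in>S. K A * of_bool ({i\<in>U. \<sigma> i \<in> J} = A))"
    proof (rule perm_avg_cong)
      fix \<sigma> assume "\<sigma> permutes U"
      from pre[OF this] show "K {i\<in>U. \<sigma> i \<in> J} = (\<Sum>A\<in>S. K A * of_bool ({i\<in>U. \<sigma> i \<in> J} = A))"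
        using finS by (simp add: of_bool_def if_distrib sum.delta cong: if_cong)
    qed
    also have "\<dots> = (\<Sum>A\<in>S. K A * c A)" unfolding perm_avg_sum perm_avg_cmult c_def ..
    also have "\<dots> = (\<Sum>A\<in>S. K A * c J)" using const by (intro sum.cong) auto
    finally show ?thesis by (simp add: sum_distrib_left mult.commute)
  qed
  have "c J * card S = 1" using expand[of "\<lambda>_. 1"] perm_avg_const[OF U, of 1] by simp
  then have "c J = 1 / card S" using JS finS by (metis eq_divide_eq mult_zero_right zero_neq_one)
  then show ?thesis using expand[of H] by (simp add: S_def)
qed

section \<open>The permutation weights and the mean over permutations\<close>

lemma weights_sums:
  assumes n: "1 \<le> n" and m: "1 \<le> m"
  shows "(\<Sum>i=1..n+m. weights n m i) = 0" "(\<Sum>i=1..n+m. (weights n m i)\<^sup>2) = 1 / n + 1 / m"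
    "(\<Sum>i=1..n+m. \<bar>weights n m i\<bar>) = 2"
    "(\<Sum>i=1..n+m. \<Sum>j=1..n+m. \<bar>weights n m i - weights n m j\<bar>) = 2 * (real n + real m)"
proof -
  have split: "(\<Sum>i=1..n+m. h (weights n m i)) = n * h (1 / n) + m * h (- (1 / m))" for h :: "real \<Rightarrow> real"
  proof -
    have "(\<Sum>i=1..n+m. h (weights n m i)) = (\<Sum>i\<in>{1..n}. h (weights n m i)) + (\<Sum>i\<in>{n+1..n+m}. h (weights n m i))"
      by (subst sum.union_disjoint[symmetric]) (auto intro!: sum.cong)
    also have "(\<Sum>i\<in>{1..n}. h (weights n m i)) = (\<Sum>i\<in>{1..n}. h (1 / n))" by (intro sum.cong) (auto simp: weights_def)
    also have "(\<Sum>i\<in>{n+1..n+m}. h (weights n m i)) = (\<Sum>i\<in>{n+1..n+m}. h (- (1 / m)))" by (intro sum.cong) (auto simp: weights_def)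
    finally show ?thesis by simp
  qed
  show "(\<Sum>i=1..n+m. weights n m i) = 0" using split[of "\<lambda>x. x"] n m by simp
  show "(\<Sum>i=1..n+m. (weights n m i)\<^sup>2) = 1 / n + 1 / m" using split[of "\<lambda>x. x\<^sup>2"] n m by (simp add: power2_eq_square)
  show "(\<Sum>i=1..n+m. \<bar>weights n m i\<bar>) = 2" using split[of abs] n m by simp
  have nm: "\<bar>1 / real n + 1 / real m\<bar> = 1 / real n + 1 / real m" "\<bar>- (1 / real m) - 1 / real n\<bar> = 1 / real n + 1 / real m"
  proof -
    have "0 < 1 / real n" "0 < 1 / real m" using n m by auto
    then show "\<bar>1 / real n + 1 / real m\<bar> = 1 / real n + 1 / real m" "\<bar>- (1 / real m) - 1 / real n\<bar> = 1 / real n + 1 / real m" by linarith+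
  qed
  have "(\<Sum>i=1..n+m. \<Sum>j=1..n+m. \<bar>weights n m i - weights n m j\<bar>)
    = (\<Sum>i=1..n+m. n * \<bar>weights n m i - 1 / n\<bar> + m * \<bar>weights n m i - - (1 / m)\<bar>)"
    by (intro sum.cong refl split[where h="\<lambda>x. \<bar>_ - x\<bar>"])
  also have "\<dots> = n * (m * \<bar>1 / real n + 1 / real m\<bar>) + m * (n * \<bar>- (1 / real m) - 1 / real n\<bar>)"
    by (subst split[where h="\<lambda>x. n * \<bar>x - 1 / n\<bar> + m * \<bar>x - - (1 / m)\<bar>"]) simp
  also have "\<dots> = 2 * (real n + real m)" unfolding nm using n m by (simp add: field_simps)
  finally show "(\<Sum>i=1..n+m. \<Sum>j=1..n+m. \<bar>weights n m i - weights n m j\<bar>) = 2 * (real n + real m)" .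
qed

context two_samples begin

abbreviation U :: "nat set" where "U \<equiv> {1..n+m}"

definition perm_mean_stat :: "(nat \<Rightarrow> 'e) \<Rightarrow> real" where
  "perm_mean_stat z = perm_avg U (\<lambda>\<sigma>. weighted_stat G (n+m) (\<lambda>i. weights n m (\<sigma> i)) z)"

lemma perm_mean_stat_measurable: "perm_mean_stat \<in> borel_measurable sample"
  unfolding perm_mean_stat_def perm_avg_def
  by (intro borel_measurable_divide borel_measurable_sum weighted_stat_measurable borel_measurable_const)

lemma sum_abs_permuted_weights:
  assumes "\<sigma> permutes U" shows "(\<Sum>i=1..n+m. \<bar>weights n m (\<sigma> i)\<bar>) = 2"
  using weights_sums(3)[OF n m] sum.permute[OF assms, of "\<lambda>i. \<bar>weights n m i\<bar>"] by (simp add: comp_def)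

lemma perm_mean_stat_bounds:
  assumes "z \<in> space sample" shows "0 \<le> perm_mean_stat z" "perm_mean_stat z \<le> 2"
proof -
  show "0 \<le> perm_mean_stat z" unfolding perm_mean_stat_def
    by (intro perm_avg_nonneg weighted_stat_sample_bounds(2)[OF assms]) simp
  have "perm_mean_stat z \<le> perm_avg U (\<lambda>\<sigma>. 2)" unfolding perm_mean_stat_def
  proof (rule perm_avg_mono)
    fix \<sigma> assume "\<sigma> permutes U"
    then show "weighted_stat G (n+m) (\<lambda>i. weights n m (\<sigma> i)) z \<le> 2"
      using weighted_stat_sample_bounds(3)[OF assms, of "\<lambda>i. weights n m (\<sigma> i)"] sum_abs_permuted_weights by simp
  qed
  then show "perm_mean_stat z \<le> 2" by (simp add: perm_avg_const)
qed

text \<open>For fixed \<sigma> the signal enters through the sum of the permuted weights over the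
  first sample. The square of this sum averages to \<open>1 / (n + m - 1)\<close> over permutations,
  so its absolute value averages to at most the square root; the other terms of the bound do not
  depend on \<sigma>.\<close>

theorem perm_mean_stat_expectation_le:
  assumes d: "\<And>f. f \<in> G \<Longrightarrow> (\<integral>x. f x \<partial>P) - (\<integral>x. f x \<partial>Q) \<le> d"
  shows "(\<integral>z. perm_mean_stat z \<partial>sample)
    \<le> (expected_sup G n P + expected_sup G n Q) / n + (expected_sup G m P + expected_sup G m Q) / m
       + d / sqrt (real n + real m - 1)"
proof -
  define B where "B = (expected_sup G n P + expected_sup G n Q) / n + (expected_sup G m P + expected_sup G m Q) / m"
  let ?X = "{1..n}"
  obtain f0 where "f0 \<in> G" using nonempty by auto
  then have d0: "0 \<le> d" using mean_diff_abs_le[OF d] by (meson abs_ge_zero order_trans)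
  have "(\<integral>z. perm_mean_stat z \<partial>sample) = perm_avg U (\<lambda>\<sigma>. \<integral>z. weighted_stat G (n+m) (\<lambda>i. weights n m (\<sigma> i)) z \<partial>sample)"
    unfolding perm_mean_stat_def perm_avg_def using weighted_stat_integrable by simp
  also have "\<dots> \<le> perm_avg U (\<lambda>\<sigma>. B + d * \<bar>\<Sum>i\<in>?X. weights n m (\<sigma> i)\<bar>)"
  proof (rule perm_avg_mono)
    fix \<sigma> assume s: "\<sigma> permutes U"
    define A where "A = {i\<in>U. \<sigma> i \<in> ?X}"
    have XU: "?X \<subseteq> U" by auto
    have "card A = card (inv \<sigma> ` ?X)"
    proof -
      have "A = inv \<sigma> ` ?X"
      proof
        show "A \<subseteq> inv \<sigma> ` ?X"
        proof
          fix i assume "i \<in> A"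
          then have "\<sigma> i \<in> ?X" by (simp add: A_def)
          then have "inv \<sigma> (\<sigma> i) \<in> inv \<sigma> ` ?X" by (rule imageI)
          then show "i \<in> inv \<sigma> ` ?X" using permutes_inverses(2)[OF s] by simp
        qed
        show "inv \<sigma> ` ?X \<subseteq> A"
        proof
          fix j assume "j \<in> inv \<sigma> ` ?X"
          then obtain i where i: "i \<in> ?X" "j = inv \<sigma> i" by auto
          then have "i \<in> U" using XU by blast
          then have "j \<in> U" unfolding i(2) using permutes_in_image[OF permutes_inv[OF s]] by blast
          moreover have "\<sigma> j = i" unfolding i(2) by (rule permutes_inverses(1)[OF s])
          ultimately show "j \<in> A" using i(1) unfolding A_def by blast
        qed
      qed
      then show ?thesis by simp
    qed
    also have "\<dots> = n" using permutes_inj_on[OF permutes_inv[OF s], of ?X] by (simp add: card_image)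
    finally have cA: "card A = n" .
    have "(\<integral>z. weighted_stat G (n+m) (\<lambda>i. weights n m (\<sigma> i)) z \<partial>sample) \<le> B + \<bar>\<Sum>i=1..n. weights n m (\<sigma> i)\<bar> * d"
      unfolding B_def
    proof (rule weighted_stat_expectation_le[OF _ cA])
      show "A \<subseteq> U" by (auto simp: A_def)
      fix i assume i: "i \<in> U"
      then have "\<sigma> i \<in> U" using permutes_in_image[OF s] by blast
      then show "weights n m (\<sigma> i) = (if i \<in> A then 1 / real n else - (1 / real m))"
        using i by (auto simp: A_def weights_def)
    qed (rule d)
    then show "(\<integral>z. weighted_stat G (n+m) (\<lambda>i. weights n m (\<sigma> i)) z \<partial>sample) \<le> B + d * \<bar>\<Sum>i\<in>?X. weights n m (\<sigma> i)\<bar>"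
      by (simp add: mult.commute)
  qed
  also have "\<dots> = B + d * perm_avg U (\<lambda>\<sigma>. \<bar>\<Sum>i\<in>?X. weights n m (\<sigma> i)\<bar>)"
    by (simp add: perm_avg_add perm_avg_cmult perm_avg_const)
  also have "\<dots> \<le> B + d * sqrt (perm_avg U (\<lambda>\<sigma>. (\<Sum>i\<in>?X. weights n m (\<sigma> i))\<^sup>2))"
    using d0 by (intro add_left_mono mult_left_mono perm_avg_abs_le) auto
  also have "perm_avg U (\<lambda>\<sigma>. (\<Sum>i\<in>?X. weights n m (\<sigma> i))\<^sup>2) = 1 / (real n + real m - 1)"
  proof -
    have "perm_avg U (\<lambda>\<sigma>. (\<Sum>i\<in>?X. weights n m (\<sigma> i))\<^sup>2)
      = real (card ?X) * (real (card U) - real (card ?X)) / (real (card U) * (real (card U) - 1)) * (\<Sum>k\<in>U. (weights n m k)\<^sup>2)"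
      using n m weights_sums(1)[OF n m] by (intro perm_avg_block_square) auto
    also have "\<dots> = real n * real m / ((real n + real m) * (real n + real m - 1)) * (1 / n + 1 / m)"
      unfolding weights_sums(2)[OF n m] by simp
    also have "\<dots> = 1 / (real n + real m - 1)"
    proof -
      have "1 / real n + 1 / real m = (real n + real m) / (real n * real m)" using n m by (simp add: field_simps)
      moreover have "0 < real n + real m - 1" "0 < real n * real m" "0 < real n + real m" using n m by auto
      ultimately show ?thesis using n m by simp
    qed
    finally show ?thesis .
  qed
  finally show ?thesis by (simp add: B_def real_sqrt_divide)
qed

end

section \<open>Upper tails of the permutation mean and of the dispersion\<close>

lemma (in prob_space) Chernoff_bounded:
  fixes T :: "'a \<Rightarrow> real"
  assumes l: "0 < l" and T: "T \<in> borel_measurable M" "\<And>x. x \<in> space M \<Longrightarrow> \<bar>T x\<bar> \<le> K"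
  shows "prob {x \<in> space M. t \<le> T x} \<le> exp (- l * t) * expectation (\<lambda>x. exp (l * T x))"
proof -
  have "integrable M (\<lambda>x. exp (l * T x))"
  proof (rule integrable_bounded)
    show "(\<lambda>x. exp (l * T x)) \<in> borel_measurable M" using T(1) by measurable
    fix x assume "x \<in> space M"
    then have "l * T x \<le> l * K" using T(2) l by (intro mult_left_mono) (auto simp: abs_le_iff)
    then show "\<bar>exp (l * T x)\<bar> \<le> exp (l * K)" by simp
  qed
  moreover from this have "set_integrable M (space M) (\<lambda>x. exp (l * T x))"
    unfolding set_integrable_def by (rule integrable_mult_indicator[OF sets.top])
  ultimately show ?thesis
    using Chernoff_ineq_ge[OF l, of "space M" T t] by (simp add: set_integral_space)
qed

section \<open>Sublinearity of the statistic in its weights\<close>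

context two_samples begin

lemma weighted_stat_cong:
  "(\<And>i. i \<in> U \<Longrightarrow> c i = c' i) \<Longrightarrow> weighted_stat G (n+m) c z = weighted_stat G (n+m) c' z"
  unfolding weighted_stat_def by (intro SUP_cong refl sum.cong) auto

context
  fixes z assumes z: "z \<in> space sample"
begin

lemmas stat_ge = weighted_stat_sample_bounds(4)[OF z]

lemma weighted_stat_le: "(\<And>f. f \<in> G \<Longrightarrow> (\<Sum>i=1..n+m. c i * f (z i)) \<le> B) \<Longrightarrow> weighted_stat G (n+m) c z \<le> B"
  unfolding weighted_stat_def using nonempty by (rule cSUP_least)

lemma weighted_stat_cmult_le:
  assumes "0 \<le> r" shows "weighted_stat G (n+m) (\<lambda>i. r * c i) z \<le> r * weighted_stat G (n+m) c z"
proof (rule weighted_stat_le)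
  fix f assume "f \<in> G"
  then have "r * (\<Sum>i=1..n+m. c i * f (z i)) \<le> r * weighted_stat G (n+m) c z"
    using assms by (intro mult_left_mono stat_ge)
  then show "(\<Sum>i=1..n+m. r * c i * f (z i)) \<le> r * weighted_stat G (n+m) c z"
    by (simp add: sum_distrib_left mult.assoc)
qed

lemma weighted_stat_cmult:
  assumes "0 < r" shows "weighted_stat G (n+m) (\<lambda>i. r * c i) z = r * weighted_stat G (n+m) c z"
proof (rule antisym)
  show "weighted_stat G (n+m) (\<lambda>i. r * c i) z \<le> r * weighted_stat G (n+m) c z"
    using assms by (intro weighted_stat_cmult_le) simp
  have "weighted_stat G (n+m) (\<lambda>i. (1 / r) * (r * c i)) z \<le> (1 / r) * weighted_stat G (n+m) (\<lambda>i. r * c i) z"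
    using assms by (intro weighted_stat_cmult_le) simp
  then show "r * weighted_stat G (n+m) c z \<le> weighted_stat G (n+m) (\<lambda>i. r * c i) z"
    using assms by (simp add: field_simps)
qed

lemma weighted_stat_sum_le:
  "weighted_stat G (n+m) (\<lambda>i. \<Sum>k\<in>K. c k i) z \<le> (\<Sum>k\<in>K. weighted_stat G (n+m) (c k) z)"
proof (rule weighted_stat_le)
  fix f assume f: "f \<in> G"
  have "(\<Sum>i=1..n+m. (\<Sum>k\<in>K. c k i) * f (z i)) = (\<Sum>k\<in>K. \<Sum>i=1..n+m. c k i * f (z i))"
    by (subst sum.swap) (simp add: sum_distrib_right)
  also have "\<dots> \<le> (\<Sum>k\<in>K. weighted_stat G (n+m) (c k) z)" using f by (intro sum_mono stat_ge)
  finally show "(\<Sum>i=1..n+m. (\<Sum>k\<in>K. c k i) * f (z i)) \<le> (\<Sum>k\<in>K. weighted_stat G (n+m) (c k) z)" .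
qed

lemma weighted_stat_diff_le:
  "weighted_stat G (n+m) c z - weighted_stat G (n+m) c' z \<le> (\<Sum>i=1..n+m. \<bar>c i - c' i\<bar>)"
proof -
  have "weighted_stat G (n+m) c z \<le> weighted_stat G (n+m) c' z + (\<Sum>i=1..n+m. \<bar>c i - c' i\<bar>)"
  proof (rule weighted_stat_le)
    fix f assume f: "f \<in> G"
    have "(\<Sum>i=1..n+m. c i * f (z i)) = (\<Sum>i=1..n+m. c' i * f (z i)) + (\<Sum>i=1..n+m. (c i - c' i) * f (z i))"
      by (simp add: sum.distrib[symmetric] algebra_simps)
    also have "\<dots> \<le> weighted_stat G (n+m) c' z + (\<Sum>i=1..n+m. \<bar>c i - c' i\<bar>)"
      using stat_ge[OF f, of c'] weighted_stat_sample_bounds(1)[OF z f, of "\<lambda>i. c i - c' i"] by linarith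
    finally show "(\<Sum>i=1..n+m. c i * f (z i)) \<le> \<dots>" .
  qed
  then show ?thesis by simp
qed

lemma weighted_stat_uminus: "weighted_stat G (n+m) (\<lambda>i. - c i) z = weighted_stat G (n+m) c z"
proof -
  have *: "weighted_stat G (n+m) (\<lambda>i. - c i) z \<le> weighted_stat G (n+m) c z" for c
  proof (rule weighted_stat_le)
    fix f assume f: "f \<in> G"
    have "(\<Sum>i=1..n+m. - c i * f (z i)) = (\<Sum>i=1..n+m. c i * neg f (z i))"
      using sample_space[OF z] by (intro sum.cong refl) (simp add: neg_apply)
    then show "(\<Sum>i=1..n+m. - c i * f (z i)) \<le> weighted_stat G (n+m) c z" using stat_ge[OF neg_mem[OF f]] by simp
  qed
  show ?thesis using *[of c] *[of "\<lambda>i. - c i"] by simp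
qed

end

text \<open>These are the weights \<open>weights n m \<circ> \<sigma>\<close> averaged over the transpositions of \<open>i\<close> with all indices, with the weight at \<open>i\<close> removed: a leave-one-out statistic.\<close>

definition loo_weights :: "(nat \<Rightarrow> nat) \<Rightarrow> nat \<Rightarrow> nat \<Rightarrow> real" where
  "loo_weights \<sigma> i j = (if j = i then 0 else
     (1 - 1 / real (n + m)) * weights n m (\<sigma> j) + weights n m (\<sigma> i) / real (n + m))"

text \<open>Position \<open>i\<close> receives every weight once, and these sum to \<open>0\<close>.
  Any other position \<open>j\<close> is affected only by the transposition with
  \<open>k = j\<close>.\<close>

lemma loo_weights_average:
  assumes s: "\<sigma> permutes U" and ij: "i \<in> U" "j \<in> U"
  shows "(\<Sum>k\<in>U. (1 / real (n + m)) * weights n m ((\<sigma> \<circ> Transposition.transpose i k) j)) = loo_weights \<sigma> i j"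
proof -
  let ?w = "\<lambda>i. weights n m (\<sigma> i)" and ?N = "real (n + m)"
  have z: "sum ?w U = 0" using weights_sums(1)[OF n m] sum.permute[OF s, of "weights n m"] by (simp add: comp_def)
  have N: "?N \<noteq> 0" using n by simp
  show ?thesis
  proof (cases "j = i")
    case True
    then have "(\<Sum>k\<in>U. (1 / ?N) * weights n m ((\<sigma> \<circ> Transposition.transpose i k) j)) = (1 / ?N) * sum ?w U"
      by (simp add: sum_distrib_left)
    then show ?thesis using True z by (simp add: loo_weights_def)
  next
    case False
    have "(\<Sum>k\<in>U. (1 / ?N) * weights n m ((\<sigma> \<circ> Transposition.transpose i k) j))
      = (\<Sum>k\<in>U. (1 / ?N) * (?w j + (if k = j then ?w i - ?w j else 0)))"
      using False by (intro sum.cong refl) (auto simp: Transposition.transpose_def)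
    also have "\<dots> = (1 / ?N) * (?N * ?w j + (?w i - ?w j))"
    proof -
      have "(\<Sum>k\<in>U. ?w j + (if k = j then ?w i - ?w j else 0)) = ?N * ?w j + (?w i - ?w j)"
        using ij by (simp add: sum.distrib del: of_nat_add)
      then show ?thesis by (simp only: sum_distrib_left[symmetric])
    qed
    also have "\<dots> = loo_weights \<sigma> i j" using False N by (simp add: loo_weights_def field_simps del: of_nat_add)
    finally show ?thesis .
  qed
qed

text \<open>With \<open>N = n + m\<close> the coefficient is
  \<open>(N - 1) * (1 - 1 / N) - 1 / N = N - 2\<close>, where the last term appears because the
  weights at the other positions sum to minus the weight at \<open>j\<close>. The defect
  \<open>2\<close> becomes the self-bounding constant.\<close>

lemma loo_weights_sum:
  assumes s: "\<sigma> permutes U" and j: "j \<in> U"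
  shows "(\<Sum>i\<in>U. loo_weights \<sigma> i j) = (real (n + m) - 2) * weights n m (\<sigma> j)"
proof -
  let ?w = "\<lambda>i. weights n m (\<sigma> i)" and ?N = "real (n + m)"
  have z: "sum ?w U = 0" using weights_sums(1)[OF n m] sum.permute[OF s, of "weights n m"] by (simp add: comp_def)
  have N: "?N \<noteq> 0" using n by simp
  have "(\<Sum>i\<in>U. loo_weights \<sigma> i j) = (\<Sum>i\<in>U. ((1 - 1 / ?N) * ?w j + ?w i / ?N) - (if i = j then ?w j else 0))"
    by (intro sum.cong refl) (auto simp: loo_weights_def algebra_simps)
  also have "\<dots> = ?N * ((1 - 1 / ?N) * ?w j) + sum ?w U / ?N - ?w j"
    using j by (simp add: sum.distrib sum_subtractf sum_divide_distrib del: of_nat_add)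
  also have "\<dots> = (?N - 2) * ?w j" unfolding z using N by (simp add: field_simps del: of_nat_add)
  finally show ?thesis .
qed

definition loo_mean_stat :: "nat \<Rightarrow> (nat \<Rightarrow> 'e) \<Rightarrow> real" where
  "loo_mean_stat i z = perm_avg U (\<lambda>\<sigma>. weighted_stat G (n+m) (loo_weights \<sigma> i) z)"

text \<open>The leave-one-out weights average permuted weights, so sublinearity bounds their
  statistic by an average of permuted statistics; averaging over \<sigma> absorbs the
  transpositions.\<close>

lemma loo_mean_stat_le:
  assumes z: "z \<in> space sample" and i: "i \<in> U" shows "loo_mean_stat i z \<le> perm_mean_stat z"
proof -
  let ?N = "real (n + m)" and ?T = "\<lambda>\<sigma>. weighted_stat G (n+m) (\<lambda>j. weights n m (\<sigma> j)) z"
  have N: "0 < ?N" using n by simp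
  have "loo_mean_stat i z \<le> perm_avg U (\<lambda>\<sigma>. \<Sum>k\<in>U. (1 / ?N) * ?T (\<sigma> \<circ> Transposition.transpose i k))"
    unfolding loo_mean_stat_def
  proof (rule perm_avg_mono)
    fix \<sigma> assume s: "\<sigma> permutes U"
    have "weighted_stat G (n+m) (loo_weights \<sigma> i) z
      = weighted_stat G (n+m) (\<lambda>j. \<Sum>k\<in>U. (1 / ?N) * weights n m ((\<sigma> \<circ> Transposition.transpose i k) j)) z"
      using loo_weights_average[OF s i] by (intro weighted_stat_cong) simp
    also have "\<dots> \<le> (\<Sum>k\<in>U. weighted_stat G (n+m) (\<lambda>j. (1 / ?N) * weights n m ((\<sigma> \<circ> Transposition.transpose i k) j)) z)"
      by (rule weighted_stat_sum_le[OF z])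
    also have "\<dots> \<le> (\<Sum>k\<in>U. (1 / ?N) * ?T (\<sigma> \<circ> Transposition.transpose i k))"
      using N by (intro sum_mono weighted_stat_cmult_le[OF z]) simp
    finally show "weighted_stat G (n+m) (loo_weights \<sigma> i) z \<le> \<dots>" .
  qed
  also have "\<dots> = (\<Sum>k\<in>U. (1 / ?N) * perm_avg U (\<lambda>\<sigma>. ?T (\<sigma> \<circ> Transposition.transpose i k)))"
    unfolding perm_avg_sum perm_avg_cmult ..
  also have "\<dots> = (\<Sum>k\<in>U. (1 / ?N) * perm_mean_stat z)"
  proof (rule sum.cong[OF refl])
    fix k assume "k \<in> U"
    then show "(1 / ?N) * perm_avg U (\<lambda>\<sigma>. ?T (\<sigma> \<circ> Transposition.transpose i k)) = (1 / ?N) * perm_mean_stat z"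
      unfolding perm_mean_stat_def using perm_avg_compose[OF permutes_swap_id[OF i], of k ?T] by simp
  qed
  also have "\<dots> = perm_mean_stat z" using N by (simp del: of_nat_add)
  finally show ?thesis .
qed

text \<open>In absolute sum, the passage to the leave-one-out weights costs the weight at
  \<open>i\<close> plus its mean distance to all weights. Averaged over \<sigma>, each of the two
  parts is \<open>2 / (n + m)\<close>.\<close>

lemma perm_mean_stat_diff_le:
  assumes z: "z \<in> space sample" and i: "i \<in> U"
  shows "perm_mean_stat z - loo_mean_stat i z \<le> 4 / real (n + m)"
proof -
  let ?N = "real (n + m)" and ?w = "weights n m"
  have N: "0 < ?N" using n by simp
  define g where "g k = \<bar>?w k\<bar> + (1 / ?N) * (\<Sum>l\<in>U. \<bar>?w l - ?w k\<bar>)" for k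
  have "perm_mean_stat z - loo_mean_stat i z
    = perm_avg U (\<lambda>\<sigma>. weighted_stat G (n+m) (\<lambda>j. ?w (\<sigma> j)) z - weighted_stat G (n+m) (loo_weights \<sigma> i) z)"
    unfolding perm_mean_stat_def loo_mean_stat_def perm_avg_diff ..
  also have "\<dots> \<le> perm_avg U (\<lambda>\<sigma>. g (\<sigma> i))"
  proof (rule perm_avg_mono)
    fix \<sigma> assume s: "\<sigma> permutes U"
    have "weighted_stat G (n+m) (\<lambda>j. ?w (\<sigma> j)) z - weighted_stat G (n+m) (loo_weights \<sigma> i) z
      \<le> (\<Sum>j\<in>U. \<bar>?w (\<sigma> j) - loo_weights \<sigma> i j\<bar>)" by (rule weighted_stat_diff_le[OF z])
    also have "\<dots> = (\<Sum>j\<in>U. (if j = i then \<bar>?w (\<sigma> i)\<bar> else 0) + (1 / ?N) * \<bar>?w (\<sigma> j) - ?w (\<sigma> i)\<bar>)"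
    proof (rule sum.cong[OF refl])
      fix j
      show "\<bar>?w (\<sigma> j) - loo_weights \<sigma> i j\<bar> = (if j = i then \<bar>?w (\<sigma> i)\<bar> else 0) + (1 / ?N) * \<bar>?w (\<sigma> j) - ?w (\<sigma> i)\<bar>"
      proof (cases "j = i")
        case False
        have "?w (\<sigma> j) - loo_weights \<sigma> i j = (1 / ?N) * (?w (\<sigma> j) - ?w (\<sigma> i))"
          using False by (simp add: loo_weights_def algebra_simps)
        then have "\<bar>?w (\<sigma> j) - loo_weights \<sigma> i j\<bar> = (1 / ?N) * \<bar>?w (\<sigma> j) - ?w (\<sigma> i)\<bar>"
          using N by (simp only: abs_mult) simp
        then show ?thesis using False by simp
      qed (simp add: loo_weights_def)
    qed
    also have "\<dots> = \<bar>?w (\<sigma> i)\<bar> + (1 / ?N) * (\<Sum>j\<in>U. \<bar>?w (\<sigma> j) - ?w (\<sigma> i)\<bar>)"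
      using i by (simp add: sum.distrib sum_distrib_left del: of_nat_add)
    also have "(\<Sum>j\<in>U. \<bar>?w (\<sigma> j) - ?w (\<sigma> i)\<bar>) = (\<Sum>l\<in>U. \<bar>?w l - ?w (\<sigma> i)\<bar>)"
      using sum.permute[OF s, of "\<lambda>l. \<bar>?w l - ?w (\<sigma> i)\<bar>"] by (simp add: comp_def)
    finally show "weighted_stat G (n+m) (\<lambda>j. ?w (\<sigma> j)) z - weighted_stat G (n+m) (loo_weights \<sigma> i) z \<le> g (\<sigma> i)"
      by (simp add: g_def)
  qed
  also have "\<dots> = sum g U / card U" using i by (intro perm_avg_eval) auto
  also have "sum g U = 2 + (1 / ?N) * (\<Sum>k\<in>U. \<Sum>l\<in>U. \<bar>?w k - ?w l\<bar>)"
    unfolding g_def sum.distrib sum_distrib_left[symmetric] using weights_sums(3)[OF n m] by (simp add: abs_minus_commute)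
  also have "\<dots> = 4"
  proof -
    have "2 * (real n + real m) = 2 * ?N" by simp
    then show ?thesis unfolding weights_sums(4)[OF n m] using N by (simp del: of_nat_add)
  qed
  finally show ?thesis by simp
qed

text \<open>Sublinearity applied to \<open>loo_weights_sum\<close> shows that the leave-one-out
  means sum to at least \<open>n + m - 2\<close> times the full mean, which leaves at most twice
  that mean for the \<open>n + m\<close> increments.\<close>

lemma perm_mean_stat_total:
  assumes z: "z \<in> space sample"
  shows "(\<Sum>i\<in>U. perm_mean_stat z - loo_mean_stat i z) \<le> 2 * perm_mean_stat z"
proof -
  let ?N = "real (n + m)" and ?w = "weights n m"
  have N: "2 \<le> ?N" using n m by simp
  have "(?N - 2) * perm_mean_stat z = perm_avg U (\<lambda>\<sigma>. (?N - 2) * weighted_stat G (n+m) (\<lambda>j. ?w (\<sigma> j)) z)"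
    by (simp add: perm_mean_stat_def perm_avg_cmult)
  also have "\<dots> \<le> perm_avg U (\<lambda>\<sigma>. \<Sum>i\<in>U. weighted_stat G (n+m) (loo_weights \<sigma> i) z)"
  proof (rule perm_avg_mono)
    fix \<sigma> assume s: "\<sigma> permutes U"
    show "(?N - 2) * weighted_stat G (n+m) (\<lambda>j. ?w (\<sigma> j)) z \<le> (\<Sum>i\<in>U. weighted_stat G (n+m) (loo_weights \<sigma> i) z)"
    \<comment> \<open>Homogeneity is used for positive factors only; for \<open>n = m = 1\<close>
      the factor is \<open>0\<close> and nonnegativity of the statistics suffices.\<close>
    proof (cases "?N = 2")
      case True
      then show ?thesis using weighted_stat_sample_bounds(2)[OF z] by (auto intro!: sum_nonneg simp del: of_nat_add)
    next
      case False
      then have "0 < ?N - 2" using N by simp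
      then have "(?N - 2) * weighted_stat G (n+m) (\<lambda>j. ?w (\<sigma> j)) z = weighted_stat G (n+m) (\<lambda>j. (?N - 2) * ?w (\<sigma> j)) z"
        by (rule weighted_stat_cmult[OF z, symmetric])
      also have "\<dots> = weighted_stat G (n+m) (\<lambda>j. \<Sum>i\<in>U. loo_weights \<sigma> i j) z"
        using loo_weights_sum[OF s] by (intro weighted_stat_cong) simp
      also have "\<dots> \<le> (\<Sum>i\<in>U. weighted_stat G (n+m) (loo_weights \<sigma> i) z)" by (rule weighted_stat_sum_le[OF z])
      finally show ?thesis .
    qed
  qed
  also have "\<dots> = (\<Sum>i\<in>U. loo_mean_stat i z)" unfolding perm_avg_sum loo_mean_stat_def ..
  finally show ?thesis by (simp add: sum_subtractf algebra_simps)
qed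

text \<open>Scaling by \<open>(n + m) / 4\<close> brings the leave-one-out increments into the unit
  interval, with self-bounding constant \<open>2\<close>. The parameter stays free: the Hoeffding
  condition uses \<open>1/2\<close>, the Bernstein condition \<open>11/25\<close>.\<close>

theorem perm_mean_stat_tail:
  assumes l: "0 < l" "l < 1"
  shows "sample.prob {z \<in> space sample. perm_mean_stat z \<ge> t}
    \<le> exp (l * (real (n + m) / 4) * (sample.expectation perm_mean_stat / (1 - l) - t))"
proof -
  define c where "c = real (n + m) / 4"
  have c: "0 < c" using n by (simp add: c_def)
  have loo_m: "loo_mean_stat i \<in> borel_measurable sample" for i
    unfolding loo_mean_stat_def perm_avg_def
    by (intro borel_measurable_divide borel_measurable_sum weighted_stat_measurable borel_measurable_const)
  have bd: "\<bar>c * perm_mean_stat z\<bar> \<le> c * 2" if "z \<in> space sample" for z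
    using perm_mean_stat_bounds[OF that] c by (simp add: abs_mult)
  have m: "(\<lambda>z. c * perm_mean_stat z) \<in> borel_measurable sample" using perm_mean_stat_measurable by measurable
  have "(\<integral>z. exp (l * (c * perm_mean_stat z)) \<partial>sample)
    \<le> exp (l * (\<integral>z. c * perm_mean_stat z \<partial>sample) / (1 - l * (2 / 2)))"
  proof (rule self_bounding_mgf[where Y'="\<lambda>i z. c * loo_mean_stat i z" and a=2 and K="c * 2"])
    show "(\<lambda>z. c * loo_mean_stat i z) \<in> borel_measurable sample" for i using loo_m by measurable
    fix i z y assume i: "i \<in> U" "z \<in> space sample"
    show "c * loo_mean_stat i (z(i := y)) = c * loo_mean_stat i z"
    proof -
      have "weighted_stat G (n+m) (loo_weights \<sigma> i) (z(i := y)) = weighted_stat G (n+m) (loo_weights \<sigma> i) z" for \<sigma>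
        unfolding weighted_stat_def by (intro SUP_cong refl sum.cong) (auto simp: loo_weights_def)
      then show ?thesis by (simp add: loo_mean_stat_def)
    qed
    have "c * (perm_mean_stat z - loo_mean_stat i z) \<le> c * (4 / real (n + m))"
      using c perm_mean_stat_diff_le[OF i(2,1)] by (intro mult_left_mono) auto
    also have "\<dots> = 1" using n by (simp add: c_def)
    finally have "c * (perm_mean_stat z - loo_mean_stat i z) \<le> 1" .
    moreover have "0 \<le> c * (perm_mean_stat z - loo_mean_stat i z)" using c loo_mean_stat_le[OF i(2,1)] by simp
    ultimately show "0 \<le> c * perm_mean_stat z - c * loo_mean_stat i z \<and> c * perm_mean_stat z - c * loo_mean_stat i z \<le> 1"
      by (simp add: right_diff_distrib)
  next
    fix z assume z: "z \<in> space sample"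
    have "(\<Sum>i\<in>U. c * perm_mean_stat z - c * loo_mean_stat i z) = c * (\<Sum>i\<in>U. perm_mean_stat z - loo_mean_stat i z)"
      by (simp add: sum_distrib_left right_diff_distrib sum_subtractf)
    also have "\<dots> \<le> c * (2 * perm_mean_stat z)" using c by (intro mult_left_mono perm_mean_stat_total z) auto
    finally show "(\<Sum>i\<in>U. c * perm_mean_stat z - c * loo_mean_stat i z) \<le> 2 * (c * perm_mean_stat z)" by simp
  qed (use l bd m in auto)
  also have "\<dots> = exp (l * c * (sample.expectation perm_mean_stat / (1 - l)))" by (simp add: mult.assoc)
  finally have mgf: "(\<integral>z. exp (l * (c * perm_mean_stat z)) \<partial>sample) \<le> \<dots>" .
  have "sample.prob {z \<in> space sample. c * t \<le> c * perm_mean_stat z}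
    \<le> exp (- l * (c * t)) * (\<integral>z. exp (l * (c * perm_mean_stat z)) \<partial>sample)"
    using l(1) m bd by (rule sample.Chernoff_bounded)
  also have "\<dots> \<le> exp (- l * (c * t)) * exp (l * c * (sample.expectation perm_mean_stat / (1 - l)))"
    using mgf by (intro mult_left_mono) auto
  also have "\<dots> = exp (l * c * (sample.expectation perm_mean_stat / (1 - l) - t))"
    by (simp add: exp_add[symmetric] algebra_simps)
  finally show ?thesis using c by (simp add: c_def)
qed

text \<open>Squared deviations are at most \<open>4\<close>, so a quarter of the dispersion has
  increments between \<open>0\<close> and \<open>1\<close>. Deleting each point in turn counts every
  summand \<open>n + m - 1\<close> times, hence the self-bounding constant \<open>1\<close>.\<close>

theorem dispersion_tail:
  assumes l: "0 < l" "l < 2"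
  shows "sample.prob {z \<in> space sample. dispersion_on U z \<ge> t}
    \<le> exp (l / 4 * (sample.expectation (dispersion_on U) / (1 - l / 2) - t))"
proof -
  define K where "K = real (card U)"
  have bd: "\<bar>dispersion_on U z / 4\<bar> \<le> K" if "z \<in> space sample" for z
    using dispersion_bounds(1)[OF that, of U] by (simp add: K_def)
  have dm: "(\<lambda>z. dispersion_on U z / 4) \<in> borel_measurable sample" using dispersion_measurable[of U] by measurable
  have "(\<integral>z. exp (l * (dispersion_on U z / 4)) \<partial>sample)
    \<le> exp (l * (\<integral>z. dispersion_on U z / 4 \<partial>sample) / (1 - l * (1 / 2)))"
  proof (rule self_bounding_mgf[where Y'="\<lambda>i z. dispersion_on (U - {i}) z / 4" and a=1 and K=K])
    show "(\<lambda>z. dispersion_on (U - {i}) z / 4) \<in> borel_measurable sample" for i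
      using dispersion_measurable[of "U - {i}"] by (intro borel_measurable_divide borel_measurable_const) auto
    fix i z y assume i: "i \<in> U" "z \<in> space sample"
    show "dispersion_on (U - {i}) (z(i := y)) / 4 = dispersion_on (U - {i}) z / 4"
      unfolding dispersion_on_def by (intro arg_cong2[where f="(/)"] SUP_cong refl sum.cong) auto
    have zi: "z i \<in> space E" using sample_space[OF i(2,1)] .
    have "dispersion_on (U - {i}) z \<le> dispersion_on U z"
      unfolding dispersion_on_def[of "U - {i}"]
    proof (rule cSUP_least[OF nonempty])
      fix f assume f: "f \<in> G"
      have "(\<Sum>j\<in>U - {i}. (f (z j) - pooled_mean f)\<^sup>2) \<le> (\<Sum>j\<in>U. (f (z j) - pooled_mean f)\<^sup>2)"
        by (intro sum_mono2) auto
      also have "\<dots> \<le> dispersion_on U z" using dispersion_bounds(2)[OF i(2) order_refl f] .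
      finally show "(\<Sum>j\<in>U - {i}. (f (z j) - pooled_mean f)\<^sup>2) \<le> dispersion_on U z" .
    qed
    moreover have "dispersion_on U z \<le> dispersion_on (U - {i}) z + 4"
      unfolding dispersion_on_def[of U]
    proof (rule cSUP_least[OF nonempty])
      fix f assume f: "f \<in> G"
      have "(\<Sum>j\<in>U. (f (z j) - pooled_mean f)\<^sup>2) = (f (z i) - pooled_mean f)\<^sup>2 + (\<Sum>j\<in>U - {i}. (f (z j) - pooled_mean f)\<^sup>2)"
        using i by (intro sum.remove) auto
      then show "(\<Sum>j\<in>U. (f (z j) - pooled_mean f)\<^sup>2) \<le> dispersion_on (U - {i}) z + 4"
        using pooled_square_bounds(2)[OF f zi] dispersion_bounds(2)[OF i(2), of "U - {i}" f] f by auto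
    qed
    ultimately show "0 \<le> dispersion_on U z / 4 - dispersion_on (U - {i}) z / 4 \<and> dispersion_on U z / 4 - dispersion_on (U - {i}) z / 4 \<le> 1"
      by simp
  next
    fix z assume z: "z \<in> space sample"
    have "(real (n + m) - 1) * dispersion_on U z \<le> (\<Sum>i\<in>U. dispersion_on (U - {i}) z)"
    proof -
      have N: "0 < real (n + m) - 1" using n m by simp
      have "dispersion_on U z \<le> (\<Sum>i\<in>U. dispersion_on (U - {i}) z) / (real (n + m) - 1)"
        unfolding dispersion_on_def[of U]
      proof (rule cSUP_least[OF nonempty])
        fix f assume f: "f \<in> G"
        define a where "a j = (f (z j) - pooled_mean f)\<^sup>2" for j
        have "(real (n + m) - 1) * sum a U = (\<Sum>i\<in>U. sum a (U - {i}))"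
          by (simp add: sum_diff1 sum_subtractf algebra_simps)
        also have "\<dots> \<le> (\<Sum>i\<in>U. dispersion_on (U - {i}) z)"
          unfolding a_def using f by (intro sum_mono dispersion_bounds(2)[OF z]) auto
        finally show "(\<Sum>j\<in>U. (f (z j) - pooled_mean f)\<^sup>2) \<le> (\<Sum>i\<in>U. dispersion_on (U - {i}) z) / (real (n + m) - 1)"
          using N by (simp add: a_def pos_le_divide_eq mult.commute)
      qed
      then show ?thesis using N by (simp add: pos_le_divide_eq mult.commute)
    qed
    then show "(\<Sum>i\<in>U. dispersion_on U z / 4 - dispersion_on (U - {i}) z / 4) \<le> 1 * (dispersion_on U z / 4)"
      by (simp add: sum_subtractf sum_divide_distrib[symmetric] algebra_simps)
  qed (use l bd dm in auto)
  also have "\<dots> = exp (l / 4 * (sample.expectation (dispersion_on U) / (1 - l / 2)))" by simp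
  finally have mgf: "(\<integral>z. exp (l * (dispersion_on U z / 4)) \<partial>sample) \<le> \<dots>" .
  have "sample.prob {z \<in> space sample. t / 4 \<le> dispersion_on U z / 4}
    \<le> exp (- l * (t / 4)) * (\<integral>z. exp (l * (dispersion_on U z / 4)) \<partial>sample)"
    using l(1) dm bd by (rule sample.Chernoff_bounded)
  also have "\<dots> \<le> exp (- l * (t / 4)) * exp (l / 4 * (sample.expectation (dispersion_on U) / (1 - l / 2)))"
    using mgf by (intro mult_left_mono) auto
  also have "\<dots> = exp (l / 4 * (sample.expectation (dispersion_on U) / (1 - l / 2) - t))"
    by (simp add: exp_add[symmetric] algebra_simps)
  finally show ?thesis by simp
qed

end

section \<open>Conditional concentration of the permuted statistic\<close>

context two_samples begin

definition kappa :: real where "kappa = 1 / real n + 1 / real m"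

lemma kappa_pos: "0 < kappa"
proof -
  have "0 < 1 / real n" "0 < 1 / real m" using n m by auto
  then show ?thesis unfolding kappa_def by (rule add_pos_pos)
qed

definition perm_tail :: "real \<Rightarrow> (nat \<Rightarrow> 'e) \<Rightarrow> real" where
  "perm_tail t z = perm_avg U (\<lambda>\<sigma>. of_bool (t \<le> weighted_stat G (n+m) (\<lambda>i. weights n m (\<sigma> i)) z))"

lemma perm_tail_measurable: "perm_tail t \<in> borel_measurable sample"
proof -
  have "(\<lambda>z. of_bool (t \<le> weighted_stat G (n+m) c z) :: real) \<in> borel_measurable sample" for c
    using weighted_stat_measurable[of c] by measurable
  then show ?thesis unfolding perm_tail_def perm_avg_def
    by (intro borel_measurable_divide borel_measurable_sum borel_measurable_const)
qed

lemma perm_tail_Chernoff: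
  assumes "0 < l"
  shows "perm_tail t z \<le> exp (- l * t) * perm_avg U (\<lambda>\<sigma>. exp (l * weighted_stat G (n+m) (\<lambda>i. weights n m (\<sigma> i)) z))"
  unfolding perm_tail_def perm_avg_cmult[symmetric]
proof (rule perm_avg_mono)
  fix \<sigma>
  let ?T = "weighted_stat G (n+m) (\<lambda>i. weights n m (\<sigma> i)) z"
  show "of_bool (t \<le> ?T) \<le> exp (- l * t) * exp (l * ?T)"
  proof (cases "t \<le> ?T")
    case True
    then have "0 \<le> - l * t + l * ?T" using assms by simp
    then show ?thesis by (simp add: exp_add[symmetric] of_bool_def)
  qed simp
qed

definition values_at :: "(nat \<Rightarrow> 'e) \<Rightarrow> (nat \<Rightarrow> real) set" where
  "values_at z = (\<lambda>f i. f (z i)) ` G"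

text \<open>The smaller sample plays the random set, since both \<open>cut_pair_sum\<close> and the
  Hoeffding constant use \<open>a \<le> b\<close>. If it is the second sample, the weights change
  sign, which a symmetric class does not notice.\<close>

lemma slice_representation:
  assumes z: "z \<in> space sample"
  obtains a b J where "1 \<le> a" "a \<le> b" "a + b = n + m" "b = max n m" "J \<subseteq> U" "card J = a"
    "1 / real a + 1 / real b = kappa"
    "\<And>\<sigma>. \<sigma> permutes U \<Longrightarrow> weighted_stat G (n+m) (\<lambda>i. weights n m (\<sigma> i)) z
       = slice_stat (values_at z) U (real a) (real b) {i\<in>U. \<sigma> i \<in> J}"
proof (cases "n \<le> m")
  case True
  have "weighted_stat G (n+m) (\<lambda>i. weights n m (\<sigma> i)) z
       = slice_stat (values_at z) U (real n) (real m) {i\<in>U. \<sigma> i \<in> {1..n}}" if s: "\<sigma> permutes U" for \<sigma>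
  proof -
    have "weights n m (\<sigma> i) = (if i \<in> {i\<in>U. \<sigma> i \<in> {1..n}} then 1 / real n else - (1 / real m))" if "i \<in> U" for i
      using permutes_in_image[OF s, of i] that by (auto simp: weights_def)
    then show ?thesis unfolding weighted_stat_def slice_stat_def values_at_def image_image
      by (intro SUP_cong refl sum.cong) simp
  qed
  then show ?thesis using True n m by (intro that[of n m "{1..n}"]) (auto simp: kappa_def)
next
  case False
  let ?J = "{n+1..n+m}"
  have "weighted_stat G (n+m) (\<lambda>i. weights n m (\<sigma> i)) z
       = slice_stat (values_at z) U (real m) (real n) {i\<in>U. \<sigma> i \<in> ?J}" if s: "\<sigma> permutes U" for \<sigma>
  proof -
    have "- weights n m (\<sigma> i) = (if i \<in> {i\<in>U. \<sigma> i \<in> ?J} then 1 / real m else - (1 / real n))" if "i \<in> U" for i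
      using permutes_in_image[OF s, of i] that by (auto simp: weights_def)
    then have "weighted_stat G (n+m) (\<lambda>i. - weights n m (\<sigma> i)) z = slice_stat (values_at z) U (real m) (real n) {i\<in>U. \<sigma> i \<in> ?J}"
      unfolding weighted_stat_def slice_stat_def values_at_def image_image by (intro SUP_cong refl sum.cong) simp
    then show ?thesis by (simp add: weighted_stat_uminus[OF z])
  qed
  then show ?thesis using False n m by (intro that[of m n ?J]) (auto simp: kappa_def)
qed

context
  fixes z assumes z: "z \<in> space sample"
begin

lemma values_at_bounds: "v \<in> values_at z \<Longrightarrow> i \<in> U \<Longrightarrow> \<bar>v i\<bar> \<le> 1"
  unfolding values_at_def using class_abs_le sample_space[OF z] by auto

lemma values_at_nonempty: "values_at z \<noteq> {}"
  unfolding values_at_def using nonempty by simp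

text \<open>A swap changes the statistic by at most \<open>2 * kappa\<close>, and
  \<open>slice_Hoeffding\<close> charges \<open>a * (l * (2 * kappa))\<^sup>2 / 8\<close>, which is
  \<open>(a * kappa) / 2\<close> times \<open>kappa * l\<^sup>2\<close>. Finally
  \<open>a * kappa = 1 + a / b \<le> 2\<close>.\<close>

theorem perm_mgf_Hoeffding:
  assumes l: "0 < l"
  shows "perm_avg U (\<lambda>\<sigma>. exp (l * weighted_stat G (n+m) (\<lambda>i. weights n m (\<sigma> i)) z))
    \<le> exp (l * perm_mean_stat z + kappa * l\<^sup>2)"
proof -
  obtain a b J where ab: "1 \<le> a" "a \<le> b" "a + b = n + m" "b = max n m" and J: "J \<subseteq> U" "card J = a"
    and k: "1 / real a + 1 / real b = kappa"
    and rep: "\<And>\<sigma>. \<sigma> permutes U \<Longrightarrow> weighted_stat G (n+m) (\<lambda>i. weights n m (\<sigma> i)) z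
       = slice_stat (values_at z) U (real a) (real b) {i\<in>U. \<sigma> i \<in> J}"
    by (rule slice_representation[OF z]) (rule that; assumption)
  define t where "t = slice_stat (values_at z) U (real a) (real b)"
  define S where "S = slice U a"
  have avg: "perm_avg U (\<lambda>\<sigma>. H (weighted_stat G (n+m) (\<lambda>i. weights n m (\<sigma> i)) z)) = (\<Sum>A\<in>S. H (t A)) / card S" for H :: "real \<Rightarrow> real"
  proof -
    have "perm_avg U (\<lambda>\<sigma>. H (weighted_stat G (n+m) (\<lambda>i. weights n m (\<sigma> i)) z)) = perm_avg U (\<lambda>\<sigma>. H (t {i\<in>U. \<sigma> i \<in> J}))"
      by (intro perm_avg_cong) (simp add: rep t_def)
    then show ?thesis using perm_avg_preimage[of U J "\<lambda>A. H (t A)"] J by (simp add: S_def)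
  qed
  define L where "L v A = (\<Sum>i\<in>U. (if i \<in> A then 1 / real a else - (1 / real b)) * v i)" for v A
  have st: "t A = (SUP v\<in>values_at z. L v A)" for A by (simp add: t_def slice_stat_def L_def)
  have Lb: "\<bar>L v A\<bar> \<le> real (card U) * 1" if "v \<in> values_at z" for v A
    unfolding L_def
  proof (rule abs_sum_le_card)
    fix i assume "i \<in> U"
    have "1 / real a \<le> 1" "1 / real b \<le> 1" using ab by auto
    then show "\<bar>(if i \<in> A then 1 / real a else - (1 / real b)) * v i\<bar> \<le> 1"
      using values_at_bounds[OF that \<open>i \<in> U\<close>] unfolding abs_mult by (intro mult_le_one) auto
  qed
  have osc: "l * t A - l * t (Transposition.transpose x y ` A) \<le> l * (2 * kappa)"
    if A: "A \<in> slice U a" "x \<in> A" "y \<in> U" for A x y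
  proof (cases "y \<in> A")
    case True
    then show ?thesis using transpose_image_both[OF A(2)] l kappa_pos by simp
  next
    case False
    let ?A' = "Transposition.transpose x y ` A"
    have AU: "A \<subseteq> U" "finite A" using A(1) finite_subset by (auto simp: slice_def)
    have "x \<in> U" using A(2) AU(1) by blast
    from transpose_image_slice[OF A(1) this A(3)] have A': "?A' \<subseteq> U" unfolding slice_def by blast
    have "t A \<le> t ?A' + 2 * kappa"
      unfolding st[of A]
    proof (rule cSUP_least[OF values_at_nonempty])
      fix v assume v: "v \<in> values_at z"
      have "L v A = kappa * sum v A - sum v U / b" unfolding L_def k[symmetric]
        using AU by (intro slice_weights_sum) auto
      moreover have "L v ?A' = kappa * sum v ?A' - sum v U / b" unfolding L_def k[symmetric]
        using A' by (intro slice_weights_sum) auto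
      moreover have "sum v ?A' = sum v A - v x + v y" using transpose_image_sum[OF AU(2) A(2) False] .
      ultimately have "L v A = L v ?A' + kappa * (v x - v y)" by (simp add: algebra_simps)
      moreover have "kappa * (v x - v y) \<le> kappa * 2"
        using values_at_bounds[OF v, of x] values_at_bounds[OF v, of y] A AU kappa_pos
        by (intro mult_left_mono) auto
      moreover have "L v ?A' \<le> t ?A'" unfolding st using v Lb
        by (intro cSUP_real_bounds(3)[OF values_at_nonempty, where C="real (card U) * 1"]) auto
      ultimately show "L v A \<le> t ?A' + 2 * kappa" by linarith
    qed
    then have "l * t A \<le> l * (t ?A' + 2 * kappa)" using l by (intro mult_left_mono) auto
    then show ?thesis by (simp add: algebra_simps)
  qed
  have "(\<Sum>A\<in>S. exp (l * t A)) / card S \<le> exp (sum (\<lambda>A. l * t A) S / card S + a * (l * (2 * kappa))\<^sup>2 / 8)"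
    unfolding S_def using ab osc by (intro slice_Hoeffding) auto
  also have "sum (\<lambda>A. l * t A) S / card S = l * (sum t S / card S)" by (simp add: sum_distrib_left)
  also have "sum t S / card S = perm_mean_stat z" using avg[of "\<lambda>x. x"] by (simp add: perm_mean_stat_def)
  also have "a * (l * (2 * kappa))\<^sup>2 / 8 = (a * kappa) / 2 * (kappa * l\<^sup>2)" by (simp add: power2_eq_square)
  also have "l * perm_mean_stat z + (a * kappa) / 2 * (kappa * l\<^sup>2) \<le> l * perm_mean_stat z + 1 * (kappa * l\<^sup>2)"
  proof (intro add_left_mono mult_right_mono)
    have "a * kappa = 1 + real a / real b" unfolding k[symmetric] using ab by (simp add: field_simps)
    also have "real a / real b \<le> 1" using ab by simp
    finally show "(a * kappa) / 2 \<le> 1" by simp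
  qed (use kappa_pos in simp)
  finally show ?thesis unfolding avg[of "\<lambda>x. exp (l * x)"] by simp
qed

text \<open>\<open>slice_concentration\<close> asks for sums of squares about the empirical mean of
  the values. That mean minimizes such sums, so the dispersion about \<open>pooled_mean\<close> is
  an admissible bound.\<close>

theorem perm_mgf_dispersion:
  assumes s: "0 \<le> s" "dispersion_on U z \<le> s\<^sup>2" and l: "0 < l" "l * (sqrt kappa * s / max n m) < 1"
  shows "perm_avg U (\<lambda>\<sigma>. exp (l * weighted_stat G (n+m) (\<lambda>i. weights n m (\<sigma> i)) z))
    \<le> exp (l * (perm_mean_stat z + l * (kappa\<^sup>2 * s\<^sup>2 / 2)) / (1 - l * (sqrt kappa * s / max n m)))"
proof -
  obtain a b J where ab: "1 \<le> a" "a \<le> b" "a + b = n + m" "b = max n m" and J: "J \<subseteq> U" "card J = a"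
    and k: "1 / real a + 1 / real b = kappa"
    and rep: "\<And>\<sigma>. \<sigma> permutes U \<Longrightarrow> weighted_stat G (n+m) (\<lambda>i. weights n m (\<sigma> i)) z
       = slice_stat (values_at z) U (real a) (real b) {i\<in>U. \<sigma> i \<in> J}"
    by (rule slice_representation[OF z]) (rule that; assumption)
  define t where "t = slice_stat (values_at z) U (real a) (real b)"
  have avg: "perm_avg U (\<lambda>\<sigma>. H (weighted_stat G (n+m) (\<lambda>i. weights n m (\<sigma> i)) z)) = (\<Sum>A\<in>slice U a. H (t A)) / card (slice U a)" for H :: "real \<Rightarrow> real"
  proof -
    have "perm_avg U (\<lambda>\<sigma>. H (weighted_stat G (n+m) (\<lambda>i. weights n m (\<sigma> i)) z)) = perm_avg U (\<lambda>\<sigma>. H (t {i\<in>U. \<sigma> i \<in> J}))"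
      by (intro perm_avg_cong) (simp add: rep t_def)
    then show ?thesis using perm_avg_preimage[of U J "\<lambda>A. H (t A)"] J by simp
  qed
  have "(\<Sum>A\<in>slice U a. exp (l * t A)) / card (slice U a)
    \<le> exp (l * ((\<Sum>A\<in>slice U a. t A) / card (slice U a) + l * ((1 / real a + 1 / real b)\<^sup>2 * s\<^sup>2 / 2))
        / (1 - l * (sqrt (1 / real a + 1 / real b) * s / b)))"
    unfolding t_def
  proof (rule slice_concentration)
    show "values_at z \<noteq> {}" by (rule values_at_nonempty)
    show "\<bar>v i\<bar> \<le> 1" if "v \<in> values_at z" "i \<in> U" for v i using values_at_bounds that .
    show "\<exists>u\<in>values_at z. \<forall>i\<in>U. u i = - v i" if v: "v \<in> values_at z" for v
    proof -
      obtain f where f: "f \<in> G" "v = (\<lambda>i. f (z i))" using v by (auto simp: values_at_def)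
      show ?thesis
      proof (intro bexI ballI)
        show "(\<lambda>i. neg f (z i)) \<in> values_at z" using neg_mem[OF f(1)] by (auto simp: values_at_def)
        fix i assume "i \<in> U" then show "neg f (z i) = - v i" using sample_space[OF z] by (simp add: f(2) neg_apply)
      qed
    qed
    show "(\<Sum>i\<in>U. (v i - sum v U / card U)\<^sup>2) \<le> s\<^sup>2" if v: "v \<in> values_at z" for v
    proof -
      obtain f where f: "f \<in> G" "v = (\<lambda>i. f (z i))" using v by (auto simp: values_at_def)
      define \<mu> where "\<mu> = sum v U / card U" define c where "c = pooled_mean f"
      have cU: "real (card U) * \<mu> = sum v U" using n by (simp add: \<mu>_def)
      have "(\<Sum>i\<in>U. (v i - c)\<^sup>2) = (\<Sum>i\<in>U. (v i - \<mu>)\<^sup>2 + 2 * (\<mu> - c) * (v i - \<mu>) + (\<mu> - c)\<^sup>2)"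
        by (intro sum.cong refl) (simp add: power2_eq_square algebra_simps)
      also have "\<dots> = (\<Sum>i\<in>U. (v i - \<mu>)\<^sup>2) + 2 * (\<mu> - c) * (sum v U - real (card U) * \<mu>) + real (card U) * (\<mu> - c)\<^sup>2"
        by (simp add: sum.distrib sum_distrib_left[symmetric] sum_subtractf)
      finally have "(\<Sum>i\<in>U. (v i - \<mu>)\<^sup>2) \<le> (\<Sum>i\<in>U. (v i - c)\<^sup>2)" unfolding cU by simp
      also have "\<dots> \<le> dispersion_on U z" unfolding f(2) c_def using dispersion_bounds(2)[OF z order_refl f(1)] .
      finally show ?thesis using s by (simp add: \<mu>_def)
    qed
  qed (use ab s l k in \<open>simp_all\<close>)
  then show ?thesis unfolding avg[of "\<lambda>x. exp (l * x)"] k perm_mean_stat_def using avg[of "\<lambda>x. x"] ab(4) by simp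
qed

end

end

section \<open>Lower tail of a linear statistic and the permutation tail probability\<close>

text \<open>This bound yields the constant of the Bernstein inequality needed here, in which the linear term has coefficient \<open>max (1/n) (1/m)\<close> only.\<close>

lemma exp_le_Pade:
  fixes u x :: real
  assumes "\<bar>u\<bar> \<le> x" "x < 2" shows "exp u \<le> 1 + u + u\<^sup>2 / (2 - x)"
proof (cases "0 \<le> u")
  case True
  define g where "g u = 2 + u - (2 - u) * exp u" for u :: real
  have "g 0 \<le> g u"
  proof (rule DERIV_nonneg_imp_nondecreasing[OF True])
    fix y :: real
    have "(g has_real_derivative 1 - (1 - y) * exp y) (at y)"
      unfolding g_def by (auto intro!: derivative_eq_intros simp: algebra_simps)
    moreover have "0 \<le> 1 - (1 - y) * exp y"
    proof -
      have "(1 - y) * exp y \<le> exp (- y) * exp y" using exp_ge_add_one_self[of "- y"] by (intro mult_right_mono) auto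
      then show ?thesis by (simp add: exp_add[symmetric])
    qed
    ultimately show "\<exists>d. DERIV g y :> d \<and> 0 \<le> d" by blast
  qed
  then have "(2 - u) * exp u \<le> 2 + u" by (simp add: g_def)
  moreover have "0 < 2 - u" using assms True by simp
  ultimately have "exp u \<le> (2 + u) / (2 - u)" by (simp add: pos_le_divide_eq mult.commute)
  also have "\<dots> = 1 + u + u\<^sup>2 / (2 - u)" using \<open>0 < 2 - u\<close> by (simp add: field_simps power2_eq_square)
  also have "\<dots> \<le> 1 + u + u\<^sup>2 / (2 - x)" using assms True by (intro add_left_mono divide_left_mono) auto
  finally show ?thesis .
next
  case False
  then have "exp u \<le> 1 + u + u\<^sup>2 / 2" using exp_minus_le_quadratic[of "- u"] by simp
  also have "\<dots> \<le> 1 + u + u\<^sup>2 / (2 - x)" using assms by (intro add_left_mono divide_left_mono) auto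
  finally show ?thesis .
qed

section \<open>Exponential moments of bounded variables\<close>

context prob_space begin

lemma Hoeffding_mgf:
  fixes g :: "'a \<Rightarrow> real"
  assumes g: "g \<in> borel_measurable M" "\<And>x. x \<in> space M \<Longrightarrow> \<bar>g x\<bar> \<le> C"
  shows "expectation (\<lambda>x. exp (g x - expectation g)) \<le> exp (C\<^sup>2 / 2)"
proof -
  interpret interval_bounded_random_variable M g "- C" C
  proof
    show "AE x in M. g x \<in> {- C..C}"
    proof (rule AE_I2)
      fix x assume "x \<in> space M"
      from g(2)[OF this] show "g x \<in> {- C..C}" by (auto simp: abs_le_iff)
    qed
  qed (rule g(1))
  have i: "integrable M (\<lambda>x. exp (g x - expectation g))"
  proof (rule integrable_bounded)
    show "(\<lambda>x. exp (g x - expectation g)) \<in> borel_measurable M" using g(1) by measurable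
    fix x assume "x \<in> space M"
    then show "\<bar>exp (g x - expectation g)\<bar> \<le> exp (C - expectation g)" using g(2)[of x] by (simp add: abs_le_iff)
  qed
  have "nn_integral M (\<lambda>x. ennreal (exp (1 * (g x - expectation g)))) \<le> ennreal (exp (1\<^sup>2 * (C - expectation g - (- C - expectation g))\<^sup>2 / 8))"
    using Hoeffdings_lemma_nn_integral[of 1] by simp
  moreover have "1\<^sup>2 * (C - expectation g - (- C - expectation g))\<^sup>2 / 8 = C\<^sup>2 / 2" by (simp add: power2_eq_square)
  ultimately have "ennreal (expectation (\<lambda>x. exp (g x - expectation g))) \<le> ennreal (exp (C\<^sup>2 / 2))"
    using nn_integral_eq_integral[OF i] by simp
  then show ?thesis by simp
qed

text \<open>\<open>exp_le_Pade\<close> is applied to the centered variable: the linear term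
  integrates to \<open>0\<close> and the quadratic one to the variance.\<close>

lemma Bernstein_mgf:
  fixes g :: "'a \<Rightarrow> real"
  assumes g: "g \<in> borel_measurable M" "\<And>x. x \<in> space M \<Longrightarrow> \<bar>g x - expectation g\<bar> \<le> x0" "x0 < 2"
  shows "expectation (\<lambda>x. exp (g x - expectation g)) \<le> exp (variance g / (2 - x0))"
proof -
  define e where "e = expectation g"
  have ge: "\<bar>g x - e\<bar> \<le> x0" if "x \<in> space M" for x using g(2)[OF that] by (simp add: e_def)
  have gi: "integrable M g"
  proof (rule integrable_bounded[OF g(1)])
    fix x assume "x \<in> space M" then show "\<bar>g x\<bar> \<le> x0 + \<bar>e\<bar>" using ge[of x] by linarith
  qed
  have i1: "integrable M (\<lambda>x. exp (g x - e))"
  proof (rule integrable_bounded)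
    show "(\<lambda>x. exp (g x - e)) \<in> borel_measurable M" using g(1) by measurable
    fix x assume "x \<in> space M" then show "\<bar>exp (g x - e)\<bar> \<le> exp x0" using ge[of x] by (simp add: abs_le_iff)
  qed
  have i2: "integrable M (\<lambda>x. (g x - e)\<^sup>2)"
  proof (rule integrable_bounded)
    show "(\<lambda>x. (g x - e)\<^sup>2) \<in> borel_measurable M" using g(1) by measurable
    fix x assume x: "x \<in> space M"
    have "\<bar>g x - e\<bar>\<^sup>2 \<le> x0\<^sup>2" using ge[OF x] by (intro power_mono) auto
    then show "\<bar>(g x - e)\<^sup>2\<bar> \<le> x0\<^sup>2" by simp
  qed
  have "expectation (\<lambda>x. exp (g x - e)) \<le> expectation (\<lambda>x. 1 + (g x - e) + (g x - e)\<^sup>2 / (2 - x0))"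
  proof (rule integral_mono[OF i1])
    show "integrable M (\<lambda>x. 1 + (g x - e) + (g x - e)\<^sup>2 / (2 - x0))" using gi i2 by simp
    fix x assume "x \<in> space M"
    then show "exp (g x - e) \<le> 1 + (g x - e) + (g x - e)\<^sup>2 / (2 - x0)" using ge g(3) by (intro exp_le_Pade) auto
  qed
  also have "\<dots> = 1 + variance g / (2 - x0)" using gi i2 by (simp add: prob_space e_def)
  also have "\<dots> \<le> exp (variance g / (2 - x0))" by (rule exp_ge_add_one_self)
  finally show ?thesis by (simp add: e_def)
qed

end

section \<open>Lower tails of one linear statistic\<close>

context two_samples begin

definition linear_stat :: "('e \<Rightarrow> real) \<Rightarrow> (nat \<Rightarrow> 'e) \<Rightarrow> real" where
  "linear_stat f z = (\<Sum>i=1..n+m. weights n m i * f (z i))"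

context
  fixes f :: "'e \<Rightarrow> real" assumes fm: "f \<in> borel_measurable E" and fb: "\<And>x. x \<in> space E \<Longrightarrow> \<bar>f x\<bar> \<le> 1"
begin

lemma component_facts:
  "prob_space (component i)" "f \<in> borel_measurable (component i)" "space (component i) = space E"
  using prob_space_component[of i] fm measurable_cong_sets[OF sets_P refl, of borel] measurable_cong_sets[OF sets_Q refl, of borel]
    sets_eq_imp_space_eq[OF sets_P] sets_eq_imp_space_eq[OF sets_Q] by auto

lemma linear_stat_measurable: "linear_stat f \<in> borel_measurable sample"
  unfolding linear_stat_def
  by (intro borel_measurable_sum borel_measurable_times borel_measurable_const measurable_compose[OF coord_measurable fm])

lemma linear_stat_bounded: assumes "z \<in> space sample" shows "\<bar>linear_stat f z\<bar> \<le> 2"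
proof -
  have "\<bar>linear_stat f z\<bar> \<le> (\<Sum>i=1..n+m. \<bar>weights n m i\<bar>)"
    unfolding linear_stat_def
  proof (intro order_trans[OF sum_abs] sum_mono)
    fix i assume "i \<in> U"
    then show "\<bar>weights n m i * f (z i)\<bar> \<le> \<bar>weights n m i\<bar>"
      using fb[OF sample_space[OF assms]] by (simp add: abs_mult mult_left_le)
  qed
  then show ?thesis using weights_sums(3)[OF n m] by simp
qed

text \<open>The Chernoff bound in product form. \<open>f\<close> ranges over all bounded measurable
  functions, because it will be chosen near-optimal for \<open>ipm F P Q\<close> and such a function
  need not lie in the countable class \<open>G\<close>.\<close>

lemma linear_stat_lower_tail:
  assumes l: "0 < l"
    and mgf: "\<And>i. i \<in> U \<Longrightarrow> (\<integral>x. exp (- l * weights n m i * f x - (\<integral>x. - l * weights n m i * f x \<partial>component i)) \<partial>component i) \<le> exp (q i)"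
  shows "sample.prob {z \<in> space sample. linear_stat f z \<le> (\<integral>x. f x \<partial>P) - (\<integral>x. f x \<partial>Q) - t} \<le> exp (sum q U - l * t)"
proof -
  let ?D = "(\<integral>x. f x \<partial>P) - (\<integral>x. f x \<partial>Q)"
  define g where "g i x = - l * weights n m i * f x" for i x
  define \<mu> where "\<mu> i = (\<integral>x. g i x \<partial>component i)" for i
  have sum_mu: "sum \<mu> U = - l * ?D"
  proof -
    have "sum \<mu> U = (\<Sum>i\<in>{1..n}. \<mu> i) + (\<Sum>i\<in>{n+1..n+m}. \<mu> i)"
      by (subst sum.union_disjoint[symmetric]) (auto intro!: sum.cong)
    also have "(\<Sum>i\<in>{1..n}. \<mu> i) = (\<Sum>i\<in>{1..n}. - l * (1 / n) * (\<integral>x. f x \<partial>P))"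
      by (intro sum.cong refl) (simp add: \<mu>_def g_def weights_def)
    also have "(\<Sum>i\<in>{n+1..n+m}. \<mu> i) = (\<Sum>i\<in>{n+1..n+m}. - l * (- (1 / m)) * (\<integral>x. f x \<partial>Q))"
      by (intro sum.cong refl) (simp add: \<mu>_def g_def weights_def)
    finally show ?thesis using n m by (simp add: algebra_simps)
  qed
  have gm: "(\<lambda>x. exp (g i x - \<mu> i)) \<in> borel_measurable (component i)" for i
    unfolding g_def using component_facts(2)[of i] by measurable
  have gi: "integrable (component i) (\<lambda>x. exp (g i x - \<mu> i))" for i
  proof (rule prob_space.integrable_bounded[OF component_facts(1) gm])
    fix x assume "x \<in> space (component i)"
    then have "\<bar>f x\<bar> \<le> 1" using fb component_facts(3)[of i] by simp
    then have "g i x \<le> \<bar>- l * weights n m i\<bar> * 1" unfolding g_def by (rule mult_le_abs_bound)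
    then show "\<bar>exp (g i x - \<mu> i)\<bar> \<le> exp (\<bar>- l * weights n m i\<bar> * 1 - \<mu> i)" by simp
  qed
  have "sample.prob {z \<in> space sample. linear_stat f z \<le> ?D - t} = sample.prob {z \<in> space sample. t - ?D \<le> - linear_stat f z}"
    by (intro arg_cong[where f="measure sample"]) auto
  also have "\<dots> \<le> exp (- l * (t - ?D)) * (\<integral>z. exp (l * (- linear_stat f z)) \<partial>sample)"
    using l linear_stat_measurable linear_stat_bounded by (intro sample.Chernoff_bounded[where K=2]) auto
  also have "(\<integral>z. exp (l * (- linear_stat f z)) \<partial>sample) = (\<integral>z. exp (sum \<mu> U) * (\<Prod>i\<in>U. exp (g i (z i) - \<mu> i)) \<partial>sample)"
    by (intro Bochner_Integration.integral_cong refl)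
      (simp add: exp_sum[symmetric] exp_add[symmetric] linear_stat_def g_def sum_subtractf sum_distrib_left sum_negf[symmetric] mult_ac)
  also have "\<dots> = exp (sum \<mu> U) * (\<Prod>i\<in>U. \<integral>x. exp (g i x - \<mu> i) \<partial>component i)"
    by (subst product_integral_prod[symmetric]) (auto simp: gi)
  also have "exp (- l * (t - ?D)) * (exp (sum \<mu> U) * (\<Prod>i\<in>U. \<integral>x. exp (g i x - \<mu> i) \<partial>component i))
     \<le> exp (- l * (t - ?D)) * (exp (sum \<mu> U) * (\<Prod>i\<in>U. exp (q i)))"
    using mgf unfolding g_def \<mu>_def by (intro mult_left_mono prod_mono) (auto intro!: integral_nonneg)
  also have "\<dots> = exp (sum q U - l * t)"
    unfolding sum_mu by (simp add: exp_sum[symmetric] exp_add[symmetric] algebra_simps)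
  finally show ?thesis .
qed

lemma linear_stat_Hoeffding:
  assumes L: "0 < L"
  shows "sample.prob {z \<in> space sample. linear_stat f z \<le> (\<integral>x. f x \<partial>P) - (\<integral>x. f x \<partial>Q) - sqrt kappa * sqrt (2 * L)} \<le> exp (- L)"
proof -
  \<comment> \<open>The minimizer of \<open>l\<^sup>2 / 2 * kappa - l * t\<close> at the deviation
    \<open>t = sqrt kappa * sqrt (2 * L)\<close>; the squared weights sum to
    \<open>kappa\<close>.\<close>
  define l where "l = sqrt (2 * L) / sqrt kappa"
  have l: "0 < l" using L kappa_pos by (simp add: l_def)
  have "sample.prob {z \<in> space sample. linear_stat f z \<le> (\<integral>x. f x \<partial>P) - (\<integral>x. f x \<partial>Q) - sqrt kappa * sqrt (2 * L)}
    \<le> exp ((\<Sum>i\<in>U. (l * weights n m i)\<^sup>2 / 2) - l * (sqrt kappa * sqrt (2 * L)))"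
  proof (rule linear_stat_lower_tail[OF l])
    fix i assume "i \<in> U"
    have "(\<integral>x. exp (- l * weights n m i * f x - (\<integral>x. - l * weights n m i * f x \<partial>component i)) \<partial>component i) \<le> exp (\<bar>l * weights n m i\<bar>\<^sup>2 / 2)"
    proof (rule prob_space.Hoeffding_mgf[OF component_facts(1)])
      show "(\<lambda>x. - l * weights n m i * f x) \<in> borel_measurable (component i)" using component_facts(2)[of i] by measurable
      fix x assume "x \<in> space (component i)"
      then have "\<bar>f x\<bar> \<le> 1" using fb component_facts(3)[of i] by simp
      then have "\<bar>- l * weights n m i\<bar> * \<bar>f x\<bar> \<le> \<bar>- l * weights n m i\<bar> * 1" by (intro mult_left_mono) auto
      then show "\<bar>- l * weights n m i * f x\<bar> \<le> \<bar>l * weights n m i\<bar>" by (simp add: abs_mult)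
    qed
    then show "(\<integral>x. exp (- l * weights n m i * f x - (\<integral>x. - l * weights n m i * f x \<partial>component i)) \<partial>component i) \<le> exp ((l * weights n m i)\<^sup>2 / 2)"
      by simp
  qed
  also have "(\<Sum>i\<in>U. (l * weights n m i)\<^sup>2 / 2) = l\<^sup>2 / 2 * (\<Sum>i\<in>U. (weights n m i)\<^sup>2)"
    by (simp add: sum_distrib_left power_mult_distrib)
  also have "\<dots> - l * (sqrt kappa * sqrt (2 * L)) = - L"
  proof -
    have "l\<^sup>2 * kappa = 2 * L" using kappa_pos L by (simp add: l_def power_divide)
    moreover have "l * (sqrt kappa * sqrt (2 * L)) = 2 * L" using kappa_pos L by (simp add: l_def)
    ultimately show ?thesis unfolding weights_sums(2)[OF n m, folded kappa_def] by simp
  qed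
  finally show ?thesis .
qed

lemma linear_stat_Bernstein:
  assumes L: "0 < L" and v: "0 < v" "PP.variance f / n + QQ.variance f / m \<le> v" and b: "b = max (1 / n) (1 / m)"
  shows "sample.prob {z \<in> space sample. linear_stat f z \<le> (\<integral>x. f x \<partial>P) - (\<integral>x. f x \<partial>Q) - (sqrt (2 * v * L) + b * L)} \<le> exp (- L)"
proof -
  \<comment> \<open>With \<open>v = 2 * L * r\<^sup>2\<close> the deviation is
    \<open>2 * L * r + b * L\<close>, and \<open>l = 1 / (b + r)\<close> makes the exponent
    \<open>L * r / (b + r) - (2 * L * r + b * L) / (b + r)\<close>, which is exactly
    \<open>- L\<close>. Positivity of \<open>v\<close> gives \<open>l * b < 1\<close>.\<close>
  define r where "r = sqrt (v / (2 * L))"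
  have r: "0 < r" "v = 2 * L * r\<^sup>2" using v L by (auto simp: r_def)
  have bpos: "0 < b" using n unfolding b by (simp add: less_max_iff_disj)
  define l where "l = 1 / (b + r)"
  have l: "0 < l" "l * b < 1" "1 - l * b = r / (b + r)" using r bpos by (auto simp: l_def field_simps)
  have wb: "\<bar>weights n m i\<bar> \<le> b" if "i \<in> U" for i using that by (auto simp: weights_def b)
  define vi where "vi i = prob_space.variance (component i) f" for i
  have "sample.prob {z \<in> space sample. linear_stat f z \<le> (\<integral>x. f x \<partial>P) - (\<integral>x. f x \<partial>Q) - (sqrt (2 * v * L) + b * L)}
    \<le> exp ((\<Sum>i\<in>U. (l * weights n m i)\<^sup>2 * vi i / (2 - 2 * (l * b))) - l * (sqrt (2 * v * L) + b * L))"
  proof (rule linear_stat_lower_tail[OF l(1)])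
    fix i assume i: "i \<in> U"
    interpret C: prob_space "component i" by (rule component_facts(1))
    define g where "g x = - l * weights n m i * f x" for x
    have fi: "integrable (component i) f" using component_facts(2)[of i] fb component_facts(3)[of i]
      by (intro C.integrable_bounded[where C=1]) auto
    have Eg: "C.expectation g = - l * weights n m i * C.expectation f" unfolding g_def using fi by simp
    have Ef: "\<bar>C.expectation f\<bar> \<le> 1" using component_facts(2)[of i] fb component_facts(3)[of i] by (intro C.abs_expectation_le) auto
    have "C.expectation (\<lambda>x. exp (g x - C.expectation g)) \<le> exp (C.variance g / (2 - 2 * (l * b)))"
    proof (rule C.Bernstein_mgf)
      show "g \<in> borel_measurable (component i)" unfolding g_def using component_facts(2)[of i] by measurable
      fix x assume "x \<in> space (component i)"
      then have "\<bar>f x\<bar> \<le> 1" using fb component_facts(3)[of i] by simp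
      then have d: "\<bar>f x - C.expectation f\<bar> \<le> 2" using Ef by linarith
      have "\<bar>g x - C.expectation g\<bar> = \<bar>l * weights n m i\<bar> * \<bar>f x - C.expectation f\<bar>"
        unfolding Eg g_def right_diff_distrib[symmetric] abs_mult by simp
      also have "\<dots> \<le> (l * b) * 2"
        using d wb[OF i] l by (intro mult_mono) (auto simp: abs_mult)
      finally show "\<bar>g x - C.expectation g\<bar> \<le> 2 * (l * b)" by simp
    next
      show "2 * (l * b) < 2" using l by simp
    qed
    also have "C.variance g = (l * weights n m i)\<^sup>2 * vi i"
    proof -
      have "C.variance g = C.expectation (\<lambda>x. (l * weights n m i)\<^sup>2 * (f x - C.expectation f)\<^sup>2)"
        unfolding Eg unfolding g_def right_diff_distrib[symmetric] by (simp add: power_mult_distrib)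
      then show ?thesis by (simp add: vi_def)
    qed
    finally show "(\<integral>x. exp (- l * weights n m i * f x - (\<integral>x. - l * weights n m i * f x \<partial>component i)) \<partial>component i)
      \<le> exp ((l * weights n m i)\<^sup>2 * vi i / (2 - 2 * (l * b)))" by (simp add: g_def)
  qed
  also have "(\<Sum>i\<in>U. (l * weights n m i)\<^sup>2 * vi i / (2 - 2 * (l * b))) = l\<^sup>2 / (2 - 2 * (l * b)) * (PP.variance f / n + QQ.variance f / m)"
  proof -
    have "(\<Sum>i\<in>U. (weights n m i)\<^sup>2 * vi i) = (\<Sum>i\<in>{1..n}. (weights n m i)\<^sup>2 * vi i) + (\<Sum>i\<in>{n+1..n+m}. (weights n m i)\<^sup>2 * vi i)"
      by (subst sum.union_disjoint[symmetric]) (auto intro!: sum.cong)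
    also have "(\<Sum>i\<in>{1..n}. (weights n m i)\<^sup>2 * vi i) = (\<Sum>i\<in>{1..n}. (1 / n)\<^sup>2 * PP.variance f)"
      by (intro sum.cong refl) (simp add: vi_def weights_def)
    also have "(\<Sum>i\<in>{n+1..n+m}. (weights n m i)\<^sup>2 * vi i) = (\<Sum>i\<in>{n+1..n+m}. (1 / m)\<^sup>2 * QQ.variance f)"
      by (intro sum.cong refl) (simp add: vi_def weights_def)
    finally have *: "(\<Sum>i\<in>U. (weights n m i)\<^sup>2 * vi i) = PP.variance f / n + QQ.variance f / m"
      using n m by (simp add: power2_eq_square)
    show ?thesis unfolding *[symmetric] by (simp add: sum_distrib_left sum_divide_distrib power_mult_distrib mult_ac)
  qed
  also have "exp (l\<^sup>2 / (2 - 2 * (l * b)) * (PP.variance f / n + QQ.variance f / m) - l * (sqrt (2 * v * L) + b * L))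
    \<le> exp (l\<^sup>2 / (2 - 2 * (l * b)) * v - l * (sqrt (2 * v * L) + b * L))"
    unfolding exp_le_cancel_iff using v l by (intro diff_right_mono mult_left_mono) auto
  also have "l\<^sup>2 / (2 - 2 * (l * b)) * v - l * (sqrt (2 * v * L) + b * L) = - L"
  proof -
    have sq: "sqrt (2 * v * L) = 2 * L * r"
    proof (rule real_sqrt_unique)
      show "(2 * L * r)\<^sup>2 = 2 * v * L" unfolding r(2) by (simp add: power2_eq_square)
    qed (use L r in simp)
    have "2 - 2 * (l * b) = 2 * (r / (b + r))" using l(3) by simp
    then have "l\<^sup>2 / (2 - 2 * (l * b)) * v = (1 / (b + r))\<^sup>2 / (2 * (r / (b + r))) * (2 * L * r\<^sup>2)"
      using r(2) by (simp add: l_def)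
    also have "\<dots> = L * r / (b + r)"
    proof -
      have "(1 / c)\<^sup>2 / (2 * (r / c)) * (2 * L * r\<^sup>2) = L * r / c" if "0 < c" for c
        using r(1) that by (simp add: field_simps power2_eq_square)
      then show ?thesis using r(1) bpos by simp
    qed
    finally have 1: "l\<^sup>2 / (2 - 2 * (l * b)) * v = L * r / (b + r)" .
    have 2: "l * (sqrt (2 * v * L) + b * L) = (2 * L * r + b * L) / (b + r)" unfolding sq by (simp add: l_def)
    have "L * r / (b + r) - (2 * L * r + b * L) / (b + r) = (- L) * (b + r) / (b + r)"
      unfolding diff_divide_distrib[symmetric] by (simp add: algebra_simps)
    also have "\<dots> = - L" using r bpos by simp
    finally show ?thesis unfolding 1 2 .
  qed
  finally show ?thesis .
qed

end

text \<open>Off the event that the permutation mean reaches \<open>w\<close>, the gap between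
  \<open>t\<close> and \<open>w\<close> makes the conditional Chernoff bound small enough. The event
  itself is \<open>perm_mean_stat_tail\<close> at \<open>1/2\<close>: dividing by
  \<open>1 - 1/2\<close> is the factor \<open>2\<close> before \<open>EB\<close>, and
  \<open>1/2 * (N / 4) * (12 / N) = 3/2\<close>.\<close>

theorem perm_tail_core_Hoeffding:
  assumes EB: "sample.expectation perm_mean_stat \<le> EB" and L: "0 < L" and LB: "0 < LB"
    and t: "2 * EB + 12 / (real n + real m) * L + sqrt kappa * (2 * sqrt (2 * LB)) \<le> t"
  shows "sample.prob {z \<in> space sample. exp (- LB) < perm_tail t z} \<le> exp (- (3 / 2 * L))"
proof -
  define N where "N = real n + real m" have N: "0 < N" using n by (simp add: N_def)
  define w where "w = 2 * EB + 12 / N * L"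
  have sub: "{z \<in> space sample. exp (- LB) < perm_tail t z} \<subseteq> {z \<in> space sample. w \<le> perm_mean_stat z}"
  proof (clarify, rule ccontr)
    fix z assume z: "z \<in> space sample" and big: "exp (- LB) < perm_tail t z" and "\<not> w \<le> perm_mean_stat z"
    then have W: "perm_mean_stat z < w" by simp
    \<comment> \<open>The minimizer of \<open>kappa * l\<^sup>2 - l * x\<close> at the gap
      \<open>x = sqrt kappa * (2 * sqrt (2 * LB))\<close>. The minimum is \<open>- 2 * LB\<close>,
      below the required \<open>- LB\<close>.\<close>
    define l where "l = sqrt (2 * LB) / sqrt kappa"
    have l: "0 < l" using LB kappa_pos by (simp add: l_def)
    have "perm_tail t z \<le> exp (- l * t) * exp (l * perm_mean_stat z + kappa * l\<^sup>2)"
      using perm_tail_Chernoff[OF l, of t z] perm_mgf_Hoeffding[OF z l]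
      by (meson exp_ge_zero mult_left_mono order_trans)
    also have "\<dots> = exp (kappa * l\<^sup>2 - l * (t - perm_mean_stat z))" by (simp add: exp_add[symmetric] algebra_simps)
    also have "\<dots> \<le> exp (- LB)"
      unfolding exp_le_cancel_iff
    proof -
      have kl: "kappa * l\<^sup>2 = 2 * LB" using kappa_pos LB by (simp add: l_def power_divide)
      have "l * (sqrt kappa * (2 * sqrt (2 * LB))) = 4 * LB" using kappa_pos LB by (simp add: l_def)
      moreover have "l * (sqrt kappa * (2 * sqrt (2 * LB))) \<le> l * (t - perm_mean_stat z)"
        using W t l unfolding w_def N_def by (intro mult_left_mono) auto
      ultimately show "kappa * l\<^sup>2 - l * (t - perm_mean_stat z) \<le> - LB" using kl LB by linarith
    qed
    finally show False using big by simp
  qed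
  have "sample.prob {z \<in> space sample. exp (- LB) < perm_tail t z} \<le> sample.prob {z \<in> space sample. w \<le> perm_mean_stat z}"
    using sub perm_mean_stat_measurable by (intro sample.finite_measure_mono) auto
  also have "\<dots> \<le> exp (1 / 2 * (real (n + m) / 4) * (sample.expectation perm_mean_stat / (1 - 1 / 2) - w))"
    by (rule perm_mean_stat_tail) auto
  also have "\<dots> \<le> exp (- (3 / 2 * L))"
    unfolding exp_le_cancel_iff
  proof -
    have "1 / 2 * (N / 4) * (sample.expectation perm_mean_stat / (1 - 1 / 2) - w) \<le> 1 / 2 * (N / 4) * (- (12 / N * L))"
      using EB N by (intro mult_left_mono) (auto simp: w_def)
    also have "\<dots> = - (3 / 2 * L)" using N by simp
    finally show "1 / 2 * (real (n + m) / 4) * (sample.expectation perm_mean_stat / (1 - 1 / 2) - w) \<le> - (3 / 2 * L)"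
      by (simp add: N_def)
  qed
  finally show ?thesis .
qed

lemma kappa_max: "2 \<le> kappa * max n m"
proof -
  have "1 \<le> real (max n m) / n" "1 \<le> real (max n m) / m" using n m by auto
  moreover have "kappa * max n m = real (max n m) / n + real (max n m) / m" by (simp add: kappa_def distrib_right)
  ultimately show ?thesis by linarith
qed

text \<open>The parameters \<open>25/28\<close>, \<open>11/25\<close> and \<open>7/8\<close> are tuned so that, for \<open>exp (-L) < 1/3\<close>, all error terms together stay below \<open>3 * exp (-L)\<close>.\<close>

theorem perm_tail_core_dispersion:
  assumes EB: "sample.expectation perm_mean_stat \<le> EB" and L: "0 < L" and LB: "0 < LB" "48 * kappa * LB < 1"
    and R: "sample.expectation (dispersion_on U) + 4 * L \<le> R"
    and t: "2 * EB + 12 / (real n + real m) * L + 2 * kappa * sqrt LB * sqrt R \<le> t"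
  shows "sample.prob {z \<in> space sample. exp (- LB) < perm_tail t z} \<le> exp (- (7 / 6 * L)) + exp (- (3 / 2 * L))"
proof -
  define N where "N = real n + real m" have N: "0 < N" using n by (simp add: N_def)
  \<comment> \<open>\<open>2 * (25/28) = 1 / (1 - 11/25)\<close> matches the tail of the permutation
    mean at \<open>11/25\<close>, and \<open>25/28 = 1 - 3/28\<close> compensates the division by
    \<open>1 - l * h\<close>. Similarly, in \<open>s\<close> the square of \<open>4/3\<close> is
    \<open>16/9 = 1 / (1 - 7/16)\<close>, the factor of \<open>dispersion_tail\<close> at
    \<open>7/8\<close>.\<close>
  define w where "w = (2 * EB + 12 / N * L) * (25 / 28)"
  define s where "s = 4 / 3 * sqrt R"
  have "0 \<le> sample.expectation (dispersion_on U)"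
    using dispersion_bounds(3)[of _ U] by (intro integral_nonneg_AE AE_I2) auto
  then have Rpos: "0 < R" using R L by linarith
  then have s: "0 < s" "s\<^sup>2 = 16 / 9 * R" by (auto simp: s_def power_mult_distrib power_divide)
  have sub: "{z \<in> space sample. exp (- LB) < perm_tail t z}
    \<subseteq> {z \<in> space sample. w \<le> perm_mean_stat z} \<union> {z \<in> space sample. 16 / 9 * R \<le> dispersion_on U z}"
  proof (rule subsetI, rule ccontr)
    fix z assume "z \<in> {z \<in> space sample. exp (- LB) < perm_tail t z}"
      and "z \<notin> {z \<in> space sample. w \<le> perm_mean_stat z} \<union> {z \<in> space sample. 16 / 9 * R \<le> dispersion_on U z}"
    then have z: "z \<in> space sample" and big: "exp (- LB) < perm_tail t z"
      and W: "perm_mean_stat z < w" and D: "dispersion_on U z \<le> s\<^sup>2" using s by auto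
    \<comment> \<open>Chosen so that \<open>l * (kappa * s) = sqrt (2 * LB)\<close>: the variance
      term then equals \<open>LB\<close>, up to the factor \<open>g\<close>.\<close>
    define l where "l = sqrt (2 * LB) / (kappa * s)"
    have l: "0 < l" using LB kappa_pos s by (simp add: l_def)
    define h where "h = sqrt kappa * s / max n m"
    \<comment> \<open>The square of \<open>l * h\<close> is
      \<open>2 * (kappa * LB) / (kappa * max n m)\<^sup>2\<close>; \<open>kappa_max\<close> and
      \<open>48 * kappa * LB < 1\<close> bound it by \<open>1/96\<close>, which is below the square
      of \<open>3/28\<close>.\<close>
    have lh: "l * h \<le> 3 / 28"
    proof (rule power2_le_imp_le)
      have "(l * h)\<^sup>2 = (sqrt (2 * LB))\<^sup>2 * (sqrt kappa)\<^sup>2 / (kappa * max n m)\<^sup>2"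
        using s kappa_pos by (simp add: l_def h_def power_mult_distrib power_divide)
      also have "\<dots> = 2 * (kappa * LB) / (kappa * max n m)\<^sup>2" using LB kappa_pos by simp
      also have "\<dots> \<le> 2 * (kappa * LB) / 2\<^sup>2"
      proof (rule divide_left_mono)
        show "(2::real)\<^sup>2 \<le> (kappa * max n m)\<^sup>2" using kappa_max by (intro power_mono) auto
        then show "0 < (kappa * max n m)\<^sup>2 * (2::real)\<^sup>2" using kappa_pos n by simp
      qed (use LB kappa_pos in simp)
      also have "\<dots> \<le> 2 * (1 / 48) / 2\<^sup>2" using LB by (simp add: mult.assoc mult.commute[of kappa])
      also have "\<dots> \<le> (3 / 28)\<^sup>2" by (simp add: power2_eq_square)
      finally show "(l * h)\<^sup>2 \<le> (3 / 28)\<^sup>2" .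
    qed simp
    have lh1: "l * h < 1" using lh by linarith
    define g where "g = 1 / (1 - l * h)"
    have g: "0 < g" "g \<le> 28 / 25" using lh by (auto simp: g_def divide_le_eq)
    have mgf: "perm_avg U (\<lambda>\<sigma>. exp (l * weighted_stat G (n+m) (\<lambda>i. weights n m (\<sigma> i)) z))
      \<le> exp (l * (perm_mean_stat z + l * (kappa\<^sup>2 * s\<^sup>2 / 2)) / (1 - l * h))"
      unfolding h_def using z s D l lh1[unfolded h_def] by (intro perm_mgf_dispersion) auto
    have ll: "l * (l * (kappa\<^sup>2 * s\<^sup>2 / 2)) = LB"
    proof -
      have "l * (l * (kappa\<^sup>2 * s\<^sup>2 / 2)) = (l * (kappa * s))\<^sup>2 / 2" by (simp add: power_mult_distrib power2_eq_square)
      also have "l * (kappa * s) = sqrt (2 * LB)" using kappa_pos s by (simp add: l_def)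
      finally show ?thesis using LB by simp
    qed
    have "perm_tail t z \<le> exp (- l * t) * exp (l * (perm_mean_stat z + l * (kappa\<^sup>2 * s\<^sup>2 / 2)) / (1 - l * h))"
      using perm_tail_Chernoff[OF l, of t z] mgf by (meson exp_ge_zero mult_left_mono order_trans)
    also have "\<dots> = exp (g * (l * perm_mean_stat z) + g * LB - l * t)"
    proof -
      have "l * (perm_mean_stat z + l * (kappa\<^sup>2 * s\<^sup>2 / 2)) / (1 - l * h) = g * (l * perm_mean_stat z + l * (l * (kappa\<^sup>2 * s\<^sup>2 / 2)))"
      proof -
        have "l * (a + c) / (1 - l * h) = g * (l * a + l * c)" for a c
          by (simp add: g_def distrib_left add_divide_distrib)
        then show ?thesis .
      qed
      then show ?thesis unfolding ll by (simp add: exp_add[symmetric] algebra_simps)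
    qed
    also have "\<dots> \<le> exp (- LB)"
    proof -
      have 1: "g * (l * perm_mean_stat z) \<le> 28 / 25 * (l * w)"
        using g l W perm_mean_stat_bounds(1)[OF z] by (intro mult_mono mult_left_mono) auto
      have 2: "g * LB \<le> 28 / 25 * LB" using g LB by (intro mult_right_mono) auto
      have "28 / 25 * w = 2 * EB + 12 / N * L" by (simp add: w_def)
      then have "28 / 25 * w + 2 * kappa * sqrt LB * sqrt R \<le> t" using t unfolding N_def by linarith
      then have 3: "l * (28 / 25 * w + 2 * kappa * sqrt LB * sqrt R) \<le> l * t"
        using l by (intro mult_left_mono) auto
      have 4: "l * (2 * kappa * sqrt LB * sqrt R) = 3 / 2 * sqrt 2 * LB"
      proof -
        have R': "sqrt R = 3 / 4 * s" by (simp add: s_def)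
        have "l * (2 * kappa * sqrt LB * sqrt R) = sqrt 2 * (sqrt LB * sqrt LB) * (3 / 2)"
          unfolding R' using kappa_pos s by (simp add: l_def real_sqrt_mult)
        then show ?thesis using LB by simp
      qed
      \<comment> \<open>The gain \<open>3/2 * sqrt 2 * LB\<close> must cover the variance term
        \<open>28/25 * LB\<close> and the target \<open>LB\<close>. The margin is narrow:
        \<open>2.12\<close> against about \<open>2.1213\<close>.\<close>
      have "53 / 25 \<le> 3 / 2 * sqrt 2"
      proof -
        have "(1.414::real) \<le> sqrt 2" by (rule real_le_rsqrt) (simp add: power2_eq_square)
        then show ?thesis by simp
      qed
      then have "53 / 25 * LB \<le> 3 / 2 * sqrt 2 * LB" using LB by (intro mult_right_mono) auto
      then have "g * (l * perm_mean_stat z) + g * LB - l * t \<le> - LB"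
        using 1 2 3 4 unfolding distrib_left mult.left_commute[of l "28 / 25"] by linarith
      then show ?thesis by simp
    qed
    finally show False using big by simp
  qed
  have m1: "{z \<in> space sample. w \<le> perm_mean_stat z} \<in> sets sample" using perm_mean_stat_measurable by measurable
  have m2: "{z \<in> space sample. 16 / 9 * R \<le> dispersion_on U z} \<in> sets sample" using dispersion_measurable[of U] by measurable
  have "sample.prob {z \<in> space sample. exp (- LB) < perm_tail t z}
    \<le> sample.prob ({z \<in> space sample. w \<le> perm_mean_stat z} \<union> {z \<in> space sample. 16 / 9 * R \<le> dispersion_on U z})"
    using sub m1 m2 by (intro sample.finite_measure_mono) auto
  also have "\<dots> \<le> sample.prob {z \<in> space sample. w \<le> perm_mean_stat z} + sample.prob {z \<in> space sample. 16 / 9 * R \<le> dispersion_on U z}"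
    using m1 m2 by (rule measure_Un_le)
  also have "sample.prob {z \<in> space sample. w \<le> perm_mean_stat z} \<le> exp (- (7 / 6 * L))"
  proof -
    have "sample.prob {z \<in> space sample. w \<le> perm_mean_stat z} \<le> exp (11 / 25 * (real (n + m) / 4) * (sample.expectation perm_mean_stat / (1 - 11 / 25) - w))"
      by (rule perm_mean_stat_tail) auto
    also have "\<dots> \<le> exp (- (7 / 6 * L))" unfolding exp_le_cancel_iff
    proof -
      \<comment> \<open>The constants combine to \<open>11/25 * 1/4 * 12 * 25/28 = 33/28\<close>,
        slightly above \<open>7/6\<close>.\<close>
      have "11 / 25 * (N / 4) * (sample.expectation perm_mean_stat / (1 - 11 / 25) - w) \<le> 11 / 25 * (N / 4) * (- (12 / N * L * (25 / 28)))"
        using EB N by (intro mult_left_mono) (auto simp: w_def algebra_simps)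
      also have "\<dots> = - (33 / 28 * L)" using N by simp
      also have "\<dots> \<le> - (7 / 6 * L)" using L by simp
      finally show "11 / 25 * (real (n + m) / 4) * (sample.expectation perm_mean_stat / (1 - 11 / 25) - w) \<le> - (7 / 6 * L)"
        by (simp add: N_def)
    qed
    finally show ?thesis .
  qed
  also have "sample.prob {z \<in> space sample. 16 / 9 * R \<le> dispersion_on U z} \<le> exp (- (3 / 2 * L))"
  proof -
    have "sample.prob {z \<in> space sample. 16 / 9 * R \<le> dispersion_on U z}
      \<le> exp ((7 / 8) / 4 * (sample.expectation (dispersion_on U) / (1 - (7 / 8) / 2) - 16 / 9 * R))"
      by (rule dispersion_tail) auto
    \<comment> \<open>The exponent is at most
      \<open>- (7/32) * (16/9) * (4 * L) = - (14/9) * L\<close>.\<close>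
    also have "\<dots> \<le> exp (- (3 / 2 * L))" unfolding exp_le_cancel_iff using R L by simp
    finally show ?thesis .
  qed
  finally show ?thesis by simp
qed

end

section \<open>Binomial tails, quantiles, separability and laws\<close>

lemma quadratic_le_neg_ln:
  fixes u :: real
  assumes "0 \<le> u" "u < 1" shows "u + u\<^sup>2 / 2 \<le> - ln (1 - u)"
proof -
  define g where "g u = - ln (1 - u) - u - u\<^sup>2 / 2" for u :: real
  have "g 0 \<le> g u"
  proof (rule DERIV_nonneg_imp_nondecreasing[OF assms(1)])
    fix y :: real assume y: "0 \<le> y" "y \<le> u"
    then have y1: "y < 1" using assms by simp
    have "(g has_real_derivative 1 / (1 - y) - 1 - y) (at y)"
      unfolding g_def using y1 by (auto intro!: derivative_eq_intros simp: field_simps)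
    moreover have "1 / (1 - y) - 1 - y = y\<^sup>2 / (1 - y)" using y1 by (simp add: field_simps power2_eq_square)
    moreover have "0 \<le> y\<^sup>2 / (1 - y)" using y1 by simp
    ultimately show "\<exists>d. DERIV g y :> d \<and> 0 \<le> d" by metis
  qed
  then show ?thesis by (simp add: g_def)
qed

text \<open>With \<open>u = s / (\<mu> + s)\<close> the logarithm is \<open>- ln (1 - u)\<close>, at
  least \<open>u + u\<^sup>2 / 2\<close>, so the exponent is at most
  \<open>- s\<^sup>2 / (2 * (\<mu> + s))\<close>. The denominator contains the threshold of the
  count and not its mean, which suits the term \<open>3 * \<alpha> / B\<close> in
  \<open>alpha_B\<close>.\<close>

lemma Chernoff_exponent_le:
  fixes \<mu> s L c :: real
  assumes \<mu>: "0 < \<mu>" and s: "0 < s" and L: "3 * (\<mu> + s) * L \<le> s\<^sup>2"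
  shows "- (\<mu> + s) * ln ((\<mu> + s) / \<mu>) + s \<le> - (3 / 2 * L)"
proof -
  define k where "k = \<mu> + s"
  have k: "0 < k" using \<mu> s by (simp add: k_def)
  define u where "u = s / k"
  have u: "0 \<le> u" "u < 1" "k * u = s" using k \<mu> s by (auto simp: u_def k_def)
  have mu: "\<mu> / k = 1 - u" using k by (simp add: u_def k_def field_simps)
  have "ln (k / \<mu>) = - ln (1 - u)" unfolding mu[symmetric] using k \<mu> by (simp add: ln_div)
  then have "u + u\<^sup>2 / 2 \<le> ln (k / \<mu>)" using quadratic_le_neg_ln[OF u(1,2)] by simp
  then have "k * (u + u\<^sup>2 / 2) \<le> k * ln (k / \<mu>)" using k by (intro mult_left_mono) auto
  moreover have "k * (u + u\<^sup>2 / 2) = s + s * u / 2" using u(3) by (simp add: distrib_left power2_eq_square)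
  moreover have "3 * L \<le> s * u"
  proof -
    have "3 * L * k \<le> s * s" using L by (simp add: k_def power2_eq_square mult_ac)
    then show ?thesis unfolding u_def using k by (simp add: pos_le_divide_eq)
  qed
  ultimately show ?thesis unfolding k_def[symmetric] by linarith
qed

text \<open>Each Bernoulli factor is bounded by the Poisson one,
  \<open>exp ((exp \<theta> - 1) * a)\<close>, for which only the upper bound \<open>a\<close> on
  the success probability matters; \<theta> is optimal for the Poisson law of mean
  \<open>a * B\<close>.\<close>

lemma (in prob_space) binomial_upper_tail:
  fixes k a :: real and B :: nat
  assumes A: "A \<in> events" "prob A \<le> a" and a: "0 < a" and k: "a * B < k"
  shows "measure (PiM {1..B} (\<lambda>_. M)) {c \<in> space (PiM {1..B} (\<lambda>_. M)). k \<le> (\<Sum>b=1..B. indicator A (c b))}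
    \<le> exp (- k * ln (k / (a * B)) + (k - a * B))"
proof (cases "B = 0")
  case True
  then show ?thesis using k by simp
next
  case False
  interpret F: prob_family "\<lambda>_::nat. M" by (rule prob_family.intro) (rule prob_space_axioms)
  interpret Pi: prob_space "PiM {1..B} (\<lambda>_. M)" by (rule F.prob_space_product)
  have aB: "0 < a * B" using a False by simp
  define \<theta> where "\<theta> = ln (k / (a * B))"
  have e\<theta>: "exp \<theta> = k / (a * B)" unfolding \<theta>_def using k aB by (intro exp_ln divide_pos_pos) auto
  have \<theta>: "0 < \<theta>" unfolding \<theta>_def using k aB by (intro ln_gt_zero) simp
  have im: "(\<lambda>c. indicator A (c b) :: real) \<in> borel_measurable (PiM {1..B} (\<lambda>_. M))" if "b \<in> {1..B}" for b
    using measurable_compose[OF measurable_component_singleton[OF that] borel_measurable_indicator[OF A(1)]] .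
  have "Pi.prob {c \<in> space (PiM {1..B} (\<lambda>_. M)). k \<le> (\<Sum>b=1..B. indicator A (c b))}
    \<le> exp (- \<theta> * k) * Pi.expectation (\<lambda>c. exp (\<theta> * (\<Sum>b=1..B. indicator A (c b))))"
  proof (rule Pi.Chernoff_bounded[OF \<theta>])
    show "(\<lambda>c. \<Sum>b=1..B. indicator A (c b) :: real) \<in> borel_measurable (PiM {1..B} (\<lambda>_. M))"
      using im by (intro borel_measurable_sum) auto
    show "\<bar>\<Sum>b=1..B. indicator A (c b)\<bar> \<le> real B" for c :: "nat \<Rightarrow> 'a"
      using abs_sum_le_card[of "{1..B}" "\<lambda>b. indicator A (c b)" 1] by (simp add: indicator_def)
  qed
  also have "Pi.expectation (\<lambda>c. exp (\<theta> * (\<Sum>b=1..B. indicator A (c b))))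
    = Pi.expectation (\<lambda>c. \<Prod>b=1..B. exp (\<theta> * indicator A (c b)))"
    by (simp only: sum_distrib_left exp_sum finite_atLeastAtMost)
  also have "\<dots> = (\<Prod>b=1..B. expectation (\<lambda>x. exp (\<theta> * indicator A x)))"
  proof (rule F.product_integral_prod)
    show "integrable M (\<lambda>x. exp (\<theta> * indicator A x))"
    proof (rule integrable_bounded)
      show "(\<lambda>x. exp (\<theta> * indicator A x)) \<in> borel_measurable M" using A(1) by measurable
      show "\<bar>exp (\<theta> * indicator A x)\<bar> \<le> exp \<theta>" for x using \<theta> by (simp add: indicator_def)
    qed
  qed simp
  also have "expectation (\<lambda>x. exp (\<theta> * indicator A x)) = 1 + (exp \<theta> - 1) * prob A"
  proof -
    have "expectation (\<lambda>x. exp (\<theta> * indicator A x)) = expectation (\<lambda>x. 1 + (exp \<theta> - 1) * indicator A x)"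
      by (intro Bochner_Integration.integral_cong) (auto simp: indicator_def)
    also have "\<dots> = 1 + (exp \<theta> - 1) * prob A"
    proof -
      have "integrable M (indicator A :: 'a \<Rightarrow> real)"
        using A(1) by (intro integrable_bounded[where C=1]) (auto simp: indicator_def)
      then show ?thesis using A(1) by (simp add: prob_space)
    qed
    finally show ?thesis .
  qed
  also have "(\<Prod>b=1..B. 1 + (exp \<theta> - 1) * prob A) \<le> exp ((exp \<theta> - 1) * a) ^ B"
  proof -
    have "1 + (exp \<theta> - 1) * prob A \<le> 1 + (exp \<theta> - 1) * a" using A(2) \<theta> by (intro add_left_mono mult_left_mono) auto
    also have "\<dots> \<le> exp ((exp \<theta> - 1) * a)" by (rule exp_ge_add_one_self)
    finally have "(1 + (exp \<theta> - 1) * prob A) ^ B \<le> exp ((exp \<theta> - 1) * a) ^ B" using \<theta> by (intro power_mono) auto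
    then show ?thesis by simp
  qed
  also have "exp (- \<theta> * k) * exp ((exp \<theta> - 1) * a) ^ B = exp (- k * \<theta> + (exp \<theta> * (a * B) - a * B))"
    by (simp add: exp_of_nat_mult[symmetric] exp_add[symmetric] algebra_simps)
  also have "exp \<theta> * (a * B) = k"
    using nonzero_eq_divide_eq[of "a * B" "exp \<theta>" k] e\<theta> aB by (metis less_irrefl)
  finally show ?thesis by (simp add: \<theta>_def)
qed

text \<open>Exact because the empirical distribution function uses the strict inequality, hence is left-continuous.\<close>

lemma perm_quantile_less_iff:
  assumes \<alpha>: "0 < \<alpha>" "\<alpha> < 1"
  shows "perm_quantile F N B c z \<alpha> < T \<longleftrightarrow> 1 - \<alpha> \<le> perm_cdf F N B c z T"
proof -
  define \<tau> where "\<tau> b = weighted_stat F N (c b) z" for b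
  define p where "p x = (1 / (real B + 1)) * (\<Sum>b=0..B. of_bool (\<tau> b < x))" for x :: real
  have p: "perm_cdf F N B c z x = p x" for x by (simp add: perm_cdf_def p_def \<tau>_def)
  define S where "S = {q. 1 - \<alpha> \<le> p q}"
  have mono: "p x \<le> p y" if "\<And>b. b \<le> B \<Longrightarrow> \<tau> b < x \<Longrightarrow> \<tau> b < y" for x y
    unfolding p_def using that by (intro mult_left_mono sum_mono) (auto simp: of_bool_def)
  have bdd: "Min (\<tau> ` {0..B}) \<le> q" if q: "q \<in> S" for q
  proof (rule ccontr)
    assume "\<not> ?thesis"
    moreover have "Min (\<tau> ` {0..B}) \<le> \<tau> b" if "b \<in> {0..B}" for b using that by (intro Min_le) auto
    ultimately have "\<not> \<tau> b < q" if "b \<in> {0..B}" for b using that by fastforce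
    then have "p q = 0" by (simp add: p_def)
    then show False using q \<alpha> by (simp add: S_def)
  qed
  have "Max (\<tau> ` {0..B}) + 1 \<in> S"
  proof -
    have "\<tau> b < Max (\<tau> ` {0..B}) + 1" if "b \<in> {0..B}" for b
    proof -
      have "\<tau> b \<le> Max (\<tau> ` {0..B})" using that by (intro Max_ge) auto
      then show ?thesis by simp
    qed
    then have "p (Max (\<tau> ` {0..B}) + 1) = 1" by (simp add: p_def)
    then show ?thesis using \<alpha> by (simp add: S_def)
  qed
  then have ne: "S \<noteq> {}" by blast
  have "Inf S < T \<longleftrightarrow> 1 - \<alpha> \<le> p T"
  proof
    assume "Inf S < T"
    then obtain q where q: "q \<in> S" "q < T" using cInf_less_iff[OF ne] bdd by (meson bdd_belowI)
    then have "p q \<le> p T" by (intro mono) auto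
    then show "1 - \<alpha> \<le> p T" using q by (simp add: S_def)
  next
    assume T: "1 - \<alpha> \<le> p T"
    \<comment> \<open>The finitely many statistics below \<open>T\<close> stay below a point
      \<open>T'\<close> strictly between their maximum and \<open>T\<close>, so the level is already
      attained at \<open>T'\<close>. The element \<open>T - 1\<close> keeps \<open>J\<close>
      nonempty.\<close>
    define J where "J = insert (T - 1) {x \<in> \<tau> ` {0..B}. x < T}"
    have J: "finite J" "J \<noteq> {}" "\<And>x. x \<in> J \<Longrightarrow> x < T" by (auto simp: J_def)
    have M: "Max J < T" using J by (subst Max_less_iff) auto
    define T' where "T' = (Max J + T) / 2"
    have T': "T' < T" "Max J < T'" using M by (auto simp: T'_def)
    have "p T \<le> p T'"
    proof (rule mono)
      fix b assume "b \<le> B" "\<tau> b < T"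
      then have "\<tau> b \<in> J" by (auto simp: J_def)
      then have "\<tau> b \<le> Max J" using J by simp
      then show "\<tau> b < T'" using T' by simp
    qed
    then have "T' \<in> S" using T by (simp add: S_def)
    then have "Inf S \<le> T'" using bdd by (intro cInf_lower bdd_belowI)
    then show "Inf S < T" using T' by simp
  qed
  then show ?thesis unfolding perm_quantile_def p S_def .
qed

text \<open>Add the negatives to a countable dense subset. A weighted sum evaluates \<open>f\<close>
  at finitely many points, hence is continuous for pointwise convergence, and its supremum over
  \<open>F\<close> equals that over the dense set. Integrals need not be continuous in this sense,
  so the equality is stated for statistics alone.\<close>

lemma exists_countable_subclass:
  assumes F: "bounded_function_class E F" "symmetric_class E F" "pointwise_separable E F"
  obtains G where "G \<subseteq> F" "countable_class E G"
    "\<And>N c z. (\<And>i. i \<in> {1..N} \<Longrightarrow> z i \<in> space E) \<Longrightarrow> weighted_stat F N c z = weighted_stat G N c z"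
proof -
  let ?X = "subtopology (product_topology (\<lambda>_. euclideanreal) (space E)) F"
  have FE: "F \<subseteq> space E \<rightarrow>\<^sub>E {-1..1}" and Fm: "F \<subseteq> borel_measurable E" and Fne: "F \<noteq> {}"
    using F(1) by (auto simp: bounded_function_class_def)
  have top: "topspace ?X = F" using FE by (auto simp: PiE_def)
  obtain C where C: "countable C" "C \<subseteq> F" "?X closure_of C = F"
    using F(3) unfolding pointwise_separable_def separable_space_def top by blast
  define neg where "neg f = (\<lambda>x\<in>space E. - f x)" for f :: "'a \<Rightarrow> real"
  define G where "G = C \<union> neg ` C"
  have GF: "G \<subseteq> F" using C(2) F(2) by (auto simp: G_def neg_def symmetric_class_def)
  have "C \<noteq> {}" using C(3) Fne by auto
  then have Gne: "G \<noteq> {}" by (simp add: G_def)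
  have neg2: "neg (neg f) = f" if "f \<in> F" for f
    using FE that by (auto simp: neg_def PiE_def extensional_def fun_eq_iff)
  have cc: "countable_class E G"
  proof
    show "countable G" using C(1) by (simp add: G_def)
    show "bounded_function_class E G" using GF FE Fm Gne unfolding bounded_function_class_def by blast
    have "neg f \<in> G" if "f \<in> G" for f using that C(2) neg2 by (auto simp: G_def)
    then show "symmetric_class E G" by (simp add: symmetric_class_def neg_def)
  qed
  have "weighted_stat F N c z = weighted_stat G N c z" if z: "\<And>i. i \<in> {1..N} \<Longrightarrow> z i \<in> space E" for N c z
  proof -
    define h where "h f = (\<Sum>i=1..N. c i * f (z i))" for f
    have hb: "\<bar>h f\<bar> \<le> (\<Sum>i=1..N. \<bar>c i\<bar>)" if f: "f \<in> F" for f
    proof -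
      have "\<bar>c i * f (z i)\<bar> \<le> \<bar>c i\<bar>" if "i \<in> {1..N}" for i
      proof -
        have "f (z i) \<in> {-1..1}" using FE f z[OF that] by (auto simp: PiE_iff)
        then have "\<bar>f (z i)\<bar> \<le> 1" by (auto simp: abs_le_iff)
        then show ?thesis by (simp add: abs_mult mult_left_le)
      qed
      then show ?thesis unfolding h_def by (intro order_trans[OF sum_abs] sum_mono)
    qed
    have hbG: "\<bar>h f\<bar> \<le> (\<Sum>i=1..N. \<bar>c i\<bar>)" if f: "f \<in> G" for f using hb GF that by blast
    have "continuous_map ?X euclideanreal h"
      unfolding h_def using z
      by (intro continuous_map_sum continuous_map_real_mult_left continuous_map_from_subtopology
          continuous_map_product_projection) auto
    then have "h ` F \<subseteq> euclideanreal closure_of (h ` C)"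
      using continuous_map_image_closure_subset[of ?X euclideanreal h C] C(3) by simp
    also have "\<dots> \<subseteq> closure {..SUP f\<in>G. h f}"
      using cSUP_real_bounds(3)[OF Gne hbG, of "\<lambda>f. f"] unfolding euclidean_closure_of
      by (intro closure_mono) (auto simp: G_def)
    finally have "h f \<le> (SUP f\<in>G. h f)" if "f \<in> F" for f using that by auto
    then have "(SUP f\<in>F. h f) \<le> (SUP f\<in>G. h f)" using Fne by (intro cSUP_least)
    moreover have "(SUP f\<in>G. h f) \<le> (SUP f\<in>F. h f)"
      using cSUP_real_bounds(1)[OF Fne hb, of "\<lambda>f. f"] GF Gne by (intro cSUP_subset_mono) auto
    ultimately show ?thesis unfolding weighted_stat_def h_def by (rule antisym)
  qed
  then show ?thesis by (rule that[OF GF cc])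
qed

section \<open>Laws of independent families\<close>

lemma (in prob_space) distr_indep_family:
  assumes "finite I" "I \<noteq> {}" "indep_vars (\<lambda>_. E) X I" "\<And>i. i \<in> I \<Longrightarrow> distr M E (X i) = P"
  shows "distr M (PiM I (\<lambda>_. E)) (\<lambda>\<omega>. \<lambda>i\<in>I. X i \<omega>) = PiM I (\<lambda>_. P)"
proof -
  have rv: "random_variable E (X i)" if "i \<in> I" for i using assms(3) that by (auto simp: indep_vars_def)
  have "distr M (PiM I (\<lambda>_. E)) (\<lambda>\<omega>. \<lambda>i\<in>I. X i \<omega>) = PiM I (\<lambda>i. distr M E (X i))"
    using indep_vars_iff_distr_eq_PiM'[OF assms(2), where M'="\<lambda>_. E" and X=X] rv assms(3) by blast
  also have "\<dots> = PiM I (\<lambda>_. P)" using assms(4) by (intro PiM_cong) auto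
  finally show ?thesis .
qed

text \<open>The law is determined by boxes. There, independence of the two samples factorizes the
  probability once, and independence within each sample factorizes both parts.\<close>

lemma (in prob_space) distr_pooled_samples:
  fixes X Y :: "nat \<Rightarrow> 'a \<Rightarrow> 'e"
  assumes n: "1 \<le> n" and m: "1 \<le> m"
    and X: "indep_vars (\<lambda>_. E) X {1..n}" "\<And>i. i \<in> {1..n} \<Longrightarrow> distr M E (X i) = P"
    and Y: "indep_vars (\<lambda>_. E) Y {1..m}" "\<And>j. j \<in> {1..m} \<Longrightarrow> distr M E (Y j) = Q"
    and XY: "indep_var (PiM {1..n} (\<lambda>_. E)) (\<lambda>\<omega>. \<lambda>i\<in>{1..n}. X i \<omega>)
          (PiM {1..m} (\<lambda>_. E)) (\<lambda>\<omega>. \<lambda>j\<in>{1..m}. Y j \<omega>)"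
  defines "Z \<equiv> \<lambda>\<omega>. \<lambda>i\<in>{1..n+m}. pooled n (\<lambda>i. X i \<omega>) (\<lambda>j. Y j \<omega>) i"
  shows "distr M (PiM {1..n+m} (\<lambda>_. E)) Z = PiM {1..n+m} (\<lambda>i. if i \<le> n then P else Q)"
    "random_variable (PiM {1..n+m} (\<lambda>_. E)) Z"
proof -
  have Xr: "random_variable E (X i)" if "i \<in> {1..n}" for i using X(1) that by (auto simp: indep_vars_def)
  have Yr: "random_variable E (Y i)" if "i \<in> {1..m}" for i using Y(1) that by (auto simp: indep_vars_def)
  have pP: "prob_space P" using prob_space_distr[OF Xr, of 1] X(2)[of 1] n by simp
  have pQ: "prob_space Q" using prob_space_distr[OF Yr, of 1] Y(2)[of 1] m by simp
  have sP: "sets P = sets E" using X(2)[of 1] n by auto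
  have sQ: "sets Q = sets E" using Y(2)[of 1] m by auto
  let ?C = "\<lambda>i. if i \<le> n then P else Q"
  interpret prob_family ?C by (rule prob_family.intro) (simp add: pP pQ)
  show Zr: "random_variable (PiM {1..n+m} (\<lambda>_. E)) Z"
    unfolding Z_def
  proof (rule measurable_restrict)
    fix i assume i: "i \<in> {1..n+m}"
    show "(\<lambda>\<omega>. pooled n (\<lambda>i. X i \<omega>) (\<lambda>j. Y j \<omega>) i) \<in> measurable M E"
    proof (cases "i \<le> n")
      case True then show ?thesis using Xr[of i] i by (simp add: pooled_def)
    next
      case False
      then have "i - n \<in> {1..m}" using i by auto
      then show ?thesis using Yr[of "i - n"] False by (simp add: pooled_def)
    qed
  qed
  show "distr M (PiM {1..n+m} (\<lambda>_. E)) Z = PiM {1..n+m} ?C"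
  proof (rule PiM_eqI)
    show "sets (distr M (PiM {1..n+m} (\<lambda>_. E)) Z) = sets (PiM {1..n+m} ?C)"
      unfolding sets_distr by (intro sets_PiM_cong) (auto simp: sP sQ)
    fix A assume "\<And>i. i \<in> {1..n+m} \<Longrightarrow> A i \<in> sets (?C i)"
    then have A: "A i \<in> sets E" if "i \<in> {1..n+m}" for i using that sP sQ by (metis (full_types))
    let ?S = "PiE {1..n} A" and ?T = "PiE {1..m} (\<lambda>j. A (j + n))"
    have Abox: "PiE {1..n+m} A \<in> sets (PiM {1..n+m} (\<lambda>_. E))" using A by (intro sets_PiM_I_finite) auto
    have boxes: "?S \<in> sets (PiM {1..n} (\<lambda>_. E))" "?T \<in> sets (PiM {1..m} (\<lambda>_. E))"
      using A by (auto intro!: sets_PiM_I_finite)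
    have split: "Z \<omega> \<in> PiE {1..n+m} A \<longleftrightarrow> (\<forall>i\<in>{1..n}. X i \<omega> \<in> A i) \<and> (\<forall>j\<in>{1..m}. Y j \<omega> \<in> A (j + n))" for \<omega>
    proof -
      have idx: "{1..n+m} = {1..n} \<union> (\<lambda>j. j + n) ` {1..m}"
        by (auto simp: image_iff)
      have "Z \<omega> \<in> PiE {1..n+m} A \<longleftrightarrow> (\<forall>i\<in>{1..n+m}. pooled n (\<lambda>i. X i \<omega>) (\<lambda>j. Y j \<omega>) i \<in> A i)"
        by (auto simp: Z_def PiE_iff)
      also have "(\<forall>i\<in>{1..n+m}. pooled n (\<lambda>i. X i \<omega>) (\<lambda>j. Y j \<omega>) i \<in> A i)
        \<longleftrightarrow> (\<forall>i\<in>{1..n}. pooled n (\<lambda>i. X i \<omega>) (\<lambda>j. Y j \<omega>) i \<in> A i)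
          \<and> (\<forall>j\<in>{1..m}. pooled n (\<lambda>i. X i \<omega>) (\<lambda>j. Y j \<omega>) (j + n) \<in> A (j + n))"
        unfolding idx ball_Un by blast
      also have "(\<forall>i\<in>{1..n}. pooled n (\<lambda>i. X i \<omega>) (\<lambda>j. Y j \<omega>) i \<in> A i) \<longleftrightarrow> (\<forall>i\<in>{1..n}. X i \<omega> \<in> A i)"
        by (rule ball_cong) (simp_all add: pooled_def)
      also have "(\<forall>j\<in>{1..m}. pooled n (\<lambda>i. X i \<omega>) (\<lambda>j. Y j \<omega>) (j + n) \<in> A (j + n)) \<longleftrightarrow> (\<forall>j\<in>{1..m}. Y j \<omega> \<in> A (j + n))"
        by (rule ball_cong) (simp_all add: pooled_def)
      finally show ?thesis .
    qed
    have "emeasure (distr M (PiM {1..n+m} (\<lambda>_. E)) Z) (PiE {1..n+m} A) = prob (Z -` PiE {1..n+m} A \<inter> space M)"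
      using Zr Abox by (simp add: emeasure_distr emeasure_eq_measure)
    also have "Z -` PiE {1..n+m} A \<inter> space M
      = (\<lambda>\<omega>. (\<lambda>i\<in>{1..n}. X i \<omega>, \<lambda>j\<in>{1..m}. Y j \<omega>)) -` (?S \<times> ?T) \<inter> space M"
      using split by (auto simp: PiE_iff)
    also have "prob \<dots> = prob ((\<lambda>\<omega>. \<lambda>i\<in>{1..n}. X i \<omega>) -` ?S \<inter> space M) * prob ((\<lambda>\<omega>. \<lambda>j\<in>{1..m}. Y j \<omega>) -` ?T \<inter> space M)"
      by (rule indep_varD[OF XY boxes])
    also have "(\<lambda>\<omega>. \<lambda>i\<in>{1..n}. X i \<omega>) -` ?S \<inter> space M = (\<Inter>i\<in>{1..n}. X i -` A i \<inter> space M)"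
      using n by (auto simp: PiE_iff)
    also have "prob \<dots> = (\<Prod>i\<in>{1..n}. prob (X i -` A i \<inter> space M))"
      using n A by (intro indep_varsD_finite[OF X(1)]) auto
    also have "(\<lambda>\<omega>. \<lambda>j\<in>{1..m}. Y j \<omega>) -` ?T \<inter> space M = (\<Inter>j\<in>{1..m}. Y j -` A (j + n) \<inter> space M)"
      using m by (auto simp: PiE_iff)
    also have "prob \<dots> = (\<Prod>j\<in>{1..m}. prob (Y j -` A (j + n) \<inter> space M))"
      using m A by (intro indep_varsD_finite[OF Y(1)]) auto
    also have "(\<Prod>i\<in>{1..n}. prob (X i -` A i \<inter> space M)) = (\<Prod>i\<in>{1..n}. measure (?C i) (A i))"
    proof (intro prod.cong refl)
      fix i assume i: "i \<in> {1..n}"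
      then show "prob (X i -` A i \<inter> space M) = measure (?C i) (A i)"
        using measure_distr[OF Xr[OF i], of "A i"] X(2)[OF i] A[of i] by simp
    qed
    also have "(\<Prod>j\<in>{1..m}. prob (Y j -` A (j + n) \<inter> space M)) = (\<Prod>i\<in>{n+1..n+m}. measure (?C i) (A i))"
    proof -
      have "(\<Prod>i\<in>{n+1..n+m}. measure (?C i) (A i)) = (\<Prod>j\<in>{1..m}. measure (?C (j + n)) (A (j + n)))"
        using prod.shift_bounds_cl_nat_ivl[of "\<lambda>i. measure (?C i) (A i)" 1 n m] by (simp add: add.commute)
      also have "\<dots> = (\<Prod>j\<in>{1..m}. prob (Y j -` A (j + n) \<inter> space M))"
      proof (intro prod.cong refl)
        fix j assume j: "j \<in> {1..m}"
        then show "measure (?C (j + n)) (A (j + n)) = prob (Y j -` A (j + n) \<inter> space M)"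
          using measure_distr[OF Yr[OF j], of "A (j + n)"] Y(2)[OF j] A[of "j + n"] by simp
      qed
      finally show ?thesis ..
    qed
    also have "(\<Prod>i\<in>{1..n}. measure (?C i) (A i)) * (\<Prod>i\<in>{n+1..n+m}. measure (?C i) (A i)) = (\<Prod>i\<in>{1..n+m}. measure (?C i) (A i))"
      by (subst prod.union_disjoint[symmetric]) (auto intro!: prod.cong)
    also have "ennreal (\<Prod>i\<in>{1..n+m}. measure (?C i) (A i)) = (\<Prod>i\<in>{1..n+m}. emeasure (?C i) (A i))"
      by (subst prod_ennreal[symmetric])
        (auto intro!: prod.cong simp: finite_measure.emeasure_eq_measure prob_space.finite_measure pP pQ)
    finally show "emeasure (distr M (PiM {1..n+m} (\<lambda>_. E)) Z) (PiE {1..n+m} A) = (\<Prod>i\<in>{1..n+m}. emeasure (?C i) (A i))" .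
  qed simp
qed

section \<open>The probability of not rejecting\<close>

text \<open>Continuity from below. The supremum in \<open>ipm\<close> need not be attained, so lower
  tails are available only up to an arbitrary \<epsilon>; the strict inequality recovers the exact
  threshold.\<close>

lemma (in prob_space) prob_less_le:
  fixes T :: "'a \<Rightarrow> real"
  assumes T: "T \<in> borel_measurable M" and le: "\<And>\<epsilon>. 0 < \<epsilon> \<Longrightarrow> prob {x \<in> space M. T x \<le> c - \<epsilon>} \<le> e"
  shows "prob {x \<in> space M. T x < c} \<le> e"
proof -
  define A where "A i = {x \<in> space M. T x \<le> c - 1 / real (Suc i)}" for i
  have "(\<lambda>i. prob (A i)) \<longlonglongrightarrow> prob (\<Union>i. A i)"
  proof (rule finite_Lim_measure_incseq)
    show "range A \<subseteq> events" using T unfolding A_def by auto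
    show "incseq A"
    proof (rule incseq_SucI)
      fix i
      have "1 / real (Suc (Suc i)) \<le> 1 / real (Suc i)" by (simp add: frac_le)
      then show "A i \<subseteq> A (Suc i)" unfolding A_def by auto
    qed
  qed
  moreover have "(\<Union>i. A i) = {x \<in> space M. T x < c}"
  proof
    show "(\<Union>i. A i) \<subseteq> {x \<in> space M. T x < c}"
    proof
      fix x assume "x \<in> (\<Union>i. A i)"
      then obtain i where "x \<in> space M" "T x \<le> c - 1 / real (Suc i)" by (auto simp: A_def)
      moreover have "0 < 1 / real (Suc i)" by simp
      ultimately have "x \<in> space M" "T x < c" by linarith+
      then show "x \<in> {x \<in> space M. T x < c}" by simp
    qed
    show "{x \<in> space M. T x < c} \<subseteq> (\<Union>i. A i)"
    proof
      fix x assume x: "x \<in> {x \<in> space M. T x < c}"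
      then have "0 < c - T x" by simp
      then obtain i where "inverse (real (Suc i)) < c - T x" using reals_Archimedean by blast
      then show "x \<in> (\<Union>i. A i)" using x by (auto simp: A_def inverse_eq_divide intro!: exI[of _ i])
    qed
  qed
  ultimately have "(\<lambda>i. prob (A i)) \<longlonglongrightarrow> prob {x \<in> space M. T x < c}" by simp
  moreover have "prob (A i) \<le> e" for i unfolding A_def by (intro le) simp
  ultimately show ?thesis by (intro LIMSEQ_le_const2) auto
qed

section \<open>The joint law of permuted weights and sample\<close>

lemma sets_permuted_weights_law: "sets (permuted_weights_law n m) = sets (weight_space (n+m))"
  by (simp add: permuted_weights_law_def)

lemma restrict_weights_measurable:
  "(\<lambda>\<sigma>. \<lambda>i\<in>{1..n+m}. weights n m (\<sigma> i)) \<in> measurable (measure_pmf p) (weight_space (n+m))"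
  by (simp add: space_PiM)

lemma prob_space_permuted_weights_law: "prob_space (permuted_weights_law n m)"
  unfolding permuted_weights_law_def by (rule prob_space.prob_space_distr[OF prob_space_measure_pmf restrict_weights_measurable])

context two_samples begin

abbreviation weights_law :: "(nat \<Rightarrow> real) measure" where "weights_law \<equiv> permuted_weights_law n m"

abbreviation joint_law :: "nat \<Rightarrow> ((nat \<Rightarrow> nat \<Rightarrow> real) \<times> (nat \<Rightarrow> 'e)) measure" where
  "joint_law B \<equiv> PiM {1..B} (\<lambda>_. weights_law) \<Otimes>\<^sub>M sample"

lemma weight_coordinate_measurable: "i \<in> U \<Longrightarrow> (\<lambda>w. w i) \<in> borel_measurable weights_law"
  unfolding measurable_cong_sets[OF sets_permuted_weights_law refl] by (rule measurable_component_singleton)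

lemma weighted_stat_weights_measurable:
  assumes "z \<in> space sample" shows "(\<lambda>w. weighted_stat G (n+m) w z) \<in> borel_measurable weights_law"
  unfolding weighted_stat_def using countable nonempty
  by (intro borel_measurable_cSUP borel_measurable_sum borel_measurable_times weight_coordinate_measurable
      cSUP_real_bounds(1)[OF nonempty weighted_stat_sample_bounds(1)[OF assms]]) auto

lemma weighted_stat_joint_measurable:
  assumes b: "b \<in> {1..B}"
  shows "(\<lambda>p. weighted_stat G (n+m) (fst p b) (snd p)) \<in> borel_measurable (joint_law B)"
  unfolding weighted_stat_def
proof (intro borel_measurable_cSUP[OF countable] borel_measurable_sum borel_measurable_times)
  fix f i assume f: "f \<in> G" and i: "i \<in> U"
  show "(\<lambda>p. fst p b i) \<in> borel_measurable (joint_law B)"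
    using measurable_compose[OF measurable_compose[OF measurable_fst measurable_component_singleton[OF b]]
        weight_coordinate_measurable[OF i]] .
  show "(\<lambda>p. f (snd p i)) \<in> borel_measurable (joint_law B)"
    using measurable_compose[OF measurable_snd coord_class_measurable[OF f i]] .
next
  fix p assume "p \<in> space (joint_law B)"
  then have "snd p \<in> space sample" by (auto simp: space_pair_measure)
  then show "bdd_above ((\<lambda>f. \<Sum>i=1..n+m. fst p b i * f (snd p i)) ` G)"
    by (intro cSUP_real_bounds(1)[OF nonempty weighted_stat_sample_bounds(1)])
qed

text \<open>Identifies \<open>perm_tail\<close> as the conditional probability, given the sample,
  that one permuted statistic reaches \<open>t\<close>.\<close>

lemma weights_law_tail:
  assumes z: "z \<in> space sample"
  shows "measure weights_law {w \<in> space weights_law. t \<le> weighted_stat G (n+m) w z} = perm_tail t z"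
proof -
  let ?S = "{\<sigma>. \<sigma> permutes U}" and ?r = "\<lambda>\<sigma>. \<lambda>i\<in>U. weights n m (\<sigma> i)"
  define A where "A = {w \<in> space weights_law. t \<le> weighted_stat G (n+m) w z}"
  have "A \<in> sets weights_law" unfolding A_def using weighted_stat_weights_measurable[OF z] by measurable
  then have A: "A \<in> sets (weight_space (n+m))" by (simp only: sets_permuted_weights_law)
  have sp: "space weights_law = space (weight_space (n+m))"
    by (rule sets_eq_imp_space_eq[OF sets_permuted_weights_law])
  have fin: "finite ?S" "?S \<noteq> {}" by (simp add: finite_permutations) (use permutes_id[of U] in blast)
  have "measure weights_law A = measure (measure_pmf (pmf_of_set ?S)) (?r -` A)"
    unfolding permuted_weights_law_def using measure_distr[OF restrict_weights_measurable A] by simp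
  also have "\<dots> = card (?S \<inter> ?r -` A) / card ?S"
    using fin by (intro measure_pmf_of_set)
  also have "?S \<inter> ?r -` A = ?S \<inter> {\<sigma>. t \<le> weighted_stat G (n+m) (\<lambda>i. weights n m (\<sigma> i)) z}"
  proof -
    have "?r \<sigma> \<in> A \<longleftrightarrow> t \<le> weighted_stat G (n+m) (\<lambda>i. weights n m (\<sigma> i)) z" for \<sigma>
    proof -
      have "weighted_stat G (n+m) (?r \<sigma>) z = weighted_stat G (n+m) (\<lambda>i. weights n m (\<sigma> i)) z"
        by (rule weighted_stat_cong) simp
      moreover have "?r \<sigma> \<in> space weights_law" unfolding sp by (simp add: space_PiM)
      ultimately show ?thesis by (simp add: A_def)
    qed
    then show ?thesis by auto
  qed
  also have "card (?S \<inter> {\<sigma>. t \<le> weighted_stat G (n+m) (\<lambda>i. weights n m (\<sigma> i)) z}) / card ?S = perm_tail t z"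
    using fin(1) by (simp add: perm_tail_def perm_avg_def card_permutations[OF refl])
  finally show ?thesis unfolding A_def .
qed

text \<open>Fubini: for a sample with \<open>perm_tail t z \<le> a\<close> the exceedances are
  independent Bernoulli variables with success probability at most \<open>a\<close>, and for any
  other sample the section is empty.\<close>

lemma exceedance_prob_le:
  assumes a: "0 < a" and B: "1 \<le> B" and k: "a * real B < k" "3 * k * L \<le> (k - a * real B)\<^sup>2"
  shows "measure (joint_law B) {p \<in> space (joint_law B). perm_tail t (snd p) \<le> a
      \<and> k \<le> (\<Sum>b=1..B. of_bool (t \<le> weighted_stat G (n+m) (fst p b) (snd p)))} \<le> exp (- (3 / 2 * L))"
proof -
  let ?PB = "PiM {1..B} (\<lambda>_. weights_law)"
  interpret W: prob_space weights_law by (rule prob_space_permuted_weights_law)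
  interpret F: prob_family "\<lambda>_::nat. weights_law" by (rule prob_family.intro) (rule W.prob_space_axioms)
  interpret PB: prob_space ?PB by (rule F.prob_space_product)
  interpret J: pair_prob_space ?PB sample ..
  define D where "D = {p \<in> space (joint_law B). perm_tail t (snd p) \<le> a
      \<and> k \<le> (\<Sum>b=1..B. of_bool (t \<le> weighted_stat G (n+m) (fst p b) (snd p)))}"
  have Dm: "D \<in> sets (joint_law B)"
  proof -
    have "(\<lambda>p. perm_tail t (snd p)) \<in> borel_measurable (joint_law B)"
      using measurable_compose[OF measurable_snd perm_tail_measurable] .
    moreover have "(\<lambda>p. \<Sum>b=1..B. of_bool (t \<le> weighted_stat G (n+m) (fst p b) (snd p)) :: real) \<in> borel_measurable (joint_law B)"
    proof (intro borel_measurable_sum)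
      fix b assume "b \<in> {1..B}"
      from weighted_stat_joint_measurable[OF this]
      show "(\<lambda>p. of_bool (t \<le> weighted_stat G (n+m) (fst p b) (snd p)) :: real) \<in> borel_measurable (joint_law B)"
        by measurable
    qed
    ultimately show ?thesis unfolding D_def by measurable
  qed
  have slice: "emeasure ?PB ((\<lambda>c. (c, z)) -` D) \<le> ennreal (exp (- (3 / 2 * L)))" if z: "z \<in> space sample" for z
  proof (cases "perm_tail t z \<le> a")
    case False
    then have "(\<lambda>c. (c, z)) -` D = {}" by (auto simp: D_def)
    then show ?thesis by simp
  next
    case True
    define A where "A = {w \<in> space weights_law. t \<le> weighted_stat G (n+m) w z}"
    have A: "A \<in> W.events" unfolding A_def using weighted_stat_weights_measurable[OF z] by measurable
    let ?K = "{c \<in> space ?PB. k \<le> (\<Sum>b=1..B. indicator A (c b))}"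
    have "(\<lambda>c. (c, z)) -` D \<subseteq> ?K"
    proof
      fix c assume "c \<in> (\<lambda>c. (c, z)) -` D"
      then have c: "c \<in> space ?PB" "k \<le> (\<Sum>b=1..B. of_bool (t \<le> weighted_stat G (n+m) (c b) z))"
        by (auto simp: D_def space_pair_measure)
      have "(\<Sum>b=1..B. of_bool (t \<le> weighted_stat G (n+m) (c b) z)) = (\<Sum>b=1..B. indicator A (c b) :: real)"
        using c(1) by (intro sum.cong refl) (auto simp: A_def indicator_def space_PiM PiE_iff)
      then show "c \<in> ?K" using c by simp
    qed
    moreover have "?K \<in> sets ?PB"
    proof -
      have "(\<lambda>c. indicator A (c b) :: real) \<in> borel_measurable ?PB" if "b \<in> {1..B}" for b
        using measurable_compose[OF measurable_component_singleton[OF that] borel_measurable_indicator[OF A]] .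
      then have "(\<lambda>c. \<Sum>b=1..B. indicator A (c b) :: real) \<in> borel_measurable ?PB" by (intro borel_measurable_sum) auto
      then show ?thesis by measurable
    qed
    ultimately have "emeasure ?PB ((\<lambda>c. (c, z)) -` D) \<le> emeasure ?PB ?K" by (rule emeasure_mono)
    also have "\<dots> = ennreal (PB.prob ?K)" by (rule PB.emeasure_eq_measure)
    also have "\<dots> \<le> ennreal (exp (- (3 / 2 * L)))"
    proof (rule ennreal_leI)
      have "PB.prob ?K \<le> exp (- k * ln (k / (a * B)) + (k - a * B))"
        using weights_law_tail[OF z, of t] True a k(1) A by (intro W.binomial_upper_tail) (auto simp: A_def)
      also have "\<dots> \<le> exp (- (3 / 2 * L))"
        using Chernoff_exponent_le[of "a * B" "k - a * B" L] a B k by simp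
      finally show "PB.prob ?K \<le> exp (- (3 / 2 * L))" .
    qed
    finally show ?thesis .
  qed
  have "emeasure (joint_law B) D = (\<integral>\<^sup>+z. emeasure ?PB ((\<lambda>c. (c, z)) -` D) \<partial>sample)"
    by (rule J.emeasure_pair_measure_alt2[OF Dm])
  also have "\<dots> \<le> (\<integral>\<^sup>+z. ennreal (exp (- (3 / 2 * L))) \<partial>sample)"
    using slice by (rule nn_integral_mono)
  also have "\<dots> = ennreal (exp (- (3 / 2 * L)))" by (simp add: sample.emeasure_space_1)
  finally have "ennreal (J.prob D) \<le> ennreal (exp (- (3 / 2 * L)))" by (simp add: J.emeasure_eq_measure)
  then show ?thesis unfolding D_def by simp
qed

abbreviation observed_stat :: "(nat \<Rightarrow> 'e) \<Rightarrow> real" where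
  "observed_stat \<equiv> weighted_stat G (n+m) (weights n m)"

text \<open>The event in terms of a count. The index \<open>0\<close> is left out because the
  observed statistic is never strictly below itself; the final proof takes
  \<open>k = \<alpha> * (B + 1) - 1\<close>.\<close>

definition non_rejection :: "nat \<Rightarrow> real \<Rightarrow> ((nat \<Rightarrow> nat \<Rightarrow> real) \<times> (nat \<Rightarrow> 'e)) set" where
  "non_rejection B k = {p \<in> space (joint_law B).
     k < (\<Sum>b=1..B. of_bool (observed_stat (snd p) \<le> weighted_stat G (n+m) (fst p b) (snd p)))}"

lemma non_rejection_measurable: "non_rejection B k \<in> sets (joint_law B)"
proof -
  have o: "(\<lambda>p. observed_stat (snd p)) \<in> borel_measurable (joint_law B)"
    using measurable_compose[OF measurable_snd weighted_stat_measurable] .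
  have "(\<lambda>p. \<Sum>b=1..B. of_bool (observed_stat (snd p) \<le> weighted_stat G (n+m) (fst p b) (snd p)) :: real) \<in> borel_measurable (joint_law B)"
  proof (intro borel_measurable_sum)
    fix b assume "b \<in> {1..B}"
    from weighted_stat_joint_measurable[OF this] o
    show "(\<lambda>p. of_bool (observed_stat (snd p) \<le> weighted_stat G (n+m) (fst p b) (snd p)) :: real) \<in> borel_measurable (joint_law B)"
      by measurable
  qed
  then show ?thesis unfolding non_rejection_def by measurable
qed

lemma non_rejection_prob_le:
  assumes a: "0 < a" and B: "1 \<le> B" and k: "a * real B < k" "3 * k * L \<le> (k - a * real B)\<^sup>2"
  shows "measure (joint_law B) (non_rejection B k)
    \<le> sample.prob {z \<in> space sample. observed_stat z < t} + sample.prob {z \<in> space sample. a < perm_tail t z} + exp (- (3 / 2 * L))"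
proof -
  let ?PB = "PiM {1..B} (\<lambda>_. weights_law)"
  interpret W: prob_space weights_law by (rule prob_space_permuted_weights_law)
  interpret F: prob_family "\<lambda>_::nat. weights_law" by (rule prob_family.intro) (rule W.prob_space_axioms)
  interpret PB: prob_space ?PB by (rule F.prob_space_product)
  interpret J: pair_prob_space ?PB sample ..
  define A1 where "A1 = {z \<in> space sample. observed_stat z < t}"
  define A2 where "A2 = {z \<in> space sample. a < perm_tail t z}"
  define D where "D = {p \<in> space (joint_law B). perm_tail t (snd p) \<le> a
      \<and> k \<le> (\<Sum>b=1..B. of_bool (t \<le> weighted_stat G (n+m) (fst p b) (snd p)))}"
  have A1: "A1 \<in> sample.events" unfolding A1_def using weighted_stat_measurable by measurable
  have A2: "A2 \<in> sample.events" unfolding A2_def using perm_tail_measurable by measurable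
  have D: "D \<in> sets (joint_law B)"
  proof -
    have "(\<lambda>p. perm_tail t (snd p)) \<in> borel_measurable (joint_law B)"
      using measurable_compose[OF measurable_snd perm_tail_measurable] .
    moreover have "(\<lambda>p. \<Sum>b=1..B. of_bool (t \<le> weighted_stat G (n+m) (fst p b) (snd p)) :: real) \<in> borel_measurable (joint_law B)"
    proof (intro borel_measurable_sum)
      fix b assume "b \<in> {1..B}"
      from weighted_stat_joint_measurable[OF this]
      show "(\<lambda>p. of_bool (t \<le> weighted_stat G (n+m) (fst p b) (snd p)) :: real) \<in> borel_measurable (joint_law B)"
        by measurable
    qed
    ultimately show ?thesis unfolding D_def by measurable
  qed
  have marginal: "J.prob (space ?PB \<times> A) = sample.prob A" if "A \<in> sample.events" for A
    using that by (simp add: measure_def sample.emeasure_pair_measure_Times PB.emeasure_space_1)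
  have "non_rejection B k \<subseteq> (space ?PB \<times> A1) \<union> (space ?PB \<times> A2) \<union> D"
  proof
    fix p assume p: "p \<in> non_rejection B k"
    then have sp: "p \<in> space (joint_law B)" "fst p \<in> space ?PB" "snd p \<in> space sample"
      by (auto simp: non_rejection_def space_pair_measure)
    have big: "k < (\<Sum>b=1..B. of_bool (observed_stat (snd p) \<le> weighted_stat G (n+m) (fst p b) (snd p)))"
      using p by (simp add: non_rejection_def)
    show "p \<in> (space ?PB \<times> A1) \<union> (space ?PB \<times> A2) \<union> D"
    proof (cases "observed_stat (snd p) < t \<or> a < perm_tail t (snd p)")
      case True
      then show ?thesis using sp by (cases p) (auto simp: A1_def A2_def)
    next
      case False
      then have "(\<Sum>b=1..B. of_bool (observed_stat (snd p) \<le> weighted_stat G (n+m) (fst p b) (snd p)) :: real)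
        \<le> (\<Sum>b=1..B. of_bool (t \<le> weighted_stat G (n+m) (fst p b) (snd p)))"
        by (intro sum_mono) (auto simp: of_bool_def)
      then have "k \<le> (\<Sum>b=1..B. of_bool (t \<le> weighted_stat G (n+m) (fst p b) (snd p)))" using big by linarith
      then show ?thesis using sp(1) False by (simp add: D_def)
    qed
  qed
  then have "J.prob (non_rejection B k) \<le> J.prob ((space ?PB \<times> A1) \<union> (space ?PB \<times> A2) \<union> D)"
    using A1 A2 D by (intro J.finite_measure_mono) auto
  also have "\<dots> \<le> J.prob (space ?PB \<times> A1) + J.prob (space ?PB \<times> A2) + J.prob D"
    using A1 A2 D by (intro order_trans[OF measure_Un_le] add_right_mono measure_Un_le) auto
  also have "J.prob D \<le> exp (- (3 / 2 * L))" unfolding D_def by (rule exceedance_prob_le[OF assms])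
  finally show ?thesis using marginal[OF A1] marginal[OF A2] by (simp add: A1_def A2_def)
qed

end

section \<open>Choice of the threshold\<close>

lemma sqrt_add_le:
  fixes x y :: real
  assumes "0 \<le> x" "0 \<le> y" shows "sqrt (x + y) \<le> sqrt x + sqrt y"
  using assms by (intro real_le_lsqrt) (auto simp: power2_sum)

context two_samples begin

context
  fixes F :: "('e \<Rightarrow> real) set"
  assumes F: "bounded_function_class E F" "symmetric_class E F" and GF: "G \<subseteq> F"
    and same_stat: "\<And>N c z. (\<And>i. i \<in> {1..N} \<Longrightarrow> z i \<in> space E) \<Longrightarrow> weighted_stat F N c z = weighted_stat G N c z"
begin

lemma F_nonempty: "F \<noteq> {}"
  using F(1) by (simp add: bounded_function_class_def)

lemma F_bounded: assumes "f \<in> F" "x \<in> space E" shows "\<bar>f x\<bar> \<le> 1"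
proof -
  have "f \<in> space E \<rightarrow>\<^sub>E {-1..1}" using F(1) assms by (auto simp: bounded_function_class_def)
  then have "f x \<in> {-1..1}" using assms(2) by (auto simp: PiE_iff)
  then show ?thesis by (auto simp: abs_le_iff)
qed

lemma F_measurable: "f \<in> F \<Longrightarrow> f \<in> borel_measurable E"
  using F(1) by (auto simp: bounded_function_class_def)

lemma variance_bounds:
  assumes f: "f \<in> F" and R: "prob_space R" "sets R = sets E"
  shows "0 \<le> prob_space.variance R f" "prob_space.variance R f \<le> 4" "\<bar>\<integral>x. f x \<partial>R\<bar> \<le> 1"
proof -
  interpret R: prob_space R by (rule R(1))
  note sp = sets_eq_imp_space_eq[OF R(2)]
  have fm: "f \<in> borel_measurable R" 
    unfolding measurable_cong_sets[OF R(2) refl] by (rule F_measurable[OF f])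
  have fb: "\<bar>f x\<bar> \<le> 1" if "x \<in> space R" for x using F_bounded[OF f] that sp by simp
  show m: "\<bar>R.expectation f\<bar> \<le> 1" using fm fb by (intro R.abs_expectation_le)
  have vm: "(\<lambda>x. (f x - R.expectation f)\<^sup>2) \<in> borel_measurable R" using fm by measurable
  have "(f x - R.expectation f)\<^sup>2 \<le> 4" if "x \<in> space R" for x
  proof -
    have "\<bar>f x - R.expectation f\<bar> \<le> 2" using fb[OF that] m by linarith
    then have "\<bar>f x - R.expectation f\<bar>\<^sup>2 \<le> 2\<^sup>2" by (intro power_mono) auto
    then show ?thesis by simp
  qed
  then show "0 \<le> R.variance f" "R.variance f \<le> 4" using R.bounded_expectation[OF vm, of 0 4] by auto
qed

lemma mean_diff_le_ipm:
  shows "\<And>f. f \<in> F \<Longrightarrow> (\<integral>x. f x \<partial>P) - (\<integral>x. f x \<partial>Q) \<le> ipm F P Q" "0 \<le> ipm F P Q"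
    "\<And>c. c < ipm F P Q \<Longrightarrow> \<exists>f\<in>F. c < (\<integral>x. f x \<partial>P) - (\<integral>x. f x \<partial>Q)"
proof -
  have b: "\<bar>(\<integral>x. f x \<partial>P) - (\<integral>x. f x \<partial>Q)\<bar> \<le> 2" if "f \<in> F" for f
    using variance_bounds(3)[OF that prob_P sets_P] variance_bounds(3)[OF that prob_Q sets_Q] by linarith
  note bdd = cSUP_real_bounds[where h="\<lambda>f. (\<integral>x. f x \<partial>P) - (\<integral>x. f x \<partial>Q)", OF F_nonempty b]
  show up: "(\<integral>x. f x \<partial>P) - (\<integral>x. f x \<partial>Q) \<le> ipm F P Q" if "f \<in> F" for f
    unfolding ipm_def by (rule bdd(3)[OF _ that])
  show "\<exists>f\<in>F. c < (\<integral>x. f x \<partial>P) - (\<integral>x. f x \<partial>Q)" if "c < ipm F P Q" for c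
    using that less_cSUP_iff[OF F_nonempty bdd(1)] unfolding ipm_def by blast
  obtain f where f: "f \<in> G" using nonempty by blast
  show "0 \<le> ipm F P Q"
    using up[of f] up[of "neg f"] f neg_mem[OF f] GF neg_integral[OF sets_P, of f] neg_integral[OF sets_Q, of f] by fastforce
qed

lemma variance_le_sigma_sq:
  assumes "f \<in> F" "prob_space R" "sets R = sets E" shows "prob_space.variance R f \<le> sigma_sq F R" "0 \<le> sigma_sq F R"
proof -
  have b: "\<bar>prob_space.variance R g\<bar> \<le> 4" if "g \<in> F" for g
    using variance_bounds(1,2)[OF that assms(2,3)] by linarith
  show "prob_space.variance R f \<le> sigma_sq F R"
    unfolding sigma_sq_def by (rule cSUP_real_bounds(3)[where h="prob_space.variance R", OF F_nonempty b assms(1)])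
  then show "0 \<le> sigma_sq F R" using variance_bounds(1)[OF assms] by linarith
qed

lemma variance_le_total_var:
  assumes "f \<in> F" shows "real n * PP.variance f + real m * QQ.variance f \<le> total_var F n m P Q"
proof -
  have "\<bar>real n * PP.variance g + real m * QQ.variance g\<bar> \<le> real n * 4 + real m * 4" if "g \<in> F" for g
  proof -
    have "real n * PP.variance g \<le> real n * 4" "real m * QQ.variance g \<le> real m * 4"
      "0 \<le> real n * PP.variance g" "0 \<le> real m * QQ.variance g"
      using variance_bounds(1,2)[OF that prob_P sets_P] variance_bounds(1,2)[OF that prob_Q sets_Q]
      by (auto intro: mult_left_mono)
    then show ?thesis by linarith
  qed
  then show ?thesis
    unfolding total_var_def using assms
    by (intro cSUP_real_bounds(3)[where h="\<lambda>g. real n * PP.variance g + real m * QQ.variance g", OF F_nonempty])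
qed

text \<open>The observed statistic is a supremum over \<open>G\<close>; it dominates functions of
  the larger class \<open>F\<close> because both suprema agree at sample points.\<close>

lemma linear_stat_le_observed:
  assumes f: "f \<in> F" and z: "z \<in> space sample" shows "linear_stat f z \<le> observed_stat z"
proof -
  have b: "\<bar>linear_stat g z\<bar> \<le> 2" if "g \<in> F" for g
    using F_measurable[OF that] F_bounded[OF that] z by (intro linear_stat_bounded)
  have "linear_stat f z \<le> (SUP g\<in>F. linear_stat g z)"
    by (rule cSUP_real_bounds(3)[where h="\<lambda>g. linear_stat g z", OF F_nonempty b f])
  also have "\<dots> = weighted_stat F (n+m) (weights n m) z" by (simp add: weighted_stat_def linear_stat_def)
  also have "\<dots> = observed_stat z" using sample_space[OF z] by (intro same_stat)
  finally show ?thesis .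
qed

text \<open>A function within \<open>\<epsilon> / 2\<close> of the supremum uses half of the slack;
  the tail of its linear statistic is applied with the other half.\<close>

lemma observed_stat_lower_tail:
  assumes tail: "\<And>f \<epsilon>. f \<in> F \<Longrightarrow> 0 < \<epsilon> \<Longrightarrow>
      sample.prob {z \<in> space sample. linear_stat f z \<le> (\<integral>x. f x \<partial>P) - (\<integral>x. f x \<partial>Q) - (t + \<epsilon>)} \<le> e"
  shows "sample.prob {z \<in> space sample. observed_stat z < ipm F P Q - t} \<le> e"
proof (rule sample.prob_less_le[OF weighted_stat_measurable])
  fix \<epsilon> :: real assume \<epsilon>: "0 < \<epsilon>"
  then obtain f where f: "f \<in> F" "ipm F P Q - \<epsilon> / 2 < (\<integral>x. f x \<partial>P) - (\<integral>x. f x \<partial>Q)"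
    using mean_diff_le_ipm(3)[of "ipm F P Q - \<epsilon> / 2"] by auto
  have "{z \<in> space sample. observed_stat z \<le> ipm F P Q - t - \<epsilon>}
    \<subseteq> {z \<in> space sample. linear_stat f z \<le> (\<integral>x. f x \<partial>P) - (\<integral>x. f x \<partial>Q) - (t + \<epsilon> / 2)}"
  proof
    fix z assume z: "z \<in> {z \<in> space sample. observed_stat z \<le> ipm F P Q - t - \<epsilon>}"
    then have "linear_stat f z \<le> ipm F P Q - t - \<epsilon>" using linear_stat_le_observed[OF f(1), of z] by auto
    then have "linear_stat f z \<le> (\<integral>x. f x \<partial>P) - (\<integral>x. f x \<partial>Q) - (t + \<epsilon> / 2)" using f(2) by linarith
    then show "z \<in> {z \<in> space sample. linear_stat f z \<le> (\<integral>x. f x \<partial>P) - (\<integral>x. f x \<partial>Q) - (t + \<epsilon> / 2)}" using z by simp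
  qed
  moreover have "{z \<in> space sample. linear_stat f z \<le> (\<integral>x. f x \<partial>P) - (\<integral>x. f x \<partial>Q) - (t + \<epsilon> / 2)} \<in> sample.events"
    using linear_stat_measurable[OF F_measurable[OF f(1)] F_bounded[OF f(1)]] by measurable
  ultimately have "sample.prob {z \<in> space sample. observed_stat z \<le> ipm F P Q - t - \<epsilon>}
    \<le> sample.prob {z \<in> space sample. linear_stat f z \<le> (\<integral>x. f x \<partial>P) - (\<integral>x. f x \<partial>Q) - (t + \<epsilon> / 2)}"
    by (rule sample.finite_measure_mono)
  also have "\<dots> \<le> e" using f(1) \<epsilon> by (intro tail) auto
  finally show "sample.prob {z \<in> space sample. observed_stat z \<le> ipm F P Q - t - \<epsilon>} \<le> e" .
qed

lemma linear_stat_prob_mono: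
  assumes f: "f \<in> F" and st: "s \<le> t"
  shows "sample.prob {z \<in> space sample. linear_stat f z \<le> c - t} \<le> sample.prob {z \<in> space sample. linear_stat f z \<le> c - s}"
proof (rule sample.finite_measure_mono)
  show "{z \<in> space sample. linear_stat f z \<le> c - t} \<subseteq> {z \<in> space sample. linear_stat f z \<le> c - s}" using st by auto
  show "{z \<in> space sample. linear_stat f z \<le> c - s} \<in> sample.events"
    using linear_stat_measurable[OF F_measurable[OF f] F_bounded[OF f]] by measurable
qed

lemma observed_stat_Hoeffding:
  assumes L: "0 < L"
  shows "sample.prob {z \<in> space sample. observed_stat z < ipm F P Q - sqrt kappa * sqrt (2 * L)} \<le> exp (- L)"
proof (rule observed_stat_lower_tail)
  fix f \<epsilon> assume "f \<in> F" "(0::real) < \<epsilon>"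
  then show "sample.prob {z \<in> space sample. linear_stat f z \<le> (\<integral>x. f x \<partial>P) - (\<integral>x. f x \<partial>Q) - (sqrt kappa * sqrt (2 * L) + \<epsilon>)} \<le> exp (- L)"
    using F_measurable F_bounded L by (intro order_trans[OF linear_stat_prob_mono linear_stat_Hoeffding]) auto
qed

lemma observed_stat_Bernstein:
  assumes L: "0 < L" and v: "v = sigma_sq F P / n + sigma_sq F Q / m"
  shows "sample.prob {z \<in> space sample. observed_stat z < ipm F P Q - (sqrt (2 * v * L) + max (1 / n) (1 / m) * L)} \<le> exp (- L)"
proof (rule observed_stat_lower_tail)
  fix f \<epsilon> assume f: "f \<in> F" and \<epsilon>: "(0::real) < \<epsilon>"
  let ?t = "sqrt (2 * v * L) + max (1 / n) (1 / m) * L"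
  \<comment> \<open>\<open>linear_stat_Bernstein\<close> asks for a positive variance bound, so
    \<open>v\<close> is increased by \<eta>. By subadditivity of the square root this costs at most
    \<open>sqrt (2 * \<eta> * L) = \<epsilon>\<close>.\<close>
  define \<eta> where "\<eta> = \<epsilon>\<^sup>2 / (2 * L)"
  have \<eta>: "0 < \<eta>" using \<epsilon> L by (simp add: \<eta>_def)
  have v0: "0 \<le> v"
    unfolding v using variance_le_sigma_sq(2)[OF f prob_P sets_P] variance_le_sigma_sq(2)[OF f prob_Q sets_Q] by simp
  have "PP.variance f / n + QQ.variance f / m \<le> v"
    unfolding v using variance_le_sigma_sq(1)[OF f prob_P sets_P] variance_le_sigma_sq(1)[OF f prob_Q sets_Q]
    by (intro add_mono divide_right_mono) auto
  then have tail: "sample.prob {z \<in> space sample. linear_stat f z \<le> (\<integral>x. f x \<partial>P) - (\<integral>x. f x \<partial>Q)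
      - (sqrt (2 * (v + \<eta>) * L) + max (1 / n) (1 / m) * L)} \<le> exp (- L)"
    using L \<eta> v0 by (intro linear_stat_Bernstein F_measurable[OF f] F_bounded[OF f]) auto
  have "2 * (v + \<eta>) * L = 2 * v * L + \<epsilon>\<^sup>2" using L by (simp add: \<eta>_def algebra_simps)
  then have "sqrt (2 * (v + \<eta>) * L) \<le> sqrt (2 * v * L) + sqrt (\<epsilon>\<^sup>2)" using v0 L by (simp only:) (intro sqrt_add_le; simp)
  then have "sqrt (2 * (v + \<eta>) * L) + max (1 / n) (1 / m) * L \<le> ?t + \<epsilon>" using \<epsilon> by simp
  then show "sample.prob {z \<in> space sample. linear_stat f z \<le> (\<integral>x. f x \<partial>P) - (\<integral>x. f x \<partial>Q) - (?t + \<epsilon>)} \<le> exp (- L)"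
    by (intro order_trans[OF linear_stat_prob_mono[OF f] tail])
qed

lemma expected_sup_le: "prob_space R \<Longrightarrow> sets R = sets E \<Longrightarrow> expected_sup G k R \<le> expected_sup F k R"
  using expected_sup_subclass_le[OF _ _ GF F] by blast

text \<open>In both cases \<open>t\<close> is \<open>d\<close> minus the deviation in the lower tail
  of the observed statistic, and the hypothesis says that this \<open>t\<close> still exceeds the
  threshold for the conditional tail.\<close>

theorem threshold_exists:
  fixes L LB :: real
  defines "d \<equiv> ipm F P Q" and "rn \<equiv> 1 / real n" and "rm \<equiv> 1 / real m"
    and "Ms \<equiv> 2 / real n * (expected_sup F n P + expected_sup F n Q)
              + 2 / real m * (expected_sup F m P + expected_sup F m Q)"
  assumes L: "exp (- L) < 1 / 3" "0 < L" and LB: "0 < LB"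
    and cond: "(1 - 2 / sqrt (real n + real m - 1)) * d
         \<ge> Ms + 12 / (real n + real m) * L
           + sqrt (rn + rm) * (2 * sqrt (2 * LB) + sqrt (2 * L))
       \<or>
       (1 - 2 / sqrt (real n + real m - 1) - 4 * sqrt (3 * (rn + rm) * LB)) * d
         \<ge> max rn rm * L + Ms + 12 / (real n + real m) * L
           + sqrt (2 * (sigma_sq F P / real n + sigma_sq F Q / real m) * L)
           + 2 * (rn + rm) * sqrt LB
             * sqrt (34 * (expected_sup F n P + expected_sup F m Q)
                     + 2 * real m / (real n * (real n + real m)) * (expected_sup F n P)\<^sup>2
                     + 2 * real n / (real m * (real n + real m)) * (expected_sup F m Q)\<^sup>2
                     + total_var F n m P Q + 4 * L)"
  shows "\<exists>t. sample.prob {z \<in> space sample. observed_stat z < t}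
    + sample.prob {z \<in> space sample. exp (- LB) < perm_tail t z} + exp (- (3 / 2 * L)) \<le> 3 * exp (- L)"
proof -
  have k: "rn + rm = kappa" by (simp add: rn_def rm_def kappa_def)
  define N where "N = real n + real m"
  have N: "2 \<le> N" using n m by (simp add: N_def)
  define q where "q = sqrt (N - 1)"
  have q: "1 \<le> q" using N by (simp add: q_def)
  have d0: "0 \<le> d" unfolding d_def by (rule mean_diff_le_ipm(2))
  have dG: "(\<integral>x. f x \<partial>P) - (\<integral>x. f x \<partial>Q) \<le> d" if "f \<in> G" for f
    unfolding d_def using mean_diff_le_ipm(1) GF that by blast
  have e0: "0 \<le> expected_sup F j R" for j R by (simp add: expected_sup_def)
  have eG0: "0 \<le> expected_sup G j R" for j R by (simp add: expected_sup_def)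
  note eP = expected_sup_le[OF prob_P sets_P] and eQ = expected_sup_le[OF prob_Q sets_Q]
  define EB where "EB = (expected_sup F n P + expected_sup F n Q) / n + (expected_sup F m P + expected_sup F m Q) / m + d / q"
  have "sample.expectation perm_mean_stat \<le> (expected_sup G n P + expected_sup G n Q) / n + (expected_sup G m P + expected_sup G m Q) / m + d / q"
    using perm_mean_stat_expectation_le[OF dG] by (simp add: q_def N_def)
  also have "\<dots> \<le> EB"
    unfolding EB_def by (intro add_mono divide_right_mono eP eQ order_refl) auto
  finally have EB: "sample.expectation perm_mean_stat \<le> EB" .
  have EB2: "2 * EB = Ms + 2 / q * d" by (simp add: EB_def Ms_def algebra_simps add_divide_distrib)
  \<comment> \<open>In powers of \<open>x\<close> the exponents \<open>1\<close>, \<open>7/6\<close>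
    and \<open>3/2\<close> become \<open>6\<close>, \<open>7\<close> and \<open>9\<close>, and the
    comparison of error terms is polynomial.\<close>
  define x where "x = exp (- (L / 6))"
  have x: "0 < x" by (simp add: x_def)
  have ex: "exp (- (real j / 6 * L)) = x ^ j" for j
    unfolding x_def exp_of_nat_mult[symmetric] by simp
  have xs: "exp (- L) = x ^ 6" "exp (- (3 / 2 * L)) = x ^ 9" "exp (- (7 / 6 * L)) = x ^ 7"
    using ex[of 6] ex[of 9] ex[of 7] by simp_all
  have x6: "x ^ 6 < 1 / 3" using L(1) xs(1) by simp
  have x3: "x ^ 3 \<le> 5774 / 10000"
  proof (rule power2_le_imp_le)
    have "(x ^ 3)\<^sup>2 = x ^ 6" by (simp add: power_mult[symmetric])
    then show "(x ^ 3)\<^sup>2 \<le> (5774 / 10000)\<^sup>2" using x6 by (simp add: power2_eq_square)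
  qed simp
  have x1: "x \<le> 833 / 1000"
  proof (rule ccontr)
    assume "\<not> ?thesis"
    then have "(833 / 1000) ^ 3 \<le> x ^ 3" by (intro power_mono) auto
    then show False using x3 by (simp add: power3_eq_cube)
  qed
  \<comment> \<open>After division by \<open>x ^ 6\<close> this is \<open>1 + x + 2 * x ^ 3\<close>,
    at most \<open>1 + 0.833 + 1.1548\<close>. In the Hoeffding case the summand
    \<open>x ^ 7\<close> is absent.\<close>
  have total: "x ^ 6 + (x ^ 7 + x ^ 9) + x ^ 9 \<le> 3 * x ^ 6"
  proof -
    have "x ^ 6 + (x ^ 7 + x ^ 9) + x ^ 9 = (1 + x + 2 * x ^ 3) * x ^ 6" by (simp add: algebra_simps flip: power_add power_Suc)
    also have "\<dots> \<le> 3 * x ^ 6" using x1 x3 x by (intro mult_right_mono) auto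
    finally show ?thesis .
  qed
  show ?thesis using cond
  proof
    assume c: "(1 - 2 / sqrt (real n + real m - 1)) * d
         \<ge> Ms + 12 / (real n + real m) * L + sqrt (rn + rm) * (2 * sqrt (2 * LB) + sqrt (2 * L))"
    define t where "t = d - sqrt kappa * sqrt (2 * L)"
    have "d - 2 / q * d \<ge> Ms + 12 / N * L + (sqrt kappa * (2 * sqrt (2 * LB)) + sqrt kappa * sqrt (2 * L))"
      using c unfolding k N_def[symmetric] q_def[symmetric] left_diff_distrib distrib_left[of "sqrt kappa"] by simp
    then have "2 * EB + 12 / (real n + real m) * L + sqrt kappa * (2 * sqrt (2 * LB)) \<le> t"
      unfolding EB2 t_def N_def by linarith
    then have "sample.prob {z \<in> space sample. exp (- LB) < perm_tail t z} \<le> exp (- (3 / 2 * L))"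
      by (intro perm_tail_core_Hoeffding[OF EB L(2) LB])
    moreover have "sample.prob {z \<in> space sample. observed_stat z < t} \<le> exp (- L)"
      unfolding t_def d_def by (rule observed_stat_Hoeffding[OF L(2)])
    ultimately have "sample.prob {z \<in> space sample. observed_stat z < t}
      + sample.prob {z \<in> space sample. exp (- LB) < perm_tail t z} + exp (- (3 / 2 * L)) \<le> 3 * exp (- L)"
      using total zero_less_power[OF x, of 7] unfolding xs by linarith
    then show ?thesis by blast
  next
    let ?R0 = "34 * (expected_sup F n P + expected_sup F m Q)
                     + 2 * real m / (real n * (real n + real m)) * (expected_sup F n P)\<^sup>2
                     + 2 * real n / (real m * (real n + real m)) * (expected_sup F m Q)\<^sup>2
                     + total_var F n m P Q + 4 * L"
    define v where "v = sigma_sq F P / n + sigma_sq F Q / m"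
    assume c: "(1 - 2 / sqrt (real n + real m - 1) - 4 * sqrt (3 * (rn + rm) * LB)) * d
         \<ge> max rn rm * L + Ms + 12 / (real n + real m) * L
           + sqrt (2 * (sigma_sq F P / real n + sigma_sq F Q / real m) * L)
           + 2 * (rn + rm) * sqrt LB * sqrt ?R0"
    define R0 where "R0 = ?R0"
    define t where "t = d - (sqrt (2 * v * L) + max (1 / n) (1 / m) * L)"
    obtain f0 where f0: "f0 \<in> F" using F_nonempty by blast
    have v0: "0 \<le> v"
      unfolding v_def using variance_le_sigma_sq(2)[OF f0 prob_P sets_P] variance_le_sigma_sq(2)[OF f0 prob_Q sets_Q] by simp
    have V0: "0 \<le> total_var F n m P Q"
      using variance_le_total_var[OF f0] variance_bounds(1)[OF f0 prob_P sets_P] variance_bounds(1)[OF f0 prob_Q sets_Q]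
      by (meson add_nonneg_nonneg mult_nonneg_nonneg of_nat_0_le_iff order_trans)
    have R00: "0 \<le> R0"
      unfolding R0_def using V0 e0 L(2) by (intro add_nonneg_nonneg mult_nonneg_nonneg divide_nonneg_nonneg) auto
    have Ms0: "0 \<le> Ms" unfolding Ms_def using e0 by (intro add_nonneg_nonneg mult_nonneg_nonneg) auto
    have c': "(1 - 2 / q - 4 * sqrt (3 * kappa * LB)) * d
         \<ge> max rn rm * L + Ms + 12 / N * L + sqrt (2 * v * L) + 2 * kappa * sqrt LB * sqrt R0"
      using c unfolding R0_def[symmetric] v_def[symmetric] unfolding k N_def[symmetric] q_def[symmetric] .
    have "0 < 12 / N * L" using N L by simp
    moreover have "0 \<le> max rn rm * L" using L by (simp add: rn_def le_max_iff_disj)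
    moreover have "0 \<le> sqrt (2 * v * L)" using v0 L by simp
    moreover have "0 \<le> 2 * kappa * sqrt LB * sqrt R0" using kappa_pos LB R00 by simp
    \<comment> \<open>The right side of the condition is positive, hence so is the coefficient of
      \<open>d\<close>. This yields \<open>48 * kappa * LB < 1\<close>, the smallness required by
      \<open>perm_tail_core_dispersion\<close>.\<close>
    ultimately have "0 < (1 - 2 / q - 4 * sqrt (3 * kappa * LB)) * d" using c' Ms0 by linarith
    then have "0 < 1 - 2 / q - 4 * sqrt (3 * kappa * LB)" using d0 by (simp add: zero_less_mult_iff)
    moreover have "0 < 2 / q" using q by simp
    ultimately have "4 * sqrt (3 * kappa * LB) < 1" by linarith
    moreover have s48: "4 * sqrt (3 * kappa * LB) = sqrt (48 * kappa * LB)"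
    proof -
      have "sqrt (48 * kappa * LB) = sqrt (4\<^sup>2 * (3 * kappa * LB))" by simp
      then show ?thesis by (simp only: real_sqrt_mult[of "4\<^sup>2"] real_sqrt_abs)
    qed
    ultimately have LB48: "48 * kappa * LB < 1" by simp
    \<comment> \<open>\<open>12 / kappa\<close> is the multiple of \<open>d\<^sup>2\<close> whose
      contribution to \<open>2 * kappa * sqrt LB * sqrt R\<close> is the loss
      \<open>4 * sqrt (3 * kappa * LB) * d\<close> in the condition. The dispersion produces
      \<open>3 / kappa\<close> of it.\<close>
    define R where "R = R0 + 12 / kappa * d\<^sup>2"
    have ik: "1 / kappa = real n * real m / N" using n m by (simp add: kappa_def N_def field_simps)
    have "sample.expectation (dispersion_on U) \<le> total_var F n m P Q + 16 * (expected_sup G n P + expected_sup G m Q)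
       + m / (n * (n + m)) * (expected_sup G n P)\<^sup>2 + n / (m * (n + m)) * (expected_sup G m Q)\<^sup>2 + 3 * (n * m / (n + m)) * d\<^sup>2"
      using variance_le_total_var GF by (intro dispersion_expectation_le dG) auto
    \<comment> \<open>The constants \<open>16\<close>, \<open>1\<close> and \<open>3\<close> of the
      dispersion bound are raised to \<open>34\<close>, \<open>2\<close> and \<open>12\<close>, and
      \<open>G\<close> is replaced by \<open>F\<close>.\<close>
    also have "\<dots> \<le> total_var F n m P Q + 34 * (expected_sup F n P + expected_sup F m Q)
       + 2 * real m / (real n * (real n + real m)) * (expected_sup F n P)\<^sup>2
       + 2 * real n / (real m * (real n + real m)) * (expected_sup F m Q)\<^sup>2 + 12 / kappa * d\<^sup>2"
    proof (intro add_mono order_refl)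
      show "16 * (expected_sup G n P + expected_sup G m Q) \<le> 34 * (expected_sup F n P + expected_sup F m Q)"
        by (intro mult_mono add_mono add_nonneg_nonneg eP eQ eG0) auto
      show "m / (n * (n + m)) * (expected_sup G n P)\<^sup>2 \<le> 2 * real m / (real n * (real n + real m)) * (expected_sup F n P)\<^sup>2"
        using eP[of n] eG0[of n P] by (intro mult_mono power_mono) (auto intro!: divide_right_mono)
      show "n / (m * (n + m)) * (expected_sup G m Q)\<^sup>2 \<le> 2 * real n / (real m * (real n + real m)) * (expected_sup F m Q)\<^sup>2"
        using eQ[of m] eG0[of m Q] by (intro mult_mono power_mono) (auto intro!: divide_right_mono)
      have "3 * (n * m / (n + m)) * d\<^sup>2 = 3 * (1 / kappa) * d\<^sup>2" unfolding ik N_def by simp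
      also have "\<dots> \<le> 12 * (1 / kappa) * d\<^sup>2" using kappa_pos by (intro mult_right_mono) auto
      finally show "3 * (n * m / (n + m)) * d\<^sup>2 \<le> 12 / kappa * d\<^sup>2" by simp
    qed
    finally have "sample.expectation (dispersion_on U) + 4 * L \<le> R" unfolding R_def R0_def by linarith
    moreover have "2 * EB + 12 / (real n + real m) * L + 2 * kappa * sqrt LB * sqrt R \<le> t"
    proof -
      have "sqrt R \<le> sqrt R0 + sqrt (12 / kappa * d\<^sup>2)"
        unfolding R_def using R00 kappa_pos by (intro sqrt_add_le) auto
      then have "2 * kappa * sqrt LB * sqrt R \<le> 2 * kappa * sqrt LB * (sqrt R0 + sqrt (12 / kappa * d\<^sup>2))"
        using kappa_pos LB by (intro mult_left_mono) auto
      also have "\<dots> = 2 * kappa * sqrt LB * sqrt R0 + 4 * sqrt (3 * kappa * LB) * d"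
      proof -
        have "2 * kappa * sqrt LB * sqrt (12 / kappa * d\<^sup>2) = sqrt ((2 * kappa)\<^sup>2 * LB * (12 / kappa * d\<^sup>2))"
          using kappa_pos by (simp only: real_sqrt_mult real_sqrt_abs)
        also have "(2 * kappa)\<^sup>2 * LB * (12 / kappa * d\<^sup>2) = 48 * kappa * LB * d\<^sup>2"
          using kappa_pos by (simp add: power2_eq_square)
        also have "sqrt (48 * kappa * LB * d\<^sup>2) = 4 * sqrt (3 * kappa * LB) * d"
          unfolding s48 using d0 by (simp only: real_sqrt_mult[of _ "d\<^sup>2"] real_sqrt_abs abs_of_nonneg)
        finally show ?thesis by (simp only: distrib_left)
      qed
      finally have "2 * kappa * sqrt LB * sqrt R \<le> 2 * kappa * sqrt LB * sqrt R0 + 4 * sqrt (3 * kappa * LB) * d" .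
      moreover have "d - 2 / q * d - 4 * sqrt (3 * kappa * LB) * d
         \<ge> max (1 / n) (1 / m) * L + Ms + 12 / N * L + sqrt (2 * v * L) + 2 * kappa * sqrt LB * sqrt R0"
        using c' by (simp add: left_diff_distrib rn_def rm_def)
      ultimately show ?thesis unfolding EB2 t_def N_def by linarith
    qed
    ultimately have "sample.prob {z \<in> space sample. exp (- LB) < perm_tail t z} \<le> exp (- (7 / 6 * L)) + exp (- (3 / 2 * L))"
      by (intro perm_tail_core_dispersion[OF EB L(2) LB LB48])
    moreover have "sample.prob {z \<in> space sample. observed_stat z < t} \<le> exp (- L)"
      unfolding t_def d_def by (rule observed_stat_Bernstein[OF L(2) v_def])
    ultimately have "sample.prob {z \<in> space sample. observed_stat z < t}
      + sample.prob {z \<in> space sample. exp (- LB) < perm_tail t z} + exp (- (3 / 2 * L)) \<le> 3 * exp (- L)"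
      using total unfolding xs by linarith
    then show ?thesis by blast
  qed
qed

end

end

section \<open>The power of the test\<close>

text \<open>The two variables take values in different types, so independence is expressed through
  the sigma-algebras they generate; on rectangles it yields the product.\<close>

lemma (in prob_space) distr_Pair_indep_set:
  assumes X: "X \<in> measurable M S" and Y: "Y \<in> measurable M T"
    and XY: "indep_set (sets (vimage_algebra (space M) X S)) (sets (vimage_algebra (space M) Y T))"
  shows "distr M S X \<Otimes>\<^sub>M distr M T Y = distr M (S \<Otimes>\<^sub>M T) (\<lambda>x. (X x, Y x))"
proof (rule pair_measure_eqI)
  interpret X: prob_space "distr M S X" by (rule prob_space_distr[OF X])
  interpret Y: prob_space "distr M T Y" by (rule prob_space_distr[OF Y])
  show "sigma_finite_measure (distr M S X)" "sigma_finite_measure (distr M T Y)" by unfold_locales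
  show "sets (distr M S X \<Otimes>\<^sub>M distr M T Y) = sets (distr M (S \<Otimes>\<^sub>M T) (\<lambda>x. (X x, Y x)))"
    by (simp cong: sets_pair_measure_cong)
  fix A B assume "A \<in> sets (distr M S X)" "B \<in> sets (distr M T Y)"
  then have AB: "A \<in> sets S" "B \<in> sets T" by simp_all
  have "prob ((X -` A \<inter> space M) \<inter> (Y -` B \<inter> space M)) = prob (X -` A \<inter> space M) * prob (Y -` B \<inter> space M)"
    using AB by (intro indep_setD[OF XY] in_vimage_algebra)
  moreover have "(\<lambda>x. (X x, Y x)) -` (A \<times> B) \<inter> space M = (X -` A \<inter> space M) \<inter> (Y -` B \<inter> space M)" by auto
  moreover have "(\<lambda>x. (X x, Y x)) \<in> measurable M (S \<Otimes>\<^sub>M T)" using X Y by measurable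
  ultimately show "emeasure (distr M S X) A * emeasure (distr M T Y) B = emeasure (distr M (S \<Otimes>\<^sub>M T) (\<lambda>x. (X x, Y x))) (A \<times> B)"
    using AB X Y by (simp add: emeasure_distr emeasure_eq_measure ennreal_mult)
qed

theorem theorem24:
  fixes M :: "'w measure" and E P Q :: "'e measure"
    and n m B :: nat
    and X Y :: "nat \<Rightarrow> 'w \<Rightarrow> 'e"
    and \<xi> :: "nat \<Rightarrow> 'w \<Rightarrow> nat \<Rightarrow> real"
    and F :: "('e \<Rightarrow> real) set"
    and \<alpha> \<delta> :: real
  defines "Z \<equiv> \<lambda>\<omega>. \<lambda>i\<in>{1..n+m}. pooled n (\<lambda>i. X i \<omega>) (\<lambda>j. Y j \<omega>) i"
    and "d \<equiv> ipm F P Q"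
    and "L \<equiv> ln (1 / \<delta>)"
    and "LB \<equiv> ln (1 / alpha_B \<alpha> \<delta> B)"
    and "rn \<equiv> 1 / real n" and "rm \<equiv> 1 / real m"
    and "Ms \<equiv> 2 / real n * (expected_sup F n P + expected_sup F n Q)
              + 2 / real m * (expected_sup F m P + expected_sup F m Q)"
  assumes M: "prob_space M"
    and n: "n \<ge> 1" and m: "m \<ge> 1" and B: "B \<ge> 1"
    and X_indep: "prob_space.indep_vars M (\<lambda>_. E) X {1..n}"
    and X_law: "\<And>i. i \<in> {1..n} \<Longrightarrow> distr M E (X i) = P"
    and Y_indep: "prob_space.indep_vars M (\<lambda>_. E) Y {1..m}"
    and Y_law: "\<And>j. j \<in> {1..m} \<Longrightarrow> distr M E (Y j) = Q"
    and XY_indep: "prob_space.indep_var M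
          (PiM {1..n} (\<lambda>_. E)) (\<lambda>\<omega>. \<lambda>i\<in>{1..n}. X i \<omega>)
          (PiM {1..m} (\<lambda>_. E)) (\<lambda>\<omega>. \<lambda>j\<in>{1..m}. Y j \<omega>)"
    and xi_0: "\<And>\<omega>. \<omega> \<in> space M \<Longrightarrow> \<xi> 0 \<omega> = weights n m"
    and xi_indep: "prob_space.indep_vars M (\<lambda>_. weight_space (n+m)) \<xi> {1..B}"
    and xi_law: "\<And>b. b \<in> {1..B} \<Longrightarrow>
          distr M (weight_space (n+m)) (\<xi> b) = permuted_weights_law n m"
    and xi_Z_indep: "prob_space.indep_set M
          (sets (vimage_algebra (space M) (\<lambda>\<omega>. \<lambda>b\<in>{1..B}. \<xi> b \<omega>)
             (PiM {1..B} (\<lambda>_. weight_space (n+m)))))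
          (sets (vimage_algebra (space M) Z (PiM {1..n+m} (\<lambda>_. E))))"
    and F: "bounded_function_class E F" "symmetric_class E F" "pointwise_separable E F"
    and \<alpha>: "0 < \<alpha>" "\<alpha> < 1" and \<delta>: "0 < \<delta>" "\<delta> < 1"
    and \<alpha>B: "0 < alpha_B \<alpha> \<delta> B" "alpha_B \<alpha> \<delta> B < 1"
    and cond:
      "(1 - 2 / sqrt (real n + real m - 1)) * d
         \<ge> Ms + 12 / (real n + real m) * L
           + sqrt (rn + rm) * (2 * sqrt (2 * LB) + sqrt (2 * L))
       \<or>
       (1 - 2 / sqrt (real n + real m - 1) - 4 * sqrt (3 * (rn + rm) * LB)) * d
         \<ge> max rn rm * L + Ms + 12 / (real n + real m) * L
           + sqrt (2 * (sigma_sq F P / real n + sigma_sq F Q / real m) * L)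
           + 2 * (rn + rm) * sqrt LB
             * sqrt (34 * (expected_sup F n P + expected_sup F m Q)
                     + 2 * real m / (real n * (real n + real m)) * (expected_sup F n P)\<^sup>2
                     + 2 * real n / (real m * (real n + real m)) * (expected_sup F m Q)\<^sup>2
                     + total_var F n m P Q + 4 * L)"
  shows "measure M {\<omega> \<in> space M.
           test_stat F n m (\<lambda>i. X i \<omega>) (\<lambda>j. Y j \<omega>)
             > perm_quantile F (n+m) B (\<lambda>b. \<xi> b \<omega>) (Z \<omega>) \<alpha>} \<ge> 1 - 3 * \<delta>"
proof (cases "1 / 3 \<le> \<delta>")
  case True
  \<comment> \<open>For such \<delta> the claimed bound is not positive; the other case supplies the
    strict inequality that \<open>threshold_exists\<close> asks for.\<close>
  then have "1 - 3 * \<delta> \<le> 0" by simp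
  then show ?thesis using measure_nonneg order_trans by blast
next
  case False
  interpret M: prob_space M by (rule M)
  define S where "S = PiM {1..B} (\<lambda>_. weight_space (n+m))"
  define \<Xi> where "\<Xi> = (\<lambda>\<omega>. \<lambda>b\<in>{1..B}. \<xi> b \<omega>)"
  have Xr: "X 1 \<in> measurable M E" using X_indep n by (auto simp: M.indep_vars_def)
  have Yr: "Y 1 \<in> measurable M E" using Y_indep m by (auto simp: M.indep_vars_def)
  have pP: "prob_space P" using M.prob_space_distr[OF Xr] X_law[of 1] n by simp
  have pQ: "prob_space Q" using M.prob_space_distr[OF Yr] Y_law[of 1] m by simp
  have sP: "sets P = sets E" using X_law[of 1] n by auto
  have sQ: "sets Q = sets E" using Y_law[of 1] m by auto
  obtain G where G: "G \<subseteq> F" "countable_class E G"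
    and same: "\<And>N c z. (\<And>i. i \<in> {1..N} \<Longrightarrow> z i \<in> space E) \<Longrightarrow> weighted_stat F N c z = weighted_stat G N c z"
    using exists_countable_subclass[OF F] by metis
  interpret two_samples E G P Q n m
    using G(2) pP pQ sP sQ n m by (intro two_samples.intro two_samples_axioms.intro)
  have Zlaw: "distr M (PiM {1..n+m} (\<lambda>_. E)) Z = sample"
    and Zr: "Z \<in> measurable M (PiM {1..n+m} (\<lambda>_. E))"
    unfolding Z_def using M.distr_pooled_samples[OF n m X_indep X_law Y_indep Y_law XY_indep] by simp_all
  have \<Xi>r: "\<Xi> \<in> measurable M S"
    unfolding \<Xi>_def S_def using xi_indep by (intro measurable_restrict) (auto simp: M.indep_vars_def)
  have \<Xi>law: "distr M S \<Xi> = PiM {1..B} (\<lambda>_. weights_law)"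
    unfolding \<Xi>_def S_def using B by (intro M.distr_indep_family xi_indep xi_law) auto
  have joint: "joint_law B = distr M (S \<Otimes>\<^sub>M PiM {1..n+m} (\<lambda>_. E)) (\<lambda>\<omega>. (\<Xi> \<omega>, Z \<omega>))"
    unfolding \<Xi>law[symmetric] Zlaw[symmetric]
    by (rule M.distr_Pair_indep_set[OF \<Xi>r Zr xi_Z_indep[folded \<Xi>_def S_def]])
  have pair_r: "(\<lambda>\<omega>. (\<Xi> \<omega>, Z \<omega>)) \<in> measurable M (joint_law B)"
    unfolding joint measurable_distr_eq2 using \<Xi>r Zr by measurable
  have L: "0 < L" "exp (- L) = \<delta>" unfolding L_def using \<delta> by (auto simp: ln_div)
  have LB: "0 < LB" "exp (- LB) = alpha_B \<alpha> \<delta> B" unfolding LB_def using \<alpha>B by (auto simp: ln_div)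
  obtain t where t: "sample.prob {z \<in> space sample. observed_stat z < t}
    + sample.prob {z \<in> space sample. exp (- LB) < perm_tail t z} + exp (- (3 / 2 * L)) \<le> 3 * exp (- L)"
    using threshold_exists[OF F(1,2) G(1) same _ L(1) LB(1) cond[unfolded d_def Ms_def rn_def rm_def]] False L(2) by auto
  \<comment> \<open>Rejection means that at least a fraction \<open>1 - \<alpha>\<close> of the
    \<open>B + 1\<close> statistics, the observed one included, lies strictly below the observed
    value. Equivalently, at most \<open>k\<close> of the \<open>B\<close> permuted ones reach
    it.\<close>
  define k where "k = \<alpha> * (real B + 1) - 1"
  define r where "r = sqrt (3 * \<alpha> / real B * L)"
  have r: "0 < r" "r\<^sup>2 = 3 * \<alpha> / real B * L" using \<alpha> B L(1) by (auto simp: r_def)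
  \<comment> \<open>This is the origin of \<open>alpha_B\<close>: with success probability
    \<open>alpha_B \<alpha> \<delta> B\<close>, the count has to exceed its mean by
    \<open>(B + 1) * r\<close> to get above \<open>k\<close>.\<close>
  have kr: "k - alpha_B \<alpha> \<delta> B * real B = (real B + 1) * r"
  proof -
    have ab: "alpha_B \<alpha> \<delta> B = (1 + 1 / real B) * (\<alpha> - r - 1 / (real B + 1))"
      by (simp only: alpha_B_def r_def L_def)
    have "alpha_B \<alpha> \<delta> B * real B = ((1 + 1 / real B) * real B) * (\<alpha> - r - 1 / (real B + 1))"
      unfolding ab by (simp only: mult_ac)
    also have "(1 + 1 / real B) * real B = real B + 1" using B by (simp add: field_simps)
    also have "(real B + 1) * (\<alpha> - r - 1 / (real B + 1)) = (real B + 1) * (\<alpha> - r) - (real B + 1) * (1 / (real B + 1))" by (rule right_diff_distrib)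
    also have "(real B + 1) * (1 / (real B + 1)) = 1" by simp
    finally show ?thesis by (simp add: k_def algebra_simps)
  qed
  have "measure (joint_law B) (non_rejection B k) \<le> 3 * \<delta>"
  proof -
    have "0 < (real B + 1) * r" using r(1) by simp
    then have k1: "alpha_B \<alpha> \<delta> B * real B < k" using kr by linarith
    have k2: "3 * k * L \<le> (k - alpha_B \<alpha> \<delta> B * real B)\<^sup>2"
    proof -
      \<comment> \<open>Here \<open>k\<close> is enlarged to \<open>\<alpha> * (B + 1)\<close> and
        then \<open>B + 1\<close> to \<open>(B + 1)\<^sup>2 / B\<close>, which gives exactly the
        square of \<open>(B + 1) * r\<close>.\<close>
      have "3 * k * L \<le> 3 * \<alpha> * L * (real B + 1)" using L(1) by (simp add: k_def algebra_simps)
      also have "\<dots> \<le> 3 * \<alpha> * L * ((real B + 1)\<^sup>2 / real B)"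
        using \<alpha> L(1) B by (intro mult_left_mono) (auto simp: field_simps power2_eq_square)
      also have "\<dots> = (k - alpha_B \<alpha> \<delta> B * real B)\<^sup>2"
        unfolding kr power_mult_distrib r(2) by (simp add: mult_ac)
      finally show ?thesis .
    qed
    show ?thesis
      using non_rejection_prob_le[OF \<alpha>B(1) B k1 k2, of t] t unfolding LB(2) L(2) by linarith
  qed
  then have bad: "M.prob ((\<lambda>\<omega>. (\<Xi> \<omega>, Z \<omega>)) -` non_rejection B k \<inter> space M) \<le> 3 * \<delta>"
    using non_rejection_measurable[of B k] measure_distr[of "\<lambda>\<omega>. (\<Xi> \<omega>, Z \<omega>)" M "S \<Otimes>\<^sub>M PiM {1..n+m} (\<lambda>_. E)"] \<Xi>r Zr
    unfolding joint by simp
  have event: "test_stat F n m (\<lambda>i. X i \<omega>) (\<lambda>j. Y j \<omega>) > perm_quantile F (n+m) B (\<lambda>b. \<xi> b \<omega>) (Z \<omega>) \<alpha>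
      \<longleftrightarrow> (\<Xi> \<omega>, Z \<omega>) \<notin> non_rejection B k" if \<omega>: "\<omega> \<in> space M" for \<omega>
  proof -
    have zE: "Z \<omega> i \<in> space E" if "i \<in> {1..n+m}" for i
      using measurable_space[OF Zr \<omega>] that by (auto simp: space_PiM PiE_iff)
    have st: "weighted_stat F (n+m) c (Z \<omega>) = weighted_stat G (n+m) c (Z \<omega>)" for c
      using zE by (intro same)
    have "test_stat F n m (\<lambda>i. X i \<omega>) (\<lambda>j. Y j \<omega>) = weighted_stat F (n+m) (weights n m) (Z \<omega>)"
      unfolding test_stat_def weighted_stat_def
    proof (intro SUP_cong refl)
      fix f
      have "(\<Sum>i=1..n+m. weights n m i * f (Z \<omega> i))
        = (\<Sum>i\<in>{1..n}. weights n m i * f (Z \<omega> i)) + (\<Sum>i\<in>{n+1..n+m}. weights n m i * f (Z \<omega> i))"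
        by (subst sum.union_disjoint[symmetric]) (auto intro!: sum.cong)
      also have "(\<Sum>i\<in>{1..n}. weights n m i * f (Z \<omega> i)) = (\<Sum>i\<in>{1..n}. 1 / real n * f (X i \<omega>))"
        by (intro sum.cong refl) (auto simp: weights_def Z_def pooled_def)
      also have "(\<Sum>i\<in>{n+1..n+m}. weights n m i * f (Z \<omega> i)) = (\<Sum>j\<in>{1..m}. weights n m (j + n) * f (Z \<omega> (j + n)))"
        using sum.shift_bounds_cl_nat_ivl[of "\<lambda>i. weights n m i * f (Z \<omega> i)" 1 n m] by (simp add: add.commute)
      also have "\<dots> = (\<Sum>j\<in>{1..m}. - (1 / real m * f (Y j \<omega>)))"
        by (intro sum.cong refl) (auto simp: weights_def Z_def pooled_def)
      finally show "1 / real n * (\<Sum>i=1..n. f (X i \<omega>)) - 1 / real m * (\<Sum>j=1..m. f (Y j \<omega>)) = (\<Sum>i=1..n+m. weights n m i * f (Z \<omega> i))"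
        by (simp add: sum_distrib_left sum_negf)
    qed
    then have T: "test_stat F n m (\<lambda>i. X i \<omega>) (\<lambda>j. Y j \<omega>) = observed_stat (Z \<omega>)" by (simp add: st)
    define s where "s = (\<Sum>b=1..B. of_bool (observed_stat (Z \<omega>) \<le> weighted_stat G (n+m) (\<xi> b \<omega>) (Z \<omega>)) :: real)"
    have "(\<Sum>b=0..B. of_bool (weighted_stat F (n+m) (\<xi> b \<omega>) (Z \<omega>) < observed_stat (Z \<omega>)) :: real)
      = (\<Sum>b=1..B. of_bool (weighted_stat F (n+m) (\<xi> b \<omega>) (Z \<omega>) < observed_stat (Z \<omega>)))"
      using xi_0[OF \<omega>] by (subst sum.atLeast_Suc_atMost) (simp_all add: st One_nat_def)
    also have "\<dots> = (\<Sum>b=1..B. 1 - of_bool (observed_stat (Z \<omega>) \<le> weighted_stat G (n+m) (\<xi> b \<omega>) (Z \<omega>)))"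
      by (intro sum.cong refl) (auto simp: st of_bool_def)
    also have "\<dots> = real B - s" by (simp add: sum_subtractf s_def)
    finally have cdf: "perm_cdf F (n+m) B (\<lambda>b. \<xi> b \<omega>) (Z \<omega>) (observed_stat (Z \<omega>)) = (real B - s) / (real B + 1)"
      by (simp add: perm_cdf_def)
    have "s = (\<Sum>b=1..B. of_bool (observed_stat (Z \<omega>) \<le> weighted_stat G (n+m) (\<Xi> \<omega> b) (Z \<omega>)))"
      unfolding s_def by (intro sum.cong refl) (simp add: \<Xi>_def)
    then have nr: "(\<Xi> \<omega>, Z \<omega>) \<in> non_rejection B k \<longleftrightarrow> k < s"
      using measurable_space[OF pair_r \<omega>] by (simp add: non_rejection_def)
    have "1 - \<alpha> \<le> (real B - s) / (real B + 1) \<longleftrightarrow> (1 - \<alpha>) * (real B + 1) \<le> real B - s"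
      by (rule pos_le_divide_eq) simp
    also have "\<dots> \<longleftrightarrow> s \<le> k" by (simp add: k_def algebra_simps)
    finally show ?thesis unfolding T perm_quantile_less_iff[OF \<alpha>] cdf nr by auto
  qed
  have "{\<omega> \<in> space M. test_stat F n m (\<lambda>i. X i \<omega>) (\<lambda>j. Y j \<omega>)
      > perm_quantile F (n+m) B (\<lambda>b. \<xi> b \<omega>) (Z \<omega>) \<alpha>}
    = space M - ((\<lambda>\<omega>. (\<Xi> \<omega>, Z \<omega>)) -` non_rejection B k \<inter> space M)"
    using event by auto
  then show ?thesis
    using bad M.prob_compl[OF measurable_sets[OF pair_r non_rejection_measurable]] by simp
qed

end
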